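(* Let $F$ be a distribution function in the domain of attraction of a stable distribution of index $\alpha\in(0,2)$, and let $(X_i)_{i\ge 1}$ be independent random variables with distribution function $F$. Let $(\kappa_i)_{i\ge0}$ be a sequence of real numbers converging to $0$ such that $\sum_{i\ge0}|\kappa_i|^r<\infty$ for some positive $r$. For $1\le i\le n$ set $$\overline{\mathbb S}_n(i/n)=\sum_{1\le j\le i}\kappa_{i-j}X_j,\qquad \overline s_n(i/n)=\sum_{1\le j\le i}\kappa_{i-j}\int_{F^{\leftarrow}(1/n)}^{F^{\leftarrow}(1-1/n)}x\,dF(x).$$ Then, as $n\to\infty$, the distributions of the point processes $$\sum_{1\le i\le n}\delta_{\bigl(i/n,\ (\overline{\mathbb S}_n-\overline s_n)(i/n)/F_*^{\leftarrow}(1-1/n)\bigr)}$$ converge weakly$*$ to that of the point process $$\sum_{j\ge1}\sum_{i\ge0}\Bigl(\delta_{(V_j,\ p^{1/\alpha}\kappa_iW_j^{-1/\alpha})}+\delta_{(V_j',\ -q^{1/\alpha}\kappa_i{W_j'}^{-1/\alpha})}\Bigr).$$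
   Context: Domain of attraction: $F$ being in the domain of attraction of a stable law of index $\alpha\in(0,2)$ implies the following. If $X$ has distribution function $F$, let $F_*$ be the distribution function of $|X|$; $\overline G=1-G$ for a distribution function $G$. Then $\overline F_*$ is regularly varying of index $-\alpha$ at infinity, and there are nonnegative $p,q$ with $p+q=1$ such that, at infinity, $\overline F\sim p\overline F_*$ and the tail of $-X$ is $\sim q\overline F_*$ (an equivalence with a zero constant means $o(\overline F_* )$). Quantile function: $G^{\leftarrow}(u)=\inf\{x: G(x)\ge u\}$. $(V_i)_{i\ge1}$ and $(V_i')_{i\ge1}$ are independent sequences of independent random variables uniformly distributed on $[0,1]$; $(w_i)_{i\ge1}$ and $(w_i')_{i\ge1}$ are independent sequences of independent standard (mean one) exponential random variables, independent of $(V_i)$ and $(V_i')$; $W_j=w_1+\cdots+w_j$ and $W_j'=w_1'+\cdots+w_j'$. Point processes are viewed as random elements of the space $M([0,1]\times(\mathbb R\setminus\{0\}))$ of measures on $[0,1]\times(\mathbb R\setminus\{0\})$ equipped with the topology of vague convergence (points whose second coordinate is $0$ are disregarded); the convergence is convergence in distribution of these random measures. *)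

theory Defs
  imports "HOL-Probability.Probability" "HOL-Library.Landau_Symbols"
begin

section \<open>Stable laws and domains of attraction\<close>

text \<open>
  A law is stable of index \<open>\<alpha>\<close> if it is not concentrated at one point and if, for every
  \<open>n \<ge> 1\<close>, the sum of \<open>n\<close> independent copies of \<open>Y\<close> has the law of
  \<open>n\<^sup>1\<^sup>/\<^sup>\<alpha> Y + d\<^sub>n\<close> for some real \<open>d\<^sub>n\<close>.
\<close>

definition iid_sum_law :: "nat \<Rightarrow> real measure \<Rightarrow> real measure" where
  "iid_sum_law n \<mu> =
     distr (\<Pi>\<^sub>M i\<in>{..<n}. \<mu>) borel (\<lambda>x. \<Sum>i<n. x i)"

definition stable_law :: "real \<Rightarrow> real measure \<Rightarrow> bool" where
  "stable_law \<alpha> \<nu> \<longleftrightarrow>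
     real_distribution \<nu> \<and>
     (\<forall>c. measure \<nu> {c} \<noteq> 1) \<and>
     (\<forall>n\<ge>1. \<exists>d. iid_sum_law n \<nu> = distr \<nu> borel (\<lambda>y. real n powr (1 / \<alpha>) * y + d))"

definition in_domain_of_attraction :: "(real \<Rightarrow> real) \<Rightarrow> real \<Rightarrow> bool" where
  "in_domain_of_attraction F \<alpha> \<longleftrightarrow>
     (\<exists>(a :: nat \<Rightarrow> real) (b :: nat \<Rightarrow> real) \<nu>.
        (\<forall>n. 0 < a n) \<and> stable_law \<alpha> \<nu> \<and>
        weak_conv_m
          (\<lambda>n. distr (iid_sum_law n (interval_measure F)) borel (\<lambda>s. (s - b n) / a n)) \<nu>)"

section \<open>Tails and quantiles\<close>

text \<open>The distribution functions of \<open>\<bar>X\<bar>\<close> and \<open>-X\<close> when \<open>X\<close> has distribution function \<open>F\<close>.\<close>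

definition abs_df :: "(real \<Rightarrow> real) \<Rightarrow> real \<Rightarrow> real" where
  "abs_df F = cdf (distr (interval_measure F) borel (\<lambda>x. \<bar>x\<bar>))"

definition neg_df :: "(real \<Rightarrow> real) \<Rightarrow> real \<Rightarrow> real" where
  "neg_df F = cdf (distr (interval_measure F) borel (\<lambda>x. - x))"

definition tail :: "(real \<Rightarrow> real) \<Rightarrow> real \<Rightarrow> real" where
  "tail G x = 1 - G x"

definition quantile :: "(real \<Rightarrow> real) \<Rightarrow> real \<Rightarrow> real" where
  "quantile G u = Inf {x. u \<le> G x}"

text \<open>
  Equivalence at infinity with a constant multiple, where a zero constant means
  negligibility; \<open>f \<sim>[at_top] (\<lambda>_. 0)\<close> itself would force \<open>f\<close> to vanish eventually.
\<close>

definition equiv_mult :: "(real \<Rightarrow> real) \<Rightarrow> real \<Rightarrow> (real \<Rightarrow> real) \<Rightarrow> bool" where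
  "equiv_mult f c g \<longleftrightarrow>
     (if c = 0 then f \<in> o[at_top](g) else f \<sim>[at_top] (\<lambda>x. c * g x))"

definition tail_balance :: "(real \<Rightarrow> real) \<Rightarrow> real \<Rightarrow> real \<Rightarrow> bool" where
  "tail_balance F p q \<longleftrightarrow>
     0 \<le> p \<and> 0 \<le> q \<and> p + q = 1 \<and>
     equiv_mult (tail F) p (tail (abs_df F)) \<and>
     equiv_mult (tail (neg_df F)) q (tail (abs_df F))"

section \<open>Random measures and the vague topology\<close>

definition radon_measures :: "'a::topological_space set \<Rightarrow> 'a measure set" where
  "radon_measures E =
     {\<mu>. sets \<mu> = sets (restrict_space borel E) \<and>
         (\<forall>K. compact K \<and> K \<subseteq> E \<longrightarrow> emeasure \<mu> K < \<infinity>)}"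

definition test_functions :: "'a::topological_space set \<Rightarrow> ('a \<Rightarrow> real) set" where
  "test_functions E =
     {f. continuous_on E f \<and> (\<exists>K. compact K \<and> K \<subseteq> E \<and> (\<forall>x\<in>E - K. f x = 0))}"

text \<open>
  The coarsest topology on the Radon measures on \<open>E\<close> making the integral of every continuous
  compactly supported function continuous.
\<close>

definition vague_topology :: "'a::topological_space set \<Rightarrow> 'a measure topology" where
  "vague_topology E =
     topology_generated_by
       {{\<mu> \<in> radon_measures E. (\<integral>x. f x \<partial>\<mu>) \<in> U} |f U. f \<in> test_functions E \<and> open U}"

definition borel_of_topology :: "'a topology \<Rightarrow> 'a measure" where
  "borel_of_topology T = sigma (topspace T) {U. openin T U}"

text \<open>
  A random element of \<open>T\<close> need only be defined almost surely: the limiting point process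
  below is locally finite only outside a null event.
\<close>

definition random_element :: "'b topology \<Rightarrow> 'a measure \<Rightarrow> ('a \<Rightarrow> 'b) \<Rightarrow> bool" where
  "random_element T M N \<longleftrightarrow>
     {\<omega> \<in> space M. N \<omega> \<in> topspace T} \<in> sets M \<and>
     (AE \<omega> in M. N \<omega> \<in> topspace T) \<and>
     N \<in> restrict_space M {\<omega> \<in> space M. N \<omega> \<in> topspace T} \<rightarrow>\<^sub>M borel_of_topology T"

definition law :: "'b topology \<Rightarrow> 'a measure \<Rightarrow> ('a \<Rightarrow> 'b) \<Rightarrow> 'b measure" where
  "law T M N =
     distr (restrict_space M {\<omega> \<in> space M. N \<omega> \<in> topspace T}) (borel_of_topology T) N"

definition weak_star_conv :: "'b topology \<Rightarrow> (nat \<Rightarrow> 'b measure) \<Rightarrow> 'b measure \<Rightarrow> bool" where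
  "weak_star_conv T P Q \<longleftrightarrow>
     (\<forall>H. continuous_map T euclideanreal H \<and> bounded (H ` topspace T) \<longrightarrow>
        (\<lambda>n. \<integral>\<mu>. H \<mu> \<partial>(P n)) \<longlonglongrightarrow> (\<integral>\<mu>. H \<mu> \<partial>Q))"

definition conv_in_distribution ::
    "'c topology \<Rightarrow> 'a measure \<Rightarrow> (nat \<Rightarrow> 'a \<Rightarrow> 'c) \<Rightarrow> 'b measure \<Rightarrow> ('b \<Rightarrow> 'c) \<Rightarrow> bool" where
  "conv_in_distribution T M N M' N' \<longleftrightarrow>
     (\<forall>n. random_element T M (N n)) \<and> random_element T M' N' \<and>
     weak_star_conv T (\<lambda>n. law T M (N n)) (law T M' N')"

section \<open>The point processes\<close>

text \<open>
  The sum over \<open>i \<in> I\<close> of the Dirac masses at \<open>z i\<close>, as a measure on \<open>E\<close>: points outside \<open>E\<close>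
  are disregarded, and coinciding points are counted with multiplicity.
\<close>

definition point_measure_on :: "'a::topological_space set \<Rightarrow> 'i set \<Rightarrow> ('i \<Rightarrow> 'a) \<Rightarrow> 'a measure" where
  "point_measure_on E I z = distr (count_space {i \<in> I. z i \<in> E}) (restrict_space borel E) z"

definition strip :: "(real \<times> real) set" where
  "strip = {0..1} \<times> (UNIV - {0})"

definition lin_proc :: "(nat \<Rightarrow> real) \<Rightarrow> (nat \<Rightarrow> 'a \<Rightarrow> real) \<Rightarrow> nat \<Rightarrow> 'a \<Rightarrow> real" where
  "lin_proc \<kappa> X i \<omega> = (\<Sum>j=1..i. \<kappa> (i - j) * X j \<omega>)"

text \<open>
  Both endpoints are included in the truncated mean; this matters when \<open>F\<close> has an atom at
  one of the two quantiles.
\<close>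

definition centering :: "(real \<Rightarrow> real) \<Rightarrow> (nat \<Rightarrow> real) \<Rightarrow> nat \<Rightarrow> nat \<Rightarrow> real" where
  "centering F \<kappa> n i =
     (\<Sum>j=1..i. \<kappa> (i - j) *
        (LINT x:{quantile F (1 / real n)..quantile F (1 - 1 / real n)}|interval_measure F. x))"

definition lin_point_process ::
    "(real \<Rightarrow> real) \<Rightarrow> (nat \<Rightarrow> real) \<Rightarrow> (nat \<Rightarrow> 'a \<Rightarrow> real) \<Rightarrow> nat \<Rightarrow> 'a \<Rightarrow> (real \<times> real) measure" where
  "lin_point_process F \<kappa> X n \<omega> =
     point_measure_on strip {1..n}
       (\<lambda>i. (real i / real n,
             (lin_proc \<kappa> X i \<omega> - centering F \<kappa> n i) / quantile (abs_df F) (1 - 1 / real n)))"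

definition partial_sum :: "(nat \<Rightarrow> 'a \<Rightarrow> real) \<Rightarrow> nat \<Rightarrow> 'a \<Rightarrow> real" where
  "partial_sum w j \<omega> = (\<Sum>k=1..j. w k \<omega>)"

definition limit_point_process ::
    "real \<Rightarrow> real \<Rightarrow> real \<Rightarrow> (nat \<Rightarrow> real) \<Rightarrow> (nat \<Rightarrow> 'a \<Rightarrow> real) \<Rightarrow> (nat \<Rightarrow> 'a \<Rightarrow> real) \<Rightarrow>
     (nat \<Rightarrow> 'a \<Rightarrow> real) \<Rightarrow> (nat \<Rightarrow> 'a \<Rightarrow> real) \<Rightarrow> 'a \<Rightarrow> (real \<times> real) measure" where
  "limit_point_process \<alpha> p q \<kappa> V V' w w' \<omega> =
     point_measure_on strip (({1..} \<times> UNIV) <+> ({1..} \<times> UNIV))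
       (case_sum
         (\<lambda>(j, i). (V j \<omega>, p powr (1 / \<alpha>) * \<kappa> i * partial_sum w j \<omega> powr (- 1 / \<alpha>)))
         (\<lambda>(j, i). (V' j \<omega>, - (q powr (1 / \<alpha>)) * \<kappa> i * partial_sum w' j \<omega> powr (- 1 / \<alpha>))))"

end

theory Submission
  imports Defs "HOL-Real_Asymp.Real_Asymp"
begin

text \<open>
  Convergence in distribution for the vague topology is reduced to convergence of Laplace
  functionals. Domain of attraction enters only through tail asymptotics: the characteristic
  function of the symmetrised law gives regular variation of its tail, which transfers to the
  original law. A Bernstein-type exponential bound, for which the summability of
  \<open>\<bar>\<kappa>\<^sub>i\<bar>\<^sup>r\<close> is needed, makes the contribution of the truncated innovations negligible uniformly
  in time. Up to small probability the remaining large innovations are few and far apart, so that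
  each of them produces an isolated cluster \<open>\<kappa>\<^sub>0 X\<^sub>j, \<kappa>\<^sub>1 X\<^sub>j, \<dots>\<close> at essentially the same time,
  and the Laplace functional of the process is close to that of the independent marks
  \<open>X\<^sub>j\<close> for the test function summed over a cluster. The latter factorises, and its limit is
  identified with the Laplace functional of the limit process by a martingale argument for the
  renewal sequence \<open>W\<^sub>j\<close>.
\<close>

text \<open>A stable law is given here only by its convolution property, and the norming
  \<open>a\<close> is an arbitrary positive sequence. Symmetrising removes the centring
  \<open>b\<close>, which only contributes a phase; averaging over a Gaussian frequency then turns 1
  - cos into a function increasing in |x|, from which tails can be read off. Regular variation is
  recovered from limits along \<open>a\<close> by monotonicity alone. When \<open>r\<close> is
  large, even the squares of the coefficients need not be summable. The variance of the normalised
  truncated sum at one time is of order (1/n) times the sum of the first n squares, so Chebyshev's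
  inequality summed over n times yields no bound tending to 0. This forces exponential moments. The
  cluster comparison must not become circular: the threshold for a large innovation and the number
  \<open>m\<close> of lags are chosen after the modulus of continuity of the test function. Its
  error is therefore counted only over the pairs (innovation, lag) that can reach the support of the
  test function, a number depending on neither. The cluster functional with all lags is in general
  not a test function, so n tends to infinity at fixed \<open>m\<close>, and \<open>m\<close>
  afterwards.\<close>

section \<open>The vague topology on the strip\<close>

text \<open>Stone-Weierstrass cast as an induction principle. The linear span of the
  multiplicatively closed \<open>B\<close> is the algebra, and \<open>P\<close> is any property that
  holds for multiples of elements of \<open>B\<close> and passes to sums. It serves three times,
  with \<open>P\<close> stating continuity or convergence of integrals. \<open>P_add\<close> also
  supplies continuity of the summands, so that their integrability is at hand when integrals are
  added.\<close>

lemma Stone_Weierstrass_span: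
  fixes S :: "'s::t2_space set"
  assumes "compact S"
    and cont: "\<And>b. b \<in> B \<Longrightarrow> continuous_on S b"
    and one_in: "(\<lambda>_. 1) \<in> B"
    and mult: "\<And>b c. b \<in> B \<Longrightarrow> c \<in> B \<Longrightarrow> (\<lambda>x. b x * c x) \<in> B"
    and sep: "\<And>x y. x \<in> S \<Longrightarrow> y \<in> S \<Longrightarrow> x \<noteq> y \<Longrightarrow> \<exists>b\<in>B. b x \<noteq> b y"
    and P_base: "\<And>b c. b \<in> B \<Longrightarrow> P (\<lambda>x. c * b x)"
    and P_add: "\<And>f g. continuous_on S f \<Longrightarrow> continuous_on S g \<Longrightarrow> P f \<Longrightarrow> P g \<Longrightarrow> P (\<lambda>x. f x + g x)"
    and f: "continuous_on S f" and "e > (0::real)"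
  shows "\<exists>g. P g \<and> continuous_on S g \<and> (\<forall>x\<in>S. \<bar>f x - g x\<bar> < e)"
proof -
  \<comment> \<open>Lists of coefficient-generator pairs represent the span: sums are appends, and
    the induction peels off one term at a time.\<close>
  define R where "R = {g. \<exists>cs. set (map snd cs) \<subseteq> B \<and> g = (\<lambda>x. \<Sum>(c,b)\<leftarrow>cs. c * b x)}"
  have base: "(\<lambda>x. c * b x) \<in> R" if "b \<in> B" for b c
    unfolding R_def using that by (auto intro!: exI[of _ "[(c,b)]"])
  have R_add: "(\<lambda>x. g x + h x) \<in> R" if "g \<in> R" "h \<in> R" for g h
  proof -
    from that obtain cs ds where "set (map snd cs) \<subseteq> B" "g = (\<lambda>x. \<Sum>(c,b)\<leftarrow>cs. c * b x)"
      "set (map snd ds) \<subseteq> B" "h = (\<lambda>x. \<Sum>(c,b)\<leftarrow>ds. c * b x)" unfolding R_def by blast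
    then show ?thesis unfolding R_def by (intro CollectI exI[of _ "cs @ ds"]) auto
  qed
  have R_ind: "Q g" if "g \<in> R" and zero: "Q (\<lambda>_. 0)"
    and step: "\<And>c b g. b \<in> B \<Longrightarrow> g \<in> R \<Longrightarrow> Q g \<Longrightarrow> Q (\<lambda>x. c * b x + g x)" for Q g
  proof -
    from that(1) obtain cs where cs: "set (map snd cs) \<subseteq> B" and g: "g = (\<lambda>x. \<Sum>(c,b)\<leftarrow>cs. c * b x)"
      unfolding R_def by blast
    have "Q (\<lambda>x. \<Sum>(c,b)\<leftarrow>cs. c * b x)" using cs
    proof (induction cs)
      case (Cons a cs)
      obtain c b where a: "a = (c,b)" by (cases a)
      have "(\<lambda>x. \<Sum>(c,b)\<leftarrow>cs. c * b x) \<in> R" unfolding R_def using Cons.prems by auto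
      from step[OF _ this, of b c] Cons a show ?case by auto
    qed (simp add: zero)
    then show ?thesis by (simp add: g)
  qed
  have R_mult1: "(\<lambda>x. (c * b x) * g x) \<in> R" if "b \<in> B" "g \<in> R" for b c g
    using that(2)
  proof (rule R_ind)
    show "(\<lambda>x. (c * b x) * 0) \<in> R" using base[OF that(1), of 0] by simp
    fix c' b' g' assume "b' \<in> B" "g' \<in> R" and IH: "(\<lambda>x. c * b x * g' x) \<in> R"
    have "(\<lambda>x. (c * c') * (b x * b' x)) \<in> R" by (rule base[OF mult]) fact+
    from R_add[OF this IH] show "(\<lambda>x. c * b x * (c' * b' x + g' x)) \<in> R"
      by (simp add: algebra_simps)
  qed
  have R_mult: "(\<lambda>x. h x * g x) \<in> R" if "h \<in> R" "g \<in> R" for g h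
    using that(1)
  proof (rule R_ind)
    show "(\<lambda>x. 0 * g x) \<in> R" using base[OF one_in, of 0] by simp
    fix c' b' g' assume "b' \<in> B" "g' \<in> R" and IH: "(\<lambda>x. g' x * g x) \<in> R"
    from R_add[OF R_mult1[OF \<open>b' \<in> B\<close> that(2), of c'] IH]
    show "(\<lambda>x. (c' * b' x + g' x) * g x) \<in> R" by (simp add: algebra_simps)
  qed
  have R_cont: "continuous_on S g" if "g \<in> R" for g
    using that
  proof (rule R_ind)
    show "continuous_on S (\<lambda>x. c * b x + g x)" if "b \<in> B" "continuous_on S g" for c b g
      using cont[OF that(1)] that(2) by (intro continuous_intros)
  qed simp
  interpret function_ring_on R S
  proof
    show "(\<lambda>_. c) \<in> R" for c using base[OF one_in, of c] by simp
    show "\<exists>f\<in>R. f x \<noteq> f y" if xy: "x \<in> S" "y \<in> S" "x \<noteq> y" for x y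
    proof -
      from sep[OF xy] obtain b where b: "b \<in> B" "b x \<noteq> b y" by blast
      with base[OF b(1), of 1] show ?thesis by auto
    qed
  qed (use assms R_cont R_add R_mult in auto)
  from Stone_Weierstrass_basic[OF f \<open>e > 0\<close>]
  obtain g where g: "g \<in> R" "\<forall>x\<in>S. \<bar>f x - g x\<bar> < e" by blast
  have "P g" using g(1)
  proof (rule R_ind)
    show "P (\<lambda>_. 0)" using P_base[OF one_in, of 0] by simp
    show "P (\<lambda>x. c * b x + g x)" if "b \<in> B" "g \<in> R" "P g" for c b g
    proof (rule P_add)
      show "continuous_on S (\<lambda>x. c * b x)" using cont[OF that(1)] by (intro continuous_intros)
    qed (use R_cont that P_base in auto)
  qed
  with g R_cont[OF g(1)] show ?thesis by blast
qed

text \<open>The condition is |x| + 1/|x| <= m multiplied by |x|. In this form it is visibly closed,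
  and it excludes x = 0 without a division.\<close>

definition strip_exh :: "nat \<Rightarrow> (real \<times> real) set" where
  "strip_exh m = {0..1} \<times> {x. x\<^sup>2 + 1 \<le> real m * \<bar>x\<bar>}"

definition bump :: "nat \<Rightarrow> real \<times> real \<Rightarrow> real" where
  "bump m z = max 0 (min 1 (real m + 1 - (\<bar>snd z\<bar> + 1 / \<bar>snd z\<bar>)))"

lemma strip_exh_iff:
  "z \<in> strip_exh m \<longleftrightarrow> z \<in> strip \<and> \<bar>snd z\<bar> + 1 / \<bar>snd z\<bar> \<le> real m"
proof (cases "snd z = 0")
  case False
  then have "\<bar>snd z\<bar> > 0" by simp
  have "(snd z)\<^sup>2 + 1 \<le> real m * \<bar>snd z\<bar> \<longleftrightarrow> \<bar>snd z\<bar> + 1 / \<bar>snd z\<bar> \<le> real m"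
    using \<open>\<bar>snd z\<bar> > 0\<close> by (simp add: field_simps power2_eq_square)
  then show ?thesis using False by (auto simp: strip_exh_def strip_def mem_Times_iff)
qed (auto simp: strip_exh_def strip_def mem_Times_iff)

lemma compact_strip_exh: "compact (strip_exh m)"
proof -
  have "{x. x\<^sup>2 + 1 \<le> real m * \<bar>x\<bar>} \<subseteq> cball 0 (real m)"
  proof
    fix x :: real assume "x \<in> {x. x\<^sup>2 + 1 \<le> real m * \<bar>x\<bar>}"
    then have "\<bar>x\<bar> * \<bar>x\<bar> \<le> real m * \<bar>x\<bar>" and "0 < \<bar>x\<bar>" by (auto simp: power2_eq_square)
    then have "\<bar>x\<bar> \<le> real m" by (rule mult_right_le_imp_le)
    then show "x \<in> cball 0 (real m)" by simp
  qed
  moreover have "closed {x::real. x\<^sup>2 + 1 \<le> real m * \<bar>x\<bar>}"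
    by (intro closed_Collect_le continuous_intros)
  ultimately have "compact {x. x\<^sup>2 + 1 \<le> real m * \<bar>x\<bar>}"
    using bounded_subset bounded_cball compact_eq_bounded_closed by blast
  then show ?thesis unfolding strip_exh_def by (intro compact_Times) auto
qed

lemma strip_exh_subset: "strip_exh m \<subseteq> strip"
  by (auto simp: strip_exh_iff)

lemma continuous_on_strip_rho: "continuous_on strip (\<lambda>z. \<bar>snd z\<bar> + 1 / \<bar>snd z\<bar>)"
  by (intro continuous_intros) (auto simp: strip_def)

text \<open>|x| + 1/|x| is continuous off the axis, hence bounded on a compact set. So the countably
  many sets \<open>strip_exh m\<close> suffice to test local finiteness, which is what makes it a
  measurable condition later.\<close>

lemma compact_subset_strip_exh:
  assumes "compact K" "K \<subseteq> strip" shows "\<exists>m. K \<subseteq> strip_exh m"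
proof -
  have "compact ((\<lambda>z. \<bar>snd z\<bar> + 1 / \<bar>snd z\<bar>) ` K)"
    using assms by (intro compact_continuous_image continuous_on_subset[OF continuous_on_strip_rho])
  then have "bounded ((\<lambda>z. \<bar>snd z\<bar> + 1 / \<bar>snd z\<bar>) ` K)" by (rule compact_imp_bounded)
  then obtain a where a: "\<forall>z\<in>K. \<bar>snd z\<bar> + 1 / \<bar>snd z\<bar> \<le> a"
    unfolding bounded_iff by fastforce
  obtain m where "a \<le> real m" using real_arch_simple by blast
  with a assms(2) have "K \<subseteq> strip_exh m" by (force simp: strip_exh_iff)
  then show ?thesis ..
qed

lemma continuous_on_bump: "continuous_on strip (bump m)"
  unfolding bump_def by (intro continuous_intros continuous_on_strip_rho) 

lemma bump_bounds: "0 \<le> bump m z" "bump m z \<le> 1"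
  by (auto simp: bump_def)

lemma bump_one: "z \<in> strip_exh m \<Longrightarrow> bump m z = 1"
  by (auto simp: bump_def strip_exh_iff)

lemma bump_zero: "z \<in> strip - strip_exh (Suc m) \<Longrightarrow> bump m z = 0"
  by (auto simp: bump_def strip_exh_iff)

lemma radon_strip_iff:
  "\<mu> \<in> radon_measures strip \<longleftrightarrow>
     sets \<mu> = sets (restrict_space borel strip) \<and> (\<forall>m. emeasure \<mu> (strip_exh m) < \<infinity>)"
proof
  assume "\<mu> \<in> radon_measures strip"
  then show "sets \<mu> = sets (restrict_space borel strip) \<and> (\<forall>m. emeasure \<mu> (strip_exh m) < \<infinity>)"
    using compact_strip_exh strip_exh_subset by (auto simp: radon_measures_def)
next
  assume *: "sets \<mu> = sets (restrict_space borel strip) \<and> (\<forall>m. emeasure \<mu> (strip_exh m) < \<infinity>)"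
  have "emeasure \<mu> K < \<infinity>" if K: "compact K" "K \<subseteq> strip" for K
  proof -
    obtain m where m: "K \<subseteq> strip_exh m" using compact_subset_strip_exh[OF K] ..
    have "strip_exh m \<in> sets \<mu>" using * compact_strip_exh[of m] strip_exh_subset[of m]
      by (auto simp: sets_restrict_space borel_compact intro!: image_eqI[of _ _ "strip_exh m"])
    then show ?thesis using emeasure_mono[OF m] * by (meson le_less_trans)
  qed
  with * show "\<mu> \<in> radon_measures strip" by (auto simp: radon_measures_def)
qed

lemma test_function_support:
  assumes "f \<in> test_functions strip"
  shows "\<exists>m. \<forall>z\<in>strip - strip_exh m. f z = 0"
proof -
  obtain K where "compact K" "K \<subseteq> strip" "\<forall>z\<in>strip - K. f z = 0"
    using assms by (auto simp: test_functions_def)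
  with compact_subset_strip_exh[of K] show ?thesis by blast
qed

lemma bump_mult_test_function:
  assumes "continuous_on strip f" shows "(\<lambda>z. bump m z * f z) \<in> test_functions strip"
  unfolding test_functions_def
  using assms compact_strip_exh[of "Suc m"] strip_exh_subset[of "Suc m"]
  by (auto intro!: continuous_intros continuous_on_bump bump_zero exI[of _ "strip_exh (Suc m)"])

lemma test_function_bounded:
  assumes "f \<in> test_functions strip"
  shows "\<exists>B>0. \<forall>z\<in>strip. \<bar>f z\<bar> \<le> B"
proof -
  obtain K where K: "compact K" "K \<subseteq> strip" "\<forall>z\<in>strip - K. f z = 0" "continuous_on strip f"
    using assms by (auto simp: test_functions_def)
  have "bounded (f ` K)"
    using K by (intro compact_imp_bounded compact_continuous_image continuous_on_subset[OF K(4)])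
  then obtain B where "\<forall>z\<in>K. \<bar>f z\<bar> \<le> B" unfolding bounded_iff by auto
  then show ?thesis using K(3) by (intro exI[of _ "max B 1"]) (force simp: max_def)
qed

lemma test_function_measurable:
  assumes "f \<in> test_functions strip" "sets \<mu> = sets (restrict_space borel strip)"
  shows "f \<in> borel_measurable \<mu>"
  using assms borel_measurable_continuous_on_restrict[of strip f]
  by (simp add: test_functions_def cong: measurable_cong_sets)

lemma space_radon: "sets \<mu> = sets (restrict_space borel strip) \<Longrightarrow> space \<mu> = strip"
  by (metis sets_eq_imp_space_eq space_restrict_space2 space_restrict_space space_borel Int_UNIV_right)

lemma test_function_integrable:
  assumes "f \<in> test_functions strip" "\<mu> \<in> radon_measures strip"
  shows "integrable \<mu> f"
proof -
  have s: "sets \<mu> = sets (restrict_space borel strip)" using assms by (simp add: radon_measures_def)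
  obtain B where B: "B > 0" "\<forall>z\<in>strip. \<bar>f z\<bar> \<le> B" using test_function_bounded[OF assms(1)] by blast
  obtain m where m: "\<forall>z\<in>strip - strip_exh m. f z = 0" using test_function_support[OF assms(1)] by blast
  have "strip_exh m \<in> sets \<mu>" using s compact_strip_exh[of m] strip_exh_subset[of m]
      by (auto simp: sets_restrict_space borel_compact intro!: image_eqI[of _ _ "strip_exh m"])
  moreover have "emeasure \<mu> (strip_exh m) < \<infinity>" using assms(2) by (simp add: radon_strip_iff)
  ultimately have "integrable \<mu> (\<lambda>z. B * indicator (strip_exh m) z)" by auto
  then show ?thesis
  proof (rule Bochner_Integration.integrable_bound)
    show "f \<in> borel_measurable \<mu>" by (rule test_function_measurable[OF assms(1) s])
    show "AE x in \<mu>. norm (f x) \<le> norm (B * indicator (strip_exh m) x)"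
      using B m space_radon[OF s] by (intro AE_I2) (auto simp: indicator_def)
  qed
qed

section \<open>A countable code for the vague topology\<close>

definition sep_fun :: "nat \<Rightarrow> real \<times> real \<Rightarrow> real" where
  "sep_fun k z = (case prod_decode k of (m, l) \<Rightarrow> case prod_decode l of (a, b) \<Rightarrow>
      bump m z * ((fst z) ^ a * (snd z + real m + 1) ^ b))"

definition sep_index :: "nat \<Rightarrow> nat \<Rightarrow> nat \<Rightarrow> nat" where
  "sep_index m a b = prod_encode (m, prod_encode (a, b))"

lemma sep_fun_index: "sep_fun (sep_index m a b) z = bump m z * ((fst z) ^ a * (snd z + real m + 1) ^ b)"
  by (simp add: sep_fun_def sep_index_def)

lemma sep_index_surj: "\<exists>m a b. k = sep_index m a b"
  unfolding sep_index_def by (metis prod_decode_inverse prod.exhaust)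

lemma sep_fun_test: "sep_fun k \<in> test_functions strip"
proof -
  obtain m a b where k: "k = sep_index m a b" using sep_index_surj by blast
  have "sep_fun k = (\<lambda>z. bump m z * ((fst z) ^ a * (snd z + real m + 1) ^ b))"
    by (auto simp: k sep_fun_index)
  then show ?thesis by (auto intro!: bump_mult_test_function continuous_intros)
qed

text \<open>This is why the monomials are in x + m + 1 instead of x: on the support of
  \<open>bump m\<close> one has |x| <= m + 1. Non-negativity makes the code below take values in the
  unit cube.\<close>

lemma sep_fun_nonneg: "z \<in> strip \<Longrightarrow> 0 \<le> sep_fun k z"
proof -
  assume z: "z \<in> strip"
  obtain m a b where k: "k = sep_index m a b" using sep_index_surj by blast
  show ?thesis
  proof (cases "z \<in> strip_exh (Suc m)")
    case True
    then have "\<bar>snd z\<bar> + 1 / \<bar>snd z\<bar> \<le> real m + 1" by (simp add: strip_exh_iff)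
    moreover have "1 / \<bar>snd z\<bar> \<ge> 0" by simp
    ultimately have "snd z + real m + 1 \<ge> 0" by linarith
    with z show ?thesis
      by (auto simp: k sep_fun_index strip_def intro!: mult_nonneg_nonneg bump_bounds)
  next
    case False with z have "bump m z = 0" by (intro bump_zero) auto
    then show ?thesis by (simp add: k sep_fun_index)
  qed
qed

text \<open>The exponential serves twice. It sends the integrals into a compact cube, and it makes
  every monomial in the coordinates a Laplace functional, namely that of a finite sum of the
  functions \<open>sep_fun k\<close>.\<close>

definition vague_code :: "(real \<times> real) measure \<Rightarrow> nat \<Rightarrow> real" where
  "vague_code \<mu> k = exp (- (\<integral>z. sep_fun k z \<partial>\<mu>))"

lemma vague_code_bounds:
  assumes "\<mu> \<in> radon_measures strip"
  shows "vague_code \<mu> k \<in> {0<..1}"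
proof -
  have "space \<mu> = strip" using assms by (auto simp: radon_measures_def dest: space_radon)
  then have "0 \<le> (\<integral>z. sep_fun k z \<partial>\<mu>)"
    by (intro integral_nonneg_AE AE_I2) (auto simp: sep_fun_nonneg)
  then show ?thesis by (simp add: vague_code_def)
qed

abbreviation code_topology :: "(real \<times> real) measure topology" where
  "code_topology \<equiv> pullback_topology (radon_measures strip) vague_code euclidean"

lemma topspace_code: "topspace code_topology = radon_measures strip"
  by (simp add: topspace_pullback_topology)

lemma continuous_map_code_sep: "continuous_map code_topology euclideanreal (\<lambda>\<mu>. \<integral>z. sep_fun k z \<partial>\<mu>)"
proof -
  have 1: "continuous_map code_topology euclidean vague_code"
    using continuous_map_pullback[OF continuous_map_id, of "radon_measures strip" vague_code] by simp
  have "continuous_map code_topology euclideanreal (\<lambda>\<mu>. vague_code \<mu> k)"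
  proof -
    have "continuous_map euclidean euclideanreal (\<lambda>x::nat\<Rightarrow>real. x k)"
      by (simp add: continuous_on_product_coordinates)
    from continuous_map_compose[OF 1 this] show ?thesis by (simp add: o_def)
  qed
  then have "continuous_map code_topology (subtopology euclideanreal {0<..}) (\<lambda>\<mu>. vague_code \<mu> k)"
    using vague_code_bounds by (auto simp: continuous_map_in_subtopology topspace_code)
  moreover have "continuous_map (subtopology euclideanreal {0<..}) euclideanreal (\<lambda>x. - ln x)"
    by (auto intro!: continuous_intros)
  ultimately have "continuous_map code_topology euclideanreal ((\<lambda>x. - ln x) \<circ> (\<lambda>\<mu>. vague_code \<mu> k))"
    by (rule continuous_map_compose)
  then show ?thesis by (simp add: o_def vague_code_def)
qed

text \<open>The error is bounded by a multiple of the bump itself. Its integral is then controlled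
  by the integral of \<open>bump m\<close>, which is one of the coded integrals; a uniform bound
  would be useless, since the total mass of a Radon measure may be infinite.\<close>

lemma bump_poly_dense:
  assumes f: "f \<in> test_functions strip"
  shows "\<exists>m. \<forall>e>0. \<exists>g. continuous_on strip g \<and> continuous_map code_topology euclideanreal (\<lambda>\<mu>. \<integral>z. bump m z * g z \<partial>\<mu>)
     \<and> (\<forall>z\<in>strip. \<bar>f z - bump m z * g z\<bar> \<le> e * bump m z)"
proof -
  obtain m where m: "\<forall>z\<in>strip - strip_exh m. f z = 0" using test_function_support[OF f] by blast
  define B where "B = {b. \<exists>i j. b = (\<lambda>z::real\<times>real. (fst z) ^ i * (snd z + real m + 1) ^ j)}"
  define P where "P = (\<lambda>g. continuous_on strip g \<and> continuous_map code_topology euclideanreal (\<lambda>\<mu>. \<integral>z. bump m z * g z \<partial>\<mu>))"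
  have "\<exists>g. P g \<and> continuous_on (strip_exh (Suc m)) g \<and> (\<forall>x\<in>strip_exh (Suc m). \<bar>f x - g x\<bar> < e)" if "e > 0" for e
  proof (rule Stone_Weierstrass_span[where B=B])
    show "compact (strip_exh (Suc m))" by (rule compact_strip_exh)
    show "continuous_on (strip_exh (Suc m)) b" if "b \<in> B" for b
      using that by (auto simp: B_def intro!: continuous_intros)
    show "(\<lambda>_. 1) \<in> B" unfolding B_def by (rule CollectI, rule exI[of _ 0], rule exI[of _ 0]) auto
    show "(\<lambda>x. b x * c x) \<in> B" if bc: "b \<in> B" "c \<in> B" for b c
    proof -
      from bc obtain i j i' j' where "b = (\<lambda>z. (fst z) ^ i * (snd z + real m + 1) ^ j)"
        "c = (\<lambda>z. (fst z) ^ i' * (snd z + real m + 1) ^ j')" by (auto simp: B_def)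
      then show ?thesis unfolding B_def
        by (intro CollectI exI[of _ "i+i'"] exI[of _ "j+j'"]) (auto simp: power_add algebra_simps)
    qed
    show "\<exists>b\<in>B. b x \<noteq> b y" if "x \<noteq> y" for x y
    proof (cases "fst x = fst y")
      case True
      with that have "snd x \<noteq> snd y" by (simp add: prod_eq_iff)
      moreover have "(\<lambda>z. snd z + real m + 1) \<in> B"
        unfolding B_def by (rule CollectI, rule exI[of _ 0], rule exI[of _ 1]) auto
      ultimately show ?thesis by (intro bexI[of _ "\<lambda>z. snd z + real m + 1"]) auto
    next
      case False
      moreover have "fst \<in> B"
        unfolding B_def by (rule CollectI, rule exI[of _ 1], rule exI[of _ 0]) auto
      ultimately show ?thesis by blast
    qed
    show "P (\<lambda>x. c * b x)" if "b \<in> B" for b c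
    proof -
      from that obtain i j where b: "b = (\<lambda>z. (fst z) ^ i * (snd z + real m + 1) ^ j)" by (auto simp: B_def)
      have "continuous_map code_topology euclideanreal (\<lambda>\<mu>. c * (\<integral>z. sep_fun (sep_index m i j) z \<partial>\<mu>))"
        by (intro continuous_map_real_mult_left continuous_map_code_sep)
      moreover have "(\<integral>z. bump m z * (c * b z) \<partial>\<mu>) = c * (\<integral>z. sep_fun (sep_index m i j) z \<partial>\<mu>)" for \<mu>
        by (subst integral_mult_right_zero[symmetric], rule Bochner_Integration.integral_cong) (auto simp: sep_fun_index b)
      ultimately show ?thesis by (auto simp: P_def b intro!: continuous_intros)
    qed
    show "P (\<lambda>x. g x + h x)" if "P g" "P h" for g h
    proof -
      have g: "continuous_on strip g" and h: "continuous_on strip h" using that by (auto simp: P_def)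
      have A: "continuous_map code_topology euclideanreal (\<lambda>\<mu>. (\<integral>z. bump m z * g z \<partial>\<mu>) + (\<integral>z. bump m z * h z \<partial>\<mu>))"
        using that by (intro continuous_map_add) (auto simp: P_def)
      have B: "(\<integral>z. bump m z * (g z + h z) \<partial>\<mu>) = (\<integral>z. bump m z * g z \<partial>\<mu>) + (\<integral>z. bump m z * h z \<partial>\<mu>)"
        if "\<mu> \<in> topspace code_topology" for \<mu>
        unfolding distrib_left
        using that[unfolded topspace_code]
        by (intro Bochner_Integration.integral_add test_function_integrable bump_mult_test_function g h)
      have "continuous_map code_topology euclideanreal (\<lambda>\<mu>. \<integral>z. bump m z * (g z + h z) \<partial>\<mu>)"
        by (rule continuous_map_eq[OF A B[symmetric]])
      then show ?thesis using g h by (auto simp: P_def intro!: continuous_intros)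
    qed
    show "continuous_on (strip_exh (Suc m)) f"
      using f strip_exh_subset by (auto simp: test_functions_def intro: continuous_on_subset)
    show "0 < e" by fact
  qed
  moreover have "\<bar>f z - bump m z * g z\<bar> \<le> e * bump m z"
    if z: "z \<in> strip" and g: "\<forall>x\<in>strip_exh (Suc m). \<bar>f x - g x\<bar> < e" for g z e
  proof -
    \<comment> \<open>\<open>f\<close> vanishes outside \<open>strip_exh m\<close>, and inside it
      the bump is 1. Multiplying by the bump thus leaves \<open>f\<close> unchanged and cuts off the
      polynomial.\<close>
    have "bump m z * f z = f z" using m bump_one z by (cases "z \<in> strip_exh m") auto
    then have "\<bar>f z - bump m z * g z\<bar> = bump m z * \<bar>f z - g z\<bar>"
      by (metis abs_mult abs_of_nonneg bump_bounds(1) right_diff_distrib)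
    also have "\<dots> \<le> e * bump m z"
    proof (cases "z \<in> strip_exh (Suc m)")
      case True with g show ?thesis using bump_bounds[of m z] by (simp add: mult.commute[of e] less_imp_le mult_left_mono)
    next
      case False with z show ?thesis by (simp add: bump_zero)
    qed
    finally show ?thesis .
  qed
  ultimately have "\<exists>g. P g \<and> (\<forall>z\<in>strip. \<bar>f z - bump m z * g z\<bar> \<le> e * bump m z)" if "e > 0" for e
    using that by (meson less_imp_le)
  then show ?thesis unfolding P_def by blast
qed

lemma continuous_map_code_test:
  assumes f: "f \<in> test_functions strip"
  shows "continuous_map code_topology euclideanreal (\<lambda>\<mu>. \<integral>z. f z \<partial>\<mu>)"
proof -
  obtain m where m: "\<And>e. e>0 \<Longrightarrow> \<exists>g. continuous_on strip g \<and> continuous_map code_topology euclideanreal (\<lambda>\<mu>. \<integral>z. bump m z * g z \<partial>\<mu>)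
     \<and> (\<forall>z\<in>strip. \<bar>f z - bump m z * g z\<bar> \<le> e * bump m z)"
    using bump_poly_dense[OF f] by blast
  have bump_test: "bump m \<in> test_functions strip" using bump_mult_test_function[of "\<lambda>_. 1" m] by simp
  have bump_cont: "continuous_map code_topology euclideanreal (\<lambda>\<mu>. \<integral>z. bump m z \<partial>\<mu>)"
    using continuous_map_code_sep[of "sep_index m 0 0"] by (simp add: sep_fun_index)
  have "openin code_topology {\<mu> \<in> topspace code_topology. (\<integral>z. f z \<partial>\<mu>) \<in> U}" if U: "openin euclideanreal U" for U
  proof (subst openin_subopen, safe)
    fix \<mu>0 assume \<mu>0: "\<mu>0 \<in> topspace code_topology" "(\<integral>z. f z \<partial>\<mu>0) \<in> U"
    obtain d where d: "d > 0" "ball (\<integral>z. f z \<partial>\<mu>0) d \<subseteq> U"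
      using U \<mu>0(2) by (auto simp: open_contains_ball)
    \<comment> \<open>The added 1 makes "the integral of \<open>bump m\<close> is less than
      \<open>C\<close>" an open condition satisfied at the given measure.\<close>
    define C where "C = (\<integral>z. bump m z \<partial>\<mu>0) + 1"
    have "C > 0" unfolding C_def by (smt (verit) Bochner_Integration.integral_nonneg bump_bounds(1))
    obtain g where g: "continuous_on strip g" "continuous_map code_topology euclideanreal (\<lambda>\<mu>. \<integral>z. bump m z * g z \<partial>\<mu>)"
       "\<forall>z\<in>strip. \<bar>f z - bump m z * g z\<bar> \<le> d / (4 * C) * bump m z"
      using m[of "d / (4*C)"] d \<open>C > 0\<close> by auto
    have diff: "\<bar>(\<integral>z. f z \<partial>\<mu>) - (\<integral>z. bump m z * g z \<partial>\<mu>)\<bar> \<le> d / (4*C) * (\<integral>z. bump m z \<partial>\<mu>)"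
      if "\<mu> \<in> topspace code_topology" for \<mu>
    proof -
      have R: "\<mu> \<in> radon_measures strip" using that by (simp only: topspace_code)
      have sp: "space \<mu> = strip" using R by (auto simp: radon_measures_def dest: space_radon)
      have i: "integrable \<mu> f" "integrable \<mu> (\<lambda>z. bump m z * g z)" "integrable \<mu> (bump m)"
        by (auto intro!: test_function_integrable[OF _ R] f bump_test bump_mult_test_function g(1))
      have "\<bar>(\<integral>z. f z \<partial>\<mu>) - (\<integral>z. bump m z * g z \<partial>\<mu>)\<bar> = \<bar>\<integral>z. f z - bump m z * g z \<partial>\<mu>\<bar>"
        using i by simp
      also have "\<dots> \<le> (\<integral>z. \<bar>f z - bump m z * g z\<bar> \<partial>\<mu>)" by (rule integral_abs_bound)
      also have "\<dots> \<le> (\<integral>z. d / (4*C) * bump m z \<partial>\<mu>)"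
        using i g(3) sp by (intro integral_mono) auto
      finally show ?thesis by simp
    qed
    \<comment> \<open>On \<open>W\<close> the two approximation errors are at most d/4 each, and the
      approximating integral moves by less than d/2.\<close>
    define W where "W = {\<mu> \<in> topspace code_topology. (\<integral>z. bump m z * g z \<partial>\<mu>) \<in> ball (\<integral>z. bump m z * g z \<partial>\<mu>0) (d/2)} \<inter>
      {\<mu> \<in> topspace code_topology. (\<integral>z. bump m z \<partial>\<mu>) \<in> {..<C}}"
    have "openin code_topology W" unfolding W_def
      by (intro openin_Int openin_continuous_map_preimage[OF g(2)] openin_continuous_map_preimage[OF bump_cont]) auto
    moreover have "\<mu>0 \<in> W" using \<mu>0 d by (auto simp: W_def C_def)
    moreover have "W \<subseteq> {\<mu> \<in> topspace code_topology. (\<integral>z. f z \<partial>\<mu>) \<in> U}"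
    proof
      fix \<mu> assume \<mu>: "\<mu> \<in> W"
      have "d / (4*C) * (\<integral>z. bump m z \<partial>\<mu>) \<le> d / (4*C) * C"
        using \<mu> d \<open>C > 0\<close> by (intro mult_left_mono) (auto simp: W_def)
      also have "\<dots> = d/4" using \<open>C > 0\<close> by simp
      finally have q: "d / (4*C) * (\<integral>z. bump m z \<partial>\<mu>) \<le> d/4" .
      have 1: "\<bar>(\<integral>z. f z \<partial>\<mu>) - (\<integral>z. bump m z * g z \<partial>\<mu>)\<bar> \<le> d/4"
        by (rule order_trans[OF diff q]) (use \<mu> in \<open>simp add: W_def\<close>)
      have "d / (4*C) * (\<integral>z. bump m z \<partial>\<mu>0) \<le> d / (4*C) * C"
        using d \<open>C > 0\<close> by (intro mult_left_mono) (auto simp: C_def)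
      also have "\<dots> = d/4" using \<open>C > 0\<close> by simp
      finally have q: "d / (4*C) * (\<integral>z. bump m z \<partial>\<mu>0) \<le> d/4" .
      have 2: "\<bar>(\<integral>z. f z \<partial>\<mu>0) - (\<integral>z. bump m z * g z \<partial>\<mu>0)\<bar> \<le> d/4"
        by (rule order_trans[OF diff[OF \<mu>0(1)] q])
      have 3: "\<bar>(\<integral>z. bump m z * g z \<partial>\<mu>0) - (\<integral>z. bump m z * g z \<partial>\<mu>)\<bar> < d/2"
        using \<mu> by (auto simp: W_def dist_real_def)
      have "\<bar>(\<integral>z. f z \<partial>\<mu>0) - (\<integral>z. f z \<partial>\<mu>)\<bar> < d" using 1 2 3 by linarith
      then have "(\<integral>z. f z \<partial>\<mu>) \<in> ball (\<integral>z. f z \<partial>\<mu>0) d" by (simp add: dist_real_def)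
      then show "\<mu> \<in> {\<mu> \<in> topspace code_topology. (\<integral>z. f z \<partial>\<mu>) \<in> U}" using d \<mu> by (auto simp: W_def)
    qed
    ultimately show "\<exists>T. openin code_topology T \<and> \<mu>0 \<in> T \<and> T \<subseteq> {\<mu> \<in> topspace code_topology. (\<integral>z. f z \<partial>\<mu>) \<in> U}"
      by blast
  qed
  then show ?thesis by (auto simp: continuous_map_def)
qed

lemma topspace_vague: "topspace (vague_topology strip) = radon_measures strip"
proof -
  have "(\<lambda>_. 0) \<in> test_functions strip" by (auto simp: test_functions_def)
  then show ?thesis unfolding vague_topology_def topology_generated_by_topspace
    by (auto intro!: exI[of _ "{\<mu> \<in> radon_measures strip. (\<integral>x. 0 \<partial>\<mu>) \<in> UNIV}"] exI[of _ "\<lambda>_. 0"] exI[of _ UNIV])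
qed

text \<open>Every generating set of the vague topology is open for the topology pulled back by the
  code, because integrals of test functions are continuous there. Measurability and weak convergence
  can therefore be tested through countably many real coordinates.\<close>

lemma vague_open_imp_code_open:
  assumes "openin (vague_topology strip) U"
  shows "\<exists>G. open G \<and> U = {\<mu> \<in> radon_measures strip. vague_code \<mu> \<in> G}"
proof -
  have "generate_topology_on {{\<mu> \<in> radon_measures strip. (\<integral>x. f x \<partial>\<mu>) \<in> U} |f U. f \<in> test_functions strip \<and> open U} U"
    using assms unfolding vague_topology_def by (rule openin_topology_generated_by)
  then have "openin code_topology U"
  proof (induction rule: generate_topology_on.induct)
    case (Basis s)
    then obtain f U where "s = {\<mu> \<in> radon_measures strip. (\<integral>x. f x \<partial>\<mu>) \<in> U}" "f \<in> test_functions strip" "open U"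
      by blast
    then show ?case using openin_continuous_map_preimage[OF continuous_map_code_test[of f], of U]
      by (simp add: topspace_code)
  qed auto
  then obtain G where "open G" "U = vague_code -` G \<inter> radon_measures strip"
    unfolding openin_pullback_topology by auto
  then show ?thesis by (intro exI[of _ G]) auto
qed

section \<open>Borel sets of the vague topology\<close>

lemma space_borel_of_topology: "space (borel_of_topology X) = topspace X"
  unfolding borel_of_topology_def by (rule space_measure_of) (auto dest: openin_subset)

lemma sets_borel_of_topology: "openin X U \<Longrightarrow> U \<in> sets (borel_of_topology X)"
  unfolding borel_of_topology_def by (subst sets_measure_of) (auto dest: openin_subset)

lemma continuous_map_borel_measurable:
  assumes "continuous_map X euclidean H"
  shows "H \<in> borel_measurable (borel_of_topology X)"
proof (rule borel_measurableI)
  fix S :: "'b set" assume "open S"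
  then have "openin X {x \<in> topspace X. H x \<in> S}"
    using openin_continuous_map_preimage[OF assms] by simp
  moreover have "{x \<in> topspace X. H x \<in> S} = H -` S \<inter> space (borel_of_topology X)"
    by (auto simp: space_borel_of_topology)
  ultimately show "H -` S \<inter> space (borel_of_topology X) \<in> sets (borel_of_topology X)"
    by (metis sets_borel_of_topology)
qed

lemma continuous_map_vague_test:
  assumes "f \<in> test_functions E"
  shows "continuous_map (vague_topology E) euclideanreal (\<lambda>\<mu>. \<integral>z. f z \<partial>\<mu>)"
proof -
  have top: "topspace (vague_topology E) \<subseteq> radon_measures E"
    unfolding vague_topology_def topology_generated_by_topspace by auto
  have "openin (vague_topology E) {\<mu> \<in> topspace (vague_topology E). (\<integral>z. f z \<partial>\<mu>) \<in> U}" if "open U" for U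
  proof -
    have *: "openin (vague_topology E) {\<mu> \<in> radon_measures E. (\<integral>z. f z \<partial>\<mu>) \<in> U}"
      unfolding vague_topology_def
      by (rule topology_generated_by_Basis) (use assms that in blast)
    moreover from openin_subset[OF *] top
    have "{\<mu> \<in> topspace (vague_topology E). (\<integral>z. f z \<partial>\<mu>) \<in> U} = {\<mu> \<in> radon_measures E. (\<integral>z. f z \<partial>\<mu>) \<in> U}"
      by auto
    ultimately show ?thesis by simp
  qed
  then show ?thesis by (auto simp: continuous_map_def)
qed

lemma vague_code_measurable: "vague_code \<in> borel_measurable (borel_of_topology (vague_topology strip))"
proof (rule measurable_coordinatewise_then_product)
  fix k
  have "(\<lambda>\<mu>. \<integral>z. sep_fun k z \<partial>\<mu>) \<in> borel_measurable (borel_of_topology (vague_topology strip))"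
    by (intro continuous_map_borel_measurable continuous_map_vague_test sep_fun_test)
  then show "(\<lambda>\<mu>. vague_code \<mu> k) \<in> borel_measurable (borel_of_topology (vague_topology strip))"
    unfolding vague_code_def by measurable
qed

text \<open>The vague topology is generated by uncountably many functionals, yet each open set is
  the preimage of an open set of sequences under the code, so countably many integrals decide
  measurability.\<close>

lemma measurable_vague:
  assumes "\<And>\<omega>. \<omega> \<in> space M \<Longrightarrow> N \<omega> \<in> radon_measures strip"
    and "\<And>k. (\<lambda>\<omega>. \<integral>z. sep_fun k z \<partial>N \<omega>) \<in> borel_measurable M"
  shows "N \<in> M \<rightarrow>\<^sub>M borel_of_topology (vague_topology strip)"
proof -
  have code: "(\<lambda>\<omega>. vague_code (N \<omega>)) \<in> borel_measurable M"
  proof (rule measurable_coordinatewise_then_product)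
    show "(\<lambda>\<omega>. vague_code (N \<omega>) k) \<in> borel_measurable M" for k
      unfolding vague_code_def using assms(2)[of k] by measurable
  qed
  show ?thesis unfolding borel_of_topology_def
  proof (rule measurable_measure_of)
    show "{U. openin (vague_topology strip) U} \<subseteq> Pow (topspace (vague_topology strip))"
      by (auto dest: openin_subset)
    show "N \<in> space M \<rightarrow> topspace (vague_topology strip)"
      using assms(1) by (auto simp: topspace_vague)
    fix U assume "U \<in> {U. openin (vague_topology strip) U}"
    then obtain G where G: "open G" "U = {\<mu> \<in> radon_measures strip. vague_code \<mu> \<in> G}"
      using vague_open_imp_code_open by auto
    have "N -` U \<inter> space M = (\<lambda>\<omega>. vague_code (N \<omega>)) -` G \<inter> space M"
      using assms(1) by (auto simp: G)
    also have "\<dots> \<in> sets M" using code G(1) by (intro measurable_sets[OF code]) auto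
    finally show "N -` U \<inter> space M \<in> sets M" .
  qed
qed

section \<open>Point measures as random elements\<close>

lemma nn_integral_point_measure:
  assumes "f \<in> borel_measurable (restrict_space borel E)" 
  shows "(\<integral>\<^sup>+x. f x \<partial>point_measure_on E I z) = (\<integral>\<^sup>+i. (if z i \<in> E then f (z i) else 0) \<partial>count_space I)"
proof -
  have "z \<in> count_space {i \<in> I. z i \<in> E} \<rightarrow>\<^sub>M restrict_space borel E"
    by (auto simp: space_restrict_space)
  then have "(\<integral>\<^sup>+x. f x \<partial>point_measure_on E I z) = (\<integral>\<^sup>+i. f (z i) \<partial>count_space {i \<in> I. z i \<in> E})"
    unfolding point_measure_on_def using assms by (intro nn_integral_distr) auto
  also have "\<dots> = (\<integral>\<^sup>+i. f (z i) * indicator {i \<in> I. z i \<in> E} i \<partial>count_space I)"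
    by (subst nn_integral_count_space_indicator)
       (auto simp: nn_integral_count_space_indicator[of I] intro!: nn_integral_cong split: split_indicator)
  also have "\<dots> = (\<integral>\<^sup>+i. (if z i \<in> E then f (z i) else 0) \<partial>count_space I)"
    by (intro nn_integral_cong) (auto split: split_indicator)
  finally show ?thesis .
qed

lemma sets_point_measure [simp]: "sets (point_measure_on E I z) = sets (restrict_space borel E)"
  by (simp add: point_measure_on_def)

lemma sets_strip [measurable]: "strip \<in> sets borel"
  unfolding strip_def borel_prod[symmetric] by (intro pair_measureI) auto

lemma borel_measurable_nn_integral_count_space:
  assumes "countable I" "\<And>i. i \<in> I \<Longrightarrow> (\<lambda>\<omega>. f \<omega> i) \<in> borel_measurable M"
  shows "(\<lambda>\<omega>. \<integral>\<^sup>+i. f \<omega> i \<partial>count_space I) \<in> borel_measurable M"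
proof -
  interpret sigma_finite_measure "count_space I"
    using assms(1) by (rule sigma_finite_measure_count_space_countable)
  have "(\<lambda>x. f (snd x) (fst x)) \<in> borel_measurable (count_space I \<Otimes>\<^sub>M M)"
    by (rule measurable_pair_measure_countable1) (use assms in auto)
  from measurable_compose[OF measurable_pair_swap' this]
  have "(\<lambda>(\<omega>, i). f \<omega> i) \<in> borel_measurable (M \<Otimes>\<^sub>M count_space I)"
    by (simp add: case_prod_unfold)
  then show ?thesis by (rule borel_measurable_nn_integral)
qed

lemma emeasure_point_measure_strip_exh:
  "emeasure (point_measure_on strip I z) (strip_exh m) = (\<integral>\<^sup>+i. indicator (strip_exh m) (z i) \<partial>count_space I)"
proof -
  have [measurable]: "strip_exh m \<in> sets borel" by (simp add: borel_compact compact_strip_exh)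
  have s: "strip_exh m \<in> sets (restrict_space borel strip)"
    using strip_exh_subset[of m] by (auto simp: sets_restrict_space intro!: image_eqI[of _ _ "strip_exh m"])
  have "emeasure (point_measure_on strip I z) (strip_exh m) = (\<integral>\<^sup>+x. indicator (strip_exh m) x \<partial>point_measure_on strip I z)"
    using s by (intro nn_integral_indicator[symmetric]) simp
  also have "\<dots> = (\<integral>\<^sup>+i. (if z i \<in> strip then indicator (strip_exh m) (z i) else 0) \<partial>count_space I)"
    using s by (intro nn_integral_point_measure) auto
  also have "\<dots> = (\<integral>\<^sup>+i. indicator (strip_exh m) (z i) \<partial>count_space I)"
    using strip_exh_subset by (intro nn_integral_cong) (auto split: split_indicator)
  finally show ?thesis .
qed

lemma point_measure_radon_iff:
  "point_measure_on strip I z \<in> radon_measures strip \<longleftrightarrow> (\<forall>m. finite {i \<in> I. z i \<in> strip_exh m})"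
proof -
  have "emeasure (point_measure_on strip I z) (strip_exh m) = emeasure (count_space I) {i \<in> I. z i \<in> strip_exh m}" for m
  proof -
    have "(\<integral>\<^sup>+i. indicator (strip_exh m) (z i) \<partial>count_space I) = (\<integral>\<^sup>+i. indicator {i \<in> I. z i \<in> strip_exh m} i \<partial>count_space I)"
      by (intro nn_integral_cong) (auto split: split_indicator)
    then show ?thesis by (simp add: emeasure_point_measure_strip_exh)
  qed
  moreover have "emeasure (count_space I) {i \<in> I. z i \<in> strip_exh m} < \<infinity> \<longleftrightarrow> finite {i \<in> I. z i \<in> strip_exh m}" for m
    by (subst emeasure_count_space) (auto simp: less_top[symmetric])
  ultimately show ?thesis by (simp add: radon_strip_iff)
qed

text \<open>Two expressions for the same integral. The finite sum is meant for computation; the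
  extended-real one is a measurable function of the configuration even where local finiteness
  fails.\<close>

lemma integral_point_measure:
  assumes f: "f \<in> test_functions strip" "\<And>z. z \<in> strip \<Longrightarrow> 0 \<le> f z" and R: "point_measure_on strip I z \<in> radon_measures strip"
  shows "(\<integral>x. f x \<partial>point_measure_on strip I z) = (\<Sum>i | i \<in> I \<and> z i \<in> strip \<and> f (z i) \<noteq> 0. f (z i))"
    and "finite {i \<in> I. z i \<in> strip \<and> f (z i) \<noteq> 0}"
    and "(\<integral>x. f x \<partial>point_measure_on strip I z) = enn2real (\<integral>\<^sup>+i. (if z i \<in> strip then ennreal (f (z i)) else 0) \<partial>count_space I)"
proof -
  let ?J = "{i \<in> I. z i \<in> strip \<and> f (z i) \<noteq> 0}"
  have m: "f \<in> borel_measurable (restrict_space borel strip)" by (rule test_function_measurable[OF f(1) refl])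
  obtain m where "\<forall>z\<in>strip - strip_exh m. f z = 0" using test_function_support[OF f(1)] by blast
  then have "?J \<subseteq> {i \<in> I. z i \<in> strip_exh m}" by auto
  then show fin: "finite ?J" using R unfolding point_measure_radon_iff by (meson finite_subset)
  have sp: "space (point_measure_on strip I z) = strip" by (rule space_radon) simp
  have "(\<integral>x. f x \<partial>point_measure_on strip I z) = enn2real (\<integral>\<^sup>+x. ennreal (f x) \<partial>point_measure_on strip I z)"
    using m f(2) sp by (intro integral_eq_nn_integral AE_I2) (auto simp: measurable_cong_sets[OF sets_point_measure refl])
  also have *: "(\<integral>\<^sup>+x. ennreal (f x) \<partial>point_measure_on strip I z) = (\<integral>\<^sup>+i. (if z i \<in> strip then ennreal (f (z i)) else 0) \<partial>count_space I)"
    using m by (intro nn_integral_point_measure) auto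
  finally show 1: "(\<integral>x. f x \<partial>point_measure_on strip I z) = enn2real (\<integral>\<^sup>+i. (if z i \<in> strip then ennreal (f (z i)) else 0) \<partial>count_space I)" .
  have "(\<integral>\<^sup>+i. (if z i \<in> strip then ennreal (f (z i)) else 0) \<partial>count_space I) = (\<Sum>i\<in>?J. ennreal (f (z i)))"
    by (subst nn_integral_count_space'[OF fin]) auto
  also have "\<dots> = ennreal (\<Sum>i\<in>?J. f (z i))" using f(2) by (intro sum_ennreal) auto
  finally show "(\<integral>x. f x \<partial>point_measure_on strip I z) = (\<Sum>i | i \<in> I \<and> z i \<in> strip \<and> f (z i) \<noteq> 0. f (z i))"
    by (subst 1) (auto intro!: enn2real_ennreal sum_nonneg f(2))
qed

text \<open>Local finiteness amounts to countably many conditions on measurable counts, and on the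
  resulting event the coded integrals are measurable by the extended-real formula.\<close>

lemma random_element_point_measure:
  assumes I: "countable I" and z: "\<And>i. i \<in> I \<Longrightarrow> z i \<in> borel_measurable M"
    and AE: "AE \<omega> in M. \<forall>m. finite {i \<in> I. z i \<omega> \<in> strip_exh m}"
  shows "random_element (vague_topology strip) M (\<lambda>\<omega>. point_measure_on strip I (\<lambda>i. z i \<omega>))"
proof -
  let ?N = "\<lambda>\<omega>. point_measure_on strip I (\<lambda>i. z i \<omega>)"
  let ?A = "{\<omega> \<in> space M. ?N \<omega> \<in> topspace (vague_topology strip)}"
  have [measurable]: "strip_exh m \<in> sets borel" for m by (simp add: borel_compact compact_strip_exh)
  have cnt: "(\<lambda>\<omega>. emeasure (?N \<omega>) (strip_exh m)) \<in> borel_measurable M" for m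
    unfolding emeasure_point_measure_strip_exh
    by (rule borel_measurable_nn_integral_count_space[OF I], rule measurable_compose[OF z]) auto
  have A_eq: "?A = {\<omega> \<in> space M. \<forall>m. emeasure (?N \<omega>) (strip_exh m) < \<infinity>}"
    by (auto simp: topspace_vague radon_strip_iff)
  have A: "?A \<in> sets M" unfolding A_eq using cnt by measurable
  moreover have "AE \<omega> in M. ?N \<omega> \<in> topspace (vague_topology strip)"
    unfolding topspace_vague point_measure_radon_iff by (rule AE)
  moreover have "?N \<in> restrict_space M ?A \<rightarrow>\<^sub>M borel_of_topology (vague_topology strip)"
  proof (rule measurable_vague)
    fix \<omega> assume "\<omega> \<in> space (restrict_space M ?A)"
    then show "?N \<omega> \<in> radon_measures strip" by (simp add: space_restrict_space topspace_vague)
  next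
    fix k
    have [measurable]: "sep_fun k \<in> borel_measurable (restrict_space borel strip)"
      by (rule test_function_measurable[OF sep_fun_test refl])
    have 1: "(\<lambda>z. if z \<in> strip then ennreal (sep_fun k z) else 0) \<in> borel_measurable borel"
    proof -
      have "(\<lambda>z. ennreal (sep_fun k z) * indicator strip z) \<in> borel_measurable borel"
        by (subst borel_measurable_restrict_space_iff_ennreal[symmetric]) auto
      moreover have "(\<lambda>z. ennreal (sep_fun k z) * indicator strip z) = (\<lambda>z. if z \<in> strip then ennreal (sep_fun k z) else 0)"
        by (auto simp: indicator_def)
      ultimately show ?thesis by simp
    qed
    have "(\<lambda>\<omega>. enn2real (\<integral>\<^sup>+i. (if z i \<omega> \<in> strip then ennreal (sep_fun k (z i \<omega>)) else 0) \<partial>count_space I)) \<in> borel_measurable M"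
    proof -
      have [measurable]: "(\<lambda>\<omega>. \<integral>\<^sup>+i. (if z i \<omega> \<in> strip then ennreal (sep_fun k (z i \<omega>)) else 0) \<partial>count_space I) \<in> borel_measurable M"
        by (rule borel_measurable_nn_integral_count_space[OF I]) (rule measurable_compose[OF z 1])
      show ?thesis by measurable
    qed
    then have "(\<lambda>\<omega>. enn2real (\<integral>\<^sup>+i. (if z i \<omega> \<in> strip then ennreal (sep_fun k (z i \<omega>)) else 0) \<partial>count_space I)) \<in> borel_measurable (restrict_space M ?A)"
      by (rule measurable_restrict_space1)
    then show "(\<lambda>\<omega>. \<integral>z. sep_fun k z \<partial>?N \<omega>) \<in> borel_measurable (restrict_space M ?A)"
    proof (rule measurable_cong[THEN iffD1, rotated])
      fix \<omega> assume "\<omega> \<in> space (restrict_space M ?A)"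
      then have "?N \<omega> \<in> radon_measures strip" by (simp add: space_restrict_space topspace_vague)
      from integral_point_measure(3)[OF sep_fun_test sep_fun_nonneg this]
      show "enn2real (\<integral>\<^sup>+i. (if z i \<omega> \<in> strip then ennreal (sep_fun k (z i \<omega>)) else 0) \<partial>count_space I) = (\<integral>z. sep_fun k z \<partial>?N \<omega>)"
        by simp
    qed
  qed
  ultimately show ?thesis unfolding random_element_def by blast
qed

text \<open>Since \<open>law\<close> restricts to the event on which \<open>N\<close> lies in the
  space, \<open>Y\<close> has to agree with the functional only there; the restriction disappears
  because that event is almost sure.\<close>

lemma integral_law:
  assumes "random_element T M N" and phi: "\<phi> \<in> borel_measurable (borel_of_topology T)"
    and Y: "Y \<in> borel_measurable M" and AE: "AE \<omega> in M. N \<omega> \<in> topspace T \<longrightarrow> \<phi> (N \<omega>) = (Y \<omega> :: real)"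
  shows "(\<integral>\<mu>. \<phi> \<mu> \<partial>law T M N) = (\<integral>\<omega>. Y \<omega> \<partial>M)"
proof -
  let ?A = "{\<omega> \<in> space M. N \<omega> \<in> topspace T}"
  have A: "?A \<in> sets M" "AE \<omega> in M. N \<omega> \<in> topspace T" "N \<in> restrict_space M ?A \<rightarrow>\<^sub>M borel_of_topology T"
    using assms(1) by (auto simp: random_element_def)
  have "(\<integral>\<mu>. \<phi> \<mu> \<partial>law T M N) = (\<integral>\<omega>. \<phi> (N \<omega>) \<partial>restrict_space M ?A)"
    unfolding law_def by (rule integral_distr[OF A(3) phi])
  also have "\<dots> = (\<integral>\<omega>. Y \<omega> \<partial>restrict_space M ?A)"
  proof (rule integral_cong_AE)
    show "(\<lambda>x. \<phi> (N x)) \<in> borel_measurable (restrict_space M ?A)" using measurable_compose[OF A(3) phi] .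
    show "Y \<in> borel_measurable (restrict_space M ?A)" using Y by (rule measurable_restrict_space1)
    show "AE \<omega> in restrict_space M ?A. \<phi> (N \<omega>) = Y \<omega>"
      using A(1) AE by (subst AE_restrict_space_iff) auto
  qed
  also have "\<dots> = (\<integral>\<omega>. indicator ?A \<omega> *\<^sub>R Y \<omega> \<partial>M)" using A(1) by (intro integral_restrict_space) auto
  also have "\<dots> = (\<integral>\<omega>. Y \<omega> \<partial>M)"
  proof (rule integral_cong_AE)
    show "AE \<omega> in M. indicator ?A \<omega> *\<^sub>R Y \<omega> = Y \<omega>" using A(2) by (auto simp: indicator_def)
  qed (use A Y in auto)
  finally show ?thesis .
qed

lemma prob_space_law:
  assumes "random_element T M N" "prob_space M"
  shows "prob_space (law T M N)"
proof -
  let ?A = "{\<omega> \<in> space M. N \<omega> \<in> topspace T}"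
  have A: "?A \<in> sets M" "AE \<omega> in M. N \<omega> \<in> topspace T" "N \<in> restrict_space M ?A \<rightarrow>\<^sub>M borel_of_topology T"
    using assms(1) by (auto simp: random_element_def)
  interpret prob_space M by fact
  have "emeasure M ?A = 1" using A(1,2) by (intro emeasure_eq_1_AE) auto
  then have "prob_space (restrict_space M ?A)" using A(1) by (intro prob_space_restrict_space) auto
  then show ?thesis unfolding law_def using A(3) by (rule prob_space.prob_space_distr)
qed

section \<open>Weak convergence from Laplace functionals\<close>

lemma compact_unit_cube: "compact {x :: nat \<Rightarrow> real. \<forall>k. x k \<in> {0..1}}"
proof -
  have "compactin (product_topology (\<lambda>i::nat. euclideanreal) UNIV) (PiE UNIV (\<lambda>_. {0..1}))"
    by (simp add: compactin_PiE)
  moreover have "PiE UNIV (\<lambda>_::nat. {0..1::real}) = {x. \<forall>k. x k \<in> {0..1}}" by (auto simp: PiE_def)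
  ultimately show ?thesis by (simp add: euclidean_product_topology)
qed

text \<open>Monomials in the coordinates are closed under products and separate the points of the
  compact cube, so convergence of mixed moments extends to continuous functions. Monomials are
  indexed by lists because a repeated entry stands for a power.\<close>

lemma cube_conv:
  fixes P :: "nat \<Rightarrow> 's measure" and Q :: "'s measure" and \<Phi> :: "'s \<Rightarrow> nat \<Rightarrow> real"
  assumes "\<And>n. prob_space (P n)" "prob_space Q"
    and [measurable]: "\<And>n. \<Phi> \<in> borel_measurable (P n)" "\<Phi> \<in> borel_measurable Q"
    and bd: "\<And>n x k. x \<in> space (P n) \<Longrightarrow> \<Phi> x k \<in> {0..1}" "\<And>x k. x \<in> space Q \<Longrightarrow> \<Phi> x k \<in> {0..1}"
    and mon: "\<And>L. (\<lambda>n. \<integral>x. (\<Prod>k\<leftarrow>L. \<Phi> x k) \<partial>P n) \<longlonglongrightarrow> (\<integral>x. (\<Prod>k\<leftarrow>L. \<Phi> x k) \<partial>Q)"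
    and h: "continuous_on UNIV h"
  shows "(\<lambda>n. \<integral>x. h (\<Phi> x) \<partial>P n) \<longlonglongrightarrow> (\<integral>x. h (\<Phi> x) \<partial>Q :: real)"
proof -
  define S :: "(nat \<Rightarrow> real) set" where "S = {x. \<forall>k. x k \<in> {0..1}}"
  define B where "B = range (\<lambda>L (x :: nat \<Rightarrow> real). \<Prod>k\<leftarrow>L. x k)"
  define Pr where "Pr = (\<lambda>h. h \<in> borel_measurable borel \<and> (\<lambda>n. \<integral>x. h (\<Phi> x) \<partial>P n) \<longlonglongrightarrow> (\<integral>x. h (\<Phi> x) \<partial>Q :: real))"
  have S: "compact S" unfolding S_def by (rule compact_unit_cube)
  have cont_mon: "continuous_on UNIV (\<lambda>x :: nat \<Rightarrow> real. \<Prod>k\<leftarrow>L. x k)" for L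
    by (induction L) (auto intro!: continuous_intros)
  have bounded: "\<exists>C. \<forall>x\<in>S. \<bar>g x\<bar> \<le> C" if "continuous_on S g" for g :: "_ \<Rightarrow> real"
    using compact_imp_bounded[OF compact_continuous_image[OF that S]] by (auto simp: bounded_iff)
  have int: "integrable R (\<lambda>x. g (\<Phi> x))" 
    if gc: "continuous_on S g" and "g \<in> borel_measurable borel" "prob_space R" and [measurable]: "\<Phi> \<in> borel_measurable R"
       "\<And>x k. x \<in> space R \<Longrightarrow> \<Phi> x k \<in> {0..1}" for g :: "_ \<Rightarrow> real" and R
  proof -
    interpret prob_space R by fact
    note [measurable] = that(2)
    obtain C where "\<forall>x\<in>S. \<bar>g x\<bar> \<le> C" using bounded[OF gc] by blast
    then show ?thesis using that(5) by (intro integrable_const_bound[of _ C] AE_I2) (auto simp: S_def)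
  qed
  have approx: "\<exists>g. Pr g \<and> continuous_on S g \<and> (\<forall>x\<in>S. \<bar>h x - g x\<bar> < e)" if "e > 0" for e
  proof (rule Stone_Weierstrass_span[where B=B])
    show "continuous_on S b" if "b \<in> B" for b
      using that cont_mon by (auto simp: B_def intro: continuous_on_subset)
    show "(\<lambda>_. 1) \<in> B" unfolding B_def by (rule image_eqI[of _ _ "[]"]) auto
    show "(\<lambda>x. b x * c x) \<in> B" if bc: "b \<in> B" "c \<in> B" for b c
    proof -
      from bc obtain L L' where "b = (\<lambda>x. \<Prod>k\<leftarrow>L. x k)" "c = (\<lambda>x. \<Prod>k\<leftarrow>L'. x k)" by (auto simp: B_def)
      then show ?thesis unfolding B_def by (intro image_eqI[of _ _ "L @ L'"]) auto
    qed
    show "\<exists>b\<in>B. b x \<noteq> b y" if "x \<noteq> y" for x y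
    proof -
      from that obtain k where "x k \<noteq> y k" by auto
      moreover have "(\<lambda>x. \<Prod>k\<leftarrow>[k]. x k) \<in> B" unfolding B_def by (rule rangeI)
      ultimately show ?thesis by (intro bexI[of _ "\<lambda>x. \<Prod>k\<leftarrow>[k]. x k"]) auto
    qed
    show "Pr (\<lambda>x. c * b x)" if "b \<in> B" for b c
    proof -
      obtain L where L: "b = (\<lambda>x. \<Prod>k\<leftarrow>L. x k)" using \<open>b \<in> B\<close> by (auto simp: B_def)
      have "b \<in> borel_measurable borel" unfolding L by (rule borel_measurable_continuous_onI[OF cont_mon])
      then show ?thesis unfolding Pr_def using mon[of L] by (auto simp: L intro!: tendsto_mult)
    qed
    show "Pr (\<lambda>x. f x + g x)" if fg: "continuous_on S f" "continuous_on S g" "Pr f" "Pr g" for f g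
    proof -
      have "(\<integral>x. f (\<Phi> x) + g (\<Phi> x) \<partial>R) = (\<integral>x. f (\<Phi> x) \<partial>R) + (\<integral>x. g (\<Phi> x) \<partial>R)"
        if "prob_space R" "\<Phi> \<in> borel_measurable R" "\<And>x k. x \<in> space R \<Longrightarrow> \<Phi> x k \<in> {0..1}" for R
        using fg that by (intro Bochner_Integration.integral_add int) (auto simp: Pr_def)
      then show ?thesis using fg(3,4) assms unfolding Pr_def by (auto intro!: tendsto_add)
    qed
    show "continuous_on S h" using h by (rule continuous_on_subset) auto
  qed (use S that in auto)
  have close: "\<bar>(\<integral>x. h (\<Phi> x) \<partial>R) - (\<integral>x. g (\<Phi> x) \<partial>R)\<bar> \<le> e"
    if R: "prob_space R" "\<Phi> \<in> borel_measurable R" "\<And>x k. x \<in> space R \<Longrightarrow> \<Phi> x k \<in> {0..1}"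
     and g: "g \<in> borel_measurable borel" "continuous_on S g" "\<forall>x\<in>S. \<bar>h x - g x\<bar> < e" for R g e
  proof -
    interpret prob_space R by fact
    have i: "integrable R (\<lambda>x. h (\<Phi> x))" "integrable R (\<lambda>x. g (\<Phi> x))"
      using R g h by (auto intro!: int borel_measurable_continuous_onI continuous_on_subset[OF h])
    then have "\<bar>(\<integral>x. h (\<Phi> x) \<partial>R) - (\<integral>x. g (\<Phi> x) \<partial>R)\<bar> = \<bar>\<integral>x. h (\<Phi> x) - g (\<Phi> x) \<partial>R\<bar>" by simp
    also have "\<dots> \<le> (\<integral>x. \<bar>h (\<Phi> x) - g (\<Phi> x)\<bar> \<partial>R)" by (rule integral_abs_bound)
    also have "\<dots> \<le> (\<integral>x. e \<partial>R)" using i g(3) R(3) by (intro integral_mono) (auto simp: S_def less_imp_le)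
    finally show ?thesis by (simp add: prob_space)
  qed
  show ?thesis
  proof (rule LIMSEQ_I)
    fix e :: real assume "e > 0"
    then obtain g where g: "Pr g" "continuous_on S g" "\<forall>x\<in>S. \<bar>h x - g x\<bar> < e/4" using approx[of "e/4"] by auto
    then have "\<exists>n0. \<forall>n\<ge>n0. norm ((\<integral>x. g (\<Phi> x) \<partial>P n) - (\<integral>x. g (\<Phi> x) \<partial>Q)) < e/4"
      using \<open>e > 0\<close> by (intro LIMSEQ_D) (auto simp: Pr_def)
    then obtain n0 where n0: "\<And>n. n \<ge> n0 \<Longrightarrow> \<bar>(\<integral>x. g (\<Phi> x) \<partial>P n) - (\<integral>x. g (\<Phi> x) \<partial>Q)\<bar> < e/4" by auto
    have gm: "g \<in> borel_measurable borel" using g by (simp add: Pr_def)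
    show "\<exists>n0. \<forall>n\<ge>n0. norm ((\<integral>x. h (\<Phi> x) \<partial>P n) - (\<integral>x. h (\<Phi> x) \<partial>Q)) < e"
    proof (intro exI allI impI)
      fix n assume "n \<ge> n0"
      have "\<bar>(\<integral>x. h (\<Phi> x) \<partial>P n) - (\<integral>x. g (\<Phi> x) \<partial>P n)\<bar> \<le> e/4"
        by (rule close) (use assms g gm in auto)
      moreover have "\<bar>(\<integral>x. h (\<Phi> x) \<partial>Q) - (\<integral>x. g (\<Phi> x) \<partial>Q)\<bar> \<le> e/4"
        by (rule close) (use assms g gm in auto)
      ultimately show "norm ((\<integral>x. h (\<Phi> x) \<partial>P n) - (\<integral>x. h (\<Phi> x) \<partial>Q)) < e"
        using n0[OF \<open>n \<ge> n0\<close>] \<open>e > 0\<close> unfolding real_norm_def by linarith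
    qed
  qed
qed

text \<open>
  The infimal convolutions \<open>h j\<close> are continuous functions of the code, which need not be true of
  \<open>H\<close> itself, and increase to \<open>H\<close>; this is how weak convergence of the codes in the cube is
  turned into weak convergence for the vague topology.
\<close>

lemma vague_weak_liminf:
  fixes P :: "nat \<Rightarrow> (real \<times> real) measure measure"
  assumes P: "\<And>n. prob_space (P n)" "prob_space Q"
    and sets: "\<And>n. sets (P n) = sets (borel_of_topology (vague_topology strip))"
      "sets Q = sets (borel_of_topology (vague_topology strip))"
    and conv: "\<And>h. continuous_on UNIV h \<Longrightarrow>
       (\<lambda>n. \<integral>\<mu>. h (vague_code \<mu>) \<partial>P n) \<longlonglongrightarrow> (\<integral>\<mu>. h (vague_code \<mu>) \<partial>Q :: real)"
    and H: "continuous_map (vague_topology strip) euclideanreal H"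
    and C: "\<And>\<mu>. \<mu> \<in> radon_measures strip \<Longrightarrow> \<bar>H \<mu>\<bar> \<le> C" and "e > 0"
  shows "\<forall>\<^sub>F n in sequentially. (\<integral>\<mu>. H \<mu> \<partial>P n) > (\<integral>\<mu>. H \<mu> \<partial>Q) - e"
proof -
  let ?R = "radon_measures strip"
  define h where "h j x = (INF \<mu>\<in>?R. H \<mu> + real j * dist x (vague_code \<mu>))" for j x
  have spQ: "space Q = ?R" and spP: "space (P n) = ?R" for n
    using sets_eq_imp_space_eq[OF sets(1)] sets_eq_imp_space_eq[OF sets(2)]
    by (auto simp: space_borel_of_topology topspace_vague)
  have ne: "?R \<noteq> {}" using prob_space.not_empty[OF P(2)] spQ by simp
  have bdd: "bdd_below ((\<lambda>\<mu>. H \<mu> + real j * dist x (vague_code \<mu>)) ` ?R)" for j x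
  proof (rule bdd_belowI2)
    fix \<mu> assume "\<mu> \<in> ?R"
    then have "- C \<le> H \<mu>" using C[of \<mu>] by linarith
    then show "- C \<le> H \<mu> + real j * dist x (vague_code \<mu>)" by (smt (verit) mult_nonneg_nonneg of_nat_0_le_iff zero_le_dist)
  qed
  have h_le: "h j x \<le> H \<mu> + real j * dist x (vague_code \<mu>)" if "\<mu> \<in> ?R" for j x \<mu>
    unfolding h_def by (rule cINF_lower[OF bdd that])
  have h_ge: "c \<le> h j x" if "\<And>\<mu>. \<mu> \<in> ?R \<Longrightarrow> c \<le> H \<mu> + real j * dist x (vague_code \<mu>)" for j x c
    unfolding h_def by (rule cINF_greatest[OF ne that])
  have lip: "h j x \<le> h j y + real j * dist x y" for j x y
  proof -
    have "h j x - real j * dist x y \<le> h j y"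
    proof (rule h_ge)
      fix \<mu> assume "\<mu> \<in> ?R"
      from h_le[OF this, of j x]
      have "h j x \<le> H \<mu> + real j * dist x (vague_code \<mu>)" .
      also have "real j * dist x (vague_code \<mu>) \<le> real j * (dist x y + dist y (vague_code \<mu>))"
        by (intro mult_left_mono dist_triangle) auto
      finally show "h j x - real j * dist x y \<le> H \<mu> + real j * dist y (vague_code \<mu>)"
        by (simp add: algebra_simps)
    qed
    then show ?thesis by simp
  qed
  have h_cont: "continuous_on UNIV (h j)" for j
  proof (rule lipschitz_on_continuous_on[of "real j"], rule lipschitz_onI)
    fix x y show "dist (h j x) (h j y) \<le> real j * dist x y"
      using lip[of j x y] lip[of j y x] by (simp add: dist_real_def dist_commute abs_le_iff)
  qed simp
  have h_meas: "(\<lambda>\<mu>. h j (vague_code \<mu>)) \<in> borel_measurable R"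
    if "sets R = sets (borel_of_topology (vague_topology strip))" for j and R
    using measurable_compose[OF vague_code_measurable borel_measurable_continuous_onI[OF h_cont[of j]]]
    by (simp add: measurable_cong_sets[OF that refl])
  have H_meas: "H \<in> borel_measurable R"
    if "sets R = sets (borel_of_topology (vague_topology strip))" for R
    using continuous_map_borel_measurable[OF H] by (simp add: measurable_cong_sets[OF that refl])
  have h_le_H: "h j (vague_code \<mu>) \<le> H \<mu>" if "\<mu> \<in> ?R" for j \<mu>
    using h_le[OF that, of j "vague_code \<mu>"] by simp
  have h_bd: "\<bar>h j (vague_code \<mu>)\<bar> \<le> C" if "\<mu> \<in> ?R" for j \<mu>
  proof -
    have "- C \<le> h j (vague_code \<mu>)"
    proof (rule h_ge)
      fix \<mu>' assume "\<mu>' \<in> ?R"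
      then have "- C \<le> H \<mu>'" using C[of \<mu>'] by linarith
      then show "- C \<le> H \<mu>' + real j * dist (vague_code \<mu>) (vague_code \<mu>')"
        by (smt (verit) mult_nonneg_nonneg of_nat_0_le_iff zero_le_dist)
    qed
    with h_le_H[OF that, of j] C[OF that] show ?thesis by linarith
  qed
  have h_lim: "(\<lambda>j. h j (vague_code \<mu>)) \<longlonglongrightarrow> H \<mu>" if mu: "\<mu> \<in> ?R" for \<mu>
  proof (rule LIMSEQ_I)
    fix r :: real assume r: "r > 0"
    have "openin (vague_topology strip) {\<mu>' \<in> topspace (vague_topology strip). H \<mu>' \<in> {H \<mu> - r/2<..}}"
      by (rule openin_continuous_map_preimage[OF H]) simp
    from vague_open_imp_code_open[OF this] obtain G where G: "open G"
      "{\<mu>' \<in> ?R. H \<mu>' > H \<mu> - r/2} = {\<mu> \<in> ?R. vague_code \<mu> \<in> G}"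
      by (auto simp: topspace_vague)
    then have "vague_code \<mu> \<in> G" using mu r by (force simp: set_eq_iff)
    with G(1) obtain d where d: "d > 0" "ball (vague_code \<mu>) d \<subseteq> G" by (auto simp: open_contains_ball)
    \<comment> \<open>At distance at least \<open>d\<close> from the code of the given measure the
      penalty is at least 2C, which exceeds any possible drop of \<open>H\<close>. Inside the ball,
      openness bounds the drop by r/2.\<close>
    obtain j0 where j0: "2 * C / d < real j0" using reals_Archimedean2 by blast
    have "norm (h j (vague_code \<mu>) - H \<mu>) < r" if "j \<ge> j0" for j
    proof -
      have "H \<mu> - r/2 \<le> h j (vague_code \<mu>)"
      proof (rule h_ge)
        fix \<mu>' assume mu': "\<mu>' \<in> ?R"
        show "H \<mu> - r / 2 \<le> H \<mu>' + real j * dist (vague_code \<mu>) (vague_code \<mu>')"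
        proof (cases "dist (vague_code \<mu>) (vague_code \<mu>') < d")
          case True
          then have "vague_code \<mu>' \<in> G" using d by auto
          then have "H \<mu>' > H \<mu> - r/2" using G(2) mu' by auto
          then show ?thesis by (smt (verit) mult_nonneg_nonneg of_nat_0_le_iff zero_le_dist)
        next
          case False
          have "2 * C \<le> real j0 * d" using j0 d by (simp add: field_simps)
          also have "\<dots> \<le> real j * dist (vague_code \<mu>) (vague_code \<mu>')"
            using False that d by (intro mult_mono) auto
          finally show ?thesis using C[OF mu] C[OF mu'] r by linarith
        qed
      qed
      with h_le_H[OF mu, of j] r show ?thesis by simp
    qed
    then show "\<exists>j0. \<forall>j\<ge>j0. norm (h j (vague_code \<mu>) - H \<mu>) < r" by blast
  qed
  interpret Q: prob_space Q by fact
  have "(\<lambda>j. \<integral>\<mu>. h j (vague_code \<mu>) \<partial>Q) \<longlonglongrightarrow> (\<integral>\<mu>. H \<mu> \<partial>Q)"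
  proof (rule integral_dominated_convergence[where w="\<lambda>_. C"])
    show "AE x in Q. (\<lambda>j. h j (vague_code x)) \<longlonglongrightarrow> H x" by (rule AE_I2) (simp add: spQ h_lim)
    show "AE x in Q. norm (h j (vague_code x)) \<le> C" for j by (rule AE_I2) (simp add: spQ h_bd)
  qed (use h_meas H_meas sets in auto)
  then have "\<forall>\<^sub>F j in sequentially. (\<integral>\<mu>. h j (vague_code \<mu>) \<partial>Q) > (\<integral>\<mu>. H \<mu> \<partial>Q) - e"
    using \<open>e > 0\<close> by (intro order_tendstoD) auto
  then obtain j where j: "(\<integral>\<mu>. h j (vague_code \<mu>) \<partial>Q) > (\<integral>\<mu>. H \<mu> \<partial>Q) - e"
    by (auto simp: eventually_sequentially)
  have "\<forall>\<^sub>F n in sequentially. (\<integral>\<mu>. h j (vague_code \<mu>) \<partial>P n) > (\<integral>\<mu>. H \<mu> \<partial>Q) - e"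
    using order_tendstoD(1)[OF conv[OF h_cont] j] .
  then show ?thesis
  proof eventually_elim
    case (elim n)
    interpret prob_space "P n" by fact
    have "(\<integral>\<mu>. h j (vague_code \<mu>) \<partial>P n) \<le> (\<integral>\<mu>. H \<mu> \<partial>P n)"
    proof (rule integral_mono)
      show "integrable (P n) (\<lambda>\<mu>. h j (vague_code \<mu>))"
        by (rule integrable_const_bound[of _ C]) (use h_meas sets h_bd spP in auto)
      show "integrable (P n) H"
        by (rule integrable_const_bound[of _ C]) (use H_meas sets C spP in auto)
      show "h j (vague_code x) \<le> H x" if "x \<in> space (P n)" for x
        using that by (simp add: spP h_le_H)
    qed
    with elim show ?case by linarith
  qed
qed

text \<open>A product of coordinates of the code is the Laplace functional of a finite sum of
  functions \<open>sep_fun k\<close>, again a non-negative test function. Laplace functionals thus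
  give all moments of the code, and these give weak convergence.\<close>

theorem conv_in_distribution_stripI:
  fixes M :: "'a measure" and M' :: "'b measure"
  assumes P: "prob_space M" "prob_space M'"
    and N: "\<And>n. random_element (vague_topology strip) M (N n)" "random_element (vague_topology strip) M' N'"
    and lap: "\<And>f. f \<in> test_functions strip \<Longrightarrow> (\<And>z. z \<in> strip \<Longrightarrow> 0 \<le> f z) \<Longrightarrow>
      (\<lambda>n. \<integral>\<mu>. exp (- (\<integral>z. f z \<partial>\<mu>)) \<partial>law (vague_topology strip) M (N n))
        \<longlonglongrightarrow> (\<integral>\<mu>. exp (- (\<integral>z. f z \<partial>\<mu>)) \<partial>law (vague_topology strip) M' N')"
  shows "conv_in_distribution (vague_topology strip) M N M' N'"
proof -
  define P where "P n = law (vague_topology strip) M (N n)" for n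
  define Q where "Q = law (vague_topology strip) M' N'"
  have pr: "prob_space (P n)" "prob_space Q" for n
    unfolding P_def Q_def by (auto intro!: prob_space_law N P)
  have sets: "sets (P n) = sets (borel_of_topology (vague_topology strip))"
      "sets Q = sets (borel_of_topology (vague_topology strip))" for n
    by (auto simp: P_def Q_def law_def)
  have sp: "space (P n) = radon_measures strip" "space Q = radon_measures strip" for n
    using sets_eq_imp_space_eq[OF sets(1)] sets_eq_imp_space_eq[OF sets(2)]
    by (auto simp: space_borel_of_topology topspace_vague)
  have conv: "(\<lambda>n. \<integral>\<mu>. h (vague_code \<mu>) \<partial>P n) \<longlonglongrightarrow> (\<integral>\<mu>. h (vague_code \<mu>) \<partial>Q :: real)"
    if "continuous_on UNIV h" for h
  proof (rule cube_conv[OF pr _ _ _ _ _ that])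
    show "vague_code \<in> borel_measurable (P n)" "vague_code \<in> borel_measurable Q" for n
      using vague_code_measurable by (auto simp: measurable_cong_sets[OF sets(1) refl] measurable_cong_sets[OF sets(2) refl])
    show "vague_code x k \<in> {0..1}" if "x \<in> space (P n)" for n x k
      using vague_code_bounds[of x k] that sp by auto
    show "vague_code x k \<in> {0..1}" if "x \<in> space Q" for x k
      using vague_code_bounds[of x k] that sp by auto
    fix L :: "nat list"
    define f where "f z = (\<Sum>k\<leftarrow>L. sep_fun k z)" for z
    have test_add: "(\<lambda>z. g z + g' z) \<in> test_functions strip" 
      if "g \<in> test_functions strip" "g' \<in> test_functions strip" for g g'
    proof -
      from that(1) obtain K where "compact K" "K \<subseteq> strip" "\<forall>z\<in>strip - K. g z = 0" "continuous_on strip g"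
        by (auto simp: test_functions_def)
      moreover from that(2) obtain K' where "compact K'" "K' \<subseteq> strip" "\<forall>z\<in>strip - K'. g' z = 0" "continuous_on strip g'"
        by (auto simp: test_functions_def)
      ultimately show ?thesis unfolding test_functions_def
        by (auto intro!: continuous_intros exI[of _ "K \<union> K'"])
    qed
    have zero: "(\<lambda>_. 0) \<in> test_functions strip" by (auto simp: test_functions_def)
    have f_test: "(\<lambda>z. \<Sum>k\<leftarrow>L. sep_fun k z) \<in> test_functions strip" for L
      by (induction L) (auto intro!: test_add sep_fun_test zero)
    have "(\<Prod>k\<leftarrow>L. vague_code \<mu> k) = exp (- (\<integral>z. (\<Sum>k\<leftarrow>L. sep_fun k z) \<partial>\<mu>))" if "\<mu> \<in> radon_measures strip" for \<mu>
    proof (induction L)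
      case (Cons k L)
      have "(\<integral>z. (\<Sum>k\<leftarrow>k # L. sep_fun k z) \<partial>\<mu>) = (\<integral>z. sep_fun k z \<partial>\<mu>) + (\<integral>z. (\<Sum>k\<leftarrow>L. sep_fun k z) \<partial>\<mu>)"
        using test_function_integrable[OF sep_fun_test that] test_function_integrable[OF f_test that] by simp
      then show ?case using Cons by (simp add: vague_code_def[of \<mu> k] exp_add[symmetric])
    qed simp
    then have eq: "(\<Prod>k\<leftarrow>L. vague_code \<mu> k) = exp (- (\<integral>z. f z \<partial>\<mu>))" if "\<mu> \<in> radon_measures strip" for \<mu>
      using that by (simp add: f_def)
    have "(\<integral>\<mu>. (\<Prod>k\<leftarrow>L. vague_code \<mu> k) \<partial>R) = (\<integral>\<mu>. exp (- (\<integral>z. f z \<partial>\<mu>)) \<partial>R)" if "space R = radon_measures strip" for R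
      using that by (intro Bochner_Integration.integral_cong) (auto simp: eq)
    then have "(\<integral>\<mu>. (\<Prod>k\<leftarrow>L. vague_code \<mu> k) \<partial>P n) = (\<integral>\<mu>. exp (- (\<integral>z. f z \<partial>\<mu>)) \<partial>P n)"
      "(\<integral>\<mu>. (\<Prod>k\<leftarrow>L. vague_code \<mu> k) \<partial>Q) = (\<integral>\<mu>. exp (- (\<integral>z. f z \<partial>\<mu>)) \<partial>Q)" for n
      using sp by auto
    moreover have "(\<lambda>n. \<integral>\<mu>. exp (- (\<integral>z. f z \<partial>\<mu>)) \<partial>P n) \<longlonglongrightarrow> (\<integral>\<mu>. exp (- (\<integral>z. f z \<partial>\<mu>)) \<partial>Q)"
      unfolding P_def Q_def f_def by (rule lap) (auto intro!: f_test sum_list_nonneg sep_fun_nonneg)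
    ultimately show "(\<lambda>n. \<integral>\<mu>. (\<Prod>k\<leftarrow>L. vague_code \<mu> k) \<partial>P n) \<longlonglongrightarrow> (\<integral>\<mu>. (\<Prod>k\<leftarrow>L. vague_code \<mu> k) \<partial>Q)" by simp
  qed
  have "weak_star_conv (vague_topology strip) P Q"
    unfolding weak_star_conv_def
  proof (intro allI impI, elim conjE)
    fix H assume H: "continuous_map (vague_topology strip) euclideanreal H" "bounded (H ` topspace (vague_topology strip))"
    then obtain C where C: "\<And>\<mu>. \<mu> \<in> radon_measures strip \<Longrightarrow> \<bar>H \<mu>\<bar> \<le> C"
      unfolding bounded_iff topspace_vague by auto
    have H': "continuous_map (vague_topology strip) euclideanreal (\<lambda>\<mu>. - H \<mu>)"
      using H(1) by (rule continuous_map_minus)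
    show "(\<lambda>n. \<integral>\<mu>. H \<mu> \<partial>P n) \<longlonglongrightarrow> (\<integral>\<mu>. H \<mu> \<partial>Q)"
    proof (rule tendstoI)
      fix e :: real assume "e > 0"
      have 1: "\<forall>\<^sub>F n in sequentially. (\<integral>\<mu>. H \<mu> \<partial>P n) > (\<integral>\<mu>. H \<mu> \<partial>Q) - e"
        by (rule vague_weak_liminf[OF pr sets conv H(1) C \<open>e > 0\<close>])
      \<comment> \<open>The lower bound applied to the negative of \<open>H\<close> is the missing
        upper bound.\<close>
      have 2: "\<forall>\<^sub>F n in sequentially. (\<integral>\<mu>. - H \<mu> \<partial>P n) > (\<integral>\<mu>. - H \<mu> \<partial>Q) - e"
        by (rule vague_weak_liminf[OF pr sets conv H' _ \<open>e > 0\<close>, of C]) (simp_all add: C)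
      show "\<forall>\<^sub>F n in sequentially. dist (\<integral>\<mu>. H \<mu> \<partial>P n) (\<integral>\<mu>. H \<mu> \<partial>Q) < e"
        using 1 2 by eventually_elim (simp add: dist_real_def abs_less_iff)
    qed
  qed
  then show ?thesis unfolding conv_in_distribution_def P_def Q_def using N by blast
qed

section \<open>Regular variation from the domain of attraction\<close>

text \<open>The law of the difference of two independent copies. Its characteristic function is the
  squared modulus, hence blind to any centring.\<close>

definition sym_law :: "real measure \<Rightarrow> real measure" where
  "sym_law \<mu> = distr (\<mu> \<Otimes>\<^sub>M \<mu>) borel (\<lambda>(x, y). x - y)"

lemma pair_real_distribution:
  assumes "real_distribution \<mu>"
  shows "prob_space (\<mu> \<Otimes>\<^sub>M \<mu>)" "pair_sigma_finite \<mu> \<mu>" "(\<lambda>(x, y). x - y) \<in> borel_measurable (\<mu> \<Otimes>\<^sub>M \<mu>)"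
proof -
  interpret real_distribution \<mu> by fact
  interpret P: pair_prob_space \<mu> \<mu> ..
  show "prob_space (\<mu> \<Otimes>\<^sub>M \<mu>)" "pair_sigma_finite \<mu> \<mu>" by unfold_locales
  show "(\<lambda>(x, y). x - y) \<in> borel_measurable (\<mu> \<Otimes>\<^sub>M \<mu>)"
    by measurable
qed

lemma real_distribution_sym_law: "real_distribution \<mu> \<Longrightarrow> real_distribution (sym_law \<mu>)"
  unfolding sym_law_def using pair_real_distribution[of \<mu>] by (intro prob_space.real_distribution_distr) auto

lemma char_uminus:
  assumes "real_distribution \<mu>" shows "char \<mu> (- t) = cnj (char \<mu> t)"
proof -
  have "cnj (char \<mu> t) = (\<integral>x. cnj (iexp (t * x)) \<partial>\<mu>)" unfolding char_def by simp
  also have "\<dots> = char \<mu> (- t)" unfolding char_def by (simp add: exp_cnj)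
  finally show ?thesis by simp
qed

lemma char_sym_law:
  assumes "real_distribution \<mu>"
  shows "char (sym_law \<mu>) t = of_real ((cmod (char \<mu> t))\<^sup>2)"
proof -
  interpret real_distribution \<mu> by fact
  interpret P: pair_prob_space \<mu> \<mu> ..
  note [measurable] = pair_real_distribution(3)[OF assms]
  have int: "integrable (\<mu> \<Otimes>\<^sub>M \<mu>) (\<lambda>z. iexp (t * (fst z - snd z)))"
    by (rule P.integrable_const_bound[of _ 1]) auto
  have "char (sym_law \<mu>) t = (\<integral>z. iexp (t * (fst z - snd z)) \<partial>(\<mu> \<Otimes>\<^sub>M \<mu>))"
    unfolding char_def sym_law_def by (subst integral_distr) (auto simp: case_prod_unfold)
  also have "\<dots> = (\<integral>x. (\<integral>y. iexp (t * (x - y)) \<partial>\<mu>) \<partial>\<mu>)"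
    using P.integral_fst[of "\<lambda>x y. iexp (t * (x - y))"] int by (simp add: case_prod_unfold)
  also have "\<dots> = (\<integral>x. (\<integral>y. iexp (t * x) * iexp (- t * y) \<partial>\<mu>) \<partial>\<mu>)"
    by (simp add: exp_add[symmetric] algebra_simps)
  also have "\<dots> = char \<mu> t * char \<mu> (- t)" unfolding char_def by simp
  also have "\<dots> = of_real ((cmod (char \<mu> t))\<^sup>2)"
    by (simp only: char_uminus[OF assms] complex_norm_square)
  finally show ?thesis .
qed

lemma cos_sym_law:
  assumes "real_distribution \<mu>"
  shows "(\<integral>x. 1 - cos (t * x) \<partial>sym_law \<mu>) = 1 - (cmod (char \<mu> t))\<^sup>2"
proof -
  interpret S: real_distribution "sym_law \<mu>" by (rule real_distribution_sym_law[OF assms])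
  have i: "integrable (sym_law \<mu>) (\<lambda>x. cos (t * x))"
    by (rule S.integrable_const_bound[of _ 1]) auto
  have "Re (char (sym_law \<mu>) t) = (\<integral>x. Re (iexp (t * x)) \<partial>sym_law \<mu>)"
    unfolding char_def using S.integrable_iexp[of "\<lambda>x. t * x"] by simp
  also have "\<dots> = (\<integral>x. cos (t * x) \<partial>sym_law \<mu>)" by (simp add: Re_exp)
  finally have "(\<integral>x. cos (t * x) \<partial>sym_law \<mu>) = (cmod (char \<mu> t))\<^sup>2" by (simp add: char_sym_law[OF assms])
  then show ?thesis using i S.prob_space by simp
qed

lemma real_distribution_iid_sum: 
  assumes "real_distribution \<mu>" shows "real_distribution (iid_sum_law n \<mu>)"
proof -
  interpret real_distribution \<mu> by fact
  interpret P: product_prob_space "\<lambda>_::nat. \<mu>" "{..<n}" ..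
  have "(\<lambda>x. \<Sum>i<n. x i) \<in> borel_measurable (Pi\<^sub>M {..<n} (\<lambda>_. \<mu>))"
    by (intro borel_measurable_sum) (auto intro!: measurable_component_singleton[THEN measurable_compose])
  then show ?thesis unfolding iid_sum_law_def by (intro P.real_distribution_distr) simp
qed

lemma char_iid_sum:
  assumes "real_distribution \<mu>"
  shows "char (iid_sum_law n \<mu>) t = char \<mu> t ^ n"
proof -
  interpret real_distribution \<mu> by fact
  interpret P: product_prob_space "\<lambda>_::nat. \<mu>" "{..<n}" ..
  have [measurable]: "(\<lambda>x. \<Sum>i<n. x i) \<in> borel_measurable (Pi\<^sub>M {..<n} (\<lambda>_. \<mu>))"
    by (intro borel_measurable_sum) (auto intro!: measurable_component_singleton[THEN measurable_compose])
  have "char (iid_sum_law n \<mu>) t = (\<integral>x. iexp (t * (\<Sum>i<n. x i)) \<partial>Pi\<^sub>M {..<n} (\<lambda>_. \<mu>))"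
    unfolding char_def iid_sum_law_def by (subst integral_distr) auto
  also have "\<dots> = (\<integral>x. (\<Prod>i<n. iexp (t * x i)) \<partial>Pi\<^sub>M {..<n} (\<lambda>_. \<mu>))"
    by (simp add: exp_sum[symmetric] sum_distrib_left)
  also have "\<dots> = (\<Prod>i<n. \<integral>x. iexp (t * x) \<partial>\<mu>)"
    by (rule P.product_integral_prod[of "{..<n}" "\<lambda>_ x. iexp (t * x)"]) (auto intro: integrable_iexp)
  also have "\<dots> = char \<mu> t ^ n" by (simp add: char_def)
  finally show ?thesis .
qed

lemma char_affine:
  assumes "real_distribution \<mu>"
  shows "char (distr \<mu> borel (\<lambda>x. a * x + b)) t = iexp (t * b) * char \<mu> (a * t)"
proof -
  interpret real_distribution \<mu> by fact
  have "char (distr \<mu> borel (\<lambda>x. a * x + b)) t = (\<integral>x. iexp (t * (a * x + b)) \<partial>\<mu>)"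
    unfolding char_def by (subst integral_distr) auto
  also have "\<dots> = (\<integral>x. iexp (t * b) * iexp (a * t * x) \<partial>\<mu>)"
    by (intro Bochner_Integration.integral_cong) (auto simp: exp_add[symmetric] algebra_simps)
  finally show ?thesis by (simp add: char_def)
qed

lemma cmod_char_affine:
  assumes "real_distribution \<mu>"
  shows "cmod (char (distr \<mu> borel (\<lambda>x. a * x + b)) t) = cmod (char \<mu> (a * t))"
  by (simp add: char_affine[OF assms] norm_mult)

text \<open>The symmetrised law has characteristic function 1, so two independent copies agree
  almost surely. By Fubini, almost every x is then the almost sure value of the other copy.\<close>

lemma char_modulus_one_imp_point_mass:
  assumes "real_distribution \<nu>" and one: "\<And>t. cmod (char \<nu> t) = 1"
  shows "\<exists>c. measure \<nu> {c} = 1"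
proof -
  interpret real_distribution \<nu> by fact
  interpret P: pair_prob_space \<nu> \<nu> ..
  note [measurable] = pair_real_distribution(3)[OF assms(1)]
  have "prob_space (return borel (0::real))" by (rule prob_space_return) simp
  then have ret: "real_distribution (return borel (0::real))"
    by (auto simp: real_distribution_def real_distribution_axioms_def)
  have "char (sym_law \<nu>) = char (return borel 0)"
    by (rule ext) (simp add: char_sym_law[OF assms(1)] one, simp add: char_def integral_return)
  then have "sym_law \<nu> = return borel 0"
    by (intro Levy_uniqueness real_distribution_sym_law assms(1) ret)
  then have "AE x in sym_law \<nu>. x = 0" by (simp only:) (subst AE_return, auto)
  then have "AE z in \<nu> \<Otimes>\<^sub>M \<nu>. fst z = snd z"
    unfolding sym_law_def by (subst (asm) AE_distr_iff) (auto simp: case_prod_unfold)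
  from P.AE_pair[OF this] have "AE x in \<nu>. AE y in \<nu>. x = y" by simp
  have "\<exists>x. AE y in \<nu>. x = y"
  proof (rule ccontr)
    assume "\<not> ?thesis"
    with \<open>AE x in \<nu>. AE y in \<nu>. x = y\<close> have "AE x in \<nu>. False" by (auto elim!: eventually_mono)
    then show False by simp
  qed
  then obtain c where "AE y in \<nu>. c = y" ..
  then have "AE y in \<nu>. y \<in> {c}" by eventually_elim simp
  then have "prob {c} = 1" by (intro prob_eq_1[THEN iffD2]) auto
  then show ?thesis ..
qed

text \<open>The function \<theta>(u) = - ln \<phi>(u^(1/\<alpha>)) satisfies \<theta>(n u) = n
  \<theta>(u). It is therefore linear on the positive rationals, and by continuity on all positive
  reals.\<close>

lemma power_scaling_imp_exponential:
  fixes \<phi> :: "real \<Rightarrow> real"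
  assumes cont: "continuous_on UNIV \<phi>" and "\<phi> 0 = 1" and nonneg: "\<And>t. 0 \<le> \<phi> t" and even: "\<And>t. \<phi> (- t) = \<phi> t"
    and "\<alpha> > 0" and scale: "\<And>n t. n \<ge> 1 \<Longrightarrow> \<phi> (real n powr (1/\<alpha>) * t) = \<phi> t ^ n"
  shows "\<exists>c. \<forall>t. \<phi> t = exp (- c * \<bar>t\<bar> powr \<alpha>)"
proof -
  \<comment> \<open>A zero at t produces zeros at t n^(-1/\<alpha>) for every n. These accumulate at
    0, where \<phi> is 1.\<close>
  have nz: "\<phi> t \<noteq> 0" for t
  proof
    assume t: "\<phi> t = 0"
    have "\<phi> (t * real n powr (- 1/\<alpha>)) = 0" if "n \<ge> 1" for n
    proof -
      have eq: "real n powr (1/\<alpha>) * (t * real n powr (- 1/\<alpha>)) = t"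
      proof -
        have "real n powr (1/\<alpha>) * real n powr (- 1/\<alpha>) = 1" using that by (simp add: powr_add[symmetric])
        then show ?thesis by (metis mult.left_commute mult.right_neutral)
      qed
      show ?thesis using scale[OF that, of "t * real n powr (- 1/\<alpha>)"] unfolding eq t by simp
    qed
    then have "(\<lambda>n. \<phi> (t * real n powr (- 1/\<alpha>))) \<longlonglongrightarrow> 0"
      by (intro tendsto_eventually eventually_sequentiallyI[of 1])
    moreover have "(\<lambda>n. t * real n powr (- 1/\<alpha>)) \<longlonglongrightarrow> 0"      using tendsto_mult[OF tendsto_const[of t] tendsto_neg_powr[OF _ filterlim_real_sequentially, of "- 1/\<alpha>"]] \<open>\<alpha> > 0\<close> by simp
    then have "(\<lambda>n. \<phi> (t * real n powr (- 1/\<alpha>))) \<longlonglongrightarrow> \<phi> 0"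
      using cont by (intro isCont_tendsto_compose[of 0 \<phi>]) (auto simp: continuous_on_eq_continuous_at)
    ultimately have "0 = \<phi> 0" by (rule LIMSEQ_unique)
    then show False using \<open>\<phi> 0 = 1\<close> by simp
  qed
  have pos: "\<phi> t > 0" for t using nz[of t] nonneg[of t] by simp
  define \<theta> where "\<theta> u = - ln (\<phi> (u powr (1/\<alpha>)))" for u
  have th_nat: "\<theta> (real n * u) = real n * \<theta> u" if "n \<ge> 1" "u > 0" for n u
  proof -
    have "(real n * u) powr (1/\<alpha>) = real n powr (1/\<alpha>) * u powr (1/\<alpha>)" using that by (simp add: powr_mult)
    then show ?thesis using scale[OF that(1), of "u powr (1/\<alpha>)"] pos by (simp add: \<theta>_def ln_realpow)
  qed
  have th_rat: "\<theta> (real m / real k) = real m / real k * \<theta> 1" if "m \<ge> 1" "k \<ge> 1" for m k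
  proof -
    have "real k * \<theta> (real m / real k) = \<theta> (real k * (real m / real k))"
      using that by (intro th_nat[symmetric]) auto
    also have "\<dots> = \<theta> (real m * 1)" using that by simp
    also have "\<dots> = real m * \<theta> 1" using that by (intro th_nat) auto
    finally show ?thesis using that by (simp add: field_simps)
  qed
  have th: "\<theta> u = u * \<theta> 1" if "u > 0" for u
  proof -
    \<comment> \<open>Rounding up keeps \<open>m k\<close> at least 1, as the rational case
      requires, while m(k)/k still tends to \<open>u\<close>.\<close>
    define m where "m k = nat \<lceil>real k * u\<rceil>" for k
    have m1: "m k \<ge> 1" if "k \<ge> 1" for k
    proof -
      have "0 < real k * u" using \<open>u > 0\<close> that by simp
      then show ?thesis unfolding m_def by linarith
    qed
    have lim: "(\<lambda>k. real (m k) / real k) \<longlonglongrightarrow> u"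
    proof (rule real_tendsto_sandwich)
      have b: "real k * u \<le> real (m k)" "real (m k) \<le> real k * u + 1" for k
        using \<open>u > 0\<close> of_nat_ceiling[of "real k * u"] unfolding m_def by auto
      show "\<forall>\<^sub>F k in sequentially. u \<le> real (m k) / real k"
        using b(1) by (intro eventually_sequentiallyI[of 1]) (simp add: pos_le_divide_eq mult.commute)
      show "\<forall>\<^sub>F k in sequentially. real (m k) / real k \<le> u + 1 / real k"
        using b(2) by (intro eventually_sequentiallyI[of 1]) (simp add: pos_divide_le_eq distrib_left mult.commute)
      show "(\<lambda>k. u + 1 / real k) \<longlonglongrightarrow> u" by real_asymp
    qed simp
    have c1: "isCont \<phi> x" for x using cont by (auto simp: continuous_on_eq_continuous_at)
    have "isCont (\<lambda>u. u powr (1/\<alpha>)) u" using that by (intro continuous_intros) auto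
    then have "isCont (\<lambda>u. \<phi> (u powr (1/\<alpha>))) u" by (rule isCont_o2[OF _ c1])
    then have "isCont \<theta> u" unfolding \<theta>_def using nz by (intro continuous_intros) auto
    then have "(\<lambda>k. \<theta> (real (m k) / real k)) \<longlonglongrightarrow> \<theta> u" using lim by (rule isCont_tendsto_compose)
    moreover have ev: "\<forall>\<^sub>F k in sequentially. real (m k) / real k * \<theta> 1 = \<theta> (real (m k) / real k)"
      by (rule eventually_sequentiallyI[of 1]) (rule th_rat[OF m1, symmetric])
    have "(\<lambda>k. \<theta> (real (m k) / real k)) \<longlonglongrightarrow> u * \<theta> 1"
      by (rule Lim_transform_eventually[OF tendsto_mult[OF lim tendsto_const] ev])
    ultimately show ?thesis by (rule LIMSEQ_unique)
  qed
  have "\<phi> t = exp (- \<theta> 1 * \<bar>t\<bar> powr \<alpha>)" for t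
  proof (cases "t = 0")
    case True then show ?thesis using \<open>\<phi> 0 = 1\<close> by simp
  next
    case False
    then have "(\<bar>t\<bar> powr \<alpha>) powr (1/\<alpha>) = \<bar>t\<bar>" using \<open>\<alpha> > 0\<close> by (simp add: powr_powr)
    then have "\<theta> (\<bar>t\<bar> powr \<alpha>) = - ln (\<phi> \<bar>t\<bar>)" by (simp add: \<theta>_def)
    moreover have "\<theta> (\<bar>t\<bar> powr \<alpha>) = \<bar>t\<bar> powr \<alpha> * \<theta> 1" by (rule th) (use False in simp)
    moreover have "\<phi> \<bar>t\<bar> = \<phi> t" using even[of t] by (auto simp: abs_if)
    ultimately have "ln (\<phi> t) = - \<theta> 1 * \<bar>t\<bar> powr \<alpha>" by (simp add: mult.commute)
    then have "exp (ln (\<phi> t)) = exp (- \<theta> 1 * \<bar>t\<bar> powr \<alpha>)" by simp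
    then show ?thesis using pos[of t] by simp
  qed
  then show ?thesis by blast
qed

text \<open>Only the modulus is determined: the shifts \<open>d\<close> in the definition of
  stability affect the phase alone. Strict positivity of \<open>c\<close> is where non-degeneracy
  enters, since c = 0 would give modulus one everywhere and hence a point mass.\<close>

lemma stable_char_modulus:
  assumes "stable_law \<alpha> \<nu>" "\<alpha> > 0"
  shows "\<exists>c>0. \<forall>t. cmod (char \<nu> t) = exp (- c * \<bar>t\<bar> powr \<alpha>)"
proof -
  have nu: "real_distribution \<nu>" and nd: "\<And>c. measure \<nu> {c} \<noteq> 1"
    and st: "\<And>n. n \<ge> 1 \<Longrightarrow> \<exists>d. iid_sum_law n \<nu> = distr \<nu> borel (\<lambda>y. real n powr (1 / \<alpha>) * y + d)"
    using assms by (auto simp: stable_law_def)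
  interpret real_distribution \<nu> by fact
  have "\<exists>c. \<forall>t. cmod (char \<nu> t) = exp (- c * \<bar>t\<bar> powr \<alpha>)"
  proof (rule power_scaling_imp_exponential)
    show "continuous_on UNIV (\<lambda>t. cmod (char \<nu> t))"
      using isCont_char by (auto simp: continuous_on_eq_continuous_at intro!: continuous_norm)
    show "cmod (char \<nu> (real n powr (1 / \<alpha>) * t)) = cmod (char \<nu> t) ^ n" if n: "n \<ge> 1" for n t
    proof -
      obtain d where "iid_sum_law n \<nu> = distr \<nu> borel (\<lambda>y. real n powr (1 / \<alpha>) * y + d)" using st[OF n] ..
      then have "cmod (char (iid_sum_law n \<nu>) t) = cmod (char \<nu> (real n powr (1 / \<alpha>) * t))"
        by (simp add: cmod_char_affine[OF nu])
      then show ?thesis by (simp add: char_iid_sum[OF nu] norm_power)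
    qed
  qed (use assms(2) in \<open>auto simp: char_zero char_uminus[OF nu]\<close>)
  then obtain c where c: "\<And>t. cmod (char \<nu> t) = exp (- c * \<bar>t\<bar> powr \<alpha>)" by blast
  have "exp (- c) \<le> 1" using c[of 1] cmod_char_le_1[of 1] by simp
  then have "c \<ge> 0" by simp
  moreover have "c \<noteq> 0" using char_modulus_one_imp_point_mass[OF nu] nd c by auto
  ultimately show ?thesis using c by (intro exI[of _ c]) auto
qed

text \<open>The quantities 1 - y and - ln y are comparable through y (- ln y) <= 1 - y <= - ln y.
  Since n (- ln y) converges, y tends to 1 and both bounds share the limit.\<close>

lemma power_tendsto_imp_scaled:
  fixes y :: "nat \<Rightarrow> real"
  assumes y: "\<And>n. 0 \<le> y n" "\<And>n. y n \<le> 1" and lim: "(\<lambda>n. y n ^ n) \<longlonglongrightarrow> L" and "L > 0"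
  shows "(\<lambda>n. real n * (1 - y n)) \<longlonglongrightarrow> - ln L"
proof -
  have pos: "\<forall>\<^sub>F n in sequentially. y n > 0"
    using order_tendstoD(1)[OF lim \<open>L > 0\<close>] eventually_gt_at_top[of 0]
    by eventually_elim (metis y(1) less_eq_real_def power_0_left less_numeral_extra(3))
  have "(\<lambda>n. - ln (y n ^ n)) \<longlonglongrightarrow> - ln L" using \<open>L > 0\<close> by (intro tendsto_intros lim) auto
  moreover have "\<forall>\<^sub>F n in sequentially. - ln (y n ^ n) = real n * (- ln (y n))"
    using pos by eventually_elim (simp add: ln_realpow)
  ultimately have l1: "(\<lambda>n. real n * (- ln (y n))) \<longlonglongrightarrow> - ln L" by (rule Lim_transform_eventually)
  have "(\<lambda>n. 1 / real n * (real n * (- ln (y n)))) \<longlonglongrightarrow> 0 * (- ln L)"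
    by (intro tendsto_mult l1) real_asymp
  then have "(\<lambda>n. 1 / real n * (real n * (- ln (y n)))) \<longlonglongrightarrow> 0" by simp
  moreover have "\<forall>\<^sub>F n in sequentially. 1 / real n * (real n * (- ln (y n))) = - ln (y n)"
    using eventually_gt_at_top[of 0] by eventually_elim simp
  ultimately have "(\<lambda>n. - ln (y n)) \<longlonglongrightarrow> 0" by (rule Lim_transform_eventually)
  then have "(\<lambda>n. exp (- (- ln (y n)))) \<longlonglongrightarrow> exp (- 0)" by (intro tendsto_intros)
  moreover have "\<forall>\<^sub>F n in sequentially. exp (- (- ln (y n))) = y n"
    using pos by eventually_elim simp
  ultimately have y1: "y \<longlonglongrightarrow> exp (- 0)" by (rule Lim_transform_eventually)
  show ?thesis
  proof (rule real_tendsto_sandwich)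
    show "(\<lambda>n. y n * (real n * (- ln (y n)))) \<longlonglongrightarrow> - ln L"
      using tendsto_mult[OF y1 l1] by simp
    show "(\<lambda>n. real n * (- ln (y n))) \<longlonglongrightarrow> - ln L" by (rule l1)
    show "\<forall>\<^sub>F n in sequentially. y n * (real n * (- ln (y n))) \<le> real n * (1 - y n)"
      using pos
    proof eventually_elim
      case (elim n)
      have "ln (1 / y n) \<le> 1 / y n - 1" using elim by (intro ln_le_minus_one) simp
      then have "- ln (y n) \<le> (1 - y n) / y n" using elim by (simp add: ln_div field_simps)
      then have "y n * (- ln (y n)) \<le> 1 - y n" using elim by (simp add: field_simps)
      then have "real n * (y n * (- ln (y n))) \<le> real n * (1 - y n)" by (rule mult_left_mono) simp
      then show ?case by (simp only: mult.left_commute)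
    qed
    show "\<forall>\<^sub>F n in sequentially. real n * (1 - y n) \<le> real n * (- ln (y n))"
      using pos by eventually_elim (intro mult_left_mono, use ln_le_minus_one in fastforce, simp)
  qed
qed

text \<open>From |sin(m y)| <= m |sin y| and the half-angle formula. It carries a bound on 1 - cos
  at small frequencies to arbitrary ones at quadratic cost.\<close>

lemma one_minus_cos_mult: "1 - cos (real m * x) \<le> (real m)\<^sup>2 * (1 - cos x)"
proof -
  have s: "\<bar>sin (real m * y)\<bar> \<le> real m * \<bar>sin y\<bar>" for y
  proof (induction m)
    case (Suc m)
    have "\<bar>sin (real (Suc m) * y)\<bar> = \<bar>sin (real m * y) * cos y + cos (real m * y) * sin y\<bar>"
      by (simp add: distrib_right sin_add) (simp add: algebra_simps)
    also have "\<dots> \<le> \<bar>sin (real m * y)\<bar> * \<bar>cos y\<bar> + \<bar>cos (real m * y)\<bar> * \<bar>sin y\<bar>"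
      by (metis abs_mult abs_triangle_ineq)
    also have "\<dots> \<le> \<bar>sin (real m * y)\<bar> * 1 + 1 * \<bar>sin y\<bar>"
      by (intro add_mono mult_left_mono mult_right_mono) auto
    finally show ?case using Suc by (simp add: distrib_right)
  qed simp
  have c: "1 - cos z = 2 * (sin (z/2))\<^sup>2" for z :: real
    using cos_double_sin[of "z/2"] by simp
  have "(sin (real m * x / 2))\<^sup>2 \<le> (real m * \<bar>sin (x/2)\<bar>)\<^sup>2"
    using s[of "x/2"] by (metis abs_ge_zero power2_abs power_mono times_divide_eq_right)
  then show ?thesis unfolding c by (simp add: power_mult_distrib)
qed

lemma (in real_distribution) integrable_cos [simp]: "integrable M (\<lambda>x. cos (t * x))"
  by (rule integrable_const_bound[of _ 1]) auto

lemma (in real_distribution) integrable_gauss [simp]: "integrable M (\<lambda>x. exp (- (t * x)\<^sup>2 / 2))"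
  by (rule integrable_const_bound[of _ 1]) auto

text \<open>The cosine transform of the standard normal law is exp(-t^2/2). The average thus
  replaces the oscillating 1 - cos by 1 - exp(-(l x)^2/2), which is increasing in |x| and so can be
  compared with tail indicators.\<close>

lemma gauss_average:
  assumes "real_distribution S"
  shows "(\<integral>x. 1 - exp (- (l * x)\<^sup>2 / 2) \<partial>S) = (\<integral>z. (\<integral>x. 1 - cos (l * z * x) \<partial>S) \<partial>std_normal_distribution)"
proof -
  interpret S: real_distribution S by fact
  interpret G: real_distribution std_normal_distribution by (rule real_dist_normal_dist)
  interpret P: pair_prob_space S std_normal_distribution ..
  have "(\<integral>z. cos (t * z) \<partial>std_normal_distribution) = exp (- t\<^sup>2 / 2)" for t
  proof -
    have "Re (char std_normal_distribution t) = (\<integral>x. Re (iexp (t * x)) \<partial>std_normal_distribution)"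
      unfolding char_def using G.integrable_iexp[of "\<lambda>x. t * x"] by simp
    then show ?thesis by (simp add: char_std_normal_distribution Re_exp)
  qed
  then have "(\<integral>x. 1 - exp (- (l * x)\<^sup>2 / 2) \<partial>S) = (\<integral>x. (\<integral>z. 1 - cos (l * x * z) \<partial>std_normal_distribution) \<partial>S)"
    using G.prob_space by simp
  also have "\<dots> = (\<integral>z. (\<integral>x. 1 - cos (l * x * z) \<partial>S) \<partial>std_normal_distribution)"
  proof (rule P.Fubini_integral[symmetric])
    have "(\<lambda>z. 1 - cos (l * fst z * snd z)) \<in> borel_measurable (S \<Otimes>\<^sub>M std_normal_distribution)"
      by measurable
    then show "integrable (S \<Otimes>\<^sub>M std_normal_distribution) (\<lambda>(x, z). 1 - cos (l * x * z))"
      by (intro P.integrable_const_bound[of _ 2] AE_I2) (auto simp: case_prod_unfold abs_le_iff)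
  qed
  finally show ?thesis by (simp add: mult_ac)
qed

section \<open>The symmetrised law under the norming sequence\<close>

locale attraction =
  fixes \<mu> \<nu> :: "real measure" and a b :: "nat \<Rightarrow> real" and \<alpha> :: real
  assumes mu: "real_distribution \<mu>" and a_pos: "\<And>n. 0 < a n" and stable: "stable_law \<alpha> \<nu>"
    and alpha: "0 < \<alpha>" "\<alpha> < 2"
    and conv: "weak_conv_m (\<lambda>n. distr (iid_sum_law n \<mu>) borel (\<lambda>s. (s - b n) / a n)) \<nu>"
begin

abbreviation S where "S \<equiv> sym_law \<mu>"

definition \<Psi> :: "real \<Rightarrow> real" where "\<Psi> t = (\<integral>x. 1 - cos (t * x) \<partial>S)"

sublocale S: real_distribution S by (rule real_distribution_sym_law[OF mu])

lemma nu: "real_distribution \<nu>" using stable by (simp add: stable_law_def)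

abbreviation Y where "Y n \<equiv> distr (iid_sum_law n \<mu>) borel (\<lambda>s. (s - b n) / a n)"

lemma Y_affine: "Y n = distr (iid_sum_law n \<mu>) borel (\<lambda>s. inverse (a n) * s + (- b n / a n))"
  by (simp add: diff_divide_distrib inverse_eq_divide)

lemma real_distribution_Y: "real_distribution (Y n)"
proof -
  interpret real_distribution "iid_sum_law n \<mu>" by (rule real_distribution_iid_sum[OF mu])
  show ?thesis by (rule real_distribution_distr) simp
qed

lemma cmod_char_Y: "cmod (char (Y n) t) = cmod (char \<mu> (t / a n)) ^ n"
  unfolding Y_affine cmod_char_affine[OF real_distribution_iid_sum[OF mu]] char_iid_sum[OF mu] norm_power
  by (simp add: field_simps)

lemma Psi_eq: "\<Psi> t = 1 - (cmod (char \<mu> t))\<^sup>2"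
  unfolding \<Psi>_def by (rule cos_sym_law[OF mu])

text \<open>Convergence in law gives convergence of the moduli of the characteristic functions, from
  which \<open>b\<close> has vanished. Writing |\<phi>(t/a_n)|^(2n) as the n-th power of 1 -
  \<Psi>(t/a_n) brings the limit into linear form; the constant is twice the exponent of the stable
  law because of the square.\<close>

lemma Psi_scaled_limit: "\<exists>c>0. \<forall>t. (\<lambda>n. real n * \<Psi> (t / a n)) \<longlonglongrightarrow> c * \<bar>t\<bar> powr \<alpha>"
proof -
  interpret mu: real_distribution \<mu> by (rule mu)
  obtain c where c: "c > 0" "\<And>t. cmod (char \<nu> t) = exp (- c * \<bar>t\<bar> powr \<alpha>)"
    using stable_char_modulus[OF stable alpha(1)] by blast
  have "(\<lambda>n. real n * \<Psi> (t / a n)) \<longlonglongrightarrow> 2 * c * \<bar>t\<bar> powr \<alpha>" for t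
  proof -
    have "(\<lambda>n. cmod (char (Y n) t)) \<longlonglongrightarrow> cmod (char \<nu> t)"
      by (intro tendsto_norm levy_continuity1 real_distribution_Y nu conv)
    then have "(\<lambda>n. (cmod (char \<mu> (t / a n)) ^ n)\<^sup>2) \<longlonglongrightarrow> (exp (- c * \<bar>t\<bar> powr \<alpha>))\<^sup>2"
      unfolding cmod_char_Y c(2) by (rule tendsto_power)
    then have "(\<lambda>n. ((cmod (char \<mu> (t / a n)))\<^sup>2) ^ n) \<longlonglongrightarrow> (exp (- c * \<bar>t\<bar> powr \<alpha>))\<^sup>2"
      by (simp add: power_mult[symmetric] mult.commute)
    from power_tendsto_imp_scaled[OF _ _ this]
    have "(\<lambda>n. real n * \<Psi> (t / a n)) \<longlonglongrightarrow> - ln ((exp (- c * \<bar>t\<bar> powr \<alpha>))\<^sup>2)"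
      unfolding Psi_eq using mu.cmod_char_le_1 by (simp add: power_le_one)
    moreover have "- ln ((exp (- c * \<bar>t\<bar> powr \<alpha>))\<^sup>2) = 2 * c * \<bar>t\<bar> powr \<alpha>" by (simp add: ln_realpow)
    ultimately show ?thesis by simp
  qed
  then show ?thesis using c(1) by (intro exI[of _ "2*c"]) auto
qed

text \<open>Pointwise convergence in t does not allow integration over a Gaussian frequency.
  Uniformity near 0 comes from weak convergence: the expectation of min(2, \<delta>|Y|) is below 1/2
  for small \<delta>, which keeps the characteristic functions of all late \<open>Y n\<close> at
  distance at most 1/2 from 1 for |t| <= \<delta>.\<close>

lemma Psi_unif_small:
  "\<exists>\<delta>>0. \<forall>\<^sub>F n in sequentially. \<forall>t. \<bar>t\<bar> \<le> \<delta> \<longrightarrow> real n * \<Psi> (t / a n) \<le> 2"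
proof -
  interpret mu: real_distribution \<mu> by (rule mu)
  interpret nu: real_distribution \<nu> by (rule nu)
  have "(\<lambda>k. \<integral>x. min 2 (\<bar>x\<bar> / real (Suc k)) \<partial>\<nu>) \<longlonglongrightarrow> (\<integral>x. 0 \<partial>\<nu>)"
  proof (rule integral_dominated_convergence[where w="\<lambda>_. 2"])
    have "(\<lambda>k. min 2 (\<bar>x\<bar> / real (Suc k))) \<longlonglongrightarrow> min 2 0" for x
      by (intro tendsto_min tendsto_const) real_asymp
    then show "AE x in \<nu>. (\<lambda>k. min 2 (\<bar>x\<bar> / real (Suc k))) \<longlonglongrightarrow> 0" by simp
  qed auto
  then have "\<forall>\<^sub>F k in sequentially. (\<integral>x. min 2 (\<bar>x\<bar> / real (Suc k)) \<partial>\<nu>) < 1/2"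
    by (intro order_tendstoD) auto
  then obtain k where k: "(\<integral>x. min 2 (\<bar>x\<bar> / real (Suc k)) \<partial>\<nu>) < 1/2" by (auto simp: eventually_sequentially)
  define \<delta> where "\<delta> = 1 / real (Suc k)"
  have "\<delta> > 0" by (simp add: \<delta>_def)
  have "(\<lambda>n. \<integral>x. min 2 (\<delta> * \<bar>x\<bar>) \<partial>Y n) \<longlonglongrightarrow> (\<integral>x. min 2 (\<delta> * \<bar>x\<bar>) \<partial>\<nu>)"
    by (rule weak_conv_imp_integral_bdd_continuous_conv[OF real_distribution_Y nu conv, of _ 2])
       (use \<open>\<delta> > 0\<close> in \<open>auto intro!: continuous_intros simp: abs_mult\<close>)
  moreover have "(\<integral>x. min 2 (\<delta> * \<bar>x\<bar>) \<partial>\<nu>) < 1/2" using k by (simp add: \<delta>_def)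
  ultimately have "\<forall>\<^sub>F n in sequentially. (\<integral>x. min 2 (\<delta> * \<bar>x\<bar>) \<partial>Y n) < 1/2" by (rule order_tendstoD)
  then have "\<forall>\<^sub>F n in sequentially. \<forall>t. \<bar>t\<bar> \<le> \<delta> \<longrightarrow> real n * \<Psi> (t / a n) \<le> 2"
  proof eventually_elim
    case (elim n)
    interpret Y: real_distribution "Y n" by (rule real_distribution_Y)
    show ?case
    proof (intro allI impI)
      fix t assume t: "\<bar>t\<bar> \<le> \<delta>"
      have int: "integrable (Y n) (\<lambda>x. iexp (t * x))" by (rule Y.integrable_iexp) auto
      have "1 - char (Y n) t = (\<integral>x. 1 - iexp (t * x) \<partial>Y n)"
        using int Y.prob_space by (simp add: char_def)
      then have "cmod (1 - char (Y n) t) \<le> (\<integral>x. cmod (1 - iexp (t * x)) \<partial>Y n)" by simp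
      also have "\<dots> \<le> (\<integral>x. min 2 (\<delta> * \<bar>x\<bar>) \<partial>Y n)"
      proof (rule integral_mono)
        show "integrable (Y n) (\<lambda>x. cmod (1 - iexp (t * x)))" using int by simp
        show "integrable (Y n) (\<lambda>x. min 2 (\<delta> * \<bar>x\<bar>))"
          by (rule Y.integrable_const_bound[of _ 2]) (use \<open>\<delta> > 0\<close> in \<open>auto simp: abs_mult\<close>)
        fix x
        have "cmod (1 - iexp (t * x)) \<le> \<bar>t * x\<bar>"
          using iexp_approx1[of "t * x" 0] by (simp add: norm_minus_commute)
        also have "\<dots> \<le> \<delta> * \<bar>x\<bar>" using t by (simp add: abs_mult mult_right_mono)
        finally show "cmod (1 - iexp (t * x)) \<le> min 2 (\<delta> * \<bar>x\<bar>)"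
          using norm_triangle_ineq4[of 1 "iexp (t * x)"] by simp
      qed
      finally have "cmod (1 - char (Y n) t) \<le> 1/2" using elim by simp
      then have half: "cmod (char (Y n) t) \<ge> 1/2"
        using norm_triangle_ineq2[of 1 "1 - char (Y n) t"] by simp
      define y where "y = cmod (char \<mu> (t / a n))"
      have y: "0 \<le> y" "y \<le> 1" by (auto simp: y_def mu.cmod_char_le_1)
      have yn: "y ^ n \<ge> 1/2" using half by (simp add: cmod_char_Y y_def)
      show "real n * \<Psi> (t / a n) \<le> 2"
      proof (cases "n = 0")
        case False
        then have "y > 0" using y yn by (cases "y = 0") (auto simp: zero_power)
        have "1 - y\<^sup>2 \<le> - ln (y\<^sup>2)" using ln_le_minus_one[of "y\<^sup>2"] \<open>y > 0\<close> by simp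
        then have "real n * (1 - y\<^sup>2) \<le> real n * (- ln (y\<^sup>2))" by (rule mult_left_mono) simp
        also have "\<dots> = - (2 * ln (y ^ n))" using \<open>y > 0\<close> by (simp add: ln_realpow)
        also have "ln (y ^ n) \<ge> ln (1/2)" using yn by (intro ln_mono) auto
        then have "- (2 * ln (y ^ n)) \<le> 2 * ln 2" by (simp add: ln_div)
        also have "\<dots> \<le> 2" using ln_2_less_1 by simp
        finally show ?thesis by (simp add: Psi_eq y_def)
      qed simp
    qed
  qed
  with \<open>\<delta> > 0\<close> show ?thesis by blast
qed

lemma Psi_mult: "\<Psi> (real m * t) \<le> (real m)\<^sup>2 * \<Psi> t"
proof -
  have "\<Psi> (real m * t) \<le> (\<integral>x. (real m)\<^sup>2 * (1 - cos (t * x)) \<partial>S)"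
    unfolding \<Psi>_def
  proof (rule integral_mono)
    show "1 - cos (real m * t * x) \<le> (real m)\<^sup>2 * (1 - cos (t * x))" for x
      using one_minus_cos_mult[of m "t * x"] by (simp add: mult.assoc)
  qed auto
  then show ?thesis by (simp add: \<Psi>_def)
qed

text \<open>Divide t by an integer m so that t/m falls into the range of
  \<open>Psi_unif_small\<close>, and come back at cost m^2. The quadratic bound is integrable under
  the Gaussian and will serve for domination.\<close>

lemma Psi_growth:
  "\<exists>\<delta>>0. \<forall>\<^sub>F n in sequentially. \<forall>t. real n * \<Psi> (t / a n) \<le> 2 * (\<bar>t\<bar> / \<delta> + 1)\<^sup>2"
proof -
  obtain \<delta> where d: "\<delta> > 0" and ev: "\<forall>\<^sub>F n in sequentially. \<forall>t. \<bar>t\<bar> \<le> \<delta> \<longrightarrow> real n * \<Psi> (t / a n) \<le> 2"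
    using Psi_unif_small by blast
  from ev have "\<forall>\<^sub>F n in sequentially. \<forall>t. real n * \<Psi> (t / a n) \<le> 2 * (\<bar>t\<bar> / \<delta> + 1)\<^sup>2"
  proof eventually_elim
    case (elim n)
    show ?case
    proof
      fix t
      define m where "m = nat \<lfloor>\<bar>t\<bar> / \<delta>\<rfloor> + 1"
      have m: "\<bar>t\<bar> / \<delta> \<le> real m" "real m \<le> \<bar>t\<bar> / \<delta> + 1" "m > 0"
        unfolding m_def using d by (auto simp: of_nat_nat) linarith
      have "\<bar>t / real m\<bar> \<le> \<delta>" using m(1,3) d by (simp add: abs_div field_simps)
      then have "real n * \<Psi> (t / real m / a n) \<le> 2" using elim by blast
      have "real n * \<Psi> (t / a n) = real n * \<Psi> (real m * (t / real m / a n))" using m(3) by simp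
      also have "\<dots> \<le> real n * ((real m)\<^sup>2 * \<Psi> (t / real m / a n))" by (intro mult_left_mono Psi_mult) simp
      also have "\<dots> = (real m)\<^sup>2 * (real n * \<Psi> (t / real m / a n))" by simp
      also have "\<dots> \<le> (real m)\<^sup>2 * 2" by (intro mult_left_mono) (fact | simp)+
      also have "\<dots> \<le> 2 * (\<bar>t\<bar> / \<delta> + 1)\<^sup>2" using m(2) by (simp add: power_mono)
      finally show "real n * \<Psi> (t / a n) \<le> 2 * (\<bar>t\<bar> / \<delta> + 1)\<^sup>2" .
    qed
  qed
  with d show ?thesis by blast
qed

lemma Psi_measurable [measurable]: "\<Psi> \<in> borel_measurable borel"
proof -
  interpret mu: real_distribution \<mu> by (rule mu)
  have "\<Psi> = (\<lambda>t. 1 - (cmod (char \<mu> t))\<^sup>2)" by (auto simp: Psi_eq)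
  then show ?thesis by simp
qed

text \<open>Dominated convergence over the Gaussian frequency. The constant is \<open>c\<close>
  times the absolute Gaussian moment of order \<alpha>, which is not 0 because otherwise the
  Gaussian variance would vanish.\<close>

lemma gauss_moment: "\<exists>C>0. \<forall>l\<ge>0. (\<lambda>n. real n * (\<integral>x. 1 - exp (- (l * (x / a n))\<^sup>2 / 2) \<partial>S)) \<longlonglongrightarrow> C * l powr \<alpha>"
proof -
  let ?G = std_normal_distribution
  interpret G: real_distribution ?G by (rule real_dist_normal_dist)
  obtain c where c: "c > 0" "\<And>t. (\<lambda>n. real n * \<Psi> (t / a n)) \<longlonglongrightarrow> c * \<bar>t\<bar> powr \<alpha>"
    using Psi_scaled_limit by blast
  obtain \<delta> where d: "\<delta> > 0" and ev: "\<forall>\<^sub>F n in sequentially. \<forall>t. real n * \<Psi> (t / a n) \<le> 2 * (\<bar>t\<bar> / \<delta> + 1)\<^sup>2"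
    using Psi_growth by blast
  have Psi0: "0 \<le> \<Psi> t" for t unfolding \<Psi>_def by (intro integral_nonneg_AE AE_I2) simp
  define K where "K = (\<integral>z. \<bar>z\<bar> powr \<alpha> \<partial>?G)"
  have sq: "integrable ?G (\<lambda>z. z\<^sup>2)" by (rule integrable_std_normal_distribution_moment)
  have sq1: "integrable ?G (\<lambda>z. 1 + z\<^sup>2)" using sq by simp
  have Kint: "integrable ?G (\<lambda>z. \<bar>z\<bar> powr \<alpha>)"
  proof (rule Bochner_Integration.integrable_bound[OF sq1])
    have "\<bar>z\<bar> powr \<alpha> \<le> 1 + z\<^sup>2" for z :: real
    proof (cases "\<bar>z\<bar> \<le> 1")
      case True then have "\<bar>z\<bar> powr \<alpha> \<le> 1" using alpha by (intro powr_le1) auto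
      then show ?thesis using zero_le_power2[of z] by linarith
    next
      case False then have "\<bar>z\<bar> powr \<alpha> \<le> \<bar>z\<bar> powr 2" using alpha by (intro powr_mono) auto
      then show ?thesis using False by simp
    qed
    then show "AE z in ?G. norm (\<bar>z\<bar> powr \<alpha>) \<le> norm (1 + z\<^sup>2)" by simp
  qed simp
  have "K \<ge> 0" unfolding K_def by simp
  moreover have "K \<noteq> 0"
  proof
    assume "K = 0"
    then have "AE z in ?G. \<bar>z\<bar> powr \<alpha> = 0" unfolding K_def using integral_nonneg_eq_0_iff_AE[OF Kint] by simp
    then have "AE z in ?G. z\<^sup>2 = 0" by eventually_elim simp
    then have "(\<integral>z. z\<^sup>2 \<partial>?G) = 0" by (subst integral_cong_AE[of _ _ "\<lambda>_. 0"]) auto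
    moreover have "(\<integral>z. z\<^sup>2 \<partial>?G) = 1" using std_normal_distribution_even_moments[of 1] by (simp add: fact_numeral)
    ultimately show False by simp
  qed
  ultimately have K: "K > 0" by simp
  have "(\<lambda>n. real n * (\<integral>x. 1 - exp (- (l * (x / a n))\<^sup>2 / 2) \<partial>S)) \<longlonglongrightarrow> (c * K) * l powr \<alpha>" if l: "l \<ge> 0" for l
  proof -
    have eq: "real n * (\<integral>x. 1 - exp (- (l * (x / a n))\<^sup>2 / 2) \<partial>S) = (\<integral>z. real n * \<Psi> (l * z / a n) \<partial>?G)" for n
      using gauss_average[OF S.real_distribution_axioms, of "l / a n"] unfolding \<Psi>_def
      by (simp add: mult.assoc)
    have "(\<lambda>n. \<integral>z. real n * \<Psi> (l * z / a n) \<partial>?G) \<longlonglongrightarrow> (\<integral>z. c * \<bar>l * z\<bar> powr \<alpha> \<partial>?G)"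
    proof -
      obtain N where N: "\<And>n t. n \<ge> N \<Longrightarrow> real n * \<Psi> (t / a n) \<le> 2 * (\<bar>t\<bar> / \<delta> + 1)\<^sup>2"
        using ev by (auto simp: eventually_sequentially)
      have "(\<lambda>n. \<integral>z. real (n + N) * \<Psi> (l * z / a (n + N)) \<partial>?G) \<longlonglongrightarrow> (\<integral>z. c * \<bar>l * z\<bar> powr \<alpha> \<partial>?G)"
      proof (rule integral_dominated_convergence[where w="\<lambda>z. 4 * (l / \<delta>)\<^sup>2 * z\<^sup>2 + 4"])
        show "integrable ?G (\<lambda>z. 4 * (l / \<delta>)\<^sup>2 * z\<^sup>2 + 4)" using sq by simp
        show "AE z in ?G. (\<lambda>n. real (n + N) * \<Psi> (l * z / a (n + N))) \<longlonglongrightarrow> c * \<bar>l * z\<bar> powr \<alpha>"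
          using LIMSEQ_ignore_initial_segment[OF c(2)] by (intro AE_I2)
        show "AE z in ?G. norm (real (n + N) * \<Psi> (l * z / a (n + N))) \<le> 4 * (l / \<delta>)\<^sup>2 * z\<^sup>2 + 4" for n
        proof (rule AE_I2)
          fix z
          have "(\<bar>l * z\<bar> / \<delta> - 1)\<^sup>2 \<ge> 0" by simp
          then have "2 * (\<bar>l * z\<bar> / \<delta> + 1)\<^sup>2 \<le> 4 * (\<bar>l * z\<bar> / \<delta>)\<^sup>2 + 4" by (simp add: power2_sum power2_diff)
          also have "(\<bar>l * z\<bar> / \<delta>)\<^sup>2 = (l / \<delta>)\<^sup>2 * z\<^sup>2" by (simp add: power_divide power_mult_distrib)
          finally show "norm (real (n + N) * \<Psi> (l * z / a (n + N))) \<le> 4 * (l / \<delta>)\<^sup>2 * z\<^sup>2 + 4"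
            using N[of "n + N" "l * z"] Psi0 by (simp add: mult.assoc)
        qed
      qed auto
      then show ?thesis by (rule LIMSEQ_offset)
    qed
    moreover have "(\<integral>z. c * \<bar>l * z\<bar> powr \<alpha> \<partial>?G) = c * K * l powr \<alpha>"
      using l unfolding K_def by (simp add: abs_mult powr_mult mult_ac)
    ultimately show ?thesis unfolding eq by (simp only:)
  qed
  then show ?thesis using c(1) K by (intro exI[of _ "c * K"]) auto
qed

end

section \<open>Gaussian averages against the power measure\<close>

definition gauss_powr :: "real \<Rightarrow> real \<Rightarrow> real \<Rightarrow> real" where
  "gauss_powr \<alpha> s x = indicator {0<..} x * ((1 - exp (- (s * x)\<^sup>2 / 2)) * x powr (- 1 - \<alpha>))"

lemma gauss_powr_nonneg: "0 \<le> gauss_powr \<alpha> s x"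
  by (simp add: gauss_powr_def)

lemma gauss_powr_measurable [measurable]: "gauss_powr \<alpha> s \<in> borel_measurable borel"
  unfolding gauss_powr_def by measurable

lemma nn_powr_tail:
  assumes "\<alpha> > 0" "y > (0::real)"
  shows "(\<integral>\<^sup>+x. ennreal (indicator {y<..} x * x powr (- 1 - \<alpha>)) \<partial>lborel) = ennreal (y powr (- \<alpha>) / \<alpha>)"
proof -
  have "((\<lambda>x. x powr (- 1 - \<alpha>)) has_integral -(y powr (- 1 - \<alpha> + 1)) / (- 1 - \<alpha> + 1)) {y..}"
    using assms by (intro has_integral_powr_to_inf) auto
  then have "((\<lambda>x. x powr (- 1 - \<alpha>)) has_integral y powr (- \<alpha>) / \<alpha>) {y..}" by simp
  then have "(\<integral>\<^sup>+x. ennreal (x powr (- 1 - \<alpha>)) * indicator {y..} x \<partial>lborel) = ennreal (y powr (- \<alpha>) / \<alpha>)"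
    by (intro nn_integral_has_integral_lebesgue') auto
  also have "(\<integral>\<^sup>+x. ennreal (x powr (- 1 - \<alpha>)) * indicator {y..} x \<partial>lborel) =
     (\<integral>\<^sup>+x. ennreal (indicator {y<..} x * x powr (- 1 - \<alpha>)) \<partial>lborel)"
    using AE_lborel_singleton[of y] by (intro nn_integral_cong_AE) (auto split: split_indicator elim!: eventually_mono)
  finally show ?thesis .
qed

text \<open>Near 0 the factor 1 - exp(-x^2/2) is at most x^2, which tames x^(-1-\<alpha>) because
  \<alpha> < 2. At infinity it is bounded, and \<alpha> > 0 suffices.\<close>

lemma gauss_powr_integrable:
  assumes "0 < \<alpha>" "\<alpha> < 2"
  shows "integrable lborel (gauss_powr \<alpha> 1)" and "(\<integral>x. gauss_powr \<alpha> 1 x \<partial>lborel) > 0"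
proof -
  have 0: "(\<integral>\<^sup>+x. ennreal (x powr (1 - \<alpha>)) * indicator {0..1} x \<partial>lborel) = ennreal (1 powr (1 - \<alpha> + 1) / (1 - \<alpha> + 1))"
    using assms by (intro nn_integral_has_integral_lebesgue' has_integral_powr_from_0) auto
  have le: "ennreal (gauss_powr \<alpha> 1 x) \<le> ennreal (x powr (1 - \<alpha>)) * indicator {0..1} x
      + ennreal (indicator {1<..} x * x powr (- 1 - \<alpha>))" for x
  proof (cases "x \<le> 0")
    case True
    then show ?thesis by (simp add: gauss_powr_def)
  next
    case False
    have "1 - exp (- x\<^sup>2 / 2) \<le> x\<^sup>2" using exp_ge_add_one_self[of "- x\<^sup>2 / 2"] zero_le_power2[of x] by linarith
    then have "(1 - exp (- x\<^sup>2 / 2)) * x powr (- 1 - \<alpha>) \<le> x\<^sup>2 * x powr (- 1 - \<alpha>)" by (rule mult_right_mono) simp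
    also have "x\<^sup>2 * x powr (- 1 - \<alpha>) = x powr 2 * x powr (- 1 - \<alpha>)" using False by simp
    also have "\<dots> = x powr (1 - \<alpha>)" by (simp only: powr_add[symmetric]) simp
    finally have A: "(1 - exp (- x\<^sup>2 / 2)) * x powr (- 1 - \<alpha>) \<le> x powr (1 - \<alpha>)" .
    have B: "(1 - exp (- x\<^sup>2 / 2)) * x powr (- 1 - \<alpha>) \<le> 1 * x powr (- 1 - \<alpha>)" by (rule mult_right_mono) auto
    from A B False show ?thesis by (cases "x \<le> 1") (auto simp: gauss_powr_def intro!: ennreal_leI)
  qed
  have "(\<integral>\<^sup>+x. ennreal (gauss_powr \<alpha> 1 x) \<partial>lborel) \<le>
     (\<integral>\<^sup>+x. ennreal (x powr (1 - \<alpha>)) * indicator {0..1} x + ennreal (indicator {1<..} x * x powr (- 1 - \<alpha>)) \<partial>lborel)"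
    by (intro nn_integral_mono le)
  also have "\<dots> = ennreal (1 powr (1 - \<alpha> + 1) / (1 - \<alpha> + 1)) + ennreal (1 powr (- \<alpha>) / \<alpha>)"
    by (subst nn_integral_add) (auto simp: 0 nn_powr_tail[OF assms(1)])
  finally have fin: "(\<integral>\<^sup>+x. ennreal (gauss_powr \<alpha> 1 x) \<partial>lborel) < \<infinity>" by (auto simp: less_top[symmetric] top_unique)
  then show int: "integrable lborel (gauss_powr \<alpha> 1)"
    by (intro integrableI_nonneg) (auto simp: gauss_powr_nonneg)
  have "(\<integral>\<^sup>+x. ennreal (1 - exp (- 1 / 2)) * ennreal (indicator {1<..} x * x powr (- 1 - \<alpha>)) \<partial>lborel)
     \<le> (\<integral>\<^sup>+x. ennreal (gauss_powr \<alpha> 1 x) \<partial>lborel)"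
  proof (intro nn_integral_mono)
    fix x :: real
    show "ennreal (1 - exp (- 1 / 2)) * ennreal (indicator {1<..} x * x powr (- 1 - \<alpha>)) \<le> ennreal (gauss_powr \<alpha> 1 x)"
    proof (cases "x > 1")
      case True
      then have "1\<^sup>2 \<le> x\<^sup>2" by (intro power_mono) auto
      then have "(1 - exp (- 1 / 2)) * x powr (- 1 - \<alpha>) \<le> (1 - exp (- x\<^sup>2 / 2)) * x powr (- 1 - \<alpha>)"
        by (intro mult_right_mono) auto
      with True show ?thesis by (simp add: gauss_powr_def ennreal_mult'[symmetric] ennreal_leI)
    qed simp
  qed
  also have "(\<integral>\<^sup>+x. ennreal (1 - exp (- 1 / 2)) * ennreal (indicator {1<..} x * x powr (- 1 - \<alpha>)) \<partial>lborel)
    = ennreal (1 - exp (- 1 / 2)) * ennreal (1 powr (- \<alpha>) / \<alpha>)"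
    by (subst nn_integral_cmult) (auto simp: nn_powr_tail[OF assms(1)])
  also have "\<dots> = ennreal ((1 - exp (- 1 / 2)) * (1 / \<alpha>))" using assms by (subst ennreal_mult[symmetric]) auto
  finally have "ennreal ((1 - exp (- 1 / 2)) * (1 / \<alpha>)) \<le> ennreal (\<integral>x. gauss_powr \<alpha> 1 x \<partial>lborel)"
    using int by (subst (asm) nn_integral_eq_integral) (auto simp: gauss_powr_nonneg)
  moreover have "(\<integral>x. gauss_powr \<alpha> 1 x \<partial>lborel) \<ge> 0" by (simp add: gauss_powr_nonneg)
  ultimately have "(1 - exp (- 1 / 2)) * (1 / \<alpha>) \<le> (\<integral>x. gauss_powr \<alpha> 1 x \<partial>lborel)" by simp
  moreover have "0 < (1 - exp (- 1 / 2 :: real)) * (1 / \<alpha>)" using assms by simp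
  ultimately show "(\<integral>x. gauss_powr \<alpha> 1 x \<partial>lborel) > 0" by linarith
qed

text \<open>The substitution x to s x. It writes s^\<alpha>, the limit found in
  \<open>gauss_moment\<close>, as the integral of the same Gaussian function against the density
  x^(-1-\<alpha>), and thus identifies the limiting tail measure.\<close>

lemma gauss_powr_scale:
  assumes "0 < \<alpha>" "\<alpha> < 2" "s \<ge> 0"
  shows "integrable lborel (gauss_powr \<alpha> s)"
    and "(\<integral>x. gauss_powr \<alpha> s x \<partial>lborel) = s powr \<alpha> * (\<integral>x. gauss_powr \<alpha> 1 x \<partial>lborel)"
proof -
  have "integrable lborel (gauss_powr \<alpha> s) \<and> (\<integral>x. gauss_powr \<alpha> s x \<partial>lborel) = s powr \<alpha> * (\<integral>x. gauss_powr \<alpha> 1 x \<partial>lborel)"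
  proof (cases "s = 0")
    case True
    then have "gauss_powr \<alpha> s = (\<lambda>_. 0)" by (auto simp: gauss_powr_def)
    then show ?thesis using True by simp
  next
    case False
    with assms have s: "s > 0" by simp
    have eq: "gauss_powr \<alpha> s x = s powr (1 + \<alpha>) * gauss_powr \<alpha> 1 (0 + s * x)" for x
    proof (cases "x > 0")
      case True
      have "(s * x) powr (- 1 - \<alpha>) = s powr (- 1 - \<alpha>) * x powr (- 1 - \<alpha>)" using s True by (simp add: powr_mult)
      moreover have "s powr (1 + \<alpha>) * s powr (- 1 - \<alpha>) = 1" using s by (simp add: powr_add[symmetric])
      ultimately show ?thesis using s True by (simp add: gauss_powr_def)
    next
      case False
      then have "s * x \<le> 0" using s by (simp add: mult_le_0_iff)
      then show ?thesis using False by (simp add: gauss_powr_def)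
    qed
    have "integrable lborel (\<lambda>x. gauss_powr \<alpha> 1 (0 + s * x))"
      using lborel_integrable_real_affine[OF gauss_powr_integrable(1)[OF assms(1,2)], of s 0] s by simp
    moreover have "(\<integral>x. gauss_powr \<alpha> 1 x \<partial>lborel) = s * (\<integral>x. gauss_powr \<alpha> 1 (0 + s * x) \<partial>lborel)"
      using lborel_integral_real_affine[of s "gauss_powr \<alpha> 1" 0] s by simp
    moreover have "s powr (1 + \<alpha>) = s * s powr \<alpha>" using s by (simp add: powr_add)
    ultimately show ?thesis unfolding eq[abs_def] using s by simp
  qed
  then show "integrable lborel (gauss_powr \<alpha> s)" "(\<integral>x. gauss_powr \<alpha> s x \<partial>lborel) = s powr \<alpha> * (\<integral>x. gauss_powr \<alpha> 1 x \<partial>lborel)"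
    by auto
qed

context attraction
begin

text \<open>
  In the variable \<open>u = exp (- x\<^sup>2 / 2)\<close> the Gaussian averages are moments, so that polynomial
  approximation on \<open>[0,1]\<close> extends their convergence to all continuous functions vanishing near \<open>u = 1\<close>.
\<close>

lemma gauss_functional_limit:
  "\<exists>C>0. \<forall>Q. continuous_on UNIV Q \<longrightarrow>
     (\<lambda>n. real n * (\<integral>x. (1 - exp (- (x / a n)\<^sup>2 / 2)) * Q (exp (- (x / a n)\<^sup>2 / 2)) \<partial>S))
       \<longlonglongrightarrow> C * (\<integral>x. Q (exp (- x\<^sup>2 / 2)) * gauss_powr \<alpha> 1 x \<partial>lborel)"
proof -
  define u where "u n x = exp (- (x / a n)\<^sup>2 / 2)" for n x
  define v where "v x = exp (- x\<^sup>2 / 2)" for x :: real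
  have u01: "u n x \<in> {0..1}" and v01: "v x \<in> {0..1}" for n x by (auto simp: u_def v_def)
  have [measurable]: "u n \<in> borel_measurable borel" "v \<in> borel_measurable borel" for n
    unfolding u_def v_def by measurable
  obtain C0 where C0: "C0 > 0" and lim: "\<And>l. l \<ge> 0 \<Longrightarrow> (\<lambda>n. real n * (\<integral>x. 1 - exp (- (l * (x / a n))\<^sup>2 / 2) \<partial>S)) \<longlonglongrightarrow> C0 * l powr \<alpha>"
    using gauss_moment by blast
  define D where "D = (\<integral>x. gauss_powr \<alpha> 1 x \<partial>lborel)"
  have D: "D > 0" unfolding D_def by (rule gauss_powr_integrable(2)[OF alpha])
  define C where "C = C0 / D"
  define La where "La n Q = real n * (\<integral>x. (1 - u n x) * Q (u n x) \<partial>S)" for n and Q :: "real \<Rightarrow> real"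
  define L where "L Q = C * (\<integral>x. Q (v x) * gauss_powr \<alpha> 1 x \<partial>lborel)" for Q :: "real \<Rightarrow> real"
  have upow: "u n x ^ j = exp (- (sqrt (real j) * (x / a n))\<^sup>2 / 2)" for n x j
    unfolding u_def by (simp add: exp_of_nat_mult[symmetric] power_mult_distrib power_divide)
  have vpow: "v x ^ j = exp (- (sqrt (real j) * x)\<^sup>2 / 2)" for x j
    unfolding v_def by (simp add: exp_of_nat_mult[symmetric] power_mult_distrib)
  \<comment> \<open>Powers of u are Gaussians again, with scale sqrt j, and (1 - u) u^j = (1 -
    u^(j+1)) - (1 - u^j). Every moment is therefore a difference of two limits already known, on the
    side of the law and on the side of the power measure alike.\<close>
  have mom: "(\<lambda>n. La n (\<lambda>u. u ^ j)) \<longlonglongrightarrow> L (\<lambda>u. u ^ j)" for j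
  proof -
    have "(\<lambda>n. real n * (\<integral>x. 1 - u n x ^ Suc j \<partial>S) - real n * (\<integral>x. 1 - u n x ^ j \<partial>S)) \<longlonglongrightarrow>
        C0 * sqrt (real (Suc j)) powr \<alpha> - C0 * sqrt (real j) powr \<alpha>"
      unfolding upow by (intro tendsto_diff lim) auto
    moreover have "real n * (\<integral>x. 1 - u n x ^ Suc j \<partial>S) - real n * (\<integral>x. 1 - u n x ^ j \<partial>S) = La n (\<lambda>u. u ^ j)" for n
    proof -
      have [simp]: "integrable S (\<lambda>x. u n x ^ k)" for k
        by (rule S.integrable_const_bound[of _ 1]) (use u01[of n] in \<open>auto simp: power_le_one\<close>)
      have "(\<integral>x. (1 - u n x) * u n x ^ j \<partial>S) = (\<integral>x. (1 - u n x ^ Suc j) - (1 - u n x ^ j) \<partial>S)"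
        by (intro Bochner_Integration.integral_cong) (auto simp: algebra_simps)
      also have "\<dots> = (\<integral>x. 1 - u n x ^ Suc j \<partial>S) - (\<integral>x. 1 - u n x ^ j \<partial>S)"
        by (rule Bochner_Integration.integral_diff) (auto simp del: power_Suc)
      finally show ?thesis by (simp only: La_def right_diff_distrib)
    qed
    moreover have "C0 * sqrt (real (Suc j)) powr \<alpha> - C0 * sqrt (real j) powr \<alpha> = L (\<lambda>u. u ^ j)"
    proof -
      have "(\<integral>x. v x ^ j * gauss_powr \<alpha> 1 x \<partial>lborel) = (\<integral>x. gauss_powr \<alpha> (sqrt (real (Suc j))) x - gauss_powr \<alpha> (sqrt (real j)) x \<partial>lborel)"
      proof (intro Bochner_Integration.integral_cong refl)
        fix x
        have "v x ^ j * (1 - v x) = (1 - v x ^ Suc j) - (1 - v x ^ j)" by (simp add: algebra_simps)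
        then have "v x ^ j * (1 - exp (- (1 * x)\<^sup>2 / 2)) = (1 - exp (- (sqrt (real (Suc j)) * x)\<^sup>2 / 2)) - (1 - exp (- (sqrt (real j) * x)\<^sup>2 / 2))"
          unfolding vpow by (simp add: v_def)
        note E = this
        have "v x ^ j * gauss_powr \<alpha> 1 x = indicator {0<..} x * ((v x ^ j * (1 - exp (- (1 * x)\<^sup>2 / 2))) * x powr (- 1 - \<alpha>))"
          unfolding gauss_powr_def by (simp only: mult_ac)
        also have "\<dots> = gauss_powr \<alpha> (sqrt (real (Suc j))) x - gauss_powr \<alpha> (sqrt (real j)) x"
          unfolding E gauss_powr_def by (simp only: left_diff_distrib right_diff_distrib)
        finally show "v x ^ j * gauss_powr \<alpha> 1 x = gauss_powr \<alpha> (sqrt (real (Suc j))) x - gauss_powr \<alpha> (sqrt (real j)) x" .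
      qed
      also have "\<dots> = (sqrt (real (Suc j)) powr \<alpha> - sqrt (real j) powr \<alpha>) * D"
      proof -
        have i: "integrable lborel (gauss_powr \<alpha> (sqrt (real k)))" for k by (rule gauss_powr_scale(1)[OF alpha]) simp
        have e: "(\<integral>x. gauss_powr \<alpha> (sqrt (real k)) x \<partial>lborel) = sqrt (real k) powr \<alpha> * D" for k
          unfolding D_def by (rule gauss_powr_scale(2)[OF alpha]) simp
        show ?thesis unfolding Bochner_Integration.integral_diff[OF i i] e left_diff_distrib ..
      qed
      finally have E: "(\<integral>x. v x ^ j * gauss_powr \<alpha> 1 x \<partial>lborel) = (sqrt (real (Suc j)) powr \<alpha> - sqrt (real j) powr \<alpha>) * D" .
      show ?thesis unfolding L_def C_def E using D by (simp add: right_diff_distrib)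
    qed
    ultimately show ?thesis by simp
  qed
  define P where "P Q \<longleftrightarrow> Q \<in> borel_measurable borel \<and> (\<lambda>n. La n Q) \<longlonglongrightarrow> L Q" for Q
  have bnd: "\<exists>B. \<forall>x\<in>{0..1}. \<bar>Q x\<bar> \<le> B" if "continuous_on {0..1} Q" for Q :: "real \<Rightarrow> real"
    using compact_imp_bounded[OF compact_continuous_image[OF that compact_Icc]] by (auto simp: bounded_iff)
  have intS: "integrable S (\<lambda>x. (1 - u n x) * Q (u n x))" if Q: "continuous_on {0..1} Q" "Q \<in> borel_measurable borel" for n Q
  proof -
    obtain B where B: "\<forall>x\<in>{0..1}. \<bar>Q x\<bar> \<le> B" using bnd[OF Q(1)] by blast
    note [measurable] = Q(2)
    have "\<bar>(1 - u n x) * Q (u n x)\<bar> \<le> B" for x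
    proof -
      have "\<bar>(1 - u n x) * Q (u n x)\<bar> \<le> 1 * B" unfolding abs_mult
        using u01[of n x] B by (intro mult_mono) auto
      then show ?thesis by simp
    qed
    then show ?thesis by (intro S.integrable_const_bound[of _ B]) auto
  qed
  have intL: "integrable lborel (\<lambda>x. Q (v x) * gauss_powr \<alpha> 1 x)" if Q: "continuous_on {0..1} Q" "Q \<in> borel_measurable borel" for Q
  proof -
    obtain B where B: "\<forall>x\<in>{0..1}. \<bar>Q x\<bar> \<le> B" using bnd[OF Q(1)] by blast
    note [measurable] = Q(2)
    have "integrable lborel (\<lambda>x. B * gauss_powr \<alpha> 1 x)" using gauss_powr_integrable(1)[OF alpha] by simp
    then show ?thesis
    proof (rule Bochner_Integration.integrable_bound)
      have "0 \<le> B" using B by fastforce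
      then show "AE x in lborel. norm (Q (v x) * gauss_powr \<alpha> 1 x) \<le> norm (B * gauss_powr \<alpha> 1 x)"
        using B v01 by (intro AE_I2) (auto simp: abs_mult gauss_powr_nonneg intro!: mult_right_mono)
    qed measurable
  qed
  have "(\<lambda>n. La n Q) \<longlonglongrightarrow> L Q" if Qc: "continuous_on UNIV Q" for Q
  proof (rule LIMSEQ_I)
    fix e :: real assume "e > 0"
    have Q: "continuous_on {0..1} Q" "Q \<in> borel_measurable borel"
      using Qc by (auto intro: continuous_on_subset borel_measurable_continuous_onI)
    \<comment> \<open>\<open>La n\<close> of the constant 1 tends to \<open>C0\<close> and is
      eventually below \<open>C0\<close> + 1, so replacing \<open>Q\<close> by its approximation
      costs at most e/4 on either side.\<close>
    define e' where "e' = e / (4 * (C0 + 1))"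
    have e': "e' > 0" using \<open>e > 0\<close> C0 by (simp add: e'_def)
    have "\<exists>g. P g \<and> continuous_on {0..1} g \<and> (\<forall>x\<in>{0..1}. \<bar>Q x - g x\<bar> < e')"
    proof (rule Stone_Weierstrass_span[where B="range (\<lambda>j u. u ^ j)"])
      show "(\<lambda>_. 1) \<in> range (\<lambda>j (u::real). u ^ j)" by (rule image_eqI[of _ _ 0]) auto
      show "(\<lambda>x. b x * c x) \<in> range (\<lambda>j (u::real). u ^ j)" 
        if bc: "b \<in> range (\<lambda>j (u::real). u ^ j)" "c \<in> range (\<lambda>j (u::real). u ^ j)" for b c
      proof -
        from bc obtain i j where "b = (\<lambda>u. u ^ i)" "c = (\<lambda>u. u ^ j)" by auto
        then show ?thesis by (intro image_eqI[of _ _ "i + j"]) (auto simp: power_add)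
      qed
      show "\<exists>b\<in>range (\<lambda>j (u::real). u ^ j). b x \<noteq> b y" if "x \<noteq> y" for x y
        using that by (intro bexI[of _ "\<lambda>u. u ^ 1"]) (simp, rule rangeI)
      show "P (\<lambda>x. c * b x)" if b: "b \<in> range (\<lambda>j (u::real). u ^ j)" for b c
      proof -
        obtain j where j: "b = (\<lambda>u. u ^ j)" using b by auto
        have "La n (\<lambda>x. c * b x) = c * La n b" for n unfolding La_def by (simp add: mult.left_commute)
        moreover have "L (\<lambda>x. c * b x) = c * L b" unfolding L_def by (simp add: mult.assoc)
        ultimately show ?thesis unfolding P_def using mom[of j] by (auto simp: j intro: tendsto_mult)
      qed
      show "P (\<lambda>x. f x + g x)" if fg: "continuous_on {0..1} f" "continuous_on {0..1} g" "P f" "P g" for f g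
      proof -
        have m: "f \<in> borel_measurable borel" "g \<in> borel_measurable borel" using fg by (auto simp: P_def)
        have "La n (\<lambda>x. f x + g x) = La n f + La n g" for n
          unfolding La_def using intS[OF fg(1) m(1)] intS[OF fg(2) m(2)] by (simp add: distrib_left)
        moreover have "L (\<lambda>x. f x + g x) = L f + L g"
          unfolding L_def using intL[OF fg(1) m(1)] intL[OF fg(2) m(2)] by (simp add: distrib_left distrib_right)
        ultimately show ?thesis using fg(3,4) by (auto simp: P_def intro: tendsto_add)
      qed
    qed (use Q e' in \<open>auto intro!: continuous_intros\<close>)
    then obtain g where g: "P g" "continuous_on {0..1} g" "\<forall>x\<in>{0..1}. \<bar>Q x - g x\<bar> < e'" by blast
    have gm: "g \<in> borel_measurable borel" using g(1) by (simp add: P_def)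
    have d1: "\<bar>La n Q - La n g\<bar> \<le> e' * La n (\<lambda>_. 1)" for n
    proof -
      have "\<bar>(\<integral>x. (1 - u n x) * Q (u n x) \<partial>S) - (\<integral>x. (1 - u n x) * g (u n x) \<partial>S)\<bar>
        = \<bar>\<integral>x. (1 - u n x) * Q (u n x) - (1 - u n x) * g (u n x) \<partial>S\<bar>"
        using intS[OF Q] intS[OF g(2) gm] by simp
      also have "\<dots> \<le> (\<integral>x. \<bar>(1 - u n x) * Q (u n x) - (1 - u n x) * g (u n x)\<bar> \<partial>S)" by (rule integral_abs_bound)
      also have "\<dots> \<le> (\<integral>x. e' * ((1 - u n x) * 1) \<partial>S)"
      proof (rule integral_mono)
        show "integrable S (\<lambda>x. e' * ((1 - u n x) * 1))" using intS[of "\<lambda>_. 1" n] by simp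
        fix x
        have "\<bar>(1 - u n x) * Q (u n x) - (1 - u n x) * g (u n x)\<bar> = (1 - u n x) * \<bar>Q (u n x) - g (u n x)\<bar>"
          unfolding right_diff_distrib[symmetric] abs_mult using u01[of n x] by simp
        also have "\<dots> \<le> (1 - u n x) * e'" using u01[of n x] g(3) by (intro mult_left_mono) (auto simp: less_imp_le)
        finally show "\<bar>(1 - u n x) * Q (u n x) - (1 - u n x) * g (u n x)\<bar> \<le> e' * ((1 - u n x) * 1)" by (simp add: mult.commute)
      qed (use intS[OF Q] intS[OF g(2) gm] in simp)
      finally have "\<bar>(\<integral>x. (1 - u n x) * Q (u n x) \<partial>S) - (\<integral>x. (1 - u n x) * g (u n x) \<partial>S)\<bar> \<le> e' * (\<integral>x. (1 - u n x) * 1 \<partial>S)" by simp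
      then have "real n * \<bar>(\<integral>x. (1 - u n x) * Q (u n x) \<partial>S) - (\<integral>x. (1 - u n x) * g (u n x) \<partial>S)\<bar> \<le> real n * (e' * (\<integral>x. (1 - u n x) * 1 \<partial>S))"
        by (rule mult_left_mono) simp
      then show ?thesis unfolding La_def right_diff_distrib[symmetric] abs_mult by (simp add: mult.left_commute)
    qed
    have L1: "L (\<lambda>_. 1) = C0" using D by (simp add: L_def C_def D_def)
    have Cpos: "C > 0" using C0 D by (simp add: C_def)
    have d2: "\<bar>L Q - L g\<bar> \<le> e' * C0"
    proof -
      have "\<bar>(\<integral>x. Q (v x) * gauss_powr \<alpha> 1 x \<partial>lborel) - (\<integral>x. g (v x) * gauss_powr \<alpha> 1 x \<partial>lborel)\<bar>
        = \<bar>\<integral>x. Q (v x) * gauss_powr \<alpha> 1 x - g (v x) * gauss_powr \<alpha> 1 x \<partial>lborel\<bar>"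
        using intL[OF Q] intL[OF g(2) gm] by simp
      also have "\<dots> \<le> (\<integral>x. \<bar>Q (v x) * gauss_powr \<alpha> 1 x - g (v x) * gauss_powr \<alpha> 1 x\<bar> \<partial>lborel)" by (rule integral_abs_bound)
      also have "\<dots> \<le> (\<integral>x. e' * gauss_powr \<alpha> 1 x \<partial>lborel)"
      proof (rule integral_mono)
        show "integrable lborel (\<lambda>x. e' * gauss_powr \<alpha> 1 x)" using gauss_powr_integrable(1)[OF alpha] by simp
        fix x
        have "\<bar>Q (v x) * gauss_powr \<alpha> 1 x - g (v x) * gauss_powr \<alpha> 1 x\<bar> = \<bar>Q (v x) - g (v x)\<bar> * gauss_powr \<alpha> 1 x"
          unfolding left_diff_distrib[symmetric] abs_mult by (simp add: gauss_powr_nonneg)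
        also have "\<dots> \<le> e' * gauss_powr \<alpha> 1 x"
          using v01[of x] g(3) by (intro mult_right_mono) (auto simp: less_imp_le gauss_powr_nonneg)
        finally show "\<bar>Q (v x) * gauss_powr \<alpha> 1 x - g (v x) * gauss_powr \<alpha> 1 x\<bar> \<le> e' * gauss_powr \<alpha> 1 x" .
      qed (use intL[OF Q] intL[OF g(2) gm] in simp)
      finally have "\<bar>(\<integral>x. Q (v x) * gauss_powr \<alpha> 1 x \<partial>lborel) - (\<integral>x. g (v x) * gauss_powr \<alpha> 1 x \<partial>lborel)\<bar> \<le> e' * D"
        by (simp add: D_def)
      then have "C * \<bar>(\<integral>x. Q (v x) * gauss_powr \<alpha> 1 x \<partial>lborel) - (\<integral>x. g (v x) * gauss_powr \<alpha> 1 x \<partial>lborel)\<bar> \<le> C * (e' * D)"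
        using Cpos by (intro mult_left_mono) auto
      moreover have "C * (e' * D) = e' * C0" using D by (simp add: C_def)
      ultimately show ?thesis unfolding L_def right_diff_distrib[symmetric] abs_mult using Cpos by simp
    qed
    have "(\<lambda>n. La n (\<lambda>_. 1)) \<longlonglongrightarrow> C0" using mom[of 0] L1 by simp
    then have "\<forall>\<^sub>F n in sequentially. La n (\<lambda>_. 1) < C0 + 1" by (rule order_tendstoD) simp
    moreover have "\<forall>\<^sub>F n in sequentially. \<bar>La n g - L g\<bar> < e / 4"
      using g(1) \<open>e > 0\<close> unfolding P_def tendsto_iff dist_real_def by (meson divide_pos_pos zero_less_numeral)
    ultimately have "\<forall>\<^sub>F n in sequentially. norm (La n Q - L Q) < e"
    proof eventually_elim
      case (elim n)
      have "e' * La n (\<lambda>_. 1) \<le> e' * (C0 + 1)" using elim e' by simp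
      moreover have "4 * C0 + 4 \<noteq> 0" using C0 by simp
      then have "e' * (C0 + 1) = e / 4" by (simp add: e'_def divide_eq_eq algebra_simps)
      moreover have "e' * C0 \<le> e' * (C0 + 1)" using e' by simp
      ultimately show ?case using d1[of n] d2 elim(2) \<open>e > 0\<close> unfolding real_norm_def by linarith
    qed
    then show "\<exists>n0. \<forall>n\<ge>n0. norm (La n Q - L Q) < e" by (simp add: eventually_sequentially)
  qed
  moreover have "C > 0" using C0 D by (simp add: C_def)
  ultimately show ?thesis unfolding La_def L_def u_def v_def by blast
qed

text \<open>The event |x| > y a_n is a condition on u = exp(-(x/a_n)^2/2). Its indicator lies below
  a ramp in u, and the ramp lies below the indicator for a slightly smaller y'. Letting y and y'
  come together uses continuity of the power.\<close>

lemma sym_tail_limit: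
  "\<exists>C>0. \<forall>y>0. (\<lambda>n. real n * measure S {x. \<bar>x\<bar> > y * a n}) \<longlonglongrightarrow> C * y powr (- \<alpha>)"
proof -
  obtain C where C: "C > 0" and lim: "\<And>Q. continuous_on UNIV Q \<Longrightarrow>
     (\<lambda>n. real n * (\<integral>x. (1 - exp (- (x / a n)\<^sup>2 / 2)) * Q (exp (- (x / a n)\<^sup>2 / 2)) \<partial>S))
       \<longlonglongrightarrow> C * (\<integral>x. Q (exp (- x\<^sup>2 / 2)) * gauss_powr \<alpha> 1 x \<partial>lborel)"
    using gauss_functional_limit by blast
  define T where "T n y = real n * measure S {x. \<bar>x\<bar> > y * a n}" for n y
  have tail_int: "integrable lborel (\<lambda>x. indicator {y<..} x * x powr (- 1 - \<alpha>))"
    "(\<integral>x. indicator {y<..} x * x powr (- 1 - \<alpha>) \<partial>lborel) = y powr (- \<alpha>) / \<alpha>" if "y > 0" for y :: real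
  proof -
    show i: "integrable lborel (\<lambda>x. indicator {y<..} x * x powr (- 1 - \<alpha>))"
      by (rule integrableI_nonneg) (auto simp: nn_powr_tail[OF alpha(1) that])
    have "ennreal (\<integral>x. indicator {y<..} x * x powr (- 1 - \<alpha>) \<partial>lborel) = ennreal (y powr (- \<alpha>) / \<alpha>)"
      by (subst nn_integral_eq_integral[symmetric, OF i]) (auto simp: nn_powr_tail[OF alpha(1) that])
    then show "(\<integral>x. indicator {y<..} x * x powr (- 1 - \<alpha>) \<partial>lborel) = y powr (- \<alpha>) / \<alpha>"
      using alpha by (subst (asm) ennreal_inj) auto
  qed
  have sandwich: "\<exists>G g. (\<forall>n. T n y \<le> G n \<and> G n \<le> T n y') \<and> G \<longlonglongrightarrow> g \<and> C / \<alpha> * y powr (- \<alpha>) \<le> g \<and> g \<le> C / \<alpha> * y' powr (- \<alpha>)"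
    if y: "0 < y'" "y' < y" for y y'
  proof -
    define u1 u2 where "u1 = exp (- y\<^sup>2 / 2)" and "u2 = exp (- y'\<^sup>2 / 2)"
    have "y'\<^sup>2 < y\<^sup>2" using y by (simp add: power_strict_mono)
    then have u12: "u1 < u2" "u2 < 1" using y by (auto simp: u1_def u2_def)
    define ch where "ch u = max 0 (min 1 ((u2 - u) / (u2 - u1)))" for u
    \<comment> \<open>The functional carries the weight 1 - u, so the ramp has to be divided by it.
      This is harmless because the ramp vanishes for u >= u2; the maximum merely keeps the
      denominator positive there.\<close>
    define Q where "Q u = ch u / max (1 - u) (1 - u2)" for u
    have "max (1 - u) (1 - u2) \<noteq> 0" for u using u12 by (auto simp: max_def)
    then have Qc: "continuous_on UNIV Q" unfolding Q_def ch_def using u12 by (intro continuous_intros) auto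
    have chQ: "(1 - u) * Q u = ch u" if "u \<le> 1" for u
    proof (cases "u \<le> u2")
      case True then show ?thesis using u12 by (simp add: Q_def max_def)
    next
      case False
      then have "(u2 - u) / (u2 - u1) \<le> 0" using u12 by (simp add: divide_le_0_iff)
      then have "ch u = 0" by (simp add: ch_def)
      then show ?thesis by (simp add: Q_def)
    qed
    have ch1: "ch u = 1" if "u \<le> u1" for u using that u12 by (simp add: ch_def)
    have ch0: "ch u = 0" if "u \<ge> u2" for u using that u12 by (simp add: ch_def divide_le_0_iff)
    have ch01: "0 \<le> ch u" "ch u \<le> 1" for u by (auto simp: ch_def)
    have [measurable]: "ch \<in> borel_measurable borel" unfolding ch_def by measurable
    have ui: "x\<^sup>2 > z\<^sup>2 \<longleftrightarrow> \<bar>x\<bar> > z" if "z > 0" for x z :: real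
      using that by (metis abs_le_square_iff abs_of_pos not_le)
    define G where "G n = real n * (\<integral>x. (1 - exp (- (x / a n)\<^sup>2 / 2)) * Q (exp (- (x / a n)\<^sup>2 / 2)) \<partial>S)" for n
    define g where "g = C * (\<integral>x. Q (exp (- x\<^sup>2 / 2)) * gauss_powr \<alpha> 1 x \<partial>lborel)"
    have Geq: "G n = real n * (\<integral>x. ch (exp (- (x / a n)\<^sup>2 / 2)) \<partial>S)" for n
      unfolding G_def by (simp add: chQ)
    have chint: "integrable S (\<lambda>x. ch (exp (- (x / a n)\<^sup>2 / 2)))" for n
      by (rule S.integrable_const_bound[of _ 1]) (use ch01 in auto)
    have ind_int: "integrable S (indicator {x. \<bar>x\<bar> > z} :: real \<Rightarrow> real)" for z
      by (rule S.integrable_const_bound[of _ 1]) auto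
    have abs_a: "\<bar>x / a n\<bar> > z \<longleftrightarrow> \<bar>x\<bar> > z * a n" for x z n using a_pos[of n] by (simp add: pos_less_divide_eq abs_divide)
    have "T n y \<le> G n" for n
    proof -
      have "measure S {x. \<bar>x\<bar> > y * a n} = (\<integral>x. indicator {x. \<bar>x\<bar> > y * a n} x \<partial>S)" by simp
      also have "\<dots> \<le> (\<integral>x. ch (exp (- (x / a n)\<^sup>2 / 2)) \<partial>S)"
      proof (rule integral_mono[OF ind_int chint])
        fix x
        have "ch (exp (- (x / a n)\<^sup>2 / 2)) = 1" if "\<bar>x\<bar> > y * a n"
        proof (rule ch1)
          have "(x / a n)\<^sup>2 > y\<^sup>2" using that y abs_a[of y x n] by (subst ui) auto
          then show "exp (- (x / a n)\<^sup>2 / 2) \<le> u1" by (simp add: u1_def)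
        qed
        then show "indicator {x. \<bar>x\<bar> > y * a n} x \<le> ch (exp (- (x / a n)\<^sup>2 / 2))"
          using ch01 by (auto simp: indicator_def)
      qed
      finally show ?thesis unfolding T_def Geq by (intro mult_left_mono) auto
    qed
    moreover have "G n \<le> T n y'" for n
    proof -
      have "(\<integral>x. ch (exp (- (x / a n)\<^sup>2 / 2)) \<partial>S) \<le> (\<integral>x. indicator {x. \<bar>x\<bar> > y' * a n} x \<partial>S)"
      proof (rule integral_mono[OF chint ind_int])
        fix x
        have "ch (exp (- (x / a n)\<^sup>2 / 2)) = 0" if "\<not> \<bar>x\<bar> > y' * a n"
        proof (rule ch0)
          have "\<not> (x / a n)\<^sup>2 > y'\<^sup>2" using that y abs_a[of y' x n] by (subst ui) auto
          then show "exp (- (x / a n)\<^sup>2 / 2) \<ge> u2" by (simp add: u2_def)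
        qed
        then show "ch (exp (- (x / a n)\<^sup>2 / 2)) \<le> indicator {x. \<bar>x\<bar> > y' * a n} x"
          using ch01 by (auto simp: indicator_def)
      qed
      then show ?thesis unfolding T_def Geq by (intro mult_left_mono) auto
    qed
    moreover have "G \<longlonglongrightarrow> g" unfolding G_def g_def by (rule lim[OF Qc])
    moreover have geq: "Q (exp (- x\<^sup>2 / 2)) * gauss_powr \<alpha> 1 x = indicator {0<..} x * (ch (exp (- x\<^sup>2 / 2)) * x powr (- 1 - \<alpha>))" for x
    proof -
      have "Q (exp (- x\<^sup>2 / 2)) * gauss_powr \<alpha> 1 x = indicator {0<..} x * (((1 - exp (- x\<^sup>2 / 2)) * Q (exp (- x\<^sup>2 / 2))) * x powr (- 1 - \<alpha>))"
        unfolding gauss_powr_def mult_1 by (simp only: mult_ac)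
      then show ?thesis by (simp add: chQ)
    qed
    have le2: "indicator {0<..} x * (ch (exp (- x\<^sup>2 / 2)) * x powr (- 1 - \<alpha>)) \<le> indicator {y'<..} x * x powr (- 1 - \<alpha>)" for x
    proof (cases "x > y'")
      case True then show ?thesis using y ch01[of "exp (- x\<^sup>2 / 2)"] by (simp add: mult_left_le_one_le)
    next
      case False
      have "ch (exp (- x\<^sup>2 / 2)) = 0" if "x > 0"
      proof (rule ch0)
        have "x\<^sup>2 \<le> y'\<^sup>2" using that False by (intro power_mono) auto
        then show "u2 \<le> exp (- x\<^sup>2 / 2)" by (simp add: u2_def)
      qed
      then show ?thesis by (auto simp: indicator_def)
    qed
    have le1: "indicator {y<..} x * x powr (- 1 - \<alpha>) \<le> indicator {0<..} x * (ch (exp (- x\<^sup>2 / 2)) * x powr (- 1 - \<alpha>))" for x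
    proof (cases "x > y")
      case True
      have "ch (exp (- x\<^sup>2 / 2)) = 1"
      proof (rule ch1)
        have "y\<^sup>2 \<le> x\<^sup>2" using y True by (intro power_mono) auto
        then show "exp (- x\<^sup>2 / 2) \<le> u1" by (simp add: u1_def)
      qed
      then show ?thesis using y True by simp
    qed (simp add: ch01)
    have y0: "y > 0" using y by simp
    have gint: "integrable lborel (\<lambda>x. indicator {0<..} x * (ch (exp (- x\<^sup>2 / 2)) * x powr (- 1 - \<alpha>)))"
      by (rule Bochner_Integration.integrable_bound[OF tail_int(1)[OF y(1)]])
         (use le2 in \<open>auto simp: abs_mult ch01 intro!: AE_I2\<close>)
    have "C / \<alpha> * y powr (- \<alpha>) \<le> g"
    proof -
      have "y powr (- \<alpha>) / \<alpha> \<le> (\<integral>x. indicator {0<..} x * (ch (exp (- x\<^sup>2 / 2)) * x powr (- 1 - \<alpha>)) \<partial>lborel)"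
        unfolding tail_int(2)[OF y0, symmetric] by (intro integral_mono tail_int(1) y0 gint le1)
      then have "C * (y powr (- \<alpha>) / \<alpha>) \<le> g" unfolding g_def geq using C by (intro mult_left_mono) auto
      then show ?thesis by simp
    qed
    moreover have "g \<le> C / \<alpha> * y' powr (- \<alpha>)"
    proof -
      have "(\<integral>x. indicator {0<..} x * (ch (exp (- x\<^sup>2 / 2)) * x powr (- 1 - \<alpha>)) \<partial>lborel) \<le> y' powr (- \<alpha>) / \<alpha>"
        unfolding tail_int(2)[OF y(1), symmetric] by (intro integral_mono tail_int(1) y gint le2)
      then have "g \<le> C * (y' powr (- \<alpha>) / \<alpha>)" unfolding g_def geq using C by (intro mult_left_mono) auto
      then show ?thesis by simp
    qed
    ultimately show ?thesis by blast
  qed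
  have "(\<lambda>n. T n y) \<longlonglongrightarrow> C / \<alpha> * y powr (- \<alpha>)" if y: "y > 0" for y
  proof -
    have cont: "((\<lambda>z. C / \<alpha> * z powr (- \<alpha>)) \<longlongrightarrow> C / \<alpha> * y powr (- \<alpha>)) (at y)"
      using y by (intro tendsto_intros) auto
    show ?thesis
    proof (rule order_tendstoI)
      fix b assume b: "C / \<alpha> * y powr (- \<alpha>) < b"
      have "\<forall>\<^sub>F z in at_left y. C / \<alpha> * z powr (- \<alpha>) < b"
        using order_tendstoD(2)[OF cont b] by (simp add: eventually_at_split)
      moreover have "\<forall>\<^sub>F z in at_left y. z \<in> {0<..<y}" using y by (rule eventually_at_left_real)
      ultimately have "\<forall>\<^sub>F z in at_left y. C / \<alpha> * z powr (- \<alpha>) < b \<and> 0 < z \<and> z < y"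
        by eventually_elim auto
      then obtain z where z: "C / \<alpha> * z powr (- \<alpha>) < b" "0 < z" "z < y"
        using eventually_happens'[OF trivial_limit_at_left_real] by blast
      from sandwich[OF z(2,3)] obtain G g where G: "\<forall>n. T n y \<le> G n" "G \<longlonglongrightarrow> g" "g \<le> C / \<alpha> * z powr (- \<alpha>)" by blast
      have "\<forall>\<^sub>F n in sequentially. G n < b" by (rule order_tendstoD(2)[OF G(2)]) (use G z in linarith)
      then show "\<forall>\<^sub>F n in sequentially. T n y < b" by eventually_elim (meson G(1) le_less_trans)
    next
      fix b assume b: "b < C / \<alpha> * y powr (- \<alpha>)"
      have "\<forall>\<^sub>F z in at_right y. b < C / \<alpha> * z powr (- \<alpha>)"
        using order_tendstoD(1)[OF cont b] by (simp add: eventually_at_split)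
      moreover have "\<forall>\<^sub>F z in at_right y. z > y" by (simp add: eventually_at_filter)
      ultimately have "\<forall>\<^sub>F z in at_right y. b < C / \<alpha> * z powr (- \<alpha>) \<and> z > y"
        by eventually_elim auto
      then obtain z where z: "b < C / \<alpha> * z powr (- \<alpha>)" "y < z"
        using eventually_happens'[OF trivial_limit_at_right_real] by blast
      from sandwich[OF y z(2)] obtain G g where G: "\<forall>n. G n \<le> T n y" "G \<longlonglongrightarrow> g" "C / \<alpha> * z powr (- \<alpha>) \<le> g" by blast
      have "\<forall>\<^sub>F n in sequentially. b < G n" by (rule order_tendstoD(1)[OF G(2)]) (use G z in linarith)
      then show "\<forall>\<^sub>F n in sequentially. b < T n y" by eventually_elim (meson G(1) less_le_trans)
    qed
  qed
  then show ?thesis unfolding T_def using C alpha by (intro exI[of _ "C / \<alpha>"]) auto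
qed

end

section \<open>Monotone tails along a norming sequence\<close>

lemma antimono_tendsto_powr:
  fixes f :: "nat \<Rightarrow> real"
  assumes y: "y > 0"
    and up: "\<And>y' e. 0 < y' \<Longrightarrow> y' < y \<Longrightarrow> e > 0 \<Longrightarrow> \<forall>\<^sub>F n in F. f n < C * y' powr (- \<alpha>) + e"
    and lo: "\<And>y' e. y < y' \<Longrightarrow> e > 0 \<Longrightarrow> \<forall>\<^sub>F n in F. f n > C * y' powr (- \<alpha>) - e"
  shows "(f \<longlongrightarrow> C * y powr (- \<alpha>)) F"
proof (rule order_tendstoI)
  have cont: "((\<lambda>z. C * z powr (- \<alpha>)) \<longlongrightarrow> C * y powr (- \<alpha>)) (at y)"
    using y by (intro tendsto_intros) auto
  fix b assume b: "C * y powr (- \<alpha>) < b"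
  define c where "c = (C * y powr (- \<alpha>) + b) / 2"
  have c: "C * y powr (- \<alpha>) < c" "c < b" using b by (auto simp: c_def)
  have "\<forall>\<^sub>F z in at_left y. C * z powr (- \<alpha>) < c"
    using order_tendstoD(2)[OF cont c(1)] by (simp add: eventually_at_split)
  moreover have "\<forall>\<^sub>F z in at_left y. z \<in> {0<..<y}" using y by (rule eventually_at_left_real)
  ultimately have "\<forall>\<^sub>F z in at_left y. C * z powr (- \<alpha>) < c \<and> 0 < z \<and> z < y"
    by eventually_elim auto
  then obtain z where z: "C * z powr (- \<alpha>) < c" "0 < z" "z < y"
    using eventually_happens'[OF trivial_limit_at_left_real] by blast
  from up[OF z(2,3), of "b - c"] c show "\<forall>\<^sub>F n in F. f n < b"
    by (auto elim!: eventually_mono) (use z in linarith)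
next
  have cont: "((\<lambda>z. C * z powr (- \<alpha>)) \<longlongrightarrow> C * y powr (- \<alpha>)) (at y)"
    using y by (intro tendsto_intros) auto
  fix b assume b: "b < C * y powr (- \<alpha>)"
  define c where "c = (C * y powr (- \<alpha>) + b) / 2"
  have c: "c < C * y powr (- \<alpha>)" "b < c" using b by (auto simp: c_def)
  have "\<forall>\<^sub>F z in at_right y. c < C * z powr (- \<alpha>)"
    using order_tendstoD(1)[OF cont c(1)] by (simp add: eventually_at_split)
  moreover have "\<forall>\<^sub>F z in at_right y. z > y" by (simp add: eventually_at_filter)
  ultimately have "\<forall>\<^sub>F z in at_right y. c < C * z powr (- \<alpha>) \<and> z > y"
    by eventually_elim auto
  then obtain z where z: "c < C * z powr (- \<alpha>)" "y < z"
    using eventually_happens'[OF trivial_limit_at_right_real] by blast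
  from lo[OF z(2), of "c - b"] c show "\<forall>\<^sub>F n in F. b < f n"
    by (auto elim!: eventually_mono) (use z in linarith)
qed

text \<open>If \<open>a n\<close> stayed below some A infinitely often, T(A) would be 0, as T(a_n)
  tends to 0. Positivity of the limit at y = A/x then forces a_n <= x eventually, for every x > 0,
  hence T = 0 on the positive axis. This contradicts the positive limit at y = 1.\<close>

lemma norming_at_top:
  fixes T :: "real \<Rightarrow> real" and a :: "nat \<Rightarrow> real"
  assumes anti: "antimono T" and nonneg: "\<And>x. T x \<ge> 0" and a: "\<And>n. a n > 0" and "C > 0"
    and lim: "\<And>y. y > 0 \<Longrightarrow> (\<lambda>n. real n * T (y * a n)) \<longlonglongrightarrow> C * y powr (- \<alpha>)"
  shows "filterlim a at_top sequentially"
proof (rule ccontr)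
  assume "\<not> ?thesis"
  then obtain A where "\<not> (\<forall>\<^sub>F n in sequentially. a n \<ge> A)" by (auto simp: filterlim_at_top)
  then have freq: "\<exists>\<^sub>F n in sequentially. a n < A" by (simp add: not_eventually not_le)
  then have "A > 0" using a by (metis frequently_ex less_trans)
  have l1: "(\<lambda>n. real n * T (a n)) \<longlonglongrightarrow> C" using lim[of 1] by simp
  have z: "T (a n) \<le> (C + 1) / real n" if "real n * T (a n) < C + 1" "n > 0" for n
    using that by (simp add: field_simps)
  have ev: "\<forall>\<^sub>F n in sequentially. T (a n) \<le> (C + 1) / real n"
  proof -
    have "\<forall>\<^sub>F n in sequentially. real n * T (a n) < C + 1" by (rule order_tendstoD(2)[OF l1]) simp
    then show ?thesis using eventually_gt_at_top[of 0] by eventually_elim (rule z)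
  qed
  have to0: "(\<lambda>n. (C + 1) / real n) \<longlonglongrightarrow> 0" by real_asymp
  have small: "T x = 0" if fr: "\<exists>\<^sub>F n in sequentially. a n \<le> x" for x
  proof (rule ccontr)
    assume "T x \<noteq> 0"
    then have "T x > 0" using nonneg[of x] by simp
    then have "\<forall>\<^sub>F n in sequentially. (C + 1) / real n < T x" by (rule order_tendstoD(2)[OF to0])
    with ev have "\<forall>\<^sub>F n in sequentially. T (a n) < T x" by eventually_elim linarith
    then have "\<forall>\<^sub>F n in sequentially. \<not> a n \<le> x" by eventually_elim (use anti in \<open>auto simp: antimono_def not_le[symmetric]\<close>)
    then show False using fr by (simp add: frequently_def)
  qed
  have "T A = 0" using freq by (intro small) (auto elim!: frequently_elim1)
  have a_small: "\<forall>\<^sub>F n in sequentially. a n \<le> x" if "x > 0" for x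
  proof -
    have "A / x > 0" using \<open>A > 0\<close> that by simp
    then have "\<forall>\<^sub>F n in sequentially. real n * T (A / x * a n) > 0"
      using \<open>C > 0\<close> by (intro order_tendstoD(1)[OF lim]) (auto intro!: mult_pos_pos)
    then show ?thesis
    proof eventually_elim
      case (elim n)
      then have "T (A / x * a n) > 0" by (simp add: zero_less_mult_iff)
      then have "A / x * a n < A" using \<open>T A = 0\<close> anti unfolding antimono_def by (smt (verit))
      then show ?case using that \<open>A > 0\<close> by (simp add: field_simps)
    qed
  qed
  have "T x = 0" if "x > 0" for x
    by (rule small, rule eventually_frequently[OF _ a_small[OF that]]) simp
  then have "(\<lambda>n. real n * T (a n)) = (\<lambda>_. 0)" using a by auto
  then show False using l1 \<open>C > 0\<close> by (simp add: LIMSEQ_const_iff)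
qed

text \<open>No relation between \<open>a n\<close> and \<open>a (Suc n)\<close> is available.
  Instead a real x is assigned the index for which n H(x) is close to 1, and monotonicity of H traps
  x between multiples of the corresponding norming constant that are arbitrarily close to each
  other.\<close>

lemma regular_variation_from_sequence:
  fixes H :: "real \<Rightarrow> real" and a :: "nat \<Rightarrow> real"
  assumes anti: "antimono H" and nonneg: "\<And>x. H x \<ge> 0" and H0: "(H \<longlongrightarrow> 0) at_top"
    and a: "\<And>n. a n > 0" and "C > 0" and "\<alpha> > 0"
    and lim: "\<And>y. y > 0 \<Longrightarrow> (\<lambda>n. real n * H (y * a n)) \<longlonglongrightarrow> C * y powr (- \<alpha>)"
  shows "\<And>x. H x > 0" and "\<And>l. l > 0 \<Longrightarrow> ((\<lambda>x. H (l * x) / H x) \<longlongrightarrow> l powr (- \<alpha>)) at_top"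
proof -
  have a_top: "filterlim a at_top sequentially"
    by (rule norming_at_top[OF anti nonneg a \<open>C > 0\<close> lim])
  show pos: "H x > 0" for x
  proof -
    have "\<forall>\<^sub>F n in sequentially. real n * H (1 * a n) > 0"
      using \<open>C > 0\<close> by (intro order_tendstoD(1)[OF lim]) auto
    moreover have "\<forall>\<^sub>F n in sequentially. x \<le> a n" using a_top by (simp add: filterlim_at_top)
    ultimately have "\<forall>\<^sub>F n in sequentially. H (a n) > 0 \<and> x \<le> a n"
      by eventually_elim (simp add: zero_less_mult_iff)
    then obtain n where "H (a n) > 0" "x \<le> a n" by (auto simp: eventually_sequentially)
    then show ?thesis using anti unfolding antimono_def by (meson less_le_trans)
  qed
  \<comment> \<open>The index attached to x: the integer part of 1/H(x), so that N(x) H(x) tends to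
    1.\<close>
  define N where "N x = nat \<lfloor>1 / H x\<rfloor>" for x
  have N: "real (N x) * H x \<le> 1" "real (N x) * H x > 1 - H x" for x
  proof -
    have "real (N x) = of_int \<lfloor>1 / H x\<rfloor>" using pos[of x] by (simp add: N_def)
    then have "real (N x) \<le> 1 / H x" "real (N x) > 1 / H x - 1" by linarith+
    then show "real (N x) * H x \<le> 1" "real (N x) * H x > 1 - H x" using pos[of x] by (auto simp: field_simps)
  qed
  have N_top: "filterlim N at_top at_top"
    unfolding filterlim_at_top
  proof
    fix K :: nat
    have "\<forall>\<^sub>F x in at_top. H x < 1 / (real K + 1)" by (rule order_tendstoD(2)[OF H0]) simp
    then show "\<forall>\<^sub>F x in at_top. K \<le> N x"
    proof eventually_elim
      case (elim x)
      have "real K \<le> 1 / H x" using elim pos[of x] by (simp add: field_simps)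
      then show ?case unfolding N_def by linarith
    qed
  qed
  have NH1: "((\<lambda>x. real (N x) * H x) \<longlongrightarrow> 1) at_top"
  proof (rule real_tendsto_sandwich)
    show "((\<lambda>x. 1 - H x) \<longlongrightarrow> 1) at_top" using tendsto_diff[OF tendsto_const H0, of 1] by simp
    show "((\<lambda>x. 1) \<longlongrightarrow> (1::real)) at_top" by simp
  qed (use N in \<open>auto intro!: always_eventually less_imp_le\<close>)
  have limN: "((\<lambda>x. real (N x) * H (y * a (N x))) \<longlongrightarrow> C * y powr (- \<alpha>)) at_top" if "y > 0" for y
    by (rule filterlim_compose[OF lim[OF that] N_top])
  \<comment> \<open>The solution of C y^(-\<alpha>) = 1. Hence x and \<open>ys * a (N x)\<close> are
    asymptotically equivalent.\<close>
  define ys where "ys = C powr (1 / \<alpha>)"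
  have ys: "ys > 0" "C * ys powr (- \<alpha>) = 1" using \<open>C > 0\<close> \<open>\<alpha> > 0\<close> by (auto simp: ys_def powr_powr powr_minus)
  have Cu: "C * u powr (- \<alpha>) > 1" if "0 < u" "u < ys" for u
  proof -
    have "ys powr (- \<alpha>) < u powr (- \<alpha>)" using that \<open>\<alpha> > 0\<close> by (intro powr_less_mono2_neg) auto
    then show ?thesis using ys \<open>C > 0\<close> by (metis mult_strict_left_mono)
  qed
  have Cu': "C * u powr (- \<alpha>) < 1" if "u > ys" for u
  proof -
    have "u powr (- \<alpha>) < ys powr (- \<alpha>)" using that ys \<open>\<alpha> > 0\<close> by (intro powr_less_mono2_neg) auto
    then show ?thesis using ys \<open>C > 0\<close> by (metis mult_strict_left_mono)
  qed
  have below: "\<forall>\<^sub>F x in at_top. u * a (N x) \<le> x" if "0 < u" "u < ys" for u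
    using order_tendstoD(1)[OF limN[OF that(1)] Cu[OF that]]
  proof eventually_elim
    case (elim x)
    then have "real (N x) * H x < real (N x) * H (u * a (N x))" using N(1)[of x] by linarith
    then have "H x < H (u * a (N x))" by (simp add: mult_less_cancel_left)
    then show ?case using anti unfolding antimono_def by (smt (verit))
  qed
  have above: "\<forall>\<^sub>F x in at_top. x \<le> u * a (N x)" if "u > ys" for u
  proof -
    have "u > 0" using that ys by linarith
    define c where "c = (C * u powr (- \<alpha>) + 1) / 2"
    have c: "C * u powr (- \<alpha>) < c" "c < 1" using Cu'[OF that] by (auto simp: c_def)
    show ?thesis using order_tendstoD(2)[OF limN[OF \<open>u > 0\<close>] c(1)] order_tendstoD(1)[OF NH1 c(2)]
    proof eventually_elim
      case (elim x)
      then have "real (N x) * H (u * a (N x)) < real (N x) * H x" by linarith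
      then have "H (u * a (N x)) < H x" by (simp add: mult_less_cancel_left)
      then show ?case using anti unfolding antimono_def by (smt (verit))
    qed
  qed
  fix l :: real assume l: "l > 0"
  have "((\<lambda>x. real (N x) * H (l * x)) \<longlongrightarrow> C * (l * ys) powr (- \<alpha>)) at_top"
  proof (rule order_tendstoI)
    have cont: "((\<lambda>z. C * (l * z) powr (- \<alpha>)) \<longlongrightarrow> C * (l * ys) powr (- \<alpha>)) (at ys)"
      using ys l by (intro tendsto_intros) auto
    {
      fix b assume b: "C * (l * ys) powr (- \<alpha>) < b"
      have "\<forall>\<^sub>F z in at_left ys. C * (l * z) powr (- \<alpha>) < b"
        using order_tendstoD(2)[OF cont b] by (simp add: eventually_at_split)
      moreover have "\<forall>\<^sub>F z in at_left ys. z \<in> {0<..<ys}" using ys(1) by (rule eventually_at_left_real)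
      ultimately have "\<forall>\<^sub>F z in at_left ys. C * (l * z) powr (- \<alpha>) < b \<and> 0 < z \<and> z < ys"
        by eventually_elim auto
      then obtain z where z: "C * (l * z) powr (- \<alpha>) < b" "0 < z" "z < ys"
        using eventually_happens'[OF trivial_limit_at_left_real] by blast
      show "\<forall>\<^sub>F x in at_top. real (N x) * H (l * x) < b"
        using below[OF z(2,3)] order_tendstoD(2)[OF limN[OF mult_pos_pos[OF l z(2)]] z(1)]
      proof eventually_elim
        case (elim x)
        have "l * z * a (N x) \<le> l * x" using elim(1) l by (simp add: mult.assoc)
        then have "real (N x) * H (l * x) \<le> real (N x) * H (l * z * a (N x))"
          using anti by (intro mult_left_mono) (auto simp: antimono_def)
        then show ?case using elim(2) by linarith
      qed
    }
    {
      fix b assume b: "b < C * (l * ys) powr (- \<alpha>)"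
      have "\<forall>\<^sub>F z in at_right ys. b < C * (l * z) powr (- \<alpha>)"
        using order_tendstoD(1)[OF cont b] by (simp add: eventually_at_split)
      moreover have "\<forall>\<^sub>F z in at_right ys. z > ys" by (simp add: eventually_at_filter)
      ultimately have "\<forall>\<^sub>F z in at_right ys. b < C * (l * z) powr (- \<alpha>) \<and> z > ys"
        by eventually_elim auto
      then obtain z where z: "b < C * (l * z) powr (- \<alpha>)" "ys < z"
        using eventually_happens'[OF trivial_limit_at_right_real] by blast
      then have "z > 0" using ys by linarith
      show "\<forall>\<^sub>F x in at_top. b < real (N x) * H (l * x)"
        using above[OF z(2)] order_tendstoD(1)[OF limN[OF mult_pos_pos[OF l \<open>z > 0\<close>]] z(1)]
      proof eventually_elim
        case (elim x)
        have "l * x \<le> l * z * a (N x)" using elim(1) l by (simp add: mult.assoc)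
        then have "real (N x) * H (l * z * a (N x)) \<le> real (N x) * H (l * x)"
          using anti by (intro mult_left_mono) (auto simp: antimono_def)
        then show ?case using elim(2) by linarith
      qed
    }
  qed
  moreover have "C * (l * ys) powr (- \<alpha>) = l powr (- \<alpha>)"
    using ys l by (simp add: powr_mult mult.left_commute)
  ultimately have "((\<lambda>x. (real (N x) * H (l * x)) / (real (N x) * H x)) \<longlongrightarrow> l powr (- \<alpha>) / 1) at_top"
    using NH1 by (intro tendsto_divide) auto
  moreover have "\<forall>\<^sub>F x in at_top. (real (N x) * H (l * x)) / (real (N x) * H x) = H (l * x) / H x"
    using N_top unfolding filterlim_at_top by (auto elim!: allE[of _ 1] eventually_mono)
  ultimately show "((\<lambda>x. H (l * x) / H x) \<longlongrightarrow> l powr (- \<alpha>)) at_top"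
    by (simp add: Lim_transform_eventually)
qed

section \<open>Tails of the original law and their regular variation\<close>

context attraction
begin

definition H :: "real \<Rightarrow> real" where "H x = measure \<mu> {y. \<bar>y\<bar> > x}"

lemma H_nonneg: "0 \<le> H x" and H_le_1: "H x \<le> 1"
proof -
  interpret mu: real_distribution \<mu> by (rule mu)
  show "0 \<le> H x" "H x \<le> 1" by (auto simp: H_def)
qed

lemma H_antimono: "antimono H"
proof -
  interpret mu: real_distribution \<mu> by (rule mu)
  show ?thesis unfolding H_def by (intro antimonoI mu.finite_measure_mono) auto
qed

lemma H_tendsto_0: "(H \<longlongrightarrow> 0) at_top"
proof -
  interpret mu: real_distribution \<mu> by (rule mu)
  have "(\<lambda>n. measure \<mu> {y. \<bar>y\<bar> > real n}) \<longlonglongrightarrow> measure \<mu> (\<Inter>n. {y. \<bar>y\<bar> > real n})"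
    by (rule mu.finite_Lim_measure_decseq) (auto simp: decseq_def intro: order.strict_trans1)
  also have "(\<Inter>n. {y::real. \<bar>y\<bar> > real n}) = {}"
  proof -
    have "\<exists>n. \<not> \<bar>y\<bar> > real n" for y :: real using reals_Archimedean2[of "\<bar>y\<bar>"] by (auto simp: not_less intro: less_imp_le)
    then show ?thesis by auto
  qed
  finally have "(\<lambda>n. H (real n)) \<longlonglongrightarrow> 0" by (simp add: H_def)
  show ?thesis
  proof (rule tendstoI)
    fix e :: real assume "e > 0"
    with \<open>(\<lambda>n. H (real n)) \<longlonglongrightarrow> 0\<close> have "\<forall>\<^sub>F n in sequentially. H (real n) < e" by (rule order_tendstoD)
    then obtain n where n: "H (real n) < e" by (auto simp: eventually_sequentially)
    have "H x < e" if "x \<ge> real n" for x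
      using n antimonoD[OF H_antimono that] by linarith
    then show "\<forall>\<^sub>F x in at_top. dist (H x) 0 < e"
      using H_nonneg by (auto simp: dist_real_def eventually_at_top_linorder)
  qed
qed

lemma measure_sym_law: "A \<in> sets borel \<Longrightarrow> measure S A = measure (\<mu> \<Otimes>\<^sub>M \<mu>) {z \<in> space (\<mu> \<Otimes>\<^sub>M \<mu>). fst z - snd z \<in> A}"
  unfolding sym_law_def using pair_real_distribution(3)[OF mu]
  by (subst measure_distr) (auto simp: case_prod_unfold intro!: arg_cong2[where f=measure])

lemma pair_measure_times:
  assumes "A \<in> sets borel" "B \<in> sets borel"
  shows "measure (\<mu> \<Otimes>\<^sub>M \<mu>) (A \<times> B) = measure \<mu> A * measure \<mu> B"
proof -
  interpret mu: real_distribution \<mu> by (rule mu)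
  show ?thesis using assms by (simp add: measure_def mu.emeasure_pair_measure_Times enn2real_mult)
qed

text \<open>If one copy exceeds z + M in modulus and the other is at most M, then the difference
  exceeds z. The two such events with exchanged roles are disjoint, whence the factor 2.\<close>

lemma sym_tail_lower:
  assumes "z \<ge> 0" "M \<ge> 0"
  shows "2 * (H (z + M) * (1 - H M)) \<le> measure S {x. \<bar>x\<bar> > z}"
proof -
  interpret mu: real_distribution \<mu> by (rule mu)
  interpret P: pair_prob_space \<mu> \<mu> ..
  have [measurable_cong]: "sets \<mu> = sets borel" by simp
  define A where "A = {x::real. \<bar>x\<bar> > z + M}"
  define B where "B = {x::real. \<bar>x\<bar> \<le> M}"
  have [measurable]: "A \<in> sets borel" "B \<in> sets borel" unfolding A_def B_def by measurable
  have "measure \<mu> B = 1 - H M"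
  proof -
    have "B = space \<mu> - {y. \<bar>y\<bar> > M}" by (auto simp: B_def)
    then show ?thesis unfolding H_def by (simp add: mu.prob_compl[symmetric])
  qed
  have "measure \<mu> A = H (z + M)" by (simp add: A_def H_def)
  have W: "{w \<in> space (\<mu> \<Otimes>\<^sub>M \<mu>). fst w - snd w \<in> {x. \<bar>x\<bar> > z}} \<in> sets (\<mu> \<Otimes>\<^sub>M \<mu>)"
    unfolding mem_Collect_eq by measurable
  from \<open>measure \<mu> A = _\<close> \<open>measure \<mu> B = _\<close> have "2 * (H (z + M) * (1 - H M)) = measure (\<mu> \<Otimes>\<^sub>M \<mu>) (A \<times> B) + measure (\<mu> \<Otimes>\<^sub>M \<mu>) (B \<times> A)"
    by (simp add: pair_measure_times)
  also have "\<dots> = measure (\<mu> \<Otimes>\<^sub>M \<mu>) ((A \<times> B) \<union> (B \<times> A))"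
    using assms by (intro P.finite_measure_Union[symmetric]) (auto simp: A_def B_def)
  also have "\<dots> \<le> measure (\<mu> \<Otimes>\<^sub>M \<mu>) {w \<in> space (\<mu> \<Otimes>\<^sub>M \<mu>). fst w - snd w \<in> {x. \<bar>x\<bar> > z}}"
    by (intro P.finite_measure_mono W) (auto simp: A_def B_def space_pair_measure)
  also have "\<dots> = measure S {x. \<bar>x\<bar> > z}" by (rule measure_sym_law[symmetric]) simp
  finally show ?thesis .
qed

text \<open>A difference larger than z requires one copy beyond u or both beyond z - u: if both are
  at most u and one is at most z - u, the difference is at most z. The second possibility has a
  squared probability and disappears after multiplication by n.\<close>

lemma sym_tail_upper:
  assumes "0 \<le> u" "u \<le> z" 
  shows "measure S {x. \<bar>x\<bar> > z} \<le> 2 * H u + H (z - u) ^ 2"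
proof -
  interpret mu: real_distribution \<mu> by (rule mu)
  interpret P: pair_prob_space \<mu> \<mu> ..
  have [measurable_cong]: "sets \<mu> = sets borel" by simp
  define A where "A = {x::real. \<bar>x\<bar> > u}"
  define B where "B = {x::real. \<bar>x\<bar> > z - u}"
  have [measurable]: "A \<in> sets borel" "B \<in> sets borel" unfolding A_def B_def by measurable
  have "measure S {x. \<bar>x\<bar> > z} = measure (\<mu> \<Otimes>\<^sub>M \<mu>) {w \<in> space (\<mu> \<Otimes>\<^sub>M \<mu>). fst w - snd w \<in> {x. \<bar>x\<bar> > z}}"
    by (rule measure_sym_law) simp
  also have "\<dots> \<le> measure (\<mu> \<Otimes>\<^sub>M \<mu>) ((A \<times> UNIV) \<union> (UNIV \<times> A) \<union> (B \<times> B))"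
    by (intro P.finite_measure_mono) (auto simp: A_def B_def)
  also have "\<dots> \<le> measure (\<mu> \<Otimes>\<^sub>M \<mu>) ((A \<times> UNIV) \<union> (UNIV \<times> A)) + measure (\<mu> \<Otimes>\<^sub>M \<mu>) (B \<times> B)"
    by (intro measure_Un_le) auto
  also have "\<dots> \<le> measure (\<mu> \<Otimes>\<^sub>M \<mu>) (A \<times> UNIV) + measure (\<mu> \<Otimes>\<^sub>M \<mu>) (UNIV \<times> A) + measure (\<mu> \<Otimes>\<^sub>M \<mu>) (B \<times> B)"
    by (intro add_right_mono measure_Un_le) auto
  also have "\<dots> = 2 * H u + H (z - u) ^ 2"
    using mu.prob_space by (simp add: pair_measure_times A_def B_def H_def power2_eq_square)
  finally show ?thesis .
qed

text \<open>The symmetrised tail is asymptotically twice the original one, so the constant is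
  halved. Both comparisons of the tails move y slightly to a neighbouring y', which continuity of
  the power absorbs.\<close>

lemma H_limit:
  "\<exists>C>0. \<forall>y>0. (\<lambda>n. real n * H (y * a n)) \<longlonglongrightarrow> C * y powr (- \<alpha>)"
proof -
  define T where "T z = measure S {x. \<bar>x\<bar> > z}" for z
  obtain C where C: "C > 0" and lim: "\<And>y. y > 0 \<Longrightarrow> (\<lambda>n. real n * T (y * a n)) \<longlonglongrightarrow> C * y powr (- \<alpha>)"
    unfolding T_def using sym_tail_limit by blast
  have T_anti: "antimono T" unfolding T_def by (intro antimonoI S.finite_measure_mono) auto
  have T_nonneg: "T z \<ge> 0" for z by (simp add: T_def)
  have a_top: "filterlim a at_top sequentially" by (rule norming_at_top[OF T_anti T_nonneg a_pos C lim])
  have up: "\<forall>\<^sub>F n in sequentially. real n * H (y * a n) < C / 2 * y' powr (- \<alpha>) + e"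
    if y: "0 < y'" "y' < y" and "e > 0" for y y' e
  proof -
    define K where "K = C / 2 * y' powr (- \<alpha>)"
    have K: "K > 0" using C y by (simp add: K_def)
    \<comment> \<open>Chosen so that d (K + e) = e/2, hence K < (1 - d)(K + e): the factor 1 - H(M)
      in the lower bound may be dropped at the price of the slack \<open>e\<close>.\<close>
    define d where "d = e / (2 * (K + e))"
    have d: "0 < d" "d < 1" using \<open>e > 0\<close> K by (auto simp: d_def field_simps)
    have "2 * K + 2 * e \<noteq> 0" using \<open>e > 0\<close> K by simp
    then have "d * (K + e) = e / 2" by (simp add: d_def divide_eq_eq algebra_simps)
    then have Kd: "K < (1 - d) * (K + e)" using \<open>e > 0\<close> by (simp add: left_diff_distrib)
    have "\<forall>\<^sub>F x in at_top. H x < d \<and> x \<ge> 0"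
      using order_tendstoD(2)[OF H_tendsto_0 d(1)] eventually_ge_at_top[of 0] by eventually_elim auto
    then obtain M where M: "H M < d" "M \<ge> 0"
      using eventually_happens'[OF trivial_limit_at_top_linorder] by blast
    have "\<forall>\<^sub>F n in sequentially. M / (y - y') \<le> a n" using a_top by (simp add: filterlim_at_top)
    moreover have "\<forall>\<^sub>F n in sequentially. real n * T (y' * a n) < 2 * ((1 - d) * (K + e))"
      using Kd by (intro order_tendstoD(2)[OF lim[OF y(1)]]) (auto simp: K_def)
    ultimately show ?thesis
    proof eventually_elim
      case (elim n)
      have "M \<le> (y - y') * a n" using elim(1) y by (simp add: field_simps)
      then have "H (y * a n) \<le> H (y' * a n + M)" by (intro antimonoD[OF H_antimono]) (simp add: algebra_simps)
      have "2 * (H (y * a n) * (1 - d)) \<le> 2 * (H (y' * a n + M) * (1 - H M))"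
        using M d \<open>H (y * a n) \<le> H (y' * a n + M)\<close> H_nonneg by (intro mult_left_mono mult_mono) auto
      also have "\<dots> \<le> T (y' * a n)" unfolding T_def using y a_pos[of n] M by (intro sym_tail_lower) auto
      finally have "real n * (2 * (H (y * a n) * (1 - d))) \<le> real n * T (y' * a n)" by (rule mult_left_mono) simp
      also have "\<dots> < 2 * ((1 - d) * (K + e))" by (rule elim)
      finally have "(2 * (1 - d)) * (real n * H (y * a n)) < (2 * (1 - d)) * (K + e)"
        by (simp only: mult.assoc mult.left_commute mult.commute[of "H _"])
      then show ?case using d by (simp add: K_def)
    qed
  qed
  have bounded: "\<forall>\<^sub>F n in sequentially. real n * H (y * a n) < C / 2 * (y / 2) powr (- \<alpha>) + 1" if "y > 0" for y
    using up[of "y/2" y 1] that by simp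
  \<comment> \<open>n H^2 = (n H)^2 / n, and n H is bounded by the upper estimate just
    proved.\<close>
  have sq: "(\<lambda>n. real n * H (y * a n) ^ 2) \<longlonglongrightarrow> 0" if "y > 0" for y
  proof (rule real_tendsto_sandwich)
    define B where "B = C / 2 * (y / 2) powr (- \<alpha>) + 1"
    show "\<forall>\<^sub>F n in sequentially. 0 \<le> real n * H (y * a n) ^ 2" by simp
    show "\<forall>\<^sub>F n in sequentially. real n * H (y * a n) ^ 2 \<le> B\<^sup>2 / real n"
      using bounded[OF that] eventually_gt_at_top[of 0]
    proof eventually_elim
      case (elim n)
      have "(real n * H (y * a n))\<^sup>2 \<le> B\<^sup>2" using elim H_nonneg by (intro power_mono) (auto simp: B_def)
      then show ?case using elim(2) by (simp add: field_simps power2_eq_square)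
    qed
    show "(\<lambda>n. B\<^sup>2 / real n) \<longlonglongrightarrow> 0" by real_asymp
  qed simp
  have lo: "\<forall>\<^sub>F n in sequentially. real n * H (y * a n) > C / 2 * y' powr (- \<alpha>) - e"
    if y: "0 < y" "y < y'" and "e > 0" for y y' e
  proof -
    have "y' > 0" using y by linarith
    have "(\<lambda>n. (real n * T (y' * a n) - real n * H ((y' - y) * a n) ^ 2) / 2) \<longlonglongrightarrow> (C * y' powr (- \<alpha>) - 0) / 2"
      using y by (intro tendsto_intros lim sq) auto
    then have "\<forall>\<^sub>F n in sequentially. (real n * T (y' * a n) - real n * H ((y' - y) * a n) ^ 2) / 2 > C / 2 * y' powr (- \<alpha>) - e"
      using \<open>e > 0\<close> by (intro order_tendstoD(1)) auto
    then show ?thesis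
    proof eventually_elim
      case (elim n)
      have "T (y' * a n) \<le> 2 * H (y * a n) + H (y' * a n - y * a n) ^ 2"
        unfolding T_def using y a_pos[of n] by (intro sym_tail_upper) auto
      then have "real n * T (y' * a n) \<le> real n * (2 * H (y * a n) + H ((y' - y) * a n) ^ 2)"
        by (intro mult_left_mono) (auto simp: left_diff_distrib)
      then show ?case using elim by (simp add: algebra_simps)
    qed
  qed
  have "(\<lambda>n. real n * H (y * a n)) \<longlonglongrightarrow> C / 2 * y powr (- \<alpha>)" if "y > 0" for y
    using that up lo by (intro antimono_tendsto_powr) auto
  then show ?thesis using C by (intro exI[of _ "C/2"]) auto
qed

lemma H_pos: "H x > 0"
  and H_regular: "l > 0 \<Longrightarrow> ((\<lambda>x. H (l * x) / H x) \<longlongrightarrow> l powr (- \<alpha>)) at_top"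
proof -
  obtain C where C: "C > 0" "\<And>y. y > 0 \<Longrightarrow> (\<lambda>n. real n * H (y * a n)) \<longlonglongrightarrow> C * y powr (- \<alpha>)"
    using H_limit by blast
  note * = regular_variation_from_sequence[OF H_antimono H_nonneg H_tendsto_0 a_pos C(1) alpha(1) C(2)]
  show "H x > 0" by (rule *(1))
  show "l > 0 \<Longrightarrow> ((\<lambda>x. H (l * x) / H x) \<longlongrightarrow> l powr (- \<alpha>)) at_top" by (rule *(2))
qed

end

section \<open>Quantiles and the normalisation \<open>bn\<close>\<close>

lemma interval_measure_cdf:
  assumes "real_distribution \<mu>"
  shows "interval_measure (cdf \<mu>) = \<mu>"
proof (rule cdf_unique)
  interpret real_distribution \<mu> by fact
  show "real_distribution (interval_measure (cdf \<mu>))"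
    by (rule real_distribution_interval_measure)
       (auto intro: cdf_nondecreasing cdf_is_right_cont cdf_lim_at_top_prob cdf_lim_at_bot)
  show "cdf (interval_measure (cdf \<mu>)) = cdf \<mu>"
    by (rule cdf_interval_measure)
       (auto intro: cdf_nondecreasing cdf_is_right_cont cdf_lim_at_top_prob cdf_lim_at_bot)
qed fact

text \<open>Right continuity makes the infimum attained, so that atoms are covered: F is at least u
  at the quantile and below u strictly to its left.\<close>

lemma quantile_props:
  assumes D: "real_distribution \<mu>" and u: "0 < u" "u < 1"
  shows "u \<le> cdf \<mu> (quantile (cdf \<mu>) u)" and "u \<le> cdf \<mu> x \<Longrightarrow> quantile (cdf \<mu>) u \<le> x"
    and "x < quantile (cdf \<mu>) u \<Longrightarrow> cdf \<mu> x < u" and "cdf \<mu> x < u \<Longrightarrow> x \<le> quantile (cdf \<mu>) u"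
proof -
  interpret real_distribution \<mu> by fact
  let ?A = "{x. u \<le> cdf \<mu> x}"
  have "\<forall>\<^sub>F x in at_top. cdf \<mu> x > u" using order_tendstoD(1)[OF cdf_lim_at_top_prob u(2)] .
  then obtain x1 where "u < cdf \<mu> x1" using eventually_happens'[OF trivial_limit_at_top_linorder] by blast
  then have ne: "?A \<noteq> {}" by (auto intro: less_imp_le)
  have "\<forall>\<^sub>F x in at_bot. cdf \<mu> x < u" using order_tendstoD(2)[OF cdf_lim_at_bot u(1)] .
  then obtain x0 where x0: "cdf \<mu> x0 < u" using eventually_happens'[OF trivial_limit_at_bot_linorder] by blast
  have lb: "x0 \<le> x" if "cdf \<mu> x0 < u" "u \<le> cdf \<mu> x" for x x0
    using that cdf_nondecreasing[of x x0] by linarith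
  have bdd: "bdd_below ?A" using lb[OF x0] by (auto simp: bdd_below_def)
  show le: "u \<le> cdf \<mu> x \<Longrightarrow> quantile (cdf \<mu>) u \<le> x" for x
    unfolding quantile_def by (intro cInf_lower bdd) simp
  then show "x < quantile (cdf \<mu>) u \<Longrightarrow> cdf \<mu> x < u" using not_le by blast
  show "cdf \<mu> x < u \<Longrightarrow> x \<le> quantile (cdf \<mu>) u"
    unfolding quantile_def by (rule cInf_greatest[OF ne]) (use lb in auto)
  let ?q = "quantile (cdf \<mu>) u"
  have "(cdf \<mu> \<longlongrightarrow> cdf \<mu> ?q) (at_right ?q)" using cdf_is_right_cont[of ?q] by (simp add: continuous_within)
  moreover have "\<forall>\<^sub>F x in at_right ?q. u \<le> cdf \<mu> x"
  proof -
    have "u \<le> cdf \<mu> x" if x: "x > ?q" for x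
    proof -
      obtain y where "u \<le> cdf \<mu> y" "y < x" using cInf_lessD[OF ne x[unfolded quantile_def]] by auto
      then show ?thesis using cdf_nondecreasing[of y x] by linarith
    qed
    then show ?thesis by (auto simp: eventually_at_filter)
  qed
  ultimately show "u \<le> cdf \<mu> ?q" by (rule tendsto_lowerbound) simp
qed

context attraction
begin

abbreviation F where "F \<equiv> cdf \<mu>"
definition bn :: "nat \<Rightarrow> real" where "bn n = quantile (abs_df F) (1 - 1 / real n)"

lemma interval_measure_F: "interval_measure F = \<mu>"
  by (rule interval_measure_cdf[OF mu])

lemma real_distribution_abs: "real_distribution (distr \<mu> borel (\<lambda>x. \<bar>x\<bar>))"
proof -
  interpret mu: real_distribution \<mu> by (rule mu)
  show ?thesis by (rule mu.real_distribution_distr) simp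
qed

lemma abs_df_F: "abs_df F x = 1 - H x"
proof -
  interpret mu: real_distribution \<mu> by (rule mu)
  have "abs_df F x = measure (distr \<mu> borel (\<lambda>x. \<bar>x\<bar>)) {..x}"
    unfolding abs_df_def interval_measure_F by (simp add: cdf_def)
  also have "\<dots> = measure \<mu> {y. \<bar>y\<bar> \<le> x}" by (subst measure_distr) (auto simp: vimage_def)
  also have "{y. \<bar>y\<bar> \<le> x} = space \<mu> - {y. \<bar>y\<bar> > x}" by auto
  also have "measure \<mu> (space \<mu> - {y. \<bar>y\<bar> > x}) = 1 - H x" unfolding H_def by (rule mu.prob_compl) simp
  finally show ?thesis .
qed

lemma bn_props:
  assumes "n \<ge> 2"
  shows "H (bn n) \<le> 1 / real n" and "x < bn n \<Longrightarrow> H x > 1 / real n" and "H x > 1 / real n \<Longrightarrow> x \<le> bn n"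
proof -
  have u: "0 < 1 - 1 / real n" "1 - 1 / real n < 1" using assms by auto
  have e: "abs_df F = cdf (distr \<mu> borel (\<lambda>x. \<bar>x\<bar>))" by (simp add: abs_df_def interval_measure_F)
  note * = quantile_props[OF real_distribution_abs u, folded e, folded bn_def, unfolded abs_df_F]
  show "H (bn n) \<le> 1 / real n" using *(1) by simp
  show "x < bn n \<Longrightarrow> H x > 1 / real n" using *(3)[of x] by simp
  show "H x > 1 / real n \<Longrightarrow> x \<le> bn n" using *(4)[of x] by simp
qed

lemma bn_at_top: "filterlim bn at_top sequentially"
  unfolding filterlim_at_top
proof
  fix K
  have "(\<lambda>n. 1 / real n) \<longlonglongrightarrow> 0" by real_asymp
  then have "\<forall>\<^sub>F n in sequentially. 1 / real n < H K" by (rule order_tendstoD(2)) (rule H_pos)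
  then show "\<forall>\<^sub>F n in sequentially. K \<le> bn n"
    using eventually_ge_at_top[of 2] by eventually_elim (rule bn_props(3))
qed

text \<open>n H(b_n) <= 1 holds by definition of the quantile. From below, H(l b_n) > 1/n for every
  l < 1, and by regular variation H(l b_n) exceeds H(b_n) only by a factor tending to 1 as l does. A
  jump of H at b_n therefore has no effect in the limit.\<close>

lemma bn_tail1: "(\<lambda>n. real n * H (bn n)) \<longlonglongrightarrow> 1"
proof (rule order_tendstoI)
  fix c :: real assume "1 < c"
  show "\<forall>\<^sub>F n in sequentially. real n * H (bn n) < c"
    using eventually_ge_at_top[of 2]
  proof eventually_elim
    case (elim n)
    then have "real n * H (bn n) \<le> 1" using bn_props(1)[OF elim] by (simp add: field_simps)
    then show ?case using \<open>1 < c\<close> by linarith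
  qed
next
  fix c :: real assume "c < 1"
  have "((\<lambda>l. l powr (- \<alpha>)) \<longlongrightarrow> 1 powr (- \<alpha>)) (at_left (1::real))" by (intro tendsto_intros) auto
  then have lim1: "((\<lambda>l. 1 / l powr (- \<alpha>)) \<longlongrightarrow> 1 / 1 powr (- \<alpha>)) (at_left (1::real))" by (intro tendsto_intros) auto
  have "\<forall>\<^sub>F l in at_left (1::real). 1 / l powr (- \<alpha>) > c"
    by (rule order_tendstoD(1)[OF lim1]) (use \<open>c < 1\<close> in simp)
  moreover have "\<forall>\<^sub>F l in at_left (1::real). l \<in> {0<..<1}" by (rule eventually_at_left_real) simp
  ultimately have "\<forall>\<^sub>F l in at_left (1::real). 1 / l powr (- \<alpha>) > c \<and> 0 < l \<and> l < 1" by eventually_elim auto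
  then obtain l :: real where l: "1 / l powr (- \<alpha>) > c" "0 < l" "l < 1"
    using eventually_happens'[OF trivial_limit_at_left_real] by blast
  have "(\<lambda>n. H (l * bn n) / H (bn n)) \<longlonglongrightarrow> l powr (- \<alpha>)"
    by (rule filterlim_compose[OF H_regular[OF l(2)] bn_at_top])
  then have "(\<lambda>n. 1 / (H (l * bn n) / H (bn n))) \<longlonglongrightarrow> 1 / l powr (- \<alpha>)" using l by (intro tendsto_intros) auto
  then have "\<forall>\<^sub>F n in sequentially. 1 / (H (l * bn n) / H (bn n)) > c" using l by (intro order_tendstoD(1)) auto
  moreover have "\<forall>\<^sub>F n in sequentially. bn n \<ge> 1" using bn_at_top by (simp add: filterlim_at_top)
  ultimately show "\<forall>\<^sub>F n in sequentially. c < real n * H (bn n)"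
    using eventually_ge_at_top[of 2]
  proof eventually_elim
    case (elim n)
    have "l * bn n < bn n" using elim l by simp
    then have "1 / real n < H (l * bn n)" by (rule bn_props(2)[OF elim(3)])
    then have "H (bn n) / H (l * bn n) \<le> real n * H (bn n)"
      using H_pos[of "l * bn n"] H_pos[of "bn n"] elim(3) by (simp add: field_simps)
    then show ?case using elim(1) by simp
  qed
qed

lemma bn_tail: assumes "x > 0" shows "(\<lambda>n. real n * H (x * bn n)) \<longlonglongrightarrow> x powr (- \<alpha>)"
proof -
  have "(\<lambda>n. (real n * H (bn n)) * (H (x * bn n) / H (bn n))) \<longlonglongrightarrow> 1 * x powr (- \<alpha>)"
    by (intro tendsto_mult bn_tail1 filterlim_compose[OF H_regular[OF assms] bn_at_top])
  moreover have "(real n * H (bn n)) * (H (x * bn n) / H (bn n)) = real n * H (x * bn n)" for n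
    using H_pos[of "bn n"] by simp
  ultimately show ?thesis by simp
qed

lemma equiv_mult_ratio:
  assumes "equiv_mult f c H"
  shows "((\<lambda>x. f x / H x) \<longlongrightarrow> c) at_top"
proof (cases "c = 0")
  case True
  then have "f \<in> o[at_top](H)" using assms by (simp add: equiv_mult_def)
  then show ?thesis using True by (simp add: smalloD_tendsto)
next
  case False
  then have "f \<sim>[at_top] (\<lambda>x. c * H x)" using assms by (simp add: equiv_mult_def)
  then have "((\<lambda>x. f x / (c * H x)) \<longlongrightarrow> 1) at_top"
    using False H_pos less_irrefl by (intro asymp_equivD_strong) (auto intro!: always_eventually simp: less_imp_neq[OF H_pos, symmetric])
  then have "((\<lambda>x. c * (f x / (c * H x))) \<longlongrightarrow> c * 1) at_top" by (intro tendsto_intros)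
  then show ?thesis using False by simp
qed

lemma tail_limits:
  assumes "tail_balance F p q" "x > 0"
  shows "(\<lambda>n. real n * measure \<mu> {y. y > x * bn n}) \<longlonglongrightarrow> p * x powr (- \<alpha>)"
    and "(\<lambda>n. real n * measure \<mu> {y. y < - (x * bn n)}) \<longlonglongrightarrow> q * x powr (- \<alpha>)"
proof -
  interpret mu: real_distribution \<mu> by (rule mu)
  have "tail (abs_df F) = H" by (auto simp: tail_def abs_df_F)
  then have e: "equiv_mult (tail F) p H" "equiv_mult (tail (neg_df F)) q H" using assms by (auto simp: tail_balance_def)
  have t1: "tail F z = measure \<mu> {y. y > z}" for z
  proof -
    have "{y. y > z} = space \<mu> - {..z}" by auto
    moreover have "measure \<mu> (space \<mu> - {..z}) = 1 - measure \<mu> {..z}" by (rule mu.prob_compl) simp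
    ultimately show ?thesis by (simp only: tail_def cdf_def)
  qed
  have t2: "tail (neg_df F) z = measure \<mu> {y. y < - z}" for z
  proof -
    have "neg_df F z = measure (distr \<mu> borel (\<lambda>x. - x)) {..z}"
      unfolding neg_df_def interval_measure_F by (simp add: cdf_def)
    also have "\<dots> = measure \<mu> {y. - y \<le> z}" by (subst measure_distr) (auto simp: vimage_def)
    finally have "neg_df F z = measure \<mu> {y. - y \<le> z}" .
    moreover have "{y. y < - z} = space \<mu> - {y. - y \<le> z}" by auto
    moreover have "measure \<mu> (space \<mu> - {y. - y \<le> z}) = 1 - measure \<mu> {y. - y \<le> z}" by (rule mu.prob_compl) simp
    ultimately show ?thesis by (simp only: tail_def)
  qed
  have xb: "filterlim (\<lambda>n. x * bn n) at_top sequentially"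
    by (rule filterlim_tendsto_pos_mult_at_top[OF tendsto_const assms(2) bn_at_top])
  have *: "(\<lambda>n. real n * f (x * bn n)) \<longlonglongrightarrow> c * x powr (- \<alpha>)" if "equiv_mult f c H" for f c
  proof -
    have "(\<lambda>n. (f (x * bn n) / H (x * bn n)) * (real n * H (x * bn n))) \<longlonglongrightarrow> c * x powr (- \<alpha>)"
      by (intro tendsto_mult bn_tail assms(2) filterlim_compose[OF equiv_mult_ratio[OF that] xb])
    moreover have "(f (x * bn n) / H (x * bn n)) * (real n * H (x * bn n)) = real n * f (x * bn n)" for n
      using H_pos[of "x * bn n"] by simp
    ultimately show ?thesis by simp
  qed
  show "(\<lambda>n. real n * measure \<mu> {y. y > x * bn n}) \<longlonglongrightarrow> p * x powr (- \<alpha>)"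
    using *[OF e(1)] by (simp add: t1)
  show "(\<lambda>n. real n * measure \<mu> {y. y < - (x * bn n)}) \<longlonglongrightarrow> q * x powr (- \<alpha>)"
    using *[OF e(2)] by (simp add: t2)
qed

text \<open>A Karamata-type bound by dyadic induction: halving the truncation level loses at most
  x^2 H(x/2), while U(x) = x^2 H(x) grows geometrically under doubling because 2^\<alpha> < 4. So U
  dominates the truncated second moment up to a constant, and n H(b_n) <= 1 finishes.\<close>

lemma truncated_second_moment:
  "\<exists>C. \<forall>\<^sub>F n in sequentially. real n * (\<integral>y. indicator {- bn n..bn n} y * y\<^sup>2 \<partial>\<mu>) \<le> C * (bn n)\<^sup>2"
proof -
  interpret mu: real_distribution \<mu> by (rule mu)
  define V where "V x = (\<integral>y. indicator {- x..x} y * y\<^sup>2 \<partial>\<mu>)" for x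
  define U where "U x = x\<^sup>2 * H x" for x
  have Vint: "integrable \<mu> (\<lambda>y. indicator {- x..x} y * y\<^sup>2)" for x
    by (rule mu.integrable_const_bound[of _ "x\<^sup>2"])
       (auto simp: indicator_def abs_le_square_iff[symmetric])
  have Vstep: "V x \<le> V (x/2) + x\<^sup>2 * H (x/2)" if "x \<ge> 0" for x
  proof -
    have "V x \<le> (\<integral>y. indicator {- (x/2)..x/2} y * y\<^sup>2 + x\<^sup>2 * indicator {y. \<bar>y\<bar> > x/2} y \<partial>\<mu>)"
      unfolding V_def
    proof (rule integral_mono[OF Vint])
      show "integrable \<mu> (\<lambda>y. indicator {- (x/2)..x/2} y * y\<^sup>2 + x\<^sup>2 * indicator {y. \<bar>y\<bar> > x/2} y)"
        using Vint by (intro Bochner_Integration.integrable_add integrable_mult_right) (auto intro!: mu.integrable_const_bound[of _ 1])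
      fix y
      have "y\<^sup>2 \<le> x\<^sup>2" if "- x \<le> y" "y \<le> x" using that by (intro abs_le_square_iff[THEN iffD1]) auto
      then show "indicator {- x..x} y * y\<^sup>2 \<le> indicator {- (x/2)..x/2} y * y\<^sup>2 + x\<^sup>2 * indicator {y. \<bar>y\<bar> > x/2} y"
        by (auto simp: indicator_def abs_if split: if_splits)
    qed
    also have "\<dots> = V (x/2) + x\<^sup>2 * (\<integral>y. indicator {y. \<bar>y\<bar> > x/2} y \<partial>\<mu>)"
      unfolding V_def using Vint by (subst Bochner_Integration.integral_add) (auto intro!: integrable_mult_right mu.integrable_const_bound[of _ 1])
    finally show ?thesis by (simp add: H_def)
  qed
  \<comment> \<open>The midpoint of 2^\<alpha>/4 and 1. Then H(x/2) <= 4 \<theta> H(x) for large x,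
    that is U(x/2) <= \<theta> U(x) with \<theta> < 1.\<close>
  define \<theta> where "\<theta> = (2 powr \<alpha> + 4) / 8"
  have "2 powr \<alpha> < 2 powr 2" using alpha by (intro powr_less_mono) auto
  then have p4: "2 powr \<alpha> < 4" by simp
  then have th: "0 < \<theta>" "\<theta> < 1" "2 powr \<alpha> < 4 * \<theta>" by (auto simp: \<theta>_def add_pos_pos)
  have "((\<lambda>x. H (1/2 * x) / H x) \<longlongrightarrow> (1/2) powr (- \<alpha>)) at_top" by (rule H_regular) simp
  moreover have "(1/2) powr (- \<alpha>) = 2 powr \<alpha>" by (simp add: powr_divide powr_minus)
  ultimately have "\<forall>\<^sub>F x in at_top. H (1/2 * x) / H x < 4 * \<theta>" using th(3) by (intro order_tendstoD(2)) auto
  with eventually_ge_at_top[of 1] have "\<forall>\<^sub>F x in at_top. H (x / 2) \<le> 4 * \<theta> * H x \<and> x \<ge> 1"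
  proof eventually_elim
    case (elim x) then show ?case using H_pos[of x] by (simp add: field_simps)
  qed
  then obtain x0 where "\<forall>x\<ge>x0. H (x / 2) \<le> 4 * \<theta> * H x \<and> x \<ge> 1" unfolding eventually_at_top_linorder by blast
  then have x0: "x0 \<ge> 1" "\<And>x. x \<ge> x0 \<Longrightarrow> H (x / 2) \<le> 4 * \<theta> * H x" by auto
  \<comment> \<open>The fixed point of D \<theta> + 4 \<theta> = D, which closes the induction step
    with the same constant.\<close>
  define D where "D = 4 * \<theta> / (1 - \<theta>)"
  have D: "D \<ge> 0" "D * \<theta> + 4 * \<theta> = D" using th by (auto simp: D_def field_simps)
  have U0: "U x \<ge> 0" for x using H_nonneg[of x] by (simp add: U_def)
  have Uhalf: "U (x/2) \<le> \<theta> * U x" if "x \<ge> x0" for x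
    using mult_left_mono[OF x0(2)[OF that], of "x\<^sup>2 / 4"] by (simp add: U_def power_divide mult_ac)
  have V: "V x \<le> V x0 + D * U x" if "x \<le> x0 * 2 ^ k" "x \<ge> 0" for x k
    using that
  proof (induction k arbitrary: x)
    case 0
    then have "V x \<le> V x0" unfolding V_def by (intro integral_mono Vint) (auto simp: indicator_def)
    then show ?case using D U0[of x] by (simp add: add_increasing2)
  next
    case (Suc k)
    show ?case
    proof (cases "x \<le> x0")
      case True
      then have "V x \<le> V x0" using Suc unfolding V_def by (intro integral_mono Vint) (auto simp: indicator_def)
      then show ?thesis using D U0[of x] by (simp add: add_increasing2)
    next
      case False
      have "V x \<le> V (x/2) + x\<^sup>2 * H (x/2)" using Suc by (intro Vstep) auto
      also have "V (x/2) \<le> V x0 + D * U (x/2)" using Suc by (intro Suc.IH) auto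
      also have "D * U (x/2) \<le> D * (\<theta> * U x)" using False D by (intro mult_left_mono Uhalf) auto
      also have "x\<^sup>2 * H (x/2) \<le> x\<^sup>2 * (4 * \<theta> * H x)" using False by (intro mult_left_mono x0) auto
      finally have "V x \<le> V x0 + (D * \<theta> + 4 * \<theta>) * U x" by (simp add: U_def algebra_simps)
      then show ?thesis by (simp only: D(2))
    qed
  qed
  \<comment> \<open>A positive lower bound for U. Applied at b_n it gives n <= b_n^2 / m, and so
    absorbs the additive constant \<open>V x0\<close>.\<close>
  define m where "m = (x0/2)\<^sup>2 * H x0"
  have m: "m > 0" unfolding m_def using x0(1) H_pos by (intro mult_pos_pos) auto
  have U: "m \<le> U x" if "x \<le> x0 * 2 ^ k" "x \<ge> x0/2" for x k
    using that
  proof (induction k arbitrary: x)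
    case 0
    then show ?case unfolding m_def U_def using x0(1) H_nonneg antimonoD[OF H_antimono, of x x0]
      by (intro mult_mono power_mono) auto
  next
    case (Suc k)
    show ?case
    proof (cases "x \<le> x0")
      case True
      then show ?thesis unfolding m_def U_def using Suc x0(1) H_nonneg antimonoD[OF H_antimono, of x x0]
        by (intro mult_mono power_mono) auto
    next
      case False
      have "m \<le> U (x/2)" using Suc False by (intro Suc.IH) auto
      also have "\<dots> \<le> \<theta> * U x" using False by (intro Uhalf) auto
      also have "\<dots> \<le> 1 * U x" using th U0[of x] by (intro mult_right_mono) auto
      finally show ?thesis by simp
    qed
  qed
  have V0: "V x0 \<ge> 0" unfolding V_def by (intro integral_nonneg_AE AE_I2) auto
  have "\<forall>\<^sub>F n in sequentially. x0 \<le> bn n" using bn_at_top by (simp add: filterlim_at_top)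
  with eventually_ge_at_top[of 2] have "\<forall>\<^sub>F n in sequentially. real n * V (bn n) \<le> (V x0 / m + D) * (bn n)\<^sup>2"
  proof eventually_elim
    case (elim n)
    obtain k where k: "bn n / x0 < 2 ^ k" using real_arch_pow[of 2 "bn n / x0"] by auto
    then have k': "bn n \<le> x0 * 2 ^ k" using x0(1) by (simp add: field_simps)
    have nH: "real n * H (bn n) \<le> 1" using bn_props(1)[OF elim(1)] elim(1) by (simp add: field_simps)
    have "V (bn n) \<le> V x0 + D * U (bn n)" by (rule V[OF k']) (use elim x0 in linarith)
    then have "real n * V (bn n) \<le> real n * (V x0 + D * U (bn n))" by (rule mult_left_mono) simp
    also have "\<dots> = V x0 * real n + D * (bn n)\<^sup>2 * (real n * H (bn n))" by (simp add: U_def algebra_simps)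
    also have "D * (bn n)\<^sup>2 * (real n * H (bn n)) \<le> D * (bn n)\<^sup>2 * 1" using nH D by (intro mult_left_mono) auto
    also have "V x0 * real n \<le> V x0 * ((bn n)\<^sup>2 / m)"
    proof (rule mult_left_mono[OF _ V0])
      have "m \<le> U (bn n)" by (rule U[OF k']) (use elim x0 in linarith)
      then have "real n * m \<le> (bn n)\<^sup>2 * (real n * H (bn n))" by (simp add: U_def mult_left_mono mult.left_commute)
      also have "\<dots> \<le> (bn n)\<^sup>2 * 1" using nH by (intro mult_left_mono) auto
      finally show "real n \<le> (bn n)\<^sup>2 / m" using m by (simp add: field_simps)
    qed
    finally show ?case by (simp add: algebra_simps)
  qed
  then show ?thesis unfolding V_def by blast
qed

text \<open>The symmetric truncation at \<epsilon> b_n and the quantile interval of the statement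
  differ on a set of probability O(1/n), and the integrands there are at most 2 b_n. The two
  truncated means thus differ by O(b_n / n).\<close>

lemma centering_difference:
  assumes e: "0 < \<epsilon>" "\<epsilon> \<le> 1"
  shows "\<exists>C. \<forall>\<^sub>F n in sequentially.
     \<bar>(\<integral>y. indicator {- (\<epsilon> * bn n)..\<epsilon> * bn n} y * y \<partial>\<mu>)
       - (LINT x:{quantile F (1 / real n)..quantile F (1 - 1 / real n)}|interval_measure F. x)\<bar> \<le> C * bn n / real n"
proof -
  interpret mu: real_distribution \<mu> by (rule mu)
  define K where "K = \<epsilon> powr (- \<alpha>) + 1"
  \<comment> \<open>At factor 1 the limit of n H is exactly 1. The factor 3/2 makes it strictly
    smaller than 1, which eventually forces the lower quantile above -2 b_n.\<close>
  have ev1: "\<forall>\<^sub>F n in sequentially. real n * H (3/2 * bn n) < 1"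
  proof (rule order_tendstoD(2)[OF bn_tail])
    have "(3/2) powr (- \<alpha>) < (3/2 :: real) powr 0" using alpha by (intro powr_less_mono) auto
    then show "(3/2) powr (- \<alpha>) < (1::real)" by simp
  qed simp
  have ev2: "\<forall>\<^sub>F n in sequentially. real n * H (\<epsilon> * bn n) < K"
    by (rule order_tendstoD(2)[OF bn_tail[OF e(1)]]) (simp add: K_def)
  have ev3: "\<forall>\<^sub>F n in sequentially. 1 \<le> bn n" using bn_at_top by (simp add: filterlim_at_top)
  have F_lower: "1 - H x \<le> F x" for x
  proof -
    have "1 - H x = measure \<mu> (space \<mu> - {y. \<bar>y\<bar> > x})" unfolding H_def by (rule mu.prob_compl[symmetric]) simp
    also have "\<dots> \<le> F x" unfolding cdf_def by (intro mu.finite_measure_mono) auto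
    finally show ?thesis .
  qed
  have "\<forall>\<^sub>F n in sequentially.
     \<bar>(\<integral>y. indicator {- (\<epsilon> * bn n)..\<epsilon> * bn n} y * y \<partial>\<mu>)
       - (LINT x:{quantile F (1 / real n)..quantile F (1 - 1 / real n)}|interval_measure F. x)\<bar> \<le> (2 + 2 * K) * bn n / real n"
    using ev1 ev2 ev3 eventually_ge_at_top[of 2]
  proof eventually_elim
    case (elim n)
    define Q1 Q2 b where "Q1 = quantile F (1 / real n)" and "Q2 = quantile F (1 - 1 / real n)" and "b = bn n"
    have n: "real n \<ge> 2" using elim(4) by simp
    have u: "0 < 1 / real n" "1 / real n < 1" "0 < 1 - 1 / real n" "1 - 1 / real n < 1" "1 / real n \<le> 1 - 1 / real n"
      using n by (auto simp: field_simps)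
    note q1 = quantile_props[OF mu u(1,2), folded Q1_def] and q2 = quantile_props[OF mu u(3,4), folded Q2_def]
    have b: "b \<ge> 1" "H b \<le> 1 / real n" using elim bn_props(1) by (auto simp: b_def)
    have Fb: "1 - 1 / real n \<le> F b" using F_lower[of b] b by linarith
    have "Q2 \<le> b" by (rule q2(2)[OF Fb])
    have "Q1 \<le> b" by (rule q1(2)) (use Fb u in linarith)
    have "F (- (2 * b)) \<le> H (3/2 * b)" unfolding cdf_def H_def using b by (intro mu.finite_measure_mono) auto
    also have "\<dots> < 1 / real n" using elim n by (simp add: b_def field_simps)
    finally have Flow: "F (- (2 * b)) < 1 / real n" .
    have "- (2 * b) \<le> Q1" by (rule q1(4)[OF Flow])
    have "- (2 * b) \<le> Q2" by (rule q2(4)) (use Flow u in linarith)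
    have m2: "measure \<mu> {Q2<..} \<le> 1 / real n"
    proof -
      have "{Q2<..} = space \<mu> - {..Q2}" by auto
      moreover have "measure \<mu> (space \<mu> - {..Q2}) = 1 - measure \<mu> {..Q2}" by (rule mu.prob_compl) simp
      ultimately have "measure \<mu> {Q2<..} = 1 - F Q2" by (simp only: cdf_def)
      then show ?thesis using q2(1) by linarith
    qed
    \<comment> \<open>The interval is closed, so the discarded set excludes a possible atom at Q1.
      Its mass is the left limit of F and is at most 1/n, although F(Q1) itself may be
      larger.\<close>
    have m1: "measure \<mu> {..<Q1} \<le> 1 / real n"
    proof (rule tendsto_upperbound[OF mu.cdf_at_left])
      show "\<forall>\<^sub>F x in at_left Q1. F x \<le> 1 / real n"
        using q1(3) by (auto simp: eventually_at_filter less_imp_le)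
    qed simp
    define A B where "A = {- (\<epsilon> * b)..\<epsilon> * b}" and "B = {Q1..Q2}"
    have [measurable]: "A \<in> sets borel" "B \<in> sets borel" by (auto simp: A_def B_def)
    \<comment> \<open>In A the discrepancy arises only outside the quantile interval, and there |y|
      <= b. Outside A it arises only inside the interval, where |y| <= 2b.\<close>
    have bound: "\<bar>indicator A y * y - indicator B y * y\<bar> \<le> b * indicator ({..<Q1} \<union> {Q2<..}) y + 2 * b * indicator {y. \<bar>y\<bar> > \<epsilon> * b} y" for y
    proof (cases "y \<in> A")
      case True
      then have "\<bar>y\<bar> \<le> \<epsilon> * b" by (auto simp: A_def)
      also have "\<dots> \<le> b" using e b by simp
      finally show ?thesis using True b by (cases "y \<in> B") (auto simp: B_def indicator_def)
    next
      case False
      then have "\<bar>y\<bar> > \<epsilon> * b" by (auto simp: A_def)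
      moreover have "\<bar>y\<bar> \<le> 2 * b" if "y \<in> B"
        using that \<open>Q2 \<le> b\<close> \<open>- (2 * b) \<le> Q1\<close> b by (auto simp: B_def)
      ultimately show ?thesis using False b by (cases "y \<in> B") (auto simp: indicator_def)
    qed
    have iA: "integrable \<mu> (\<lambda>y. indicator A y * y)" 
      by (rule mu.integrable_const_bound[of _ "\<epsilon> * b"]) (use e b in \<open>auto simp: A_def indicator_def\<close>)
    have iB: "integrable \<mu> (\<lambda>y. indicator B y * y)"
      by (rule mu.integrable_const_bound[of _ "\<bar>Q1\<bar> + \<bar>Q2\<bar>"]) (auto simp: B_def indicator_def)
    have ind: "integrable \<mu> (indicator C :: real \<Rightarrow> real)" if "C \<in> sets borel" for C
      using that by (intro mu.integrable_const_bound[of _ 1]) auto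
    have "(LINT x:B|interval_measure F. x) = (\<integral>y. indicator B y * y \<partial>\<mu>)"
      unfolding interval_measure_F set_lebesgue_integral_def by simp
    then have "\<bar>(\<integral>y. indicator A y * y \<partial>\<mu>) - (LINT x:B|interval_measure F. x)\<bar> = \<bar>\<integral>y. indicator A y * y - indicator B y * y \<partial>\<mu>\<bar>"
      using iA iB by simp
    also have "\<dots> \<le> (\<integral>y. \<bar>indicator A y * y - indicator B y * y\<bar> \<partial>\<mu>)" by (rule integral_abs_bound)
    also have "\<dots> \<le> (\<integral>y. b * indicator ({..<Q1} \<union> {Q2<..}) y + 2 * b * indicator {y. \<bar>y\<bar> > \<epsilon> * b} y \<partial>\<mu>)"
      using iA iB bound by (intro integral_mono) (auto intro!: integrable_mult_right ind simp del: mult_minus_left)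
    also have "\<dots> = b * measure \<mu> ({..<Q1} \<union> {Q2<..}) + 2 * b * H (\<epsilon> * b)"
      by (subst Bochner_Integration.integral_add) (auto intro!: integrable_mult_right ind simp: H_def)
    also have "\<dots> \<le> b * (2 / real n) + 2 * b * (K / real n)"
    proof (intro add_mono mult_left_mono)
      have "measure \<mu> ({..<Q1} \<union> {Q2<..}) \<le> measure \<mu> {..<Q1} + measure \<mu> {Q2<..}" by (rule measure_Un_le) auto
      then show "measure \<mu> ({..<Q1} \<union> {Q2<..}) \<le> 2 / real n" using m1 m2 by simp
      show "H (\<epsilon> * b) \<le> K / real n" using elim(2) n by (simp add: b_def field_simps)
    qed (use b in auto)
    also have "\<dots> = (2 + 2 * K) * b / real n" by (simp add: add_divide_distrib algebra_simps)
    finally show ?case unfolding A_def B_def b_def Q1_def Q2_def .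
  qed
  then show ?thesis by blast
qed

end

section \<open>Laplace functionals of renewal processes with marks\<close>

lemma (in prob_space) expectation_indep_pair:
  fixes f :: "'b \<times> 'b \<Rightarrow> real"
  assumes ind: "indep_var S X T Y" and f: "f \<in> borel_measurable (S \<Otimes>\<^sub>M T)" and bd: "\<And>z. \<bar>f z\<bar> \<le> C"
  shows "expectation (\<lambda>\<omega>. f (X \<omega>, Y \<omega>)) = (\<integral>x. (\<integral>y. f (x, y) \<partial>distr M T Y) \<partial>distr M S X)"
proof -
  have X: "random_variable S X" and Y: "random_variable T Y"
    and eq: "distr M S X \<Otimes>\<^sub>M distr M T Y = distr M (S \<Otimes>\<^sub>M T) (\<lambda>x. (X x, Y x))"
    using ind by (auto simp: indep_var_distribution_eq)
  interpret PX: prob_space "distr M S X" by (rule prob_space_distr[OF X])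
  interpret PY: prob_space "distr M T Y" by (rule prob_space_distr[OF Y])
  interpret PP: pair_prob_space "distr M S X" "distr M T Y" ..
  have "expectation (\<lambda>\<omega>. f (X \<omega>, Y \<omega>)) = (\<integral>z. f z \<partial>distr M (S \<Otimes>\<^sub>M T) (\<lambda>x. (X x, Y x)))"
    using X Y f by (intro integral_distr[symmetric]) auto
  also have "\<dots> = (\<integral>z. f z \<partial>(distr M S X \<Otimes>\<^sub>M distr M T Y))" by (simp only: eq)
  also have "\<dots> = (\<integral>x. (\<integral>y. f (x, y) \<partial>distr M T Y) \<partial>distr M S X)"
  proof (rule PP.integral_fst'[symmetric])
    show "integrable (distr M S X \<Otimes>\<^sub>M distr M T Y) f"
      using f bd by (intro PP.integrable_const_bound[of _ C]) auto
  qed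
  finally show ?thesis .
qed

abbreviation unif01 :: "real measure" where "unif01 \<equiv> uniform_measure lborel {0..1}"
abbreviation exp1 :: "real measure" where "exp1 \<equiv> density lborel (\<lambda>x. ennreal (exponential_density 1 x))"

lemma prob_space_unif01: "prob_space unif01"
  by (rule prob_space_uniform_measure) auto

lemma prob_space_exp1: "prob_space exp1"
  by (rule prob_space_exponential_density) simp

text \<open>\<open>h t u\<close> is the cost of a point with time mark t and renewal time u. It
  vanishes beyond T because late renewal times correspond to points near the axis, outside the
  support of the test function.\<close>

locale mark_function =
  fixes h :: "real \<Rightarrow> real \<Rightarrow> real" and T :: real
  assumes h_cont: "continuous_on UNIV (\<lambda>(t, u). h t u)" and h_nonneg: "\<And>t u. 0 \<le> h t u"
    and T: "0 \<le> T" and h_zero: "\<And>t u. T \<le> u \<Longrightarrow> h t u = 0"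
begin

lemma h_measurable [measurable (raw)]:
  assumes [measurable]: "f \<in> borel_measurable M" "g \<in> borel_measurable M"
  shows "(\<lambda>x. h (f x) (g x)) \<in> borel_measurable M"
proof -
  have "(\<lambda>x. (f x, g x)) \<in> M \<rightarrow>\<^sub>M borel \<Otimes>\<^sub>M borel" by measurable
  then have "(\<lambda>x. (f x, g x)) \<in> M \<rightarrow>\<^sub>M borel" by (simp add: borel_prod)
  from measurable_compose[OF this borel_measurable_continuous_onI[OF h_cont]]
  show ?thesis by simp
qed

lemma h_cont1: "continuous_on UNIV (\<lambda>u. h t u)"
proof -
  have "continuous_on UNIV (\<lambda>u::real. (t, u))" by (intro continuous_intros)
  from continuous_on_compose2[OF h_cont this] show ?thesis by simp
qed

definition \<psi> :: "real \<Rightarrow> real" where "\<psi> u = (\<integral>t. 1 - exp (- h t u) \<partial>unif01)"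
text \<open>The integral starts at -1 so that 0 is an interior point and the derivative exists there
  as well.\<close>

definition \<Psi> :: "real \<Rightarrow> real" where "\<Psi> s = integral {-1..s} \<psi>"
text \<open>For s <= T this is exp of minus the integral of \<psi> over [s, T]: the Laplace
  functional one expects from the points later than s when the renewal times form a unit-rate
  Poisson process. Identifying it this way avoids constructing a Poisson random measure.\<close>

definition B :: "real \<Rightarrow> real" where "B s = exp (\<Psi> s - \<Psi> T)"

lemma e_int: "integrable unif01 (\<lambda>t. exp (- h t u))"
proof -
  interpret prob_space unif01 by (rule prob_space_unif01)
  show ?thesis by (rule integrable_const_bound[of _ 1]) (auto simp: h_nonneg)
qed

lemma psi_eq: "(\<integral>t. exp (- h t u) \<partial>unif01) = 1 - \<psi> u"
proof -
  interpret prob_space unif01 by (rule prob_space_unif01)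
  show ?thesis unfolding \<psi>_def using e_int prob_space by simp
qed

lemma psi_bounds: "0 \<le> \<psi> u" "\<psi> u \<le> 1"
proof -
  interpret prob_space unif01 by (rule prob_space_unif01)
  show "0 \<le> \<psi> u" unfolding \<psi>_def by (intro integral_nonneg_AE AE_I2) (auto simp: h_nonneg)
  have "0 \<le> (\<integral>t. exp (- h t u) \<partial>unif01)" by (intro integral_nonneg_AE AE_I2) auto
  then show "\<psi> u \<le> 1" by (simp add: psi_eq)
qed

lemma psi_zero: "T \<le> u \<Longrightarrow> \<psi> u = 0"
  by (simp add: \<psi>_def h_zero)

lemma psi_cont: "continuous_on S \<psi>"
proof -
  interpret prob_space unif01 by (rule prob_space_unif01)
  have "isCont \<psi> u" for u
  proof (rule continuous_at_sequentiallyI)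
    fix x assume x: "x \<longlonglongrightarrow> u"
    show "(\<lambda>n. \<psi> (x n)) \<longlonglongrightarrow> \<psi> u" unfolding \<psi>_def
    proof (rule integral_dominated_convergence[where w="\<lambda>_. 1"])
      show "AE t in unif01. (\<lambda>n. 1 - exp (- h t (x n))) \<longlonglongrightarrow> 1 - exp (- h t u)"
      proof (rule AE_I2)
        fix t
        have "(\<lambda>n. h t (x n)) \<longlonglongrightarrow> h t u"
          by (rule continuous_on_tendsto_compose[OF h_cont1 x]) auto
        then show "(\<lambda>n. 1 - exp (- h t (x n))) \<longlonglongrightarrow> 1 - exp (- h t u)" by (intro tendsto_intros)
      qed
    qed (auto simp: h_nonneg)
  qed
  then show ?thesis by (simp add: continuous_at_imp_continuous_on)
qed

lemma psi_measurable [measurable]: "\<psi> \<in> borel_measurable borel"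
  by (rule borel_measurable_continuous_onI[OF psi_cont])

lemma Psi_deriv: "s > -1 \<Longrightarrow> (\<Psi> has_real_derivative \<psi> s) (at s)"
proof -
  assume s: "s > -1"
  have "(\<Psi> has_real_derivative \<psi> s) (at s within {-1..s+1})"
    unfolding \<Psi>_def using s by (intro integral_has_real_derivative psi_cont) auto
  then show ?thesis using s by (subst (asm) at_within_Icc_at) auto
qed

lemma psi_integrable: "\<psi> integrable_on {a..b}"
  by (rule integrable_continuous_interval[OF psi_cont])

lemma Psi_const: "T \<le> s \<Longrightarrow> \<Psi> s = \<Psi> T"
proof -
  assume s: "T \<le> s"
  have "integral {-1..T} \<psi> + integral {T..s} \<psi> = integral {-1..s} \<psi>"
    using T s by (intro Henstock_Kurzweil_Integration.integral_combine psi_integrable) auto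
  moreover have "integral {T..s} \<psi> = integral {T..s} (\<lambda>_. 0)"
    by (intro Henstock_Kurzweil_Integration.integral_cong) (auto simp: psi_zero)
  ultimately show ?thesis by (simp add: \<Psi>_def)
qed

lemma B_one: "T \<le> s \<Longrightarrow> B s = 1"
  unfolding B_def by (drule Psi_const) simp

lemma B_zero: "B 0 = exp (- integral {0..T} \<psi>)"
proof -
  have "integral {-1..0} \<psi> + integral {0..T} \<psi> = integral {-1..T} \<psi>"
    using T by (intro Henstock_Kurzweil_Integration.integral_combine psi_integrable) auto
  then show ?thesis by (simp add: B_def \<Psi>_def)
qed

lemma Psi_measurable [measurable]: "\<Psi> \<in> borel_measurable borel"
proof (rule borel_measurable_mono)
  show "mono \<Psi>"
  proof (rule monoI)
    fix x y :: real assume "x \<le> y"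
    then show "\<Psi> x \<le> \<Psi> y" unfolding \<Psi>_def
      by (intro integral_subset_le psi_integrable) (auto simp: psi_bounds)
  qed
qed

lemma Psi_le: "\<Psi> s \<le> \<Psi> T"
proof (cases "s \<le> T")
  case True then show ?thesis unfolding \<Psi>_def
    by (intro integral_subset_le psi_integrable) (auto simp: psi_bounds)
next
  case False then show ?thesis using Psi_const[of s] by simp
qed

lemma B_measurable [measurable]: "B \<in> borel_measurable borel"
  unfolding B_def by measurable

lemma B_bounds: "0 \<le> B s" "B s \<le> 1"
  using Psi_le[of s] by (auto simp: B_def)

text \<open>\<open>B\<close> solves the renewal equation of the marked process; this is what makes
  \<open>B (W\<^sub>N)\<close> times the first \<open>N\<close> factors a martingale.\<close>

lemma B_renewal:
  assumes "s \<ge> 0"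
  shows "(\<integral>w. (1 - \<psi> (s + w)) * B (s + w) \<partial>exp1) = B s"
proof -
  define f where "f w = exp (- w) * ((1 - \<psi> (s + w)) * B (s + w))" for w
  \<comment> \<open>Because B' = \<psi> B, the function - exp(-w) B(s + w) is an antiderivative of
    \<open>f\<close>. It tends to 0 since \<open>B\<close> equals 1 beyond T.\<close>
  have "(\<integral>\<^sup>+w. ennreal (f w) * indicator {0..} w \<partial>lborel) = ennreal (0 - (- (exp (- 0) * B (s + 0))))"
  proof (rule nn_integral_FTC_atLeast)
    show "f \<in> borel_measurable borel" unfolding f_def by measurable
    fix w :: real assume w: "0 \<le> w"
    have "(\<Psi> has_real_derivative \<psi> (s + w)) (at (s + w))" using w assms by (intro Psi_deriv) auto
    then have "((\<lambda>w. \<Psi> (s + w)) has_real_derivative \<psi> (s + w)) (at w)"       using DERIV_shift[of \<Psi> "\<psi> (s + w)" w s] by (simp add: add.commute)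
    then show "DERIV (\<lambda>w. - (exp (- w) * B (s + w))) w :> f w"
      unfolding B_def f_def by (auto intro!: derivative_eq_intros simp: algebra_simps)
    show "0 \<le> f w" unfolding f_def using psi_bounds B_bounds by simp
  next
    have "((\<lambda>w::real. - exp (- w)) \<longlongrightarrow> 0) at_top" by real_asymp
    moreover have "\<forall>\<^sub>F w in at_top. - exp (- w) = - (exp (- w) * B (s + w))"
      using eventually_ge_at_top[of T] by eventually_elim (use assms in \<open>simp add: B_one\<close>)
    ultimately show "((\<lambda>w. - (exp (- w) * B (s + w))) \<longlongrightarrow> 0) at_top" by (rule Lim_transform_eventually)
  qed
  also have "(\<integral>\<^sup>+w. ennreal (f w) * indicator {0..} w \<partial>lborel) = (\<integral>\<^sup>+w. ennreal (exponential_density 1 w) * ennreal ((1 - \<psi> (s + w)) * B (s + w)) \<partial>lborel)"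
    unfolding f_def using psi_bounds B_bounds
    by (intro nn_integral_cong) (auto simp: exponential_density_def ennreal_mult split: split_indicator)
  also have "\<dots> = (\<integral>\<^sup>+w. ennreal ((1 - \<psi> (s + w)) * B (s + w)) \<partial>exp1)"
    by (subst nn_integral_density) auto
  finally have "(\<integral>\<^sup>+w. ennreal ((1 - \<psi> (s + w)) * B (s + w)) \<partial>exp1) = ennreal (B s)" by simp
  then show ?thesis using psi_bounds B_bounds
    by (subst integral_eq_nn_integral) auto
qed

end

text \<open>The marks and the waiting times are drawn from one jointly independent family through
  two injections with disjoint images. This lets the positive and the negative half of the limit
  process be two instances over the same family.\<close>

locale marked_renewal = prob_space M for M :: "'a measure" +
  fixes Y :: "'i \<Rightarrow> 'a \<Rightarrow> real" and I :: "'i set" and v w :: "nat \<Rightarrow> 'i"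
  assumes indep: "indep_vars (\<lambda>_. borel) Y I"
    and idx: "\<And>j. 1 \<le> j \<Longrightarrow> v j \<in> I" "\<And>j. 1 \<le> j \<Longrightarrow> w j \<in> I"
    and inj: "inj v" "inj w" "\<And>i j. v i \<noteq> w j"
    and unif: "\<And>j. 1 \<le> j \<Longrightarrow> distr M borel (Y (v j)) = unif01"
    and expo: "\<And>j. 1 \<le> j \<Longrightarrow> distr M borel (Y (w j)) = exp1"
begin

definition W :: "nat \<Rightarrow> 'a \<Rightarrow> real" where "W N \<omega> = (\<Sum>k=1..N. Y (w k) \<omega>)"

lemma rv [measurable]: "1 \<le> j \<Longrightarrow> random_variable borel (Y (v j))" "1 \<le> j \<Longrightarrow> random_variable borel (Y (w j))"
  using indep idx by (auto simp: indep_vars_def)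

lemma W_measurable [measurable]: "random_variable borel (W N)"
  unfolding W_def by (intro borel_measurable_sum rv) auto

lemma AE_exp_pos: "1 \<le> j \<Longrightarrow> AE \<omega> in M. 0 < Y (w j) \<omega>"
proof -
  assume j: "1 \<le> j"
  have "AE x in exp1. 0 < x"
    using AE_lborel_singleton[of 0] by (subst AE_density) (auto simp: exponential_density_def elim!: eventually_mono)
  then have "AE x in distr M borel (Y (w j)). 0 < x" by (simp only: expo[OF j])
  then show ?thesis by (subst (asm) AE_distr_iff) (auto intro: rv j)
qed

lemma AE_W_pos: "AE \<omega> in M. \<forall>N\<ge>1. 0 < W N \<omega>"
proof -
  have "AE \<omega> in M. \<forall>j\<in>{1..}. 0 < Y (w j) \<omega>" by (subst AE_ball_countable) (auto intro: AE_exp_pos)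
  then show ?thesis by eventually_elim (auto simp: W_def intro!: sum_pos)
qed

lemma expectation_exp_W: "expectation (\<lambda>\<omega>. exp (- W N \<omega>)) = (1/2) ^ N"
proof -
  have half: "expectation (\<lambda>\<omega>. exp (- Y (w j) \<omega>)) = 1/2" if j: "1 \<le> j" for j
  proof -
    have "(\<integral>\<^sup>+x. ennreal (exp (- (2 * x))) * indicator {0..} x \<partial>lborel) = ennreal (0 - (- (exp (- (2 * 0)) / 2)))"
    proof (rule nn_integral_FTC_atLeast)
      show "DERIV (\<lambda>x. - (exp (- (2 * x)) / 2)) x :> exp (- (2 * x))" for x :: real
        by (auto intro!: derivative_eq_intros)
      show "((\<lambda>x::real. - (exp (- (2 * x)) / 2)) \<longlongrightarrow> 0) at_top" by real_asymp
    qed auto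
    also have "(\<integral>\<^sup>+x. ennreal (exp (- (2 * x))) * indicator {0..} x \<partial>lborel) = (\<integral>\<^sup>+x. ennreal (exponential_density 1 x) * ennreal (exp (- x)) \<partial>lborel)"
      by (intro nn_integral_cong) (auto simp: exponential_density_def ennreal_mult[symmetric] exp_add[symmetric] split: split_indicator)
    also have "\<dots> = (\<integral>\<^sup>+x. ennreal (exp (- x)) \<partial>exp1)" by (subst nn_integral_density) auto
    finally have eq: "(\<integral>\<^sup>+x. ennreal (exp (- x)) \<partial>exp1) = ennreal (1/2)" by simp
    have "(\<integral>x. exp (- x) \<partial>exp1) = enn2real (\<integral>\<^sup>+x. ennreal (exp (- x)) \<partial>exp1)" by (rule integral_eq_nn_integral) auto
    also have "\<dots> = 1/2" unfolding eq by (rule enn2real_ennreal) simp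
    finally have "(\<integral>x. exp (- x) \<partial>exp1) = 1/2" .
    then show ?thesis using integral_distr[OF rv(2)[OF j], of "\<lambda>x. exp (- x)"] by (simp add: expo[OF j])
  qed
  have ind: "indep_vars (\<lambda>_. borel) (\<lambda>i \<omega>. exp (- Y i \<omega>)) (w ` {1..N})"
  proof -
    have "indep_vars (\<lambda>_. borel) Y (w ` {1..N})" by (rule indep_vars_subset[OF indep]) (use idx in auto)
    then show ?thesis by (rule indep_vars_compose2[where Y="\<lambda>_ x. exp (- x)"]) auto
  qed
  have inj_w: "inj_on w {1..N}" using inj(2) by (auto simp: inj_def inj_on_def)
  have pr: "(\<Prod>i\<in>w ` {1..N}. g i) = (\<Prod>j\<in>{1..N}. g (w j))" for g :: "'i \<Rightarrow> real"
    by (subst prod.reindex[OF inj_w]) simp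
  have int: "integrable M (\<lambda>\<omega>. exp (- Y (w j) \<omega>))" if "1 \<le> j" for j
    by (rule integrable_const_bound[of _ 1]) (use AE_exp_pos[OF that] rv(2)[OF that] in \<open>auto elim!: eventually_mono\<close>)
  have "expectation (\<lambda>\<omega>. exp (- W N \<omega>)) = expectation (\<lambda>\<omega>. \<Prod>i\<in>w ` {1..N}. exp (- Y i \<omega>))"
    unfolding pr by (simp add: W_def exp_sum sum_negf[symmetric])
  also have "\<dots> = (\<Prod>i\<in>w ` {1..N}. expectation (\<lambda>\<omega>. exp (- Y i \<omega>)))"
    by (rule indep_vars_lebesgue_integral[OF _ ind]) (auto intro: int)
  also have "\<dots> = (1/2) ^ N" unfolding pr by (simp add: half)
  finally show ?thesis .
qed

text \<open>In place of the law of large numbers: the sum over N of exp(-W_N) has expectation equal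
  to the sum of 2^(-N), hence is almost surely finite, and its terms tend to 0.\<close>

lemma AE_W_at_top: "AE \<omega> in M. filterlim (\<lambda>N. W N \<omega>) at_top sequentially"
proof -
  have W0: "AE \<omega> in M. 0 \<le> W N \<omega>" for N
  proof (cases "N = 0")
    case False then show ?thesis using AE_W_pos by (auto elim!: eventually_mono simp: less_imp_le)
  qed (simp add: W_def)
  have int: "integrable M (\<lambda>\<omega>. exp (- W N \<omega>))" for N
    by (rule integrable_const_bound[of _ 1]) (use W0[of N] in \<open>auto elim!: eventually_mono\<close>)
  have "(\<integral>\<^sup>+\<omega>. (\<Sum>N. ennreal (exp (- W N \<omega>))) \<partial>M) = (\<Sum>N. \<integral>\<^sup>+\<omega>. ennreal (exp (- W N \<omega>)) \<partial>M)"
    by (rule nn_integral_suminf) auto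
  also have "\<dots> = (\<Sum>N. ennreal ((1/2) ^ N))"
    by (subst nn_integral_eq_integral[OF int]) (auto simp: expectation_exp_W)
  also have "\<dots> = ennreal (\<Sum>N. (1/2) ^ N)" by (intro suminf_ennreal2) (auto intro: summable_geometric)
  finally have "(\<integral>\<^sup>+\<omega>. (\<Sum>N. ennreal (exp (- W N \<omega>))) \<partial>M) \<noteq> \<infinity>" by simp
  then have "AE \<omega> in M. (\<Sum>N. ennreal (exp (- W N \<omega>))) \<noteq> \<infinity>"
    by (intro nn_integral_PInf_AE) auto
  then show ?thesis
  proof eventually_elim
    case (elim \<omega>)
    then have "summable (\<lambda>N. exp (- W N \<omega>))" by (intro summable_suminf_not_top) auto
    then have "(\<lambda>N. exp (- W N \<omega>)) \<longlonglongrightarrow> 0" by (rule summable_LIMSEQ_zero)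
    then have "filterlim (\<lambda>N. exp (- W N \<omega>)) (at_right 0) sequentially" by (simp add: filterlim_at eventually_at_filter)
    then have "filterlim (\<lambda>N. ln (exp (- W N \<omega>))) at_bot sequentially" by (rule filterlim_compose[OF ln_at_0])
    then show ?case by (simp add: filterlim_uminus_at_top)
  qed
qed

end

locale marked_renewal_function = marked_renewal M Y I v w + mark_function h T
  for M :: "'a measure" and Y :: "'i \<Rightarrow> 'a \<Rightarrow> real" and I v w h T
begin

definition Z :: "nat \<Rightarrow> 'a \<Rightarrow> real" where
  "Z N \<omega> = (\<Prod>j=1..N. exp (- h (Y (v j) \<omega>) (W j \<omega>)))"

lemma Z_measurable [measurable]: "random_variable borel (Z N)"
  unfolding Z_def by (intro borel_measurable_prod) (auto intro!: measurable_compose[OF _ borel_measurable_exp] borel_measurable_uminus h_measurable rv)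

lemma Z_bounds: "0 \<le> Z N \<omega>" "Z N \<omega> \<le> 1"
  unfolding Z_def by (auto intro!: prod_nonneg prod_le_1 simp: h_nonneg)

text \<open>Z_N and W_N depend on the first N marks and waiting times only. Integrating out the next
  pair turns the new factor into 1 - \<psi> and then applies \<open>B_renewal\<close> at s =
  W_N.\<close>

lemma martingale: "expectation (\<lambda>\<omega>. Z N \<omega> * B (W N \<omega>)) = B 0"
proof (induction N)
  case 0
  show ?case by (simp add: Z_def W_def prob_space)
next
  case (Suc N)
  let ?A = "v ` {1..N} \<union> w ` {1..N}" and ?v = "v (Suc N)" and ?w = "w (Suc N)"
  have A: "?A \<inter> {?v, ?w} = {}"   proof -
    have "v i = v j \<longleftrightarrow> i = j" "w i = w j \<longleftrightarrow> i = j" for i j using inj(1,2) by (auto simp: inj_def)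
    then show ?thesis using inj(3) inj(3)[symmetric] by auto
  qed
  define fA where "fA x = ((\<Prod>j=1..N. exp (- h (x (v j)) (\<Sum>k=1..j. x (w k)))), (\<Sum>k=1..N. x (w k)))" for x :: "'i \<Rightarrow> real"
  have cv: "(\<lambda>x. x (v j)) \<in> borel_measurable (Pi\<^sub>M ?A (\<lambda>_. borel))" "(\<lambda>x. x (w j)) \<in> borel_measurable (Pi\<^sub>M ?A (\<lambda>_. borel))" if "j \<in> {1..N}" for j
    using that by (auto intro!: measurable_component_singleton)
  have fA: "fA \<in> Pi\<^sub>M ?A (\<lambda>_. borel) \<rightarrow>\<^sub>M borel \<Otimes>\<^sub>M borel"
    unfolding fA_def
    by (intro measurable_Pair borel_measurable_prod borel_measurable_sum cv measurable_compose[OF _ borel_measurable_exp] borel_measurable_uminus h_measurable) auto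
  define fB where "fB x = (x ?v, x ?w)" for x :: "'i \<Rightarrow> real"
  have fB: "fB \<in> Pi\<^sub>M {?v, ?w} (\<lambda>_. borel) \<rightarrow>\<^sub>M borel \<Otimes>\<^sub>M borel"
    unfolding fB_def by (intro measurable_Pair measurable_component_singleton) auto
  have "indep_var (borel \<Otimes>\<^sub>M borel) (fA \<circ> (\<lambda>\<omega>. restrict (\<lambda>i. Y i \<omega>) ?A)) (borel \<Otimes>\<^sub>M borel) (fB \<circ> (\<lambda>\<omega>. restrict (\<lambda>i. Y i \<omega>) {?v, ?w}))"
    by (rule indep_var_compose[OF indep_var_restrict[OF indep A] fA fB]) (use idx in auto)
  moreover have "fA \<circ> (\<lambda>\<omega>. restrict (\<lambda>i. Y i \<omega>) ?A) = (\<lambda>\<omega>. (Z N \<omega>, W N \<omega>))"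
  proof
    fix \<omega>
    have "(\<Sum>k=1..j. restrict (\<lambda>i. Y i \<omega>) ?A (w k)) = W j \<omega>" if "j \<le> N" for j
      unfolding W_def using that by (intro sum.cong) auto
    then show "(fA \<circ> (\<lambda>\<omega>. restrict (\<lambda>i. Y i \<omega>) ?A)) \<omega> = (Z N \<omega>, W N \<omega>)"
      unfolding fA_def Z_def o_def by (auto intro!: prod.cong)
  qed
  moreover have "fB \<circ> (\<lambda>\<omega>. restrict (\<lambda>i. Y i \<omega>) {?v, ?w}) = (\<lambda>\<omega>. (Y ?v \<omega>, Y ?w \<omega>))"
    by (auto simp: fB_def)
  ultimately have ind: "indep_var (borel \<Otimes>\<^sub>M borel) (\<lambda>\<omega>. (Z N \<omega>, W N \<omega>)) (borel \<Otimes>\<^sub>M borel) (\<lambda>\<omega>. (Y ?v \<omega>, Y ?w \<omega>))"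
    by simp
  have ind2: "indep_var borel (Y ?v) borel (Y ?w)"
  proof -
    have "{?v} \<inter> {?w} = {}" using inj(3) by auto
    have "indep_var borel ((\<lambda>x. x ?v) \<circ> (\<lambda>\<omega>. restrict (\<lambda>i. Y i \<omega>) {?v})) borel ((\<lambda>x. x ?w) \<circ> (\<lambda>\<omega>. restrict (\<lambda>i. Y i \<omega>) {?w}))"
      by (rule indep_var_compose[OF indep_var_restrict[OF indep \<open>{?v} \<inter> {?w} = {}\<close>]])
         (use idx in \<open>auto intro!: measurable_component_singleton\<close>)
    then show ?thesis by (simp add: o_def)
  qed
  interpret U: prob_space unif01 by (rule prob_space_unif01)
  interpret E: prob_space exp1 by (rule prob_space_exp1)
  interpret UE: pair_prob_space exp1 unif01 ..
  have dUE: "distr M (borel \<Otimes>\<^sub>M borel) (\<lambda>\<omega>. (Y ?v \<omega>, Y ?w \<omega>)) = unif01 \<Otimes>\<^sub>M exp1"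
    using ind2 unfolding indep_var_distribution_eq by (simp add: unif expo)
  \<comment> \<open>The first component is clamped to [0,1] so that \<open>f\<close> is bounded
    everywhere, as \<open>expectation_indep_pair\<close> demands. For the values of
    \<open>Z N\<close> the clamping changes nothing.\<close>
  define f where "f = (\<lambda>p. max 0 (min 1 (fst (fst p))) *
    (exp (- h (fst (snd p)) (snd (fst p) + snd (snd p))) * B (snd (fst p) + snd (snd p))))"
  have f_meas: "f \<in> borel_measurable ((borel \<Otimes>\<^sub>M borel) \<Otimes>\<^sub>M (borel \<Otimes>\<^sub>M borel))"
    unfolding f_def by measurable
  have f_bd: "\<bar>f z\<bar> \<le> 1" for z
  proof -
    obtain a s t x where z: "z = ((a, s), (t, x))" by (cases z) auto
    have "\<bar>f z\<bar> = max 0 (min 1 a) * (exp (- h t (s + x)) * B (s + x))" unfolding f_def z using B_bounds by (simp add: abs_mult)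
    also have "\<dots> \<le> 1 * (1 * 1)" by (intro mult_mono) (auto simp: B_bounds h_nonneg)
    finally show ?thesis by simp
  qed
  have inner: "(\<integral>y. f ((z, s), y) \<partial>(unif01 \<Otimes>\<^sub>M exp1)) = max 0 (min 1 z) * B s" if "0 \<le> s" for z s
  proof -
    have m: "(\<lambda>(t, x). exp (- h t (s + x)) * B (s + x)) \<in> borel_measurable (unif01 \<Otimes>\<^sub>M exp1)"
      by measurable
    have m': "(\<lambda>(x, t). exp (- h t (s + x)) * B (s + x)) \<in> borel_measurable (exp1 \<Otimes>\<^sub>M unif01)"
      by measurable
    have "(\<integral>y. f ((z, s), y) \<partial>(unif01 \<Otimes>\<^sub>M exp1)) = max 0 (min 1 z) * (\<integral>(t, x). exp (- h t (s + x)) * B (s + x) \<partial>(unif01 \<Otimes>\<^sub>M exp1))"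
      unfolding f_def by (simp add: case_prod_unfold)
    also have "(\<integral>(t, x). exp (- h t (s + x)) * B (s + x) \<partial>(unif01 \<Otimes>\<^sub>M exp1)) = (\<integral>(x, t). exp (- h t (s + x)) * B (s + x) \<partial>(exp1 \<Otimes>\<^sub>M unif01))"
      using UE.integral_product_swap[OF m'] by (simp add: case_prod_unfold)
    also have "\<dots> = (\<integral>x. (\<integral>t. exp (- h t (s + x)) * B (s + x) \<partial>unif01) \<partial>exp1)"
    proof -
      have i: "integrable (exp1 \<Otimes>\<^sub>M unif01) (\<lambda>(x, t). exp (- h t (s + x)) * B (s + x))"
        using m' by (intro UE.integrable_const_bound[of _ 1] AE_I2)
           (auto simp: abs_mult h_nonneg B_bounds intro!: mult_le_one)
      show ?thesis using UE.integral_fst'[OF i] by simp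
    qed
    also have "\<dots> = (\<integral>x. (1 - \<psi> (s + x)) * B (s + x) \<partial>exp1)" by (simp add: psi_eq)
    also have "\<dots> = B s" by (rule B_renewal[OF that])
    finally show ?thesis .
  qed
  have "expectation (\<lambda>\<omega>. Z (Suc N) \<omega> * B (W (Suc N) \<omega>)) = expectation (\<lambda>\<omega>. f ((Z N \<omega>, W N \<omega>), (Y ?v \<omega>, Y ?w \<omega>)))"
  proof (intro Bochner_Integration.integral_cong refl)
    fix \<omega>
    have "W (Suc N) \<omega> = W N \<omega> + Y ?w \<omega>" by (simp add: W_def)
    moreover have "Z (Suc N) \<omega> = Z N \<omega> * exp (- h (Y ?v \<omega>) (W (Suc N) \<omega>))" by (simp add: Z_def)
    moreover have "max 0 (min 1 (Z N \<omega>)) = Z N \<omega>" using Z_bounds[of N \<omega>] by simp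
    ultimately show "Z (Suc N) \<omega> * B (W (Suc N) \<omega>) = f ((Z N \<omega>, W N \<omega>), (Y ?v \<omega>, Y ?w \<omega>))"
      by (simp add: f_def mult.assoc)
  qed
  also have "\<dots> = (\<integral>x. (\<integral>y. f (x, y) \<partial>(unif01 \<Otimes>\<^sub>M exp1)) \<partial>distr M (borel \<Otimes>\<^sub>M borel) (\<lambda>\<omega>. (Z N \<omega>, W N \<omega>)))"
    unfolding dUE[symmetric] by (rule expectation_indep_pair[OF ind f_meas f_bd])
  also have "\<dots> = expectation (\<lambda>\<omega>. (\<integral>y. f ((Z N \<omega>, W N \<omega>), y) \<partial>(unif01 \<Otimes>\<^sub>M exp1)))"
  proof (rule integral_distr)
    have sets_eq: "sets (unif01 \<Otimes>\<^sub>M exp1) = sets (borel \<Otimes>\<^sub>M borel)" by (intro sets_pair_measure_cong) auto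
    interpret UE2: pair_prob_space unif01 exp1 ..
    have "f \<in> borel_measurable ((borel \<Otimes>\<^sub>M borel) \<Otimes>\<^sub>M (unif01 \<Otimes>\<^sub>M exp1))"
      using f_meas by (simp cong: measurable_cong_sets sets_pair_measure_cong add: sets_eq)
    then show "(\<lambda>x. \<integral>y. f (x, y) \<partial>(unif01 \<Otimes>\<^sub>M exp1)) \<in> borel_measurable (borel \<Otimes>\<^sub>M borel)"
      by (intro UE2.borel_measurable_lebesgue_integral) simp
  qed simp
  also have "\<dots> = expectation (\<lambda>\<omega>. Z N \<omega> * B (W N \<omega>))"
  proof (rule integral_cong_AE)
    have "AE \<omega> in M. 0 \<le> W N \<omega>"
    proof (cases "N = 0")
      case False then show ?thesis using AE_W_pos by (auto elim!: eventually_mono simp: less_imp_le)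
    qed (simp add: W_def)
    then show "AE \<omega> in M. (\<integral>y. f ((Z N \<omega>, W N \<omega>), y) \<partial>(unif01 \<Otimes>\<^sub>M exp1)) = Z N \<omega> * B (W N \<omega>)"
    proof eventually_elim
      case (elim \<omega>)
      then show ?case using Z_bounds[of N \<omega>] by (simp add: inner)
    qed
    interpret UE2: pair_prob_space unif01 exp1 ..
    have sets_eq: "sets (unif01 \<Otimes>\<^sub>M exp1) = sets (borel \<Otimes>\<^sub>M borel)" by (intro sets_pair_measure_cong) auto
    have "f \<in> borel_measurable ((borel \<Otimes>\<^sub>M borel) \<Otimes>\<^sub>M (unif01 \<Otimes>\<^sub>M exp1))"
      using f_meas by (simp cong: measurable_cong_sets sets_pair_measure_cong add: sets_eq)
    then have "(\<lambda>x. \<integral>y. f (x, y) \<partial>(unif01 \<Otimes>\<^sub>M exp1)) \<in> borel_measurable (borel \<Otimes>\<^sub>M borel)"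
      by (intro UE2.borel_measurable_lebesgue_integral) simp
    from measurable_compose[OF _ this, of "\<lambda>\<omega>. (Z N \<omega>, W N \<omega>)" M]
    show "(\<lambda>\<omega>. \<integral>y. f ((Z N \<omega>, W N \<omega>), y) \<partial>(unif01 \<Otimes>\<^sub>M exp1)) \<in> borel_measurable M" by simp
  qed simp
  also have "\<dots> = B 0" by (rule Suc.IH)
  finally show ?case .
qed

text \<open>As soon as W_N >= T one has B(W_N) = 1, so the martingale and Z_N agree from then on;
  dominated convergence compares E Z_N with the constant \<open>B 0\<close>.\<close>

lemma laplace_limit: "(\<lambda>N. expectation (Z N)) \<longlonglongrightarrow> exp (- integral {0..T} \<psi>)"
proof -
  have int: "integrable M (Z N)" "integrable M (\<lambda>\<omega>. Z N \<omega> * B (W N \<omega>))" for N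
    by (auto intro!: integrable_const_bound[of _ 1] simp: Z_bounds abs_mult B_bounds mult_le_one)
  have "(\<lambda>N. expectation (\<lambda>\<omega>. Z N \<omega> - Z N \<omega> * B (W N \<omega>))) \<longlonglongrightarrow> expectation (\<lambda>_. 0)"
  proof (rule integral_dominated_convergence[where w="\<lambda>_. 1"])
    show "AE \<omega> in M. (\<lambda>N. Z N \<omega> - Z N \<omega> * B (W N \<omega>)) \<longlonglongrightarrow> 0"
      using AE_W_at_top
    proof eventually_elim
      case (elim \<omega>)
      then have "\<forall>\<^sub>F N in sequentially. T \<le> W N \<omega>" by (simp add: filterlim_at_top)
      then have "\<forall>\<^sub>F N in sequentially. Z N \<omega> - Z N \<omega> * B (W N \<omega>) = 0" by eventually_elim (simp add: B_one)
      then show ?case by (rule tendsto_eventually)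
    qed
    show "AE \<omega> in M. norm (Z N \<omega> - Z N \<omega> * B (W N \<omega>)) \<le> 1" for N
    proof (rule AE_I2)
      fix \<omega>
      have "0 \<le> Z N \<omega> * B (W N \<omega>)" "Z N \<omega> * B (W N \<omega>) \<le> Z N \<omega>"
        using Z_bounds[of N \<omega>] B_bounds[of "W N \<omega>"] by (auto intro: mult_left_le)
      then show "norm (Z N \<omega> - Z N \<omega> * B (W N \<omega>)) \<le> 1" using Z_bounds[of N \<omega>] by simp
    qed
  qed auto
  then have "(\<lambda>N. expectation (Z N) - B 0) \<longlonglongrightarrow> 0" using int martingale by simp
  then show ?thesis unfolding B_zero[symmetric] by (rule LIM_zero_cancel)
qed

end

section \<open>Laplace functionals of scaled independent marks\<close>

lemma integral_uniform_measure:
  fixes f :: "'a \<Rightarrow> real"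
  assumes A: "A \<in> sets M" "emeasure M A \<noteq> 0" "emeasure M A \<noteq> \<infinity>" and f: "f \<in> borel_measurable M"
  shows "(\<integral>x. f x \<partial>uniform_measure M A) = (\<integral>x. indicator A x * f x \<partial>M) / measure M A"
proof -
  have e: "emeasure M A = ennreal (measure M A)" using A by (simp add: emeasure_eq_ennreal_measure top_unique)
  then have pos: "measure M A > 0" using A(2) by (metis ennreal_0 measure_nonneg order_le_less)
  have "uniform_measure M A = density M (\<lambda>x. ennreal (indicator A x / measure M A))"
    unfolding uniform_measure_def e using pos
    by (intro arg_cong[where f="density M"] ext) (subst divide_ennreal[symmetric], auto simp: ennreal_indicator)
  then have "(\<integral>x. f x \<partial>uniform_measure M A) = (\<integral>x. (indicator A x / measure M A) * f x \<partial>M)"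
    using A(1) f pos by (simp add: integral_density)
  also have "\<dots> = (\<integral>x. (indicator A x * f x) / measure M A \<partial>M)" by simp
  finally show ?thesis by simp
qed

lemma integral_unif01:
  assumes "continuous_on UNIV f"
  shows "(\<integral>t. f t \<partial>unif01) = integral {0..1} (f :: real \<Rightarrow> real)"
proof -
  have c: "continuous_on {0..1} f" using assms by (rule continuous_on_subset) auto
  have "(\<integral>t. f t \<partial>unif01) = (\<integral>x. indicator {0..1} x * f x \<partial>lborel) / measure lborel {0..1::real}"
    using assms by (intro integral_uniform_measure) (auto intro: borel_measurable_continuous_onI)
  also have "\<dots> = (LINT x:{0..1}|lborel. f x)" by (simp add: set_lebesgue_integral_def)
  also have "\<dots> = integral {0..1} f"
    by (rule set_borel_integral_eq_integral(2)[OF borel_integrable_atLeastAtMost'[OF c]])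
  finally show ?thesis .
qed

text \<open>Conditionally on exceeding \<eta> b_n, the law of y/b_n converges weakly to a Pareto
  law, which is the image of the uniform law on (0, m) under u to c u^(-1/\<alpha>). Multiplying by
  n times the probability of the exceedance, which tends to m, undoes the conditioning and leaves an
  integral over u > 0.\<close>

lemma one_sided_limit:
  assumes rho: "real_distribution \<rho>" and b: "\<And>n. n \<ge> N0 \<Longrightarrow> b n > (0::real)" and "\<alpha> > 0" "p \<ge> 0" "\<eta> > 0"
    and tail: "\<And>x. x > 0 \<Longrightarrow> (\<lambda>n. real n * measure \<rho> {y. y > x * b n}) \<longlonglongrightarrow> p * x powr (- \<alpha>)"
    and G: "continuous_on UNIV G" "\<And>x. \<bar>G x\<bar> \<le> C" "\<And>x. x \<le> \<eta> \<Longrightarrow> G x = 0"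
  shows "(\<lambda>n. real n * (\<integral>y. G (y / b n) \<partial>\<rho>)) \<longlonglongrightarrow>
     (\<integral>u. indicator {0<..} u * G (p powr (1/\<alpha>) * u powr (- 1/\<alpha>)) \<partial>lborel :: real)"
proof -
  interpret real_distribution \<rho> by fact
  have Gm[measurable]: "G \<in> borel_measurable borel" by (rule borel_measurable_continuous_onI[OF G(1)])
  have tail_eta: "(\<lambda>n. real n * measure \<rho> {y. y > \<eta> * b n}) \<longlonglongrightarrow> p * \<eta> powr (- \<alpha>)" by (rule tail[OF \<open>\<eta> > 0\<close>])
  have Gle: "\<bar>real n * (\<integral>y. G (y / b n) \<partial>\<rho>)\<bar> \<le> C * (real n * measure \<rho> {y. y > \<eta> * b n})" if "n \<ge> N0" for n
  proof -
    have bn: "b n > 0" using b[OF that] .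
    have "\<bar>\<integral>y. G (y / b n) \<partial>\<rho>\<bar> \<le> (\<integral>y. \<bar>G (y / b n)\<bar> \<partial>\<rho>)" by (rule integral_abs_bound)
    also have "\<dots> \<le> (\<integral>y. C * indicator {y. y > \<eta> * b n} y \<partial>\<rho>)"
    proof (rule integral_mono)
      show "integrable \<rho> (\<lambda>y. \<bar>G (y / b n)\<bar>)" by (rule integrable_const_bound[of _ C]) (auto simp: G(2))
      show "integrable \<rho> (\<lambda>y. C * indicator {y. y > \<eta> * b n} y)" by (intro integrable_mult_right integrable_const_bound[of _ 1]) auto
      show "\<bar>G (y / b n)\<bar> \<le> C * indicator {y. y > \<eta> * b n} y" for y
        using G(2)[of "y / b n"] G(3)[of "y / b n"] bn by (auto simp: indicator_def field_simps)
    qed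
    finally have "\<bar>\<integral>y. G (y / b n) \<partial>\<rho>\<bar> \<le> C * measure \<rho> {y. y > \<eta> * b n}" by simp
    then have "real n * \<bar>\<integral>y. G (y / b n) \<partial>\<rho>\<bar> \<le> real n * (C * measure \<rho> {y. y > \<eta> * b n})" by (rule mult_left_mono) simp
    then show ?thesis by (simp add: abs_mult mult_ac)
  qed
  show ?thesis
  proof (cases "p = 0")
    \<comment> \<open>For p = 0 the exceedances are of order o(1/n) and conditioning on them has no
      limit; here boundedness of \<open>G\<close> alone gives the limit 0.\<close>
    case True
    have "(\<lambda>n. real n * (\<integral>y. G (y / b n) \<partial>\<rho>)) \<longlonglongrightarrow> 0"
    proof (rule Lim_null_comparison)
      show "\<forall>\<^sub>F n in sequentially. norm (real n * (\<integral>y. G (y / b n) \<partial>\<rho>)) \<le> C * (real n * measure \<rho> {y. y > \<eta> * b n})"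
        using Gle by (auto simp: eventually_sequentially)
      show "(\<lambda>n. C * (real n * measure \<rho> {y. y > \<eta> * b n})) \<longlonglongrightarrow> 0"
        using tendsto_mult[OF tendsto_const[of C] tail_eta] True by simp
    qed
    moreover have "G 0 = 0" using G(3)[of 0] \<open>\<eta> > 0\<close> by simp
    ultimately show ?thesis using True by simp
  next
    case False
    with \<open>p \<ge> 0\<close> have p: "p > 0" by simp
    \<comment> \<open>The limiting expected number of exceedances of level \<eta>, and equally the
      value of u at which c u^(-1/\<alpha>) equals \<eta>.\<close>
    define m where "m = p * \<eta> powr (- \<alpha>)"
    have m: "m > 0" using p \<open>\<eta> > 0\<close> by (simp add: m_def)
    define c where "c = p powr (1/\<alpha>)"
    have c: "c > 0" using p by (simp add: c_def)
    define R where "R = uniform_measure lborel {0<..<m}"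
    interpret R: prob_space R unfolding R_def using m by (intro prob_space_uniform_measure) auto
    define Plim where "Plim = distr R borel (\<lambda>u. c * u powr (- 1/\<alpha>))"
    have fm[measurable]: "(\<lambda>u. c * u powr (- 1/\<alpha>)) \<in> borel_measurable R" unfolding R_def by measurable
    have Plim: "real_distribution Plim" unfolding Plim_def by (rule R.real_distribution_distr[OF fm])
    interpret Plim: real_distribution Plim by (rule Plim)
    have inv: "c * u powr (- 1/\<alpha>) \<le> x \<longleftrightarrow> p * x powr (- \<alpha>) \<le> u" if "u > 0" "x > 0" for u x
    proof -
      have e: "p * x powr (- \<alpha>) = (x / c) powr (- \<alpha>)"
        using that c p \<open>\<alpha> > 0\<close> by (simp add: powr_divide c_def powr_powr powr_minus field_simps)
      have u: "u = (u powr (- 1/\<alpha>)) powr (- \<alpha>)" using that \<open>\<alpha> > 0\<close> by (simp add: powr_powr)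
      have "c * u powr (- 1/\<alpha>) \<le> x \<longleftrightarrow> u powr (- 1/\<alpha>) \<le> x / c" using c by (simp add: field_simps)
      also have "\<dots> \<longleftrightarrow> (x / c) powr (- \<alpha>) \<le> (u powr (- 1/\<alpha>)) powr (- \<alpha>)"
        using that c \<open>\<alpha> > 0\<close> by (metis divide_pos_pos neg_0_less_iff_less neg_less_0_iff_less not_le powr_gt_zero powr_less_mono2_neg powr_mono2' less_imp_le)
      finally show ?thesis using e u by simp
    qed
    have cdf_lim: "cdf Plim x = (if x \<le> \<eta> then 0 else 1 - (p * x powr (- \<alpha>)) / m)" for x
    proof (cases "x > 0")
      case True
      have px: "p * x powr (- \<alpha>) > 0" using p True by simp
      have "cdf Plim x = measure R {u. c * u powr (- 1/\<alpha>) \<le> x}"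
        unfolding cdf_def Plim_def by (subst measure_distr) (auto simp: vimage_def R_def)
      also have "\<dots> = measure lborel ({0<..<m} \<inter> {u. c * u powr (- 1/\<alpha>) \<le> x}) / measure lborel {0<..<m}"
        unfolding R_def using m by (subst measure_uniform_measure) auto
      also have "{0<..<m} \<inter> {u. c * u powr (- 1/\<alpha>) \<le> x} = {p * x powr (- \<alpha>)..<m}"
        using inv True px by auto
      also have "measure lborel {p * x powr (- \<alpha>)..<m} / measure lborel {0<..<m} = (if p * x powr (- \<alpha>) \<le> m then 1 - p * x powr (- \<alpha>) / m else 0)"
        using m by (auto simp: diff_divide_distrib)
      also have "p * x powr (- \<alpha>) \<le> m \<longleftrightarrow> \<eta> \<le> x"
      proof -
        have "p * x powr (- \<alpha>) \<le> m \<longleftrightarrow> x powr (- \<alpha>) \<le> \<eta> powr (- \<alpha>)" unfolding m_def using p by simp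
        also have "\<dots> \<longleftrightarrow> \<eta> \<le> x" using True \<open>\<eta> > 0\<close> \<open>\<alpha> > 0\<close>
          by (metis neg_less_0_iff_less not_le powr_less_mono2_neg powr_mono2' less_imp_le)
        finally show ?thesis .
      qed
      finally show ?thesis using m by (auto simp: m_def)
    next
      case False
      have "cdf Plim x = measure R {u. c * u powr (- 1/\<alpha>) \<le> x}"
        unfolding cdf_def Plim_def by (subst measure_distr) (auto simp: vimage_def R_def)
      also have "\<dots> = measure lborel ({0<..<m} \<inter> {u. c * u powr (- 1/\<alpha>) \<le> x}) / measure lborel {0<..<m}"
        unfolding R_def using m by (subst measure_uniform_measure) auto
      also have "{0<..<m} \<inter> {u. c * u powr (- 1/\<alpha>) \<le> x} = {}"
      proof -
        have "c * u powr (- 1/\<alpha>) > x" if "u > 0" for u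
          using False c that by (smt (verit) mult_pos_pos powr_gt_zero)
        then show ?thesis by force
      qed
      finally show ?thesis using False \<open>\<eta> > 0\<close> by simp
    qed
    define D where "D n = distr \<rho> borel (\<lambda>y. y / b n)" for n
    define k where "k n = measure \<rho> {y. y > \<eta> * b n}" for n
    have "\<forall>\<^sub>F n in sequentially. real n * k n > 0" unfolding k_def
      by (rule order_tendstoD(1)[OF tail_eta]) (use m in \<open>simp add: m_def\<close>)
    then obtain N1 where N1: "\<And>n. n \<ge> N1 \<Longrightarrow> real n * k n > 0" by (auto simp: eventually_sequentially)
    define N where "N = max N0 N1"
    have N: "b n > 0" "k n > 0" "real n > 0" if "n \<ge> N" for n
      using b[of n] N1[of n] that by (auto simp: N_def zero_less_mult_iff k_def)
    have prob_D: "real_distribution (D n)" for n unfolding D_def by (rule real_distribution_distr) simp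
    have mD: "measure (D n) {x<..} = measure \<rho> {y. y > x * b n}" if "n \<ge> N" for n x
    proof -
      have "(\<lambda>y. y / b n) -` {x<..} \<inter> space \<rho> = {y. y > x * b n}" using N(1)[OF that] by (auto simp: field_simps)
      then show ?thesis unfolding D_def by (subst measure_distr) auto
    qed
    have eD: "emeasure (D n) {\<eta><..} \<noteq> 0" "emeasure (D n) {\<eta><..} \<noteq> \<infinity>" "measure (D n) {\<eta><..} = k n" if "n \<ge> N" for n
    proof -
      interpret D: real_distribution "D n" by (rule prob_D)
      show *: "measure (D n) {\<eta><..} = k n" using mD[OF that] by (simp add: k_def)
      then show "emeasure (D n) {\<eta><..} \<noteq> 0" using N(2)[OF that] by (simp add: D.emeasure_eq_measure)
      show "emeasure (D n) {\<eta><..} \<noteq> \<infinity>" by simp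
    qed
    define Pn where "Pn n = uniform_measure (D (n + N)) {\<eta><..}" for n
    have Pn: "real_distribution (Pn n)" for n
    proof -
      have "prob_space (Pn n)" unfolding Pn_def using eD[of "n + N"] by (intro prob_space_uniform_measure) auto
      moreover have "sets (Pn n) = sets borel" by (simp add: Pn_def D_def)
      ultimately show ?thesis by (simp add: real_distribution_def real_distribution_axioms_def)
    qed
    have cdfPn: "cdf (Pn n) x = (if x \<le> \<eta> then 0 else 1 - (real (n + N) * measure \<rho> {y. y > x * b (n + N)}) / (real (n + N) * k (n + N)))" for n x
    proof -
      interpret D: real_distribution "D (n + N)" by (rule prob_D)
      have "cdf (Pn n) x = measure (D (n + N)) ({\<eta><..} \<inter> {..x}) / k (n + N)"
        unfolding cdf_def Pn_def using eD[of "n + N"] by (subst measure_uniform_measure) auto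
      also have "\<dots> = (if x \<le> \<eta> then 0 else 1 - measure \<rho> {y. y > x * b (n + N)} / k (n + N))"
      proof (cases "x \<le> \<eta>")
        case True
        then have "{\<eta><..} \<inter> {..x} = {}" by auto
        then show ?thesis using True by (simp only: measure_empty) simp
      next
        case False
        have "{\<eta><..} \<inter> {..x} = {\<eta><..} - {x<..}" by auto
        also have "measure (D (n + N)) \<dots> = measure (D (n + N)) {\<eta><..} - measure (D (n + N)) {x<..}"
          using False by (intro D.finite_measure_Diff) auto
        finally have "measure (D (n + N)) ({\<eta><..} \<inter> {..x}) = k (n + N) - measure \<rho> {y. y > x * b (n + N)}"
          using mD[of "n+N"] eD(3)[of "n+N"] by simp
        then show ?thesis using False N(2)[of "n + N"] by (simp add: diff_divide_distrib)
      qed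
      moreover have "real (n + N) * z / (real (n + N) * z') = z / z'" for z z'
        by (rule mult_divide_mult_cancel_left) (use N(3)[of "n + N"] in linarith)
      ultimately show ?thesis by (simp only:)
    qed
    have wc: "weak_conv_m Pn Plim"
      unfolding weak_conv_m_def weak_conv_def
    proof (intro allI impI)
      fix x
      show "(\<lambda>n. cdf (Pn n) x) \<longlonglongrightarrow> cdf Plim x"
      proof (cases "x \<le> \<eta>")
        case True then show ?thesis by (simp add: cdfPn cdf_lim)
      next
        case False
        then have "x > 0" using \<open>\<eta> > 0\<close> by simp
        have "(\<lambda>n. 1 - (real (n + N) * measure \<rho> {y. y > x * b (n + N)}) / (real (n + N) * k (n + N))) \<longlonglongrightarrow> 1 - (p * x powr (- \<alpha>)) / m"
          unfolding k_def
          by (intro tendsto_diff tendsto_const tendsto_divide LIMSEQ_ignore_initial_segment[OF tail[OF \<open>x > 0\<close>]]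
                LIMSEQ_ignore_initial_segment[OF tail_eta, folded m_def]) (use m in simp)
        then show ?thesis using False by (simp add: cdfPn cdf_lim)
      qed
    qed
    have "(\<lambda>n. \<integral>x. G x \<partial>Pn n) \<longlonglongrightarrow> (\<integral>x. G x \<partial>Plim)"
      by (rule weak_conv_imp_integral_bdd_continuous_conv[OF Pn Plim wc, of _ C])
         (use G in \<open>auto simp: continuous_on_eq_continuous_at\<close>)
    moreover have "(\<integral>x. G x \<partial>Plim) = (\<integral>u. indicator {0<..} u * G (c * u powr (- 1/\<alpha>)) \<partial>lborel) / m"
    proof -
      have "(\<integral>x. G x \<partial>Plim) = (\<integral>u. G (c * u powr (- 1/\<alpha>)) \<partial>R)" unfolding Plim_def by (rule integral_distr[OF fm Gm])
      also have "\<dots> = (\<integral>u. indicator {0<..<m} u * G (c * u powr (- 1/\<alpha>)) \<partial>lborel) / m"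
        unfolding R_def using m by (subst integral_uniform_measure) auto
      also have "(\<integral>u. indicator {0<..<m} u * G (c * u powr (- 1/\<alpha>)) \<partial>lborel) = (\<integral>u. indicator {0<..} u * G (c * u powr (- 1/\<alpha>)) \<partial>lborel)"
      proof (intro Bochner_Integration.integral_cong refl)
        fix u :: real
        show "indicator {0<..<m} u * G (c * u powr (- 1/\<alpha>)) = indicator {0<..} u * G (c * u powr (- 1/\<alpha>))"
        proof (cases "u \<ge> m")
          case True
          then have "c * u powr (- 1/\<alpha>) \<le> \<eta>" using m \<open>\<eta> > 0\<close> by (subst inv) (auto simp: m_def)
          then show ?thesis by (simp add: G(3))
        qed (auto simp: indicator_def)
      qed
      finally show ?thesis .
    qed
    moreover have "(\<integral>x. G x \<partial>Pn n) = (\<integral>y. G (y / b (n + N)) \<partial>\<rho>) / k (n + N)" for n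
    proof -
      have "(\<integral>x. G x \<partial>Pn n) = (\<integral>x. indicator {\<eta><..} x * G x \<partial>D (n + N)) / k (n + N)"
        unfolding Pn_def using eD[of "n + N"] by (subst integral_uniform_measure) (auto simp: D_def)
      also have "(\<integral>x. indicator {\<eta><..} x * G x \<partial>D (n + N)) = (\<integral>x. G x \<partial>D (n + N))"
        by (intro Bochner_Integration.integral_cong refl) (auto simp: indicator_def G(3))
      also have "\<dots> = (\<integral>y. G (y / b (n + N)) \<partial>\<rho>)" unfolding D_def by (rule integral_distr) auto
      finally show ?thesis .
    qed
    ultimately have l1: "(\<lambda>n. (\<integral>y. G (y / b (n + N)) \<partial>\<rho>) / k (n + N)) \<longlonglongrightarrow>
       (\<integral>u. indicator {0<..} u * G (c * u powr (- 1/\<alpha>)) \<partial>lborel) / m" by simp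
    have l2: "(\<lambda>n. real (n + N) * k (n + N)) \<longlonglongrightarrow> m"
      using LIMSEQ_ignore_initial_segment[OF tail_eta, of N] by (simp add: k_def m_def)
    have "(\<lambda>n. (real (n + N) * k (n + N)) * ((\<integral>y. G (y / b (n + N)) \<partial>\<rho>) / k (n + N))) \<longlonglongrightarrow>
       m * ((\<integral>u. indicator {0<..} u * G (c * u powr (- 1/\<alpha>)) \<partial>lborel) / m)"
      by (rule tendsto_mult[OF l2 l1])
    moreover have "(real (n + N) * k (n + N)) * ((\<integral>y. G (y / b (n + N)) \<partial>\<rho>) / k (n + N)) = real (n + N) * (\<integral>y. G (y / b (n + N)) \<partial>\<rho>)" for n
      using N(2)[of "n + N"] by simp
    ultimately have "(\<lambda>n. real (n + N) * (\<integral>y. G (y / b (n + N)) \<partial>\<rho>)) \<longlonglongrightarrow>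
       (\<integral>u. indicator {0<..} u * G (c * u powr (- 1/\<alpha>)) \<partial>lborel)" using m by simp
    then show ?thesis unfolding c_def by (rule LIMSEQ_offset)
  qed
qed

text \<open>The integrand will itself depend on n, so the error of the Riemann sum has to be
  expressed by the oscillation at scale 1/n and not by a limit.\<close>

lemma riemann_sum_bound:
  fixes F :: "real \<Rightarrow> real"
  assumes F: "continuous_on UNIV F" and osc: "\<And>s t. \<bar>s - t\<bar> \<le> 1 / real n \<Longrightarrow> \<bar>F s - F t\<bar> \<le> e" and n: "n > 0" 
  shows "\<bar>(\<Sum>j=1..n. F (real j / real n)) / real n - integral {0..1} F\<bar> \<le> e"
proof -
  have i: "F integrable_on {a..b}" for a b
    by (rule integrable_continuous_interval) (rule continuous_on_subset[OF F], simp)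
  have "\<bar>(\<Sum>j=1..k. F (real j / real n)) / real n - integral {0..real k / real n} F\<bar> \<le> e * real k / real n" for k
  proof (induction k)
    case (Suc k)
    let ?a = "real k / real n" and ?b = "real (Suc k) / real n"
    have ab: "0 \<le> ?a" "?a \<le> ?b" "?b - ?a = 1 / real n" using n by (auto simp: field_simps)
    have comb: "integral {0..?a} F + integral {?a..?b} F = integral {0..?b} F"
      by (intro Henstock_Kurzweil_Integration.integral_combine ab i)
    have "integral {?a..?b} (\<lambda>x. F x - F ?b) = integral {?a..?b} F - F ?b / real n"
      using ab by (subst Henstock_Kurzweil_Integration.integral_diff) (auto intro: i)
    moreover have "norm (integral {?a..?b} (\<lambda>x. F x - F ?b)) \<le> e * (?b - ?a)"
    proof (rule integral_bound)
      show "continuous_on {?a..?b} (\<lambda>x. F x - F ?b)" by (intro continuous_intros continuous_on_subset[OF F]) auto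
      show "norm (F x - F ?b) \<le> e" if "x \<in> {?a..?b}" for x
        unfolding real_norm_def using that ab by (intro osc) auto
    qed (rule ab)
    ultimately have s: "\<bar>integral {?a..?b} F - F ?b / real n\<bar> \<le> e / real n" using ab by simp
    have "(\<Sum>j=1..Suc k. F (real j / real n)) / real n = (\<Sum>j=1..k. F (real j / real n)) / real n + F ?b / real n"
      by (simp add: add_divide_distrib)
    moreover have "e * real (Suc k) / real n = e * real k / real n + e / real n" by (simp add: add_divide_distrib distrib_left)
    ultimately show ?case using Suc.IH s comb unfolding abs_le_iff by linarith
  qed simp
  from this[of n] show ?thesis using n by simp
qed

text \<open>For small c one has exp(-(1 + 2d) c) <= 1 - c <= exp(-c) whenever c <= d < 1/2, and both
  bounds multiply to the same limit.\<close>

lemma prod_one_minus_tendsto: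
  fixes c :: "nat \<Rightarrow> nat \<Rightarrow> real"
  assumes c: "\<And>n j. 0 \<le> c n j" and small: "\<And>n j. c n j \<le> d n" and d: "d \<longlonglongrightarrow> 0"
    and sum: "(\<lambda>n. \<Sum>j=1..n. c n j) \<longlonglongrightarrow> L"
  shows "(\<lambda>n. \<Prod>j=1..n. 1 - c n j) \<longlonglongrightarrow> exp (- L)"
proof (rule real_tendsto_sandwich)
  have ev: "\<forall>\<^sub>F n in sequentially. d n < 1/2" by (rule order_tendstoD(2)[OF d]) simp
  then show "\<forall>\<^sub>F n in sequentially. (\<Prod>j=1..n. 1 - c n j) \<le> exp (- (\<Sum>j=1..n. c n j))"
  proof eventually_elim
    case (elim n)
    have "(\<Prod>j=1..n. 1 - c n j) \<le> (\<Prod>j=1..n. exp (- c n j))"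
    proof (intro prod_mono conjI)
      fix j
      show "0 \<le> 1 - c n j" using small[of n j] elim by linarith
      show "1 - c n j \<le> exp (- c n j)" using exp_ge_add_one_self[of "- c n j"] by simp
    qed
    also have "\<dots> = exp (- (\<Sum>j=1..n. c n j))" by (simp add: exp_sum sum_negf[symmetric])
    finally show ?case .
  qed
  show "\<forall>\<^sub>F n in sequentially. exp (- ((1 + 2 * d n) * (\<Sum>j=1..n. c n j))) \<le> (\<Prod>j=1..n. 1 - c n j)"
    using ev
  proof eventually_elim
    case (elim n)
    have "exp (- ((1 + 2 * d n) * (\<Sum>j=1..n. c n j))) = (\<Prod>j=1..n. exp (- ((1 + 2 * d n) * c n j)))"
      by (simp add: exp_sum[symmetric] sum_negf sum_distrib_left)
    also have "\<dots> \<le> (\<Prod>j=1..n. 1 - c n j)"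
    proof (intro prod_mono conjI)
      fix j
      have cj: "0 \<le> c n j" "c n j \<le> d n" "c n j < 1/2" using c small[of n j] elim by auto
      have "- c n j - 2 * (c n j)\<^sup>2 \<le> ln (1 - c n j)"
        using cj ln_one_minus_pos_lower_bound[of "c n j"] by simp
      moreover have "(c n j)\<^sup>2 \<le> d n * c n j" unfolding power2_eq_square using cj by (intro mult_right_mono) auto
      ultimately have "- ((1 + 2 * d n) * c n j) \<le> ln (1 - c n j)" by (simp add: algebra_simps)
      then have "exp (- ((1 + 2 * d n) * c n j)) \<le> exp (ln (1 - c n j))" by simp
      then show "exp (- ((1 + 2 * d n) * c n j)) \<le> 1 - c n j" using cj by simp
    qed simp
    finally show ?case .
  qed
  show "(\<lambda>n. exp (- (\<Sum>j=1..n. c n j))) \<longlonglongrightarrow> exp (- L)" by (intro tendsto_intros sum)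
  have "(\<lambda>n. exp (- ((1 + 2 * d n) * (\<Sum>j=1..n. c n j)))) \<longlonglongrightarrow> exp (- ((1 + 2 * 0) * L))" by (intro tendsto_intros sum d)
  then show "(\<lambda>n. exp (- ((1 + 2 * d n) * (\<Sum>j=1..n. c n j)))) \<longlonglongrightarrow> exp (- L)" by simp
qed

text \<open>Test functions on the strip, extended to the plane by \<open>0\<close> at the axis and by clamping the time coordinate.\<close>

definition plane_test :: "real \<Rightarrow> (real \<Rightarrow> real \<Rightarrow> real) \<Rightarrow> bool" where
  "plane_test \<eta> g \<longleftrightarrow> 0 < \<eta> \<and> continuous_on UNIV (\<lambda>(t, x). g t x) \<and> (\<forall>t x. 0 \<le> g t x) \<and>
     (\<forall>t x. \<bar>x\<bar> \<le> \<eta> \<or> 1 / \<eta> \<le> \<bar>x\<bar> \<longrightarrow> g t x = 0) \<and> (\<forall>t x. g t x = g (max 0 (min 1 t)) x)"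

lemma plane_testD:
  assumes "plane_test \<eta> g"
  shows "0 < \<eta>" "continuous_on UNIV (\<lambda>(t, x). g t x)" "0 \<le> g t x"
    "\<bar>x\<bar> \<le> \<eta> \<Longrightarrow> g t x = 0" "1 / \<eta> \<le> \<bar>x\<bar> \<Longrightarrow> g t x = 0" "g t x = g (max 0 (min 1 t)) x"
  using assms unfolding plane_test_def by blast+

text \<open>Clamping reduces time to [0,1], and for |x| >= 1/\<eta> the function is 0. The compact
  window reaches to 1/\<eta> + 1, so two points closer than 1 either both lie in it or both lie
  where the function vanishes.\<close>

lemma plane_test_uniform:
  assumes "plane_test \<eta> g" "e > 0"
  shows "\<exists>d>0. \<forall>s t x y. \<bar>s - t\<bar> < d \<longrightarrow> \<bar>x - y\<bar> < d \<longrightarrow> \<bar>g s x - g t y\<bar> < e"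
proof -
  note g = plane_testD[OF assms(1)]
  let ?K = "{0..1} \<times> {- (1/\<eta> + 1)..1/\<eta> + 1}"
  have "uniformly_continuous_on ?K (\<lambda>(t, x). g t x)"
    by (intro compact_uniformly_continuous continuous_on_subset[OF g(2)] compact_Times) auto
  then obtain d where d: "d > 0" "\<And>z z'. z \<in> ?K \<Longrightarrow> z' \<in> ?K \<Longrightarrow> dist z' z < d \<Longrightarrow> dist ((\<lambda>(t, x). g t x) z') ((\<lambda>(t, x). g t x) z) < e"
    unfolding uniformly_continuous_on_def using \<open>e > 0\<close> by metis
  define d' where "d' = min 1 (d/2)"
  have "\<bar>g s x - g t y\<bar> < e" if st: "\<bar>s - t\<bar> < d'" and xy: "\<bar>x - y\<bar> < d'" for s t x y
  proof (cases "\<bar>x\<bar> \<le> 1/\<eta> + 1 \<and> \<bar>y\<bar> \<le> 1/\<eta> + 1")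
    case True
    let ?s = "max 0 (min 1 s)" and ?t = "max 0 (min 1 t)"
    have "\<bar>?s - ?t\<bar> \<le> \<bar>s - t\<bar>" by (auto simp: max_def min_def)
    then have "\<bar>?s - ?t\<bar> < d/2" "\<bar>x - y\<bar> < d/2" using st xy by (auto simp: d'_def)
    then have "dist (?s, x) (?t, y) < d"
      using sqrt_sum_squares_le_sum_abs[of "?s - ?t" "x - y"] by (simp add: dist_Pair_Pair dist_real_def)
    then have "dist ((\<lambda>(t, x). g t x) (?s, x)) ((\<lambda>(t, x). g t x) (?t, y)) < e"
      using True by (intro d(2)) (auto simp: abs_le_iff)
    then show ?thesis using g(6)[of s x] g(6)[of t y] by (simp add: dist_real_def)
  next
    case False
    have "\<bar>x - y\<bar> < 1" using xy by (simp add: d'_def)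
    then have "1/\<eta> \<le> \<bar>x\<bar>" "1/\<eta> \<le> \<bar>y\<bar>" using False by (auto simp: abs_if split: if_splits)
    then show ?thesis using g(5) \<open>e > 0\<close> by simp
  qed
  moreover have "d' > 0" using d by (simp add: d'_def)
  ultimately show ?thesis by blast
qed

lemma plane_test_section:
  assumes "plane_test \<eta> g"
  shows "continuous_on UNIV (\<lambda>x. g t x)"
proof -
  have "continuous_on UNIV (\<lambda>x::real. (t, x))" by (intro continuous_intros)
  from continuous_on_compose2[OF plane_testD(2)[OF assms] this] show ?thesis by simp
qed

lemma plane_test_measurable:
  assumes "plane_test \<eta> g" and [measurable]: "f \<in> borel_measurable M" "f' \<in> borel_measurable M"
  shows "(\<lambda>x. g (f x) (f' x)) \<in> borel_measurable M"
proof -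
  have "(\<lambda>x. (f x, f' x)) \<in> M \<rightarrow>\<^sub>M borel \<Otimes>\<^sub>M borel" by measurable
  then have "(\<lambda>x. (f x, f' x)) \<in> M \<rightarrow>\<^sub>M borel" by (simp add: borel_prod)
  from measurable_compose[OF this borel_measurable_continuous_onI[OF plane_testD(2)[OF assms(1)]]]
  show ?thesis by simp
qed

text \<open>A renewal time u is seen at height c u^(-1/\<alpha>). The value 0 for u <= 0 is the
  continuous extension: as u decreases to 0 the height, if c is not 0, leaves the support of
  g.\<close>

definition mark_of :: "real \<Rightarrow> (real \<Rightarrow> real \<Rightarrow> real) \<Rightarrow> real \<Rightarrow> real \<Rightarrow> real \<Rightarrow> real" where
  "mark_of \<alpha> g c t u = (if u \<le> 0 then 0 else g t (c * u powr (- 1 / \<alpha>)))"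

text \<open>|c| u^(-1/\<alpha>) <= \<eta> exactly when u >= (|c|/\<eta>)^\<alpha>, which gives the
  horizon T.\<close>

lemma mark_function_mark_of:
  assumes g: "plane_test \<eta> g" and "\<alpha> > 0"
  shows "mark_function (mark_of \<alpha> g c) ((\<bar>c\<bar> / \<eta>) powr \<alpha>)"
proof
  note gD = plane_testD[OF g]
  show "0 \<le> mark_of \<alpha> g c t u" for t u by (simp add: mark_of_def gD(3))
  show "0 \<le> (\<bar>c\<bar> / \<eta>) powr \<alpha>" by simp
  have g0: "g t 0 = 0" for t by (rule gD(4)) (use gD(1) in simp)
  show "mark_of \<alpha> g c t u = 0" if u: "(\<bar>c\<bar> / \<eta>) powr \<alpha> \<le> u" for t u
  proof (cases "u \<le> 0")
    case False
    have "\<bar>c\<bar> / \<eta> = ((\<bar>c\<bar> / \<eta>) powr \<alpha>) powr (1/\<alpha>)" using \<open>\<alpha> > 0\<close> gD(1) by (simp add: powr_powr)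
    also have "\<dots> \<le> u powr (1/\<alpha>)" using u \<open>\<alpha> > 0\<close> by (intro powr_mono2) auto
    finally have "\<bar>c\<bar> / u powr (1/\<alpha>) \<le> \<eta>" using False gD(1) by (simp add: field_simps)
    then have "\<bar>c * u powr (- 1/\<alpha>)\<bar> \<le> \<eta>" using False by (simp add: abs_mult powr_minus field_simps)
    then show ?thesis by (simp add: mark_of_def gD(4))
  qed (simp add: mark_of_def)
  show "continuous_on UNIV (\<lambda>(t, u). mark_of \<alpha> g c t u)"
  proof (cases "c = 0")
    case True
    then have "(\<lambda>(t, u). mark_of \<alpha> g c t u) = (\<lambda>_. 0)" by (auto simp: mark_of_def g0)
    then show ?thesis by simp
  next
    case False
    \<comment> \<open>Below this value of u the height is at least 1/\<eta>, beyond the support. So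
      the function is 0 on an open set containing u <= 0, and the two open pieces can be
      glued.\<close>
    define \<delta> where "\<delta> = (\<bar>c\<bar> * \<eta>) powr \<alpha>"
    have d: "\<delta> > 0" using False gD(1) by (simp add: \<delta>_def)
    let ?A = "{z :: real \<times> real. snd z < \<delta>}" and ?B = "{z :: real \<times> real. 0 < snd z}"
    have open_AB: "open ?A" "open ?B" by (auto intro!: open_Collect_less continuous_intros)
    have zero: "mark_of \<alpha> g c t u = 0" if u: "u < \<delta>" for t u
    proof (cases "u \<le> 0")
      case False
      have "u powr (1/\<alpha>) \<le> \<delta> powr (1/\<alpha>)" using u False \<open>\<alpha> > 0\<close> by (intro powr_mono2) auto
      also have "\<dots> = \<bar>c\<bar> * \<eta>" using \<open>\<alpha> > 0\<close> gD(1) by (simp add: \<delta>_def powr_powr)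
      finally have "1 / \<eta> \<le> \<bar>c\<bar> / u powr (1/\<alpha>)" using False gD(1) by (simp add: field_simps)
      then have "1 / \<eta> \<le> \<bar>c * u powr (- 1/\<alpha>)\<bar>" using False by (simp add: abs_mult powr_minus field_simps)
      then show ?thesis by (simp add: mark_of_def gD(5))
    qed (simp add: mark_of_def)
    have "continuous_on ?A (\<lambda>(t, u). mark_of \<alpha> g c t u)"
      by (rule continuous_on_eq[of _ "\<lambda>_. 0"]) (auto simp: zero)
    moreover have "continuous_on ?B (\<lambda>(t, u). mark_of \<alpha> g c t u)"
    proof (rule continuous_on_eq)
      have "continuous_on ?B (\<lambda>z. (fst z, c * snd z powr (- 1/\<alpha>)))" by (intro continuous_intros) auto
      from continuous_on_compose2[OF gD(2) this]
      show "continuous_on ?B (\<lambda>z. g (fst z) (c * snd z powr (- 1/\<alpha>)))" by (simp add: case_prod_unfold)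
    qed (auto simp: mark_of_def)
    ultimately have "continuous_on (?A \<union> ?B) (\<lambda>(t, u). mark_of \<alpha> g c t u)"
      using open_AB by (intro continuous_on_open_Un)
    moreover have "?A \<union> ?B = UNIV" using d by force
    ultimately show ?thesis by simp
  qed
qed

context mark_function
begin

text \<open>Fubini matches the two ways the intensity arises: integrated over u at fixed time for
  the innovations, and averaged over time at fixed u in the renewal computation.\<close>

lemma section_integral:
  "integrable unif01 (\<lambda>t. \<integral>u. indicator {0<..} u * (1 - exp (- h t u)) \<partial>lborel)"
  "(\<integral>t. (\<integral>u. indicator {0<..} u * (1 - exp (- h t u)) \<partial>lborel) \<partial>unif01) = integral {0..T} \<psi>"
proof -
  interpret U: prob_space unif01 by (rule prob_space_unif01)
  interpret P: pair_sigma_finite unif01 lborel by unfold_locales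
  have f_meas: "(\<lambda>(t, u). indicator {0<..} u * (1 - exp (- h t u))) \<in> borel_measurable (unif01 \<Otimes>\<^sub>M lborel)"
    by measurable
  have int: "integrable (unif01 \<Otimes>\<^sub>M lborel) (\<lambda>(t, u). indicator {0<..} u * (1 - exp (- h t u)))"
  proof (rule Bochner_Integration.integrable_bound)
    have "emeasure (unif01 \<Otimes>\<^sub>M lborel) (UNIV \<times> {0..T}) = emeasure unif01 UNIV * emeasure lborel {0..T}"
      by (rule lborel.emeasure_pair_measure_Times) auto
    also have "\<dots> < \<infinity>" using U.emeasure_space_1 T by (simp add: ennreal_mult_less_top)
    finally show "integrable (unif01 \<Otimes>\<^sub>M lborel) (indicator (UNIV \<times> {0..T}) :: real \<times> real \<Rightarrow> real)"
      by (intro integrable_real_indicator) auto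
    show "AE z in unif01 \<Otimes>\<^sub>M lborel. norm (case z of (t, u) \<Rightarrow> indicator {0<..} u * (1 - exp (- h t u))) \<le> norm (indicator (UNIV \<times> {0..T}) z :: real)"
    proof (rule AE_I2)
      fix z :: "real \<times> real"
      obtain t u where z: "z = (t, u)" by (cases z)
      show "norm (case z of (t, u) \<Rightarrow> indicator {0<..} u * (1 - exp (- h t u))) \<le> norm (indicator (UNIV \<times> {0..T}) z :: real)"
      proof (cases "0 < u \<and> u \<le> T")
        case False then show ?thesis unfolding z by (auto simp: indicator_def h_zero)
      next
        case True then show ?thesis unfolding z by (auto simp: h_nonneg)
      qed
    qed
  qed (rule f_meas)
  show "integrable unif01 (\<lambda>t. \<integral>u. indicator {0<..} u * (1 - exp (- h t u)) \<partial>lborel)"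
    using P.integrable_fst[OF int] by simp
  have "(\<integral>t. (\<integral>u. indicator {0<..} u * (1 - exp (- h t u)) \<partial>lborel) \<partial>unif01) = (\<integral>u. (\<integral>t. indicator {0<..} u * (1 - exp (- h t u)) \<partial>unif01) \<partial>lborel)"
    by (rule P.Fubini_integral[OF int, symmetric])
  also have "\<dots> = (\<integral>u. indicator {0<..} u * \<psi> u \<partial>lborel)" by (simp add: \<psi>_def)
  also have "\<dots> = (LINT u:{0..T}|lborel. \<psi> u)"
    unfolding set_lebesgue_integral_def
  proof (rule integral_cong_AE)
    show "AE u in lborel. indicator {0<..} u * \<psi> u = indicator {0..T} u *\<^sub>R \<psi> u"
      using AE_lborel_singleton[of 0] by eventually_elim (auto simp: indicator_def psi_zero)
  qed auto
  also have "\<dots> = integral {0..T} \<psi>"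
    by (rule set_borel_integral_eq_integral(2)[OF borel_integrable_atLeastAtMost'[OF psi_cont]])
  finally show "(\<integral>t. (\<integral>u. indicator {0<..} u * (1 - exp (- h t u)) \<partial>lborel) \<partial>unif01) = integral {0..T} \<psi>" .
qed

end

section \<open>Innovations as scaled independent marks\<close>

lemma exp_minus_diff_bound:
  fixes u v :: real
  assumes "0 \<le> u" "0 \<le> v"
  shows "\<bar>exp (- u) - exp (- v)\<bar> \<le> \<bar>u - v\<bar>" "\<bar>exp (- u) - exp (- v)\<bar> \<le> 1"
proof -
  have *: "exp (- u) - exp (- v) \<le> v - u \<and> exp (- u) - exp (- v) \<le> 1 \<and> 0 \<le> exp (- u) - exp (- v)" if "0 \<le> u" "u \<le> v" for u v :: real
  proof -
    have "exp (- u) - exp (- v) = exp (- u) * (1 - exp (u - v))" by (simp add: right_diff_distrib exp_add[symmetric])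
    also have "\<dots> \<le> 1 * (v - u)"
    proof (rule mult_mono)
      show "1 - exp (u - v) \<le> v - u" using exp_ge_add_one_self[of "u - v"] by linarith
    qed (use that in auto)
    finally have 1: "exp (- u) - exp (- v) \<le> v - u" by simp
    have "exp (- u) \<le> 1" "exp (- v) \<ge> 0" "exp (- v) \<le> exp (- u)" using that by auto
    with 1 show ?thesis by linarith
  qed
  from *[of u v] *[of v u] assms show "\<bar>exp (- u) - exp (- v)\<bar> \<le> \<bar>u - v\<bar>" "\<bar>exp (- u) - exp (- v)\<bar> \<le> 1"
    by (cases "u \<le> v"; auto)+
qed

locale iid_attraction = attraction \<mu> \<nu> a b \<alpha> + prob_space M
  for \<mu> \<nu> :: "real measure" and a b :: "nat \<Rightarrow> real" and \<alpha> :: real and M :: "'s measure" +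
  fixes X :: "nat \<Rightarrow> 's \<Rightarrow> real" and p q :: real
  assumes balance: "tail_balance F p q"
    and X_indep: "indep_vars (\<lambda>_. borel) X {1..}"
    and X_law: "\<And>i. 1 \<le> i \<Longrightarrow> distr M borel (X i) = \<mu>"
begin

lemma pq: "0 \<le> p" "0 \<le> q" using balance by (auto simp: tail_balance_def)

lemma X_rv: "1 \<le> i \<Longrightarrow> random_variable borel (X i)"
  using X_indep by (auto simp: indep_vars_def)

lemma bn_pos: "\<forall>\<^sub>F n in sequentially. 0 < bn n"
  using bn_at_top by (simp add: filterlim_at_top_dense)

definition intensity :: "(real \<Rightarrow> real \<Rightarrow> real) \<Rightarrow> nat \<Rightarrow> real \<Rightarrow> real" where
  "intensity g n t = real n * (\<integral>y. 1 - exp (- g t (y / bn n)) \<partial>\<mu>)"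

text \<open>A test function vanishes near the axis, so its positive and negative sides separate.
  Each is an instance of \<open>one_sided_limit\<close>, the negative one for the law of -X.\<close>

lemma intensity_limit:
  assumes g: "plane_test \<eta> g"
  shows "(\<lambda>n. intensity g n t) \<longlonglongrightarrow>
     (\<integral>u. indicator {0<..} u * (1 - exp (- mark_of \<alpha> g (p powr (1/\<alpha>)) t u)) \<partial>lborel)
   + (\<integral>u. indicator {0<..} u * (1 - exp (- mark_of \<alpha> g (- (q powr (1/\<alpha>))) t u)) \<partial>lborel)"
proof -
  note gD = plane_testD[OF g]
  interpret mu: real_distribution \<mu> by (rule mu)
  obtain N0 where N0: "\<And>n. n \<ge> N0 \<Longrightarrow> 0 < bn n" using bn_pos by (auto simp: eventually_sequentially)
  define Gp where "Gp x = 1 - exp (- g t (max x 0))" for x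
  define Gm where "Gm x = 1 - exp (- g t (- max x 0))" for x
  have c: "continuous_on UNIV Gp" "continuous_on UNIV Gm"
    unfolding Gp_def Gm_def
    by (auto intro!: continuous_intros continuous_on_compose2[OF plane_test_section[OF g]])
  have bd: "\<bar>Gp x\<bar> \<le> 1" "\<bar>Gm x\<bar> \<le> 1" for x by (auto simp: Gp_def Gm_def gD(3))
  have z: "x \<le> \<eta> \<Longrightarrow> Gp x = 0" "x \<le> \<eta> \<Longrightarrow> Gm x = 0" for x
    using gD(1) by (auto simp: Gp_def Gm_def gD(4))
  have m[measurable]: "Gp \<in> borel_measurable borel" "Gm \<in> borel_measurable borel" using c by (auto intro: borel_measurable_continuous_onI)
  have l1: "(\<lambda>n. real n * (\<integral>y. Gp (y / bn n) \<partial>\<mu>)) \<longlonglongrightarrow>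
     (\<integral>u. indicator {0<..} u * Gp (p powr (1/\<alpha>) * u powr (- 1/\<alpha>)) \<partial>lborel)"
    by (rule one_sided_limit[OF mu N0 alpha(1) pq(1) gD(1) tail_limits(1)[OF balance] c(1) bd(1) z(1)])
  define \<rho> where "\<rho> = distr \<mu> borel (\<lambda>x. - x)"
  have rho: "real_distribution \<rho>" unfolding \<rho>_def by (rule mu.real_distribution_distr) simp
  have tail_rho: "(\<lambda>n. real n * measure \<rho> {y. y > x * bn n}) \<longlonglongrightarrow> q * x powr (- \<alpha>)" if "x > 0" for x
  proof -
    have "measure \<rho> {y. y > z} = measure \<mu> {y. y < - z}" for z
      unfolding \<rho>_def by (subst measure_distr) (auto simp: vimage_def intro!: arg_cong2[where f=measure])
    then show ?thesis using tail_limits(2)[OF balance that] by simp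
  qed
  have l2: "(\<lambda>n. real n * (\<integral>y. Gm (y / bn n) \<partial>\<rho>)) \<longlonglongrightarrow>
     (\<integral>u. indicator {0<..} u * Gm (q powr (1/\<alpha>) * u powr (- 1/\<alpha>)) \<partial>lborel)"
    by (rule one_sided_limit[OF rho N0 alpha(1) pq(2) gD(1) tail_rho c(2) bd(2) z(2)])
  have g0: "g t 0 = 0" by (rule gD(4)) (use gD(1) in simp)
  have split: "1 - exp (- g t x) = Gp x + Gm (- x)" for x
    by (cases "x \<ge> 0") (auto simp: Gp_def Gm_def g0 max_def)
  have "intensity g n t = real n * (\<integral>y. Gp (y / bn n) \<partial>\<mu>) + real n * (\<integral>y. Gm (y / bn n) \<partial>\<rho>)" for n
  proof -
    have "(\<integral>y. Gm (y / bn n) \<partial>\<rho>) = (\<integral>y. Gm (- (y / bn n)) \<partial>\<mu>)"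
      unfolding \<rho>_def by (subst integral_distr) auto
    moreover have "integrable \<mu> (\<lambda>y. Gp (y / bn n))" "integrable \<mu> (\<lambda>y. Gm (- (y / bn n)))"
      by (auto intro!: mu.integrable_const_bound[of _ 1] simp: bd)
    ultimately show ?thesis unfolding intensity_def split by (simp add: distrib_left)
  qed
  moreover have "indicator {0<..} u * Gp (p powr (1/\<alpha>) * u powr (- 1/\<alpha>)) = indicator {0<..} u * (1 - exp (- mark_of \<alpha> g (p powr (1/\<alpha>)) t u))" for u
    by (auto simp: indicator_def Gp_def mark_of_def max_absorb1)
  moreover have "indicator {0<..} u * Gm (q powr (1/\<alpha>) * u powr (- 1/\<alpha>)) = indicator {0<..} u * (1 - exp (- mark_of \<alpha> g (- (q powr (1/\<alpha>))) t u))" for u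
    by (auto simp: indicator_def Gm_def mark_of_def max_absorb1)
  ultimately show ?thesis using tendsto_add[OF l1 l2] by (simp only:)
qed

text \<open>Equicontinuity in t, uniformly in n: the integrand is supported on |y| > \<eta> b_n, a
  set of probability O(1/n).\<close>

lemma intensity_diff:
  assumes g: "plane_test \<eta> g" and n: "0 < bn n" and d: "\<And>x. \<bar>g s x - g t x\<bar> \<le> e"
  shows "\<bar>intensity g n s - intensity g n t\<bar> \<le> e * (real n * H (\<eta> * bn n))"
proof -
  note gD = plane_testD[OF g]
  interpret mu: real_distribution \<mu> by (rule mu)
  have int: "integrable \<mu> (\<lambda>y. 1 - exp (- g t (y / bn n)))" for t
    by (rule mu.integrable_const_bound[of _ 1]) (use gD(3) in \<open>auto intro!: plane_test_measurable[OF g] measurable_compose[OF _ borel_measurable_exp] borel_measurable_diff borel_measurable_uminus\<close>)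
  have "\<bar>(\<integral>y. 1 - exp (- g s (y / bn n)) \<partial>\<mu>) - (\<integral>y. 1 - exp (- g t (y / bn n)) \<partial>\<mu>)\<bar>
     = \<bar>\<integral>y. (1 - exp (- g s (y / bn n))) - (1 - exp (- g t (y / bn n))) \<partial>\<mu>\<bar>"
    by (subst Bochner_Integration.integral_diff[OF int int]) simp
  also have "\<dots> \<le> (\<integral>y. \<bar>(1 - exp (- g s (y / bn n))) - (1 - exp (- g t (y / bn n)))\<bar> \<partial>\<mu>)" by (rule integral_abs_bound)
  also have "\<dots> \<le> (\<integral>y. e * indicator {y. \<bar>y\<bar> > \<eta> * bn n} y \<partial>\<mu>)"
  proof (rule integral_mono)
    show "integrable \<mu> (\<lambda>y. \<bar>(1 - exp (- g s (y / bn n))) - (1 - exp (- g t (y / bn n)))\<bar>)"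
      by (rule integrable_abs[OF Bochner_Integration.integrable_diff[OF int int]])
    show "integrable \<mu> (\<lambda>y. e * indicator {y. \<bar>y\<bar> > \<eta> * bn n} y)"
      by (intro integrable_mult_right mu.integrable_const_bound[of _ 1]) auto
    fix y
    have "\<bar>(1 - exp (- g s (y / bn n))) - (1 - exp (- g t (y / bn n)))\<bar> \<le> \<bar>g s (y / bn n) - g t (y / bn n)\<bar>"
      using exp_minus_diff_bound(1)[of "g s (y / bn n)" "g t (y / bn n)"] gD(3) by (simp add: abs_minus_commute)
    moreover have "g r (y / bn n) = 0" if "\<not> \<bar>y\<bar> > \<eta> * bn n" for r
      using that n by (intro gD(4)) (simp add: abs_divide field_simps)
    ultimately show "\<bar>(1 - exp (- g s (y / bn n))) - (1 - exp (- g t (y / bn n)))\<bar> \<le> e * indicator {y. \<bar>y\<bar> > \<eta> * bn n} y"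
      using d[of "y / bn n"] by (auto simp: indicator_def intro: order_trans)
  qed
  finally have "\<bar>(\<integral>y. 1 - exp (- g s (y / bn n)) \<partial>\<mu>) - (\<integral>y. 1 - exp (- g t (y / bn n)) \<partial>\<mu>)\<bar> \<le> e * H (\<eta> * bn n)"
    by (simp add: H_def)
  then have "real n * \<bar>(\<integral>y. 1 - exp (- g s (y / bn n)) \<partial>\<mu>) - (\<integral>y. 1 - exp (- g t (y / bn n)) \<partial>\<mu>)\<bar> \<le> real n * (e * H (\<eta> * bn n))"
    by (rule mult_left_mono) simp
  then show ?thesis unfolding intensity_def right_diff_distrib[symmetric] abs_mult by (simp add: mult_ac)
qed

lemma intensity_bounds:
  assumes g: "plane_test \<eta> g" and n: "0 < bn n"
  shows "0 \<le> intensity g n t" "intensity g n t \<le> real n * H (\<eta> * bn n)"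
proof -
  note gD = plane_testD[OF g]
  interpret mu: real_distribution \<mu> by (rule mu)
  show "0 \<le> intensity g n t" unfolding intensity_def by (intro mult_nonneg_nonneg integral_nonneg_AE AE_I2) (auto simp: gD(3))
  have int: "integrable \<mu> (\<lambda>y. 1 - exp (- g t (y / bn n)))" for t
    by (rule mu.integrable_const_bound[of _ 1]) (use gD(3) in \<open>auto intro!: plane_test_measurable[OF g] measurable_compose[OF _ borel_measurable_exp] borel_measurable_diff borel_measurable_uminus\<close>)
  have "(\<integral>y. 1 - exp (- g t (y / bn n)) \<partial>\<mu>) \<le> (\<integral>y. indicator {y. \<bar>y\<bar> > \<eta> * bn n} y \<partial>\<mu>)"
  proof (rule integral_mono[OF int])
    show "integrable \<mu> (indicator {y. \<bar>y\<bar> > \<eta> * bn n} :: real \<Rightarrow> real)"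
      by (intro mu.integrable_const_bound[of _ 1]) auto
    fix y
    have "g t (y / bn n) = 0" if "\<not> \<bar>y\<bar> > \<eta> * bn n"
      using that n by (intro gD(4)) (simp add: abs_divide field_simps)
    then show "1 - exp (- g t (y / bn n)) \<le> indicator {y. \<bar>y\<bar> > \<eta> * bn n} y"
      by (auto simp: indicator_def)
  qed
  then show "intensity g n t \<le> real n * H (\<eta> * bn n)" unfolding intensity_def H_def by (intro mult_left_mono) auto
qed

text \<open>By independence the expectation is a product of factors 1 - c with c the intensity at
  j/n divided by n. The sum of these c is a Riemann sum over time, and the product tends to the
  exponential of minus its limit.\<close>

lemma jump_laplace:
  assumes g: "plane_test \<eta> g"
  shows "(\<lambda>n. expectation (\<lambda>\<omega>. exp (- (\<Sum>j=1..n. g (real j / real n) (X j \<omega> / bn n))))) \<longlonglongrightarrow>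
    exp (- (integral {0..(\<bar>p powr (1/\<alpha>)\<bar> / \<eta>) powr \<alpha>} (mark_function.\<psi> (mark_of \<alpha> g (p powr (1/\<alpha>))))
          + integral {0..(\<bar>- (q powr (1/\<alpha>))\<bar> / \<eta>) powr \<alpha>} (mark_function.\<psi> (mark_of \<alpha> g (- (q powr (1/\<alpha>)))))))"
    (is "_ \<longlonglongrightarrow> exp (- ?L)")
proof -
  note gD = plane_testD[OF g]
  interpret mu: real_distribution \<mu> by (rule mu)
  interpret U: prob_space unif01 by (rule prob_space_unif01)
  interpret m1: mark_function "mark_of \<alpha> g (p powr (1/\<alpha>))" "(\<bar>p powr (1/\<alpha>)\<bar> / \<eta>) powr \<alpha>"
    by (rule mark_function_mark_of[OF g alpha(1)])
  interpret m2: mark_function "mark_of \<alpha> g (- (q powr (1/\<alpha>)))" "(\<bar>- (q powr (1/\<alpha>))\<bar> / \<eta>) powr \<alpha>"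
    by (rule mark_function_mark_of[OF g alpha(1)])
  define K where "K = \<eta> powr (- \<alpha>) + 1"
  have K: "K > 0" by (simp add: K_def add_nonneg_pos)
  have evK: "\<forall>\<^sub>F n in sequentially. real n * H (\<eta> * bn n) < K"
    by (rule order_tendstoD(2)[OF bn_tail[OF gD(1)]]) (simp add: K_def)
  obtain N where N: "\<And>n. n \<ge> N \<Longrightarrow> 0 < bn n" "\<And>n. n \<ge> N \<Longrightarrow> real n * H (\<eta> * bn n) < K" "N > 0"
  proof -
    have "\<forall>\<^sub>F n in sequentially. 0 < bn n \<and> real n * H (\<eta> * bn n) < K \<and> n > 0"
      using bn_pos evK eventually_gt_at_top[of 0] by eventually_elim auto
    then show ?thesis using that unfolding eventually_sequentially by (metis le_less_trans less_le_trans order_refl)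
  qed
  have unif: "\<exists>d>0. \<forall>n\<ge>N. \<forall>s t. \<bar>s - t\<bar> < d \<longrightarrow> \<bar>intensity g n s - intensity g n t\<bar> \<le> e" if "e > 0" for e
  proof -
    have eK: "e / K > 0" using that K by simp
    obtain d where d: "d > 0" "\<forall>s t x y. \<bar>s - t\<bar> < d \<longrightarrow> \<bar>x - y\<bar> < d \<longrightarrow> \<bar>g s x - g t y\<bar> < e / K"
      using plane_test_uniform[OF g eK] by blast
    have "\<bar>intensity g n s - intensity g n t\<bar> \<le> e" if "n \<ge> N" "\<bar>s - t\<bar> < d" for n s t
    proof -
      have "\<bar>intensity g n s - intensity g n t\<bar> \<le> (e / K) * (real n * H (\<eta> * bn n))"
        by (rule intensity_diff[OF g N(1)[OF that(1)]]) (use d that in \<open>auto intro: less_imp_le\<close>)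
      also have "\<dots> \<le> (e / K) * K" using N(2)[OF that(1)] eK by (intro mult_left_mono) auto
      finally show ?thesis using K by simp
    qed
    then show ?thesis using d(1) by blast
  qed
  have cont: "continuous_on UNIV (intensity g n)" if "n \<ge> N" for n
    unfolding continuous_on_iff
  proof (intro ballI allI impI)
    fix s e :: real assume "e > 0"
    then have "e / 2 > 0" by simp
    obtain d where d: "d > 0" "\<forall>n\<ge>N. \<forall>s t. \<bar>s - t\<bar> < d \<longrightarrow> \<bar>intensity g n s - intensity g n t\<bar> \<le> e / 2"
      using unif[OF \<open>e / 2 > 0\<close>] by blast
    show "\<exists>d>0. \<forall>x'\<in>UNIV. dist x' s < d \<longrightarrow> dist (intensity g n x') (intensity g n s) < e"
      using d that \<open>e > 0\<close> by (intro exI[of _ d]) (force simp: dist_real_def)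
  qed
  have "(\<lambda>n. \<integral>t. intensity g (n + N) t \<partial>unif01) \<longlonglongrightarrow> (\<integral>t.
     (\<integral>u. indicator {0<..} u * (1 - exp (- mark_of \<alpha> g (p powr (1/\<alpha>)) t u)) \<partial>lborel)
   + (\<integral>u. indicator {0<..} u * (1 - exp (- mark_of \<alpha> g (- (q powr (1/\<alpha>))) t u)) \<partial>lborel) \<partial>unif01)"
  proof (rule integral_dominated_convergence[where w="\<lambda>_. K"])
    show "AE t in unif01. norm (intensity g (n + N) t) \<le> K" for n
      using intensity_bounds[OF g N(1)] N(2)[of "n + N"] by (intro AE_I2) (smt (verit) le_add2 real_norm_def)
    show "intensity g (n + N) \<in> borel_measurable unif01" for n
    proof -
      have "borel_measurable unif01 = (borel_measurable borel :: (real \<Rightarrow> real) set)" by (rule measurable_cong_sets) auto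
      then show ?thesis using borel_measurable_continuous_onI[OF cont[OF le_add2]] by simp
    qed
    show "(\<lambda>t. (\<integral>u. indicator {0<..} u * (1 - exp (- mark_of \<alpha> g (p powr (1/\<alpha>)) t u)) \<partial>lborel)
      + (\<integral>u. indicator {0<..} u * (1 - exp (- mark_of \<alpha> g (- (q powr (1/\<alpha>))) t u)) \<partial>lborel)) \<in> borel_measurable unif01"
      using m1.section_integral(1) m2.section_integral(1) by (intro borel_measurable_add) auto
  qed (use LIMSEQ_ignore_initial_segment[OF intensity_limit[OF g]] in auto)
  also have "(\<integral>t. (\<integral>u. indicator {0<..} u * (1 - exp (- mark_of \<alpha> g (p powr (1/\<alpha>)) t u)) \<partial>lborel)
   + (\<integral>u. indicator {0<..} u * (1 - exp (- mark_of \<alpha> g (- (q powr (1/\<alpha>))) t u)) \<partial>lborel) \<partial>unif01) = ?L"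
    using m1.section_integral m2.section_integral by (subst Bochner_Integration.integral_add) auto
  finally have int_lim: "(\<lambda>n. \<integral>t. intensity g (n + N) t \<partial>unif01) \<longlonglongrightarrow> ?L" .
  define c where "c n j = intensity g n (real j / real n) / real n" for n j
  \<comment> \<open>Integrand and mesh change together. The equicontinuity established above makes
    the Riemann error small uniformly in n, and dominated convergence handles the integrals.\<close>
  have sum_lim: "(\<lambda>n. \<Sum>j=1..n + N. c (n + N) j) \<longlonglongrightarrow> ?L"
  proof (rule LIMSEQ_I)
    fix e :: real assume "e > 0"
    then have "e / 2 > 0" by simp
    obtain d where d: "d > 0" "\<forall>n\<ge>N. \<forall>s t. \<bar>s - t\<bar> < d \<longrightarrow> \<bar>intensity g n s - intensity g n t\<bar> \<le> e / 2"
      using unif[OF \<open>e / 2 > 0\<close>] by blast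
    obtain n1 where n1: "\<And>n. n \<ge> n1 \<Longrightarrow> \<bar>(\<integral>t. intensity g (n + N) t \<partial>unif01) - ?L\<bar> < e / 2"
      using LIMSEQ_D[OF int_lim \<open>e / 2 > 0\<close>] by auto
    obtain n2 where n2: "1 / d < real n2" using reals_Archimedean2 by blast
    show "\<exists>n0. \<forall>n\<ge>n0. norm ((\<Sum>j=1..n + N. c (n + N) j) - ?L) < e"
    proof (intro exI allI impI)
      fix n assume n: "n \<ge> max n1 n2"
      have "1 / d < real (n + N)" using n n2 by simp
      then have small: "1 / real (n + N) < d" using d(1) N(3) by (simp add: field_simps)
      have "\<bar>(\<Sum>j=1..n + N. intensity g (n + N) (real j / real (n + N))) / real (n + N) - integral {0..1} (intensity g (n + N))\<bar> \<le> e / 2"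
        by (rule riemann_sum_bound[OF cont]) (use d(2) small N(3) in auto)
      moreover have "(\<Sum>j=1..n + N. intensity g (n + N) (real j / real (n + N))) / real (n + N) = (\<Sum>j=1..n + N. c (n + N) j)"
        by (simp only: c_def sum_divide_distrib)
      ultimately have "\<bar>(\<Sum>j=1..n + N. c (n + N) j) - (\<integral>t. intensity g (n + N) t \<partial>unif01)\<bar> \<le> e / 2"
        by (simp only: integral_unif01[OF cont[OF le_add2]])
      then show "norm ((\<Sum>j=1..n + N. c (n + N) j) - ?L) < e"
        using n1[of n] n unfolding real_norm_def by linarith
    qed
  qed
  have prod_eq: "expectation (\<lambda>\<omega>. exp (- (\<Sum>j=1..n. g (real j / real n) (X j \<omega> / bn n)))) = (\<Prod>j=1..n. 1 - c n j)" if "n \<ge> N" for n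
  proof -
    have n: "n > 0" using that N(3) by simp
    have gm: "(\<lambda>x. exp (- g t (x / bn n))) \<in> borel_measurable borel" for t
      by (intro measurable_compose[OF _ borel_measurable_exp] borel_measurable_uminus plane_test_measurable[OF g]) auto
    have ind: "indep_vars (\<lambda>_. borel) (\<lambda>j \<omega>. exp (- g (real j / real n) (X j \<omega> / bn n))) {1..n}"
    proof -
      have "indep_vars (\<lambda>_. borel) X {1..n}" by (rule indep_vars_subset[OF X_indep]) auto
      then show ?thesis by (rule indep_vars_compose2[where Y="\<lambda>j x. exp (- g (real j / real n) (x / bn n))"]) (rule gm)
    qed
    have "expectation (\<lambda>\<omega>. exp (- (\<Sum>j=1..n. g (real j / real n) (X j \<omega> / bn n)))) = expectation (\<lambda>\<omega>. \<Prod>j\<in>{1..n}. exp (- g (real j / real n) (X j \<omega> / bn n)))"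
      by (simp add: exp_sum sum_negf[symmetric])
    also have "\<dots> = (\<Prod>j\<in>{1..n}. expectation (\<lambda>\<omega>. exp (- g (real j / real n) (X j \<omega> / bn n))))"
    proof (rule indep_vars_lebesgue_integral[OF _ ind])
      fix j assume "j \<in> {1..n}"
      then have "X j \<in> borel_measurable M" by (intro X_rv) auto
      then show "integrable M (\<lambda>\<omega>. exp (- g (real j / real n) (X j \<omega> / bn n)))"
        by (intro integrable_const_bound[of _ 1] measurable_compose[OF _ gm]) (auto simp: gD(3))
    qed simp
    also have "\<dots> = (\<Prod>j\<in>{1..n}. 1 - c n j)"
    proof (intro prod.cong refl)
      fix j assume j: "j \<in> {1..n}"
      have "expectation (\<lambda>\<omega>. exp (- g (real j / real n) (X j \<omega> / bn n))) = (\<integral>x. exp (- g (real j / real n) (x / bn n)) \<partial>\<mu>)"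
        using j by (subst X_law[of j, symmetric]) (auto intro!: integral_distr[symmetric] X_rv gm)
      also have "\<dots> = 1 - c n j"
      proof -
        have "integrable \<mu> (\<lambda>x. exp (- g (real j / real n) (x / bn n)))"
          using gm[of "real j / real n"] by (intro mu.integrable_const_bound[of _ 1]) (auto simp: gD(3))
        then show ?thesis unfolding c_def intensity_def using n mu.prob_space by simp
      qed
      finally show "expectation (\<lambda>\<omega>. exp (- g (real j / real n) (X j \<omega> / bn n))) = 1 - c n j" .
    qed
    finally show ?thesis .
  qed
  \<comment> \<open>The bounds on the intensity hold only from N on; the early rows are set to 0 so
    that \<open>prod_one_minus_tendsto\<close> applies to all n.\<close>
  define c' where "c' n j = (if n \<ge> N then c n j else 0)" for n j
  have "(\<lambda>n. \<Prod>j=1..n. 1 - c' n j) \<longlonglongrightarrow> exp (- ?L)"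
  proof (rule prod_one_minus_tendsto)
    show "0 \<le> c' n j" for n j using intensity_bounds(1)[OF g N(1)] by (auto simp: c'_def c_def)
    show "c' n j \<le> K / real n" for n j
      unfolding c'_def c_def using intensity_bounds(2)[OF g N(1), of n "real j / real n"] N(2)[of n] K by (auto intro!: divide_right_mono)
    show "(\<lambda>n. K / real n) \<longlonglongrightarrow> 0" by real_asymp
    have "(\<lambda>n. \<Sum>j=1..n + N. c' (n + N) j) \<longlonglongrightarrow> ?L" using sum_lim by (simp add: c'_def)
    then show "(\<lambda>n. \<Sum>j=1..n. c' n j) \<longlonglongrightarrow> ?L" by (rule LIMSEQ_offset)
  qed
  moreover have "\<forall>\<^sub>F n in sequentially. (\<Prod>j=1..n. 1 - c' n j) = expectation (\<lambda>\<omega>. exp (- (\<Sum>j=1..n. g (real j / real n) (X j \<omega> / bn n))))"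
    using eventually_ge_at_top[of N]
  proof eventually_elim
    case (elim n)
    show ?case unfolding prod_eq[OF elim] using elim by (simp add: c'_def)
  qed
  ultimately show ?thesis by (rule Lim_transform_eventually)
qed

end

section \<open>Approximation of a linear process by isolated clusters\<close>

text \<open>A deterministic statement on one sample path. Large innovations are more than
  \<open>m\<close> steps apart, so at time j + l with l <= m only the innovation at j matters;
  earlier ones act through lags beyond \<open>m\<close>, and at all other times the process lies
  below the support of f. The error counts only innovations larger than \<eta>/(2K) and lags with
  |\<kappa> l| > \<eta>/(2R). That number depends on neither \<epsilon> nor m, so the modulus
  \<open>e\<close> can be fixed before these two.\<close>

lemma cluster_approximation:
  fixes x y z \<kappa> :: "nat \<Rightarrow> real" and n m :: nat
  assumes f: "plane_test \<eta> f" and n: "n > 0"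
    and J_def: "J = {j \<in> {1..n}. \<epsilon> < \<bar>x j\<bar>}"
    and y: "\<And>i. i \<in> {1..n} \<Longrightarrow> y i = (\<Sum>j | j \<in> J \<and> j \<le> i. \<kappa> (i - j) * x j) + z i"
    and z: "\<And>i. i \<in> {1..n} \<Longrightarrow> \<bar>z i\<bar> \<le> \<delta>" and \<delta>: "0 < \<delta>" "4 * \<delta> \<le> \<eta>"
    and sep: "\<And>j j'. j \<in> J \<Longrightarrow> j' \<in> J \<Longrightarrow> j < j' \<Longrightarrow> j + m < j'"
    and edge: "\<And>j. j \<in> J \<Longrightarrow> j + m \<le> n"
    and R: "\<And>j. j \<in> {1..n} \<Longrightarrow> \<bar>x j\<bar> \<le> R" "R > 0"
    and K1: "card J \<le> K1" and far: "\<And>l. m < l \<Longrightarrow> \<bar>\<kappa> l\<bar> * (real K1 * R) \<le> \<delta>"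
    and K: "\<And>l. \<bar>\<kappa> l\<bar> \<le> K" "K > 0" and \<epsilon>: "0 < \<epsilon>" "\<epsilon> \<le> \<eta> / (2 * K)"
    and K0: "card {j \<in> {1..n}. \<eta> / (2 * K) < \<bar>x j\<bar>} \<le> K0"
    and Ls: "finite {l. \<eta> / (2 * R) < \<bar>\<kappa> l\<bar>}" "card {l. \<eta> / (2 * R) < \<bar>\<kappa> l\<bar>} \<le> L"
    and unif: "\<And>s t u v. \<bar>s - t\<bar> < d \<Longrightarrow> \<bar>u - v\<bar> < d \<Longrightarrow> \<bar>f s u - f t v\<bar> < e"
    and d: "real m / real n < d" "2 * \<delta> < d"
  shows "\<bar>(\<Sum>i=1..n. f (real i / real n) (y i)) - (\<Sum>j=1..n. \<Sum>l\<le>m. f (real j / real n) (\<kappa> l * x j))\<bar> \<le> real K0 * real L * e"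
proof -
  note fD = plane_testD[OF f]
  have finJ: "finite J" unfolding J_def by simp
  have Jsub: "J \<subseteq> {1..n}" unfolding J_def by auto
  have "e > 0" using unif[of 0 0 0 0] d \<delta> by (smt (verit))
  \<comment> \<open>There are at most K1 large innovations, and beyond lag \<open>m\<close> each
    contributes at most \<delta>/K1.\<close>
  have rest: "\<bar>\<Sum>j\<in>A. \<kappa> (i - j) * x j\<bar> \<le> \<delta>" if A: "A \<subseteq> {j \<in> J. j + m < i}" for A i
  proof -
    have "finite A" using A finJ by (auto intro: finite_subset)
    have "A \<subseteq> J" using A by auto
    then have cardA: "card A \<le> K1" using card_mono[OF finJ] K1 by (meson le_trans)
    show ?thesis
    proof (cases "A = {}")
      case False
      then have "card A > 0" using \<open>finite A\<close> by (simp add: card_gt_0_iff)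
      have K1pos: "real K1 > 0" using cardA \<open>card A > 0\<close> by simp
      have "\<bar>\<Sum>j\<in>A. \<kappa> (i - j) * x j\<bar> \<le> (\<Sum>j\<in>A. \<bar>\<kappa> (i - j) * x j\<bar>)" by (rule sum_abs)
      also have "\<dots> \<le> (\<Sum>j\<in>A. \<delta> / real K1)"
      proof (rule sum_mono)
        fix j assume j: "j \<in> A"
        then have "m < i - j" "j \<in> {1..n}" using A Jsub by auto
        have "\<bar>\<kappa> (i - j) * x j\<bar> \<le> \<bar>\<kappa> (i - j)\<bar> * R" unfolding abs_mult using R(1)[OF \<open>j \<in> {1..n}\<close>] by (intro mult_left_mono) auto
        also have "\<dots> \<le> \<delta> / real K1" using far[OF \<open>m < i - j\<close>] K1pos by (simp add: field_simps)
        finally show "\<bar>\<kappa> (i - j) * x j\<bar> \<le> \<delta> / real K1" .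
      qed
      also have "\<dots> = real (card A) * (\<delta> / real K1)" by simp
      also have "\<dots> \<le> real K1 * (\<delta> / real K1)" using cardA \<delta> by (intro mult_right_mono) auto
      finally show ?thesis using K1pos by simp
    qed (use \<delta> in simp)
  qed
  have near: "\<bar>y (j + l) - \<kappa> l * x j\<bar> \<le> 2 * \<delta>" if j: "j \<in> J" and l: "l \<le> m" for j l
  proof -
    have i: "j + l \<in> {1..n}" using edge[OF j] l j Jsub by auto
    let ?A = "{j' \<in> J. j' \<le> j + l}"
    have "j \<in> ?A" using j by simp
    have "(\<Sum>j' | j' \<in> J \<and> j' \<le> j + l. \<kappa> (j + l - j') * x j') = \<kappa> l * x j + (\<Sum>j'\<in>?A - {j}. \<kappa> (j + l - j') * x j')"
      using finJ \<open>j \<in> ?A\<close> by (subst sum.remove[of ?A j]) auto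
    moreover have "\<bar>\<Sum>j'\<in>?A - {j}. \<kappa> (j + l - j') * x j'\<bar> \<le> \<delta>"
    proof (rule rest, safe)
      fix j' assume j': "j' \<in> J" "j' \<le> j + l" "j' \<noteq> j"
      have "j' < j"
      proof (rule ccontr)
        assume "\<not> j' < j" then have "j < j'" using j' by simp
        from sep[OF j j'(1) this] show False using j'(2) l by simp
      qed
      from sep[OF j'(1) j this] show "j' + m < j + l" by simp
    qed
    ultimately show ?thesis using y[OF i] z[OF i] by linarith
  qed
  \<comment> \<open>At a time outside all clusters every past large innovation is more than
    \<open>m\<close> steps back. Hence |y i| <= 2 \<delta> <= \<eta>, where f vanishes.\<close>
  have away: "f (real i / real n) (y i) = 0" if i: "i \<in> {1..n}" and no: "\<And>j l. j \<in> J \<Longrightarrow> l \<le> m \<Longrightarrow> i \<noteq> j + l" for i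
  proof -
    have "\<bar>\<Sum>j | j \<in> J \<and> j \<le> i. \<kappa> (i - j) * x j\<bar> \<le> \<delta>"
    proof (rule rest, safe)
      fix j assume j: "j \<in> J" "j \<le> i"
      show "j + m < i" using no[OF j(1), of "i - j"] j(2) by (cases "i - j \<le> m") auto
    qed
    then have "\<bar>y i\<bar> \<le> \<eta>" using y[OF i] z[OF i] \<delta> by linarith
    then show ?thesis by (rule fD(4))
  qed
  have inj: "inj_on (\<lambda>(j, l). j + l) (J \<times> {..m})"
  proof (rule inj_onI, clarify)
    fix j l j' l' assume a: "j \<in> J" "l \<le> m" "j' \<in> J" "l' \<le> m" "j + l = j' + l'"
    have "j = j'"
    proof (rule ccontr)
      assume "j \<noteq> j'"
      then consider "j < j'" | "j' < j" by linarith
      then show False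
      proof cases
        case 1 with sep[OF a(1,3) 1] a show False by simp
      next
        case 2 with sep[OF a(3,1) 2] a show False by simp
      qed
    qed
    with a show "j = j' \<and> l = l'" by simp
  qed
  have img: "(\<lambda>(j, l). j + l) ` (J \<times> {..m}) \<subseteq> {1..n}"
  proof (safe)
    fix j l assume "j \<in> J" "l \<le> m"
    then show "j + l \<in> {1..n}" using edge[of j] Jsub by force
  qed
  have "(\<Sum>i=1..n. f (real i / real n) (y i)) = (\<Sum>i\<in>(\<lambda>(j, l). j + l) ` (J \<times> {..m}). f (real i / real n) (y i))"
  proof (rule sum.mono_neutral_right[OF _ img])
    show "\<forall>i\<in>{1..n} - (\<lambda>(j, l). j + l) ` (J \<times> {..m}). f (real i / real n) (y i) = 0"
    proof
      fix i assume i: "i \<in> {1..n} - (\<lambda>(j, l). j + l) ` (J \<times> {..m})"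
      show "f (real i / real n) (y i) = 0"
      proof (rule away)
        show "i \<noteq> j + l" if "j \<in> J" "l \<le> m" for j l
          using i that by force
      qed (use i in auto)
    qed
  qed simp
  also have "\<dots> = (\<Sum>(j, l)\<in>J \<times> {..m}. f (real (j + l) / real n) (y (j + l)))"
    by (subst sum.reindex[OF inj]) (simp add: case_prod_unfold o_def)
  also have "\<dots> = (\<Sum>j\<in>J. \<Sum>l\<le>m. f (real (j + l) / real n) (y (j + l)))" by (rule sum.cartesian_product[symmetric])
  finally have S1: "(\<Sum>i=1..n. f (real i / real n) (y i)) = (\<Sum>j\<in>J. \<Sum>l\<le>m. f (real (j + l) / real n) (y (j + l)))" .
  have S2: "(\<Sum>j=1..n. \<Sum>l\<le>m. f (real j / real n) (\<kappa> l * x j)) = (\<Sum>j\<in>J. \<Sum>l\<le>m. f (real j / real n) (\<kappa> l * x j))"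
  proof (rule sum.mono_neutral_right[OF _ Jsub])
    show "\<forall>j\<in>{1..n} - J. (\<Sum>l\<le>m. f (real j / real n) (\<kappa> l * x j)) = 0"
    proof (intro ballI sum.neutral)
      fix j l assume "j \<in> {1..n} - J"
      then have "\<bar>x j\<bar> \<le> \<epsilon>" by (auto simp: J_def)
      then have "\<bar>\<kappa> l * x j\<bar> \<le> K * (\<eta> / (2 * K))" unfolding abs_mult using K \<epsilon> by (intro mult_mono) auto
      also have "\<dots> \<le> \<eta>" using K fD(1) by simp
      finally show "f (real j / real n) (\<kappa> l * x j) = 0" by (rule fD(4))
    qed
  qed simp
  define J0 where "J0 = {j \<in> {1..n}. \<eta> / (2 * K) < \<bar>x j\<bar>}"
  define Lset where "Lset = {l. \<eta> / (2 * R) < \<bar>\<kappa> l\<bar>}"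
  \<comment> \<open>Outside \<open>J0\<close> times \<open>Lset\<close> the ideal value is at most
    \<eta>/2, and the actual one differs by at most 2 \<delta> <= \<eta>/2; f is 0 at both. Only the
    remaining pairs can contribute, each by at most \<open>e\<close>.\<close>
  have termwise: "\<bar>f (real (j + l) / real n) (y (j + l)) - f (real j / real n) (\<kappa> l * x j)\<bar> \<le> e * (indicator J0 j * indicator Lset l)"
    if j: "j \<in> J" and l: "l \<le> m" for j l
  proof -
    have jn: "j \<in> {1..n}" using j Jsub by auto
    show ?thesis
    proof (cases "j \<in> J0 \<and> l \<in> Lset")
      case True
      have "\<bar>real (j + l) / real n - real j / real n\<bar> = real l / real n" by (simp add: add_divide_distrib)
      also have "\<dots> \<le> real m / real n" using l by (intro divide_right_mono) auto
      finally have "\<bar>real (j + l) / real n - real j / real n\<bar> < d" using d by linarith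
      moreover have "\<bar>y (j + l) - \<kappa> l * x j\<bar> < d" using near[OF j l] d by linarith
      ultimately show ?thesis using True unif by (simp add: less_imp_le)
    next
      case False
      have "\<bar>\<kappa> l * x j\<bar> \<le> \<eta> / 2"
      proof (cases "j \<in> J0")
        case True
        with False have "\<bar>\<kappa> l\<bar> \<le> \<eta> / (2 * R)" by (auto simp: Lset_def)
        then have "\<bar>\<kappa> l * x j\<bar> \<le> \<eta> / (2 * R) * R" unfolding abs_mult using R(1)[OF jn] R(2) fD(1) by (intro mult_mono) auto
        then show ?thesis using R(2) by simp
      next
        case False
        then have "\<bar>x j\<bar> \<le> \<eta> / (2 * K)" using jn by (auto simp: J0_def)
        then have "\<bar>\<kappa> l * x j\<bar> \<le> K * (\<eta> / (2 * K))" unfolding abs_mult using K by (intro mult_mono) auto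
        then show ?thesis using K by simp
      qed
      moreover from this have "\<bar>y (j + l)\<bar> \<le> \<eta>" using near[OF j l] \<delta> by linarith
      ultimately have "f (real (j + l) / real n) (y (j + l)) = 0" "f (real j / real n) (\<kappa> l * x j) = 0"
        using fD(1) by (auto intro!: fD(4))
      then show ?thesis using \<open>e > 0\<close> by simp
    qed
  qed
  have "\<bar>(\<Sum>i=1..n. f (real i / real n) (y i)) - (\<Sum>j=1..n. \<Sum>l\<le>m. f (real j / real n) (\<kappa> l * x j))\<bar>
     = \<bar>\<Sum>j\<in>J. \<Sum>l\<le>m. f (real (j + l) / real n) (y (j + l)) - f (real j / real n) (\<kappa> l * x j)\<bar>"
    unfolding S1 S2 by (simp add: sum_subtractf)
  also have "\<dots> \<le> (\<Sum>j\<in>J. \<Sum>l\<le>m. \<bar>f (real (j + l) / real n) (y (j + l)) - f (real j / real n) (\<kappa> l * x j)\<bar>)"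
    by (intro order_trans[OF sum_abs] sum_mono sum_abs)
  also have "\<dots> \<le> (\<Sum>j\<in>J. \<Sum>l\<le>m. e * (indicator J0 j * indicator Lset l))"
    by (intro sum_mono termwise) auto
  also have "\<dots> = e * ((\<Sum>j\<in>J. indicator J0 j) * (\<Sum>l\<le>m. indicator Lset l))"
    unfolding sum_product by (subst sum_distrib_left, intro sum.cong refl, rule sum_distrib_left[symmetric])
  also have "(\<Sum>j\<in>J. indicator J0 j) = real (card (J \<inter> J0))" using finJ by (simp add: indicator_def sum_of_bool_eq)
  also have "(\<Sum>l\<le>m. indicator Lset l) = real (card ({..m} \<inter> Lset))" by (simp add: indicator_def sum_of_bool_eq)
  also have "e * (real (card (J \<inter> J0)) * real (card ({..m} \<inter> Lset))) \<le> e * (real K0 * real L)"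
  proof (intro mult_left_mono mult_mono of_nat_mono)
    show "card (J \<inter> J0) \<le> K0" using card_mono[of J0 "J \<inter> J0"] K0 by (simp add: J0_def)
    show "card ({..m} \<inter> Lset) \<le> L" using card_mono[of Lset "{..m} \<inter> Lset"] Ls by (simp add: Lset_def)
  qed (use \<open>e > 0\<close> in auto)
  finally show ?thesis by (simp add: mult_ac)
qed

text \<open>Needed for the centring: the sum of the |\<kappa> l| may diverge, but it is o(n), and
  the bias of each truncated innovation is O(b_n / n).\<close>

lemma cesaro_zero:
  fixes c :: "nat \<Rightarrow> real"
  assumes c: "c \<longlonglongrightarrow> 0" and c0: "\<And>l. 0 \<le> c l"
  shows "(\<lambda>n. (\<Sum>l<n. c l) / real n) \<longlonglongrightarrow> 0"
proof (rule LIMSEQ_I)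
  fix e :: real assume "e > 0"
  then have "\<forall>\<^sub>F l in sequentially. c l < e / 2" using order_tendstoD(2)[OF c, of "e/2"] by simp
  then obtain N where N: "\<And>l. l \<ge> N \<Longrightarrow> c l < e / 2" by (auto simp: eventually_sequentially)
  define A where "A = (\<Sum>l<N. c l)"
  obtain n1 where n1: "2 * A / e < real n1" using reals_Archimedean2 by blast
  have "norm ((\<Sum>l<n. c l) / real n - 0) < e" if n: "n \<ge> max (Suc n1) (Suc N)" for n
  proof -
    have "(\<Sum>l<n. c l) = A + (\<Sum>l=N..<n. c l)" unfolding A_def
      using n by (subst sum.atLeastLessThan_concat[of 0 N n "c", symmetric, unfolded atLeast0LessThan]) auto
    also have "(\<Sum>l=N..<n. c l) \<le> (\<Sum>l=N..<n. e / 2)" by (intro sum_mono) (use N in \<open>auto intro: less_imp_le\<close>)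
    also have "\<dots> \<le> real n * (e / 2)" using \<open>e > 0\<close> by simp
    finally have "(\<Sum>l<n. c l) \<le> A + real n * (e / 2)" by simp
    moreover have "A < real n * (e / 2)"
    proof -
      have "2 * A / e < real n" using n n1 by linarith
      then show ?thesis using \<open>e > 0\<close> by (simp add: field_simps)
    qed
    ultimately have "(\<Sum>l<n. c l) < real n * e" by simp
    moreover have "0 \<le> (\<Sum>l<n. c l)" by (intro sum_nonneg c0)
    ultimately show ?thesis using n by (simp add: field_simps)
  qed
  then show "\<exists>n0. \<forall>n\<ge>n0. norm ((\<Sum>l<n. c l) / real n - 0) < e" by blast
qed

text \<open>Split at |\<kappa> l| <= n^(-1/r'): small coefficients have squares at most n^(-2/r'),
  large ones are compared with their summable r'-th powers. A polynomial rate is essential, since it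
  has to beat a power of n produced by the exponential moments; convergence of \<kappa> to 0 alone
  would give no rate.\<close>

lemma square_sum_growth:
  fixes \<kappa> :: "nat \<Rightarrow> real"
  assumes lim: "\<kappa> \<longlonglongrightarrow> 0" and r: "0 < r" "summable (\<lambda>i. \<bar>\<kappa> i\<bar> powr r)"
  shows "\<exists>\<tau>>0. \<exists>C\<ge>0. \<forall>n\<ge>1. (\<Sum>l<n. (\<kappa> l)\<^sup>2) / real n \<le> C * real n powr (- \<tau>)"
proof -
  \<comment> \<open>Raising the exponent preserves summability, because the coefficients are
    eventually below 1, and r' >= 2 gives the comparison of squares with r'-th powers the right
    direction.\<close>
  define r' where "r' = max r 2"
  have r': "r' \<ge> 2" "r' \<ge> r" by (auto simp: r'_def)
  have sm: "summable (\<lambda>i. \<bar>\<kappa> i\<bar> powr r')"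
  proof (rule summable_comparison_test_ev[OF _ r(2)])
    have "(\<lambda>i. \<bar>\<kappa> i\<bar>) \<longlonglongrightarrow> 0" using lim by (rule tendsto_rabs_zero)
    then have "\<forall>\<^sub>F i in sequentially. \<bar>\<kappa> i\<bar> < 1" by (rule order_tendstoD) simp
    then show "\<forall>\<^sub>F i in sequentially. norm (\<bar>\<kappa> i\<bar> powr r') \<le> \<bar>\<kappa> i\<bar> powr r"
      by eventually_elim (use r' in \<open>auto intro!: powr_mono'\<close>)
  qed
  define S where "S = (\<Sum>i. \<bar>\<kappa> i\<bar> powr r')"
  have S0: "S \<ge> 0" unfolding S_def by (intro suminf_nonneg sm) auto
  have "(\<Sum>l<n. (\<kappa> l)\<^sup>2) / real n \<le> (1 + S) * real n powr (- (2 / r'))" if n: "n \<ge> 1" for n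
  proof -
    let ?c = "real n powr (- (1 / r'))"
    have cpos: "?c > 0" using n by simp
    have key: "(\<kappa> l)\<^sup>2 \<le> real n powr (- (2 / r')) + \<bar>\<kappa> l\<bar> powr r' * real n powr (1 - 2 / r')" for l
    proof (cases "\<bar>\<kappa> l\<bar> \<le> ?c")
      case True
      then have "\<bar>\<kappa> l\<bar>\<^sup>2 \<le> ?c\<^sup>2" by (intro power_mono) auto
      also have "?c\<^sup>2 = ?c powr 2" using cpos by simp
      also have "\<dots> = real n powr (- (2 / r'))" by (simp add: powr_powr)
      finally show ?thesis by (simp add: add_increasing2)
    next
      case False
      then have k: "\<bar>\<kappa> l\<bar> > 0" "?c < \<bar>\<kappa> l\<bar>" using cpos by auto
      have "\<bar>\<kappa> l\<bar> powr (2 - r') \<le> ?c powr (2 - r')" using k cpos r' by (intro powr_mono2') auto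
      also have "?c powr (2 - r') = real n powr (1 - 2 / r')"
      proof -
        have "- (1 / r') * (2 - r') = 1 - 2 / r'" using r' by (simp add: field_simps)
        then show ?thesis by (simp only: powr_powr)
      qed
      finally have "\<bar>\<kappa> l\<bar> powr r' * \<bar>\<kappa> l\<bar> powr (2 - r') \<le> \<bar>\<kappa> l\<bar> powr r' * real n powr (1 - 2 / r')" by (rule mult_left_mono) simp
      also have "\<bar>\<kappa> l\<bar> powr r' * \<bar>\<kappa> l\<bar> powr (2 - r') = \<bar>\<kappa> l\<bar> powr 2" by (simp add: powr_add[symmetric])
      also have "\<dots> = (\<kappa> l)\<^sup>2" using k by simp
      finally show ?thesis by (simp add: add_increasing)
    qed
    have "(\<Sum>l<n. (\<kappa> l)\<^sup>2) \<le> (\<Sum>l<n. real n powr (- (2 / r')) + \<bar>\<kappa> l\<bar> powr r' * real n powr (1 - 2 / r'))" by (intro sum_mono key)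
    also have "\<dots> = real n * real n powr (- (2 / r')) + (\<Sum>l<n. \<bar>\<kappa> l\<bar> powr r') * real n powr (1 - 2 / r')"
      by (simp add: sum.distrib sum_distrib_right)
    also have "(\<Sum>l<n. \<bar>\<kappa> l\<bar> powr r') \<le> S" unfolding S_def by (intro sum_le_suminf sm) auto
    also have "real n powr (1 - 2 / r') = real n * real n powr (- (2 / r'))" using n by (simp add: powr_diff powr_minus field_simps)
    finally have "(\<Sum>l<n. (\<kappa> l)\<^sup>2) \<le> real n * real n powr (- (2 / r')) + S * (real n * real n powr (- (2 / r')))" by (simp add: mult_right_mono)
    then show ?thesis using n by (simp add: field_simps)
  qed
  moreover have "2 / r' > 0" using r' by simp
  ultimately show ?thesis using S0 by (intro exI[of _ "2 / r'"] conjI exI[of _ "1 + S"]) auto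
qed

lemma exp_quadratic_bound: "exp x \<le> 1 + x + x\<^sup>2 * exp \<bar>x\<bar>" for x :: real
proof -
  obtain t where t: "\<bar>t\<bar> \<le> \<bar>x\<bar>" "exp x = (\<Sum>m<2. (x ^ m) / fact m) + (exp t / fact 2) * x ^ 2"
    using Maclaurin_exp_le[of x 2] by blast
  have "exp t / fact 2 * x ^ 2 \<le> exp \<bar>x\<bar> * x\<^sup>2"
  proof (intro mult_right_mono)
    have "exp t / fact 2 \<le> exp t" by simp
    also have "\<dots> \<le> exp \<bar>x\<bar>" using t(1) by simp
    finally show "exp t / fact 2 \<le> exp \<bar>x\<bar>" .
  qed simp
  then show ?thesis using t(2) by (simp add: numeral_2_eq_2 mult.commute)
qed

section \<open>Uniform negligibility of the small innovations\<close>

locale linear_process = iid_attraction \<mu> \<nu> a b \<alpha> M X p q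
  for \<mu> \<nu> :: "real measure" and a b :: "nat \<Rightarrow> real" and \<alpha> :: real and M :: "'s measure"
    and X :: "nat \<Rightarrow> 's \<Rightarrow> real" and p q :: real +
  fixes \<kappa> :: "nat \<Rightarrow> real" and r :: real
  assumes kappa_lim: "\<kappa> \<longlonglongrightarrow> 0" and r_pos: "0 < r" and kappa_sum: "summable (\<lambda>i. \<bar>\<kappa> i\<bar> powr r)"
begin

definition ctr :: "nat \<Rightarrow> real" where
  "ctr n = (LINT x:{quantile F (1 / real n)..quantile F (1 - 1 / real n)}|interval_measure F. x)"

definition trunc :: "real \<Rightarrow> nat \<Rightarrow> real \<Rightarrow> real" where
  "trunc \<epsilon> n y = indicator {- (\<epsilon> * bn n)..\<epsilon> * bn n} y * y"

definition lin_norm :: "nat \<Rightarrow> nat \<Rightarrow> 's \<Rightarrow> real" where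
  "lin_norm n i \<omega> = (\<Sum>j=1..i. \<kappa> (i - j) * (X j \<omega> - ctr n)) / bn n"

text \<open>The whole centring is charged to the small innovations, so that the large ones enter
  uncentred. \<open>centering_difference\<close> shows that it is the right centring for the
  truncated variables up to O(b_n / n).\<close>

definition small_part :: "real \<Rightarrow> nat \<Rightarrow> nat \<Rightarrow> 's \<Rightarrow> real" where
  "small_part \<epsilon> n i \<omega> = (\<Sum>j=1..i. \<kappa> (i - j) * (trunc \<epsilon> n (X j \<omega>) - ctr n)) / bn n"

lemma trunc_measurable [measurable]: "trunc \<epsilon> n \<in> borel_measurable borel"
  unfolding trunc_def by measurable

lemma kappa_bound: "\<exists>K\<ge>1. \<forall>l. \<bar>\<kappa> l\<bar> \<le> K"
proof -
  have "Bseq \<kappa>" using kappa_lim convergent_imp_Bseq convergentI by blast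
  then obtain K where "K > 0" "\<And>l. norm (\<kappa> l) \<le> K" by (auto simp: Bseq_def)
  then show ?thesis by (intro exI[of _ "max K 1"]) (auto intro: max.coboundedI1)
qed

lemma small_part_measurable [measurable]: "random_variable borel (small_part \<epsilon> n i)"
proof -
  have "random_variable borel (\<lambda>\<omega>. \<kappa> (i - j) * (trunc \<epsilon> n (X j \<omega>) - ctr n))" if "j \<in> {1..i}" for j
    using measurable_compose[OF X_rv trunc_measurable] that by auto
  then show ?thesis unfolding small_part_def by (intro borel_measurable_divide borel_measurable_sum) auto
qed

lemma lin_norm_measurable [measurable]: "random_variable borel (lin_norm n i)"
proof -
  have "random_variable borel (\<lambda>\<omega>. \<kappa> (i - j) * (X j \<omega> - ctr n))" if "j \<in> {1..i}" for j
    using X_rv[of j] that by auto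
  then show ?thesis unfolding lin_norm_def by (intro borel_measurable_divide borel_measurable_sum) auto
qed

lemma lag_sum: "(\<Sum>j=1..i. c (i - j)) = (\<Sum>l<i. c l)" for c :: "nat \<Rightarrow> real"
  by (rule sum.reindex_bij_witness[of _ "\<lambda>l. i - l" "\<lambda>j. i - j"]) auto

text \<open>Exponential Chebyshev inequality with parameter of order \<open>ln n\<close>: the variance of the truncated
  sum decays like a power of \<open>n\<close>, and the factor \<open>exp (lam * bound)\<close> is a small power of \<open>n\<close> once the
  truncation level is small.\<close>

lemma exp_moment_bound:
  assumes eps: "0 < \<epsilon>" and bnp: "0 < bn n" and i: "i \<le> n" and K: "\<And>l. \<bar>\<kappa> l\<bar> \<le> K" "K \<ge> 1" and la: "0 \<le> lam"
    and s: "\<bar>s\<bar> = 1"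
    and var: "(\<integral>y. (trunc \<epsilon> n y)\<^sup>2 \<partial>\<mu>) \<le> v * (bn n)\<^sup>2"
  defines "mm \<equiv> (\<integral>y. trunc \<epsilon> n y \<partial>\<mu>)"
  defines "Ys \<equiv> (\<lambda>\<omega>. s * (\<Sum>j=1..i. \<kappa> (i - j) * ((trunc \<epsilon> n (X j \<omega>) - mm) / bn n)))"
  shows "integrable M (\<lambda>\<omega>. exp (lam * Ys \<omega>))"
    and "expectation (\<lambda>\<omega>. exp (lam * Ys \<omega>)) \<le> exp (lam\<^sup>2 * v * exp (2 * lam * K * \<epsilon>) * (\<Sum>l<n. (\<kappa> l)\<^sup>2))"
proof -
  interpret mu: real_distribution \<mu> by (rule mu)
  have v0: "v \<ge> 0"
  proof -
    have "0 \<le> (\<integral>y. (trunc \<epsilon> n y)\<^sup>2 \<partial>\<mu>)" by (intro integral_nonneg_AE AE_I2) auto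
    then have "0 \<le> v * (bn n)\<^sup>2" using var by linarith
    then show ?thesis using bnp by (simp add: zero_le_mult_iff)
  qed
  have tb: "\<bar>trunc \<epsilon> n y\<bar> \<le> \<epsilon> * bn n" for y using eps bnp by (auto simp: trunc_def indicator_def)
  have tint: "integrable \<mu> (trunc \<epsilon> n)" by (rule mu.integrable_const_bound[of _ "\<epsilon> * bn n"]) (auto simp: tb)
  have tint2: "integrable \<mu> (\<lambda>y. (trunc \<epsilon> n y)\<^sup>2)"
    by (rule mu.integrable_const_bound[of _ "(\<epsilon> * bn n)\<^sup>2"]) (use tb eps bnp in \<open>auto intro!: power_mono simp: abs_le_square_iff[symmetric]\<close>)
  have mmb: "\<bar>mm\<bar> \<le> \<epsilon> * bn n"
  proof -
    have "\<bar>mm\<bar> \<le> (\<integral>y. \<bar>trunc \<epsilon> n y\<bar> \<partial>\<mu>)" unfolding mm_def by (rule integral_abs_bound)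
    also have "\<dots> \<le> (\<integral>y. \<epsilon> * bn n \<partial>\<mu>)" using tint tb by (intro integral_mono) auto
    finally show ?thesis using mu.prob_space by simp
  qed
  define Z where "Z y = (trunc \<epsilon> n y - mm) / bn n" for y
  have [measurable]: "Z \<in> borel_measurable borel" unfolding Z_def by measurable
  have Zb: "\<bar>Z y\<bar> \<le> 2 * \<epsilon>" for y
  proof -
    have "\<bar>trunc \<epsilon> n y - mm\<bar> \<le> 2 * \<epsilon> * bn n" using tb[of y] mmb by linarith
    then show ?thesis unfolding Z_def using bnp by (simp add: abs_divide pos_divide_le_eq)
  qed
  have Zint: "integrable \<mu> Z" by (rule mu.integrable_const_bound[of _ "2 * \<epsilon>"]) (auto simp: Zb)
  have Zint2: "integrable \<mu> (\<lambda>y. (Z y)\<^sup>2)"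
  proof (rule mu.integrable_const_bound[of _ "(2 * \<epsilon>)\<^sup>2"])
    have "\<bar>Z y\<bar>\<^sup>2 \<le> (2 * \<epsilon>)\<^sup>2" for y using Zb by (intro power_mono) auto
    then show "AE y in \<mu>. norm ((Z y)\<^sup>2) \<le> (2 * \<epsilon>)\<^sup>2" by (intro AE_I2) simp
  qed measurable
  have Zmean: "(\<integral>y. Z y \<partial>\<mu>) = 0"
    unfolding Z_def using tint mu.prob_space by (simp add: mm_def)
  have Zvar: "(\<integral>y. (Z y)\<^sup>2 \<partial>\<mu>) \<le> v"
  proof -
    have "(\<integral>y. (trunc \<epsilon> n y - mm)\<^sup>2 \<partial>\<mu>) = (\<integral>y. (trunc \<epsilon> n y)\<^sup>2 \<partial>\<mu>) - mm\<^sup>2"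
    proof -
      have "(\<integral>y. (trunc \<epsilon> n y - mm)\<^sup>2 \<partial>\<mu>) = (\<integral>y. (trunc \<epsilon> n y)\<^sup>2 - 2 * mm * trunc \<epsilon> n y + mm\<^sup>2 \<partial>\<mu>)"
        by (intro Bochner_Integration.integral_cong refl) (simp add: power2_diff algebra_simps)
      also have "\<dots> = (\<integral>y. (trunc \<epsilon> n y)\<^sup>2 \<partial>\<mu>) - 2 * mm * mm + mm\<^sup>2"
        using tint tint2 mu.prob_space by (simp add: mm_def)
      finally show ?thesis by (simp add: power2_eq_square)
    qed
    then have "(\<integral>y. (Z y)\<^sup>2 \<partial>\<mu>) = ((\<integral>y. (trunc \<epsilon> n y)\<^sup>2 \<partial>\<mu>) - mm\<^sup>2) / (bn n)\<^sup>2"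
      unfolding Z_def power_divide by simp
    also have "\<dots> \<le> (v * (bn n)\<^sup>2) / (bn n)\<^sup>2" using var by (intro divide_right_mono) (auto intro: order_trans[of _ "(\<integral>y. (trunc \<epsilon> n y)\<^sup>2 \<partial>\<mu>)"])
    finally show ?thesis using bnp by simp
  qed
  have one: "(\<integral>y. exp (lam * (s * (\<kappa> l * Z y))) \<partial>\<mu>) \<le> exp (lam\<^sup>2 * v * exp (2 * lam * K * \<epsilon>) * (\<kappa> l)\<^sup>2)" for l
  proof -
    let ?c = "lam * (s * \<kappa> l)"
    have cb: "\<bar>?c * Z y\<bar> \<le> 2 * lam * K * \<epsilon>" for y
    proof -
      have "\<bar>?c * Z y\<bar> = lam * \<bar>\<kappa> l\<bar> * \<bar>Z y\<bar>" using s la by (simp add: abs_mult)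
      also have "\<dots> \<le> lam * K * (2 * \<epsilon>)" using la K Zb by (intro mult_mono) auto
      finally show ?thesis by (simp add: mult_ac)
    qed
    have c2: "?c\<^sup>2 = lam\<^sup>2 * (\<kappa> l)\<^sup>2"
    proof -
      have "s\<^sup>2 = 1" using s by (metis one_power2 power2_abs)
      then show ?thesis by (simp add: power_mult_distrib)
    qed
    \<comment> \<open>Expansion to second order with the exponential remainder bounded uniformly.
      The linear term integrates to 0 because \<open>Z\<close> is centred at its own mean.\<close>
    have "(\<integral>y. exp (?c * Z y) \<partial>\<mu>) \<le> (\<integral>y. 1 + ?c * Z y + exp (2 * lam * K * \<epsilon>) * ?c\<^sup>2 * (Z y)\<^sup>2 \<partial>\<mu>)"
    proof (rule integral_mono)
      show "integrable \<mu> (\<lambda>y. exp (?c * Z y))"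
      proof (rule mu.integrable_const_bound[of _ "exp (2 * lam * K * \<epsilon>)"])
        show "AE y in \<mu>. norm (exp (?c * Z y)) \<le> exp (2 * lam * K * \<epsilon>)"
          using cb by (intro AE_I2) (simp add: abs_le_iff)
      qed measurable
      show "integrable \<mu> (\<lambda>y. 1 + ?c * Z y + exp (2 * lam * K * \<epsilon>) * ?c\<^sup>2 * (Z y)\<^sup>2)"
        using Zint Zint2 by simp
      fix y
      have "exp (?c * Z y) \<le> 1 + ?c * Z y + (?c * Z y)\<^sup>2 * exp \<bar>?c * Z y\<bar>" by (rule exp_quadratic_bound)
      also have "(?c * Z y)\<^sup>2 * exp \<bar>?c * Z y\<bar> \<le> (?c * Z y)\<^sup>2 * exp (2 * lam * K * \<epsilon>)"
        using cb by (intro mult_left_mono) auto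
      also have "(?c * Z y)\<^sup>2 = ?c\<^sup>2 * (Z y)\<^sup>2" by (rule power_mult_distrib)
      finally show "exp (?c * Z y) \<le> 1 + ?c * Z y + exp (2 * lam * K * \<epsilon>) * ?c\<^sup>2 * (Z y)\<^sup>2"
        by (simp only: mult_ac)
    qed
    also have "\<dots> = 1 + exp (2 * lam * K * \<epsilon>) * ?c\<^sup>2 * (\<integral>y. (Z y)\<^sup>2 \<partial>\<mu>)"
      using Zint Zint2 mu.prob_space by (simp add: Zmean)
    also have "\<dots> \<le> 1 + exp (2 * lam * K * \<epsilon>) * ?c\<^sup>2 * v"
      using Zvar by (intro add_left_mono mult_left_mono) auto
    also have "\<dots> \<le> exp (exp (2 * lam * K * \<epsilon>) * ?c\<^sup>2 * v)" by (rule exp_ge_add_one_self)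
    finally show ?thesis unfolding c2 by (simp add: mult_ac)
  qed
  have Y_eq: "exp (lam * Ys \<omega>) = (\<Prod>j\<in>{1..i}. exp (lam * (s * (\<kappa> (i - j) * Z (X j \<omega>)))))" for \<omega>
    unfolding Ys_def Z_def by (simp add: exp_sum[symmetric] sum_distrib_left)
  have em: "(\<lambda>x. exp (lam * (s * (\<kappa> l * Z x)))) \<in> borel_measurable borel" for l by measurable
  have ind: "indep_vars (\<lambda>_. borel) (\<lambda>j \<omega>. exp (lam * (s * (\<kappa> (i - j) * Z (X j \<omega>))))) {1..i}"
  proof -
    have "indep_vars (\<lambda>_. borel) X {1..i}" by (rule indep_vars_subset[OF X_indep]) auto
    then show ?thesis by (rule indep_vars_compose2[where Y="\<lambda>j x. exp (lam * (s * (\<kappa> (i - j) * Z x)))"]) (rule em)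
  qed
  have int: "integrable M (\<lambda>\<omega>. exp (lam * (s * (\<kappa> (i - j) * Z (X j \<omega>)))))" if j: "j \<in> {1..i}" for j
  proof (rule integrable_const_bound[of _ "exp (lam * (K * (2 * \<epsilon>)))"])
    have "lam * (s * (\<kappa> l * Z x)) \<le> lam * (K * (2 * \<epsilon>))" for l x
    proof (rule mult_left_mono[OF _ la])
      have "\<bar>s * (\<kappa> l * Z x)\<bar> \<le> 1 * (K * (2 * \<epsilon>))" unfolding abs_mult s using K Zb by (intro mult_mono) auto
      then show "s * (\<kappa> l * Z x) \<le> K * (2 * \<epsilon>)" by linarith
    qed
    then show "AE \<omega> in M. norm (exp (lam * (s * (\<kappa> (i - j) * Z (X j \<omega>))))) \<le> exp (lam * (K * (2 * \<epsilon>)))" by simp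
    show "(\<lambda>\<omega>. exp (lam * (s * (\<kappa> (i - j) * Z (X j \<omega>))))) \<in> borel_measurable M"
      by (rule measurable_compose[OF X_rv em]) (use j in simp)
  qed
  show "integrable M (\<lambda>\<omega>. exp (lam * Ys \<omega>))"
    unfolding Y_eq by (rule indep_vars_integrable[OF _ ind int]) auto
  have "expectation (\<lambda>\<omega>. exp (lam * Ys \<omega>)) = (\<Prod>j\<in>{1..i}. expectation (\<lambda>\<omega>. exp (lam * (s * (\<kappa> (i - j) * Z (X j \<omega>))))))"
    unfolding Y_eq by (rule indep_vars_lebesgue_integral[OF _ ind int]) auto
  also have "\<dots> = (\<Prod>j\<in>{1..i}. (\<integral>y. exp (lam * (s * (\<kappa> (i - j) * Z y))) \<partial>\<mu>))"
  proof (rule prod.cong[OF refl])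
    fix j assume j: "j \<in> {1..i}"
    have "(\<integral>y. exp (lam * (s * (\<kappa> (i - j) * Z y))) \<partial>distr M borel (X j)) = expectation (\<lambda>\<omega>. exp (lam * (s * (\<kappa> (i - j) * Z (X j \<omega>)))))"
      by (rule integral_distr[OF X_rv em]) (use j in simp)
    then show "expectation (\<lambda>\<omega>. exp (lam * (s * (\<kappa> (i - j) * Z (X j \<omega>))))) = (\<integral>y. exp (lam * (s * (\<kappa> (i - j) * Z y))) \<partial>\<mu>)"
      using X_law[of j] j by simp
  qed
  also have "\<dots> \<le> (\<Prod>j\<in>{1..i}. exp (lam\<^sup>2 * v * exp (2 * lam * K * \<epsilon>) * (\<kappa> (i - j))\<^sup>2))"
    by (intro prod_mono conjI one integral_nonneg_AE AE_I2) auto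
  also have "\<dots> = exp (lam\<^sup>2 * v * exp (2 * lam * K * \<epsilon>) * (\<Sum>j=1..i. (\<kappa> (i - j))\<^sup>2))"
    by (simp add: exp_sum sum_distrib_left)
  also have "\<dots> \<le> exp (lam\<^sup>2 * v * exp (2 * lam * K * \<epsilon>) * (\<Sum>l<n. (\<kappa> l)\<^sup>2))"
  proof -
    have "(\<Sum>j=1..i. (\<kappa> (i - j))\<^sup>2) = (\<Sum>l<i. (\<kappa> l)\<^sup>2)" by (rule lag_sum)
    also have "\<dots> \<le> (\<Sum>l<n. (\<kappa> l)\<^sup>2)" using i by (intro sum_mono2) auto
    finally show ?thesis using v0 by (simp add: mult_left_mono)
  qed
  finally show "expectation (\<lambda>\<omega>. exp (lam * Ys \<omega>)) \<le> exp (lam\<^sup>2 * v * exp (2 * lam * K * \<epsilon>) * (\<Sum>l<n. (\<kappa> l)\<^sup>2))" .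
qed

text \<open>A union bound over n times, each failing with probability O(n^(-2)) on either side. The
  admissible truncation levels depend on \<delta>: smaller deviations need a larger Chebyshev
  parameter and hence smaller jumps.\<close>

lemma small_part_uniform:
  assumes "\<delta> > 0"
  shows "\<exists>\<epsilon>0>0. \<forall>\<epsilon>. 0 < \<epsilon> \<longrightarrow> \<epsilon> \<le> \<epsilon>0 \<longrightarrow>
    (\<lambda>n. prob {\<omega> \<in> space M. \<exists>i\<in>{1..n}. \<delta> < \<bar>small_part \<epsilon> n i \<omega>\<bar>}) \<longlonglongrightarrow> 0"
proof -
  interpret mu: real_distribution \<mu> by (rule mu)
  obtain K where K: "K \<ge> 1" "\<And>l. \<bar>\<kappa> l\<bar> \<le> K" using kappa_bound by blast
  obtain \<tau> C1 where tau: "\<tau> > 0" and C1: "C1 \<ge> 0" "\<And>n. n \<ge> 1 \<Longrightarrow> (\<Sum>l<n. (\<kappa> l)\<^sup>2) / real n \<le> C1 * real n powr (- \<tau>)"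
    using square_sum_growth[OF kappa_lim r_pos kappa_sum] by blast
  obtain C2' where C2': "\<forall>\<^sub>F n in sequentially. real n * (\<integral>y. indicator {- bn n..bn n} y * y\<^sup>2 \<partial>\<mu>) \<le> C2' * (bn n)\<^sup>2"
    using truncated_second_moment by blast
  define C2 where "C2 = max C2' 0"
  have C2: "C2 \<ge> 0" by (simp add: C2_def)
  \<comment> \<open>With parameter A ln n, the denominator exp(A ln n * \<delta>/2) equals n^2. Half
    of \<delta> is reserved for the bias of the centring.\<close>
  define A where "A = 4 / \<delta>"
  have A: "A > 0" using assms by (simp add: A_def)
  \<comment> \<open>Makes the factor exp(2 * la * K * \<epsilon>), a power of n with exponent 2 A K
    \<epsilon>, at most n^(\<tau>/2). It spends only half of the decay n^(-\<tau>) gained in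
    \<open>square_sum_growth\<close>, and the rest beats the squared logarithm.\<close>
  define \<epsilon>0 where "\<epsilon>0 = min 1 (\<tau> / (4 * A * K))"
  have e0: "\<epsilon>0 > 0" using tau A K by (simp add: \<epsilon>0_def)
  have "(\<lambda>n. prob {\<omega> \<in> space M. \<exists>i\<in>{1..n}. \<delta> < \<bar>small_part \<epsilon> n i \<omega>\<bar>}) \<longlonglongrightarrow> 0" if e: "0 < \<epsilon>" "\<epsilon> \<le> \<epsilon>0" for \<epsilon>
  proof -
    have e1: "\<epsilon> \<le> 1" "2 * A * K * \<epsilon> \<le> \<tau> / 2"
    proof -
      show "\<epsilon> \<le> 1" using e by (simp add: \<epsilon>0_def)
      have "\<epsilon> \<le> \<tau> / (4 * A * K)" using e by (simp add: \<epsilon>0_def)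
      moreover have "4 * A * K > 0" using A K by simp
      ultimately show "2 * A * K * \<epsilon> \<le> \<tau> / 2" by (simp add: field_simps)
    qed
    obtain C3' where C3': "\<forall>\<^sub>F n in sequentially. \<bar>(\<integral>y. indicator {- (\<epsilon> * bn n)..\<epsilon> * bn n} y * y \<partial>\<mu>) - ctr n\<bar> \<le> C3' * bn n / real n"
      using centering_difference[OF e(1) e1(1)] unfolding ctr_def by blast
    define mm where "mm n = (\<integral>y. trunc \<epsilon> n y \<partial>\<mu>)" for n
    have C3: "\<forall>\<^sub>F n in sequentially. \<bar>mm n - ctr n\<bar> \<le> C3' * bn n / real n"
      using C3' by (simp add: mm_def trunc_def[abs_def])
    have ces: "(\<lambda>n. C3' * ((\<Sum>l<n. \<bar>\<kappa> l\<bar>) / real n)) \<longlonglongrightarrow> C3' * 0"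
      by (intro tendsto_mult tendsto_const cesaro_zero tendsto_rabs_zero kappa_lim) auto
    have ev_ces: "\<forall>\<^sub>F n in sequentially. C3' * ((\<Sum>l<n. \<bar>\<kappa> l\<bar>) / real n) < \<delta> / 2"
      by (rule order_tendstoD(2)[OF ces]) (use assms in simp)
    have bound_lim: "(\<lambda>n. (A * ln (real n))\<^sup>2 * C2 * real n powr (\<tau> / 2) * (C1 * real n powr (- \<tau>))) \<longlonglongrightarrow> 0"
    proof -
      have "(\<lambda>n. (ln (real n))\<^sup>2 * real n powr (- (\<tau> / 2))) \<longlonglongrightarrow> 0" using tau by real_asymp
      then have "(\<lambda>n. (A\<^sup>2 * C2 * C1) * ((ln (real n))\<^sup>2 * real n powr (- (\<tau> / 2)))) \<longlonglongrightarrow> 0"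
        by (rule tendsto_mult_right_zero)
      moreover have "real n powr (\<tau> / 2) * real n powr (- \<tau>) = real n powr (- (\<tau> / 2))" for n
        by (simp add: powr_add[symmetric])
      then have "(A * ln (real n))\<^sup>2 * C2 * real n powr (\<tau> / 2) * (C1 * real n powr (- \<tau>)) = (A\<^sup>2 * C2 * C1) * ((ln (real n))\<^sup>2 * real n powr (- (\<tau> / 2)))" for n
        unfolding power_mult_distrib by (metis (no_types, lifting) mult.assoc mult.left_commute)
      ultimately show ?thesis by (simp only:)
    qed
    have ev_bound: "\<forall>\<^sub>F n in sequentially. (A * ln (real n))\<^sup>2 * C2 * real n powr (\<tau> / 2) * (C1 * real n powr (- \<tau>)) < 1"
      by (rule order_tendstoD(2)[OF bound_lim]) simp
    have ev: "\<forall>\<^sub>F n in sequentially. prob {\<omega> \<in> space M. \<exists>i\<in>{1..n}. \<delta> < \<bar>small_part \<epsilon> n i \<omega>\<bar>} \<le> 2 * exp 1 / real n"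
      using C2' C3 ev_ces ev_bound bn_pos eventually_ge_at_top[of 2]
    proof eventually_elim
      case (elim n)
      have n: "real n \<ge> 2" using elim(6) by simp
      have bnp: "bn n > 0" by fact
      define la where "la = A * ln (real n)"
      have la: "la > 0" using A n by (simp add: la_def)
      define v where "v = C2 / real n"
      have var: "(\<integral>y. (trunc \<epsilon> n y)\<^sup>2 \<partial>\<mu>) \<le> v * (bn n)\<^sup>2"
      proof -
        have "(\<integral>y. (trunc \<epsilon> n y)\<^sup>2 \<partial>\<mu>) \<le> (\<integral>y. indicator {- bn n..bn n} y * y\<^sup>2 \<partial>\<mu>)"
        proof (rule integral_mono)
          have eb: "\<epsilon> * bn n \<le> bn n" using e1 bnp by simp
          show "integrable \<mu> (\<lambda>y. (trunc \<epsilon> n y)\<^sup>2)"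
            by (rule mu.integrable_const_bound[of _ "(\<epsilon> * bn n)\<^sup>2"]) (use e bnp in \<open>auto simp: trunc_def indicator_def abs_le_square_iff[symmetric]\<close>)
          show "integrable \<mu> (\<lambda>y. indicator {- bn n..bn n} y * y\<^sup>2)"
            by (rule mu.integrable_const_bound[of _ "(bn n)\<^sup>2"]) (use bnp in \<open>auto simp: indicator_def abs_le_square_iff[symmetric]\<close>)
          show "(trunc \<epsilon> n y)\<^sup>2 \<le> indicator {- bn n..bn n} y * y\<^sup>2" for y
            using eb by (auto simp: trunc_def indicator_def)
        qed
        also have "\<dots> \<le> C2' * (bn n)\<^sup>2 / real n" using elim(1) n by (simp add: field_simps)
        also have "\<dots> \<le> C2 * (bn n)\<^sup>2 / real n" by (intro divide_right_mono mult_right_mono) (auto simp: C2_def)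
        finally show ?thesis by (simp add: v_def)
      qed
      have expo: "la\<^sup>2 * v * exp (2 * la * K * \<epsilon>) * (\<Sum>l<n. (\<kappa> l)\<^sup>2) \<le> 1"
      proof -
        have "exp (2 * la * K * \<epsilon>) = real n powr (2 * A * K * \<epsilon>)" using n by (simp add: powr_def la_def mult_ac)
        also have "\<dots> \<le> real n powr (\<tau> / 2)" using n e1 by (intro powr_mono) auto
        finally have 1: "exp (2 * la * K * \<epsilon>) \<le> real n powr (\<tau> / 2)" .
        have 2: "(\<Sum>l<n. (\<kappa> l)\<^sup>2) / real n \<le> C1 * real n powr (- \<tau>)" using n by (intro C1) auto
        have "la\<^sup>2 * v * exp (2 * la * K * \<epsilon>) * (\<Sum>l<n. (\<kappa> l)\<^sup>2) = la\<^sup>2 * C2 * exp (2 * la * K * \<epsilon>) * ((\<Sum>l<n. (\<kappa> l)\<^sup>2) / real n)"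
          by (simp add: v_def)
        also have "\<dots> \<le> la\<^sup>2 * C2 * real n powr (\<tau> / 2) * (C1 * real n powr (- \<tau>))"
          using 1 2 C2 by (intro mult_mono) (auto intro!: mult_nonneg_nonneg divide_nonneg_nonneg sum_nonneg)
        also have "\<dots> < 1" using elim(4) by (simp add: la_def)
        finally show ?thesis by simp
      qed
      have tail: "prob {\<omega> \<in> space M. s * (\<Sum>j=1..i. \<kappa> (i - j) * ((trunc \<epsilon> n (X j \<omega>) - mm n) / bn n)) \<ge> \<delta> / 2} \<le> exp 1 / (real n)\<^sup>2"
        if i: "i \<le> n" and s: "\<bar>s\<bar> = 1" for i s
      proof -
        let ?Y = "\<lambda>\<omega>. s * (\<Sum>j=1..i. \<kappa> (i - j) * ((trunc \<epsilon> n (X j \<omega>) - mm n) / bn n))"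
        note mom = exp_moment_bound[OF e(1) bnp i K(2,1) less_imp_le[OF la] s var, folded mm_def]
        have "prob {\<omega> \<in> space M. exp (la * ?Y \<omega>) \<ge> exp (la * (\<delta> / 2))} \<le> expectation (\<lambda>\<omega>. exp (la * ?Y \<omega>)) / exp (la * (\<delta> / 2))"
          by (rule integral_Markov_inequality_measure[OF mom(1), of "{}"]) auto
        also have "\<dots> \<le> exp 1 / exp (la * (\<delta> / 2))"
          by (intro divide_right_mono order_trans[OF mom(2)]) (use expo in auto)
        also have "exp 1 / exp (la * (\<delta> / 2)) = exp 1 / (real n)\<^sup>2"
        proof -
          have "la * (\<delta> / 2) = 2 * ln (real n)" using assms by (simp add: la_def A_def)
          then have "exp (la * (\<delta> / 2)) = exp (ln (real n)) ^ 2" by (simp only: exp_double)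
          then show ?thesis using n by simp
        qed
        finally have "prob {\<omega> \<in> space M. exp (la * ?Y \<omega>) \<ge> exp (la * (\<delta> / 2))} \<le> exp 1 / (real n)\<^sup>2" .
        moreover have "exp (la * (\<delta> / 2)) \<le> exp (la * u) \<longleftrightarrow> \<delta> / 2 \<le> u" for u
          using la by (simp only: exp_le_cancel_iff mult_le_cancel_left_pos)
        ultimately show ?thesis by (simp only:)
      qed
      have incl: "{\<omega> \<in> space M. \<exists>i\<in>{1..n}. \<delta> < \<bar>small_part \<epsilon> n i \<omega>\<bar>} \<subseteq>
        (\<Union>i\<in>{1..n}. {\<omega> \<in> space M. 1 * (\<Sum>j=1..i. \<kappa> (i - j) * ((trunc \<epsilon> n (X j \<omega>) - mm n) / bn n)) \<ge> \<delta> / 2}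
          \<union> {\<omega> \<in> space M. (-1) * (\<Sum>j=1..i. \<kappa> (i - j) * ((trunc \<epsilon> n (X j \<omega>) - mm n) / bn n)) \<ge> \<delta> / 2})"
      proof (safe)
        fix \<omega> i assume w: "\<omega> \<in> space M" and i: "i \<in> {1..n}" and big: "\<delta> < \<bar>small_part \<epsilon> n i \<omega>\<bar>"
        let ?T = "\<Sum>j=1..i. \<kappa> (i - j) * ((trunc \<epsilon> n (X j \<omega>) - mm n) / bn n)"
        \<comment> \<open>Fluctuation about the truncated mean, plus the bias between that mean and
          the prescribed centring. The bias is controlled by the averages of |\<kappa> l|, uniformly
          in i.\<close>
        have "small_part \<epsilon> n i \<omega> = ?T + (\<Sum>j=1..i. \<kappa> (i - j)) * ((mm n - ctr n) / bn n)"
        proof -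
          have "\<kappa> (i - j) * (trunc \<epsilon> n (X j \<omega>) - ctr n) / bn n
            = \<kappa> (i - j) * ((trunc \<epsilon> n (X j \<omega>) - mm n) / bn n) + \<kappa> (i - j) * ((mm n - ctr n) / bn n)" for j
            using bnp by (simp add: field_simps)
          then show ?thesis unfolding small_part_def sum_divide_distrib sum_distrib_right by (simp only: sum.distrib)
        qed
        moreover have "\<bar>(\<Sum>j=1..i. \<kappa> (i - j)) * ((mm n - ctr n) / bn n)\<bar> \<le> \<delta> / 2"
        proof -
          have "\<bar>\<Sum>j=1..i. \<kappa> (i - j)\<bar> = \<bar>\<Sum>l<i. \<kappa> l\<bar>" by (simp only: lag_sum)
          also have "\<dots> \<le> (\<Sum>l<i. \<bar>\<kappa> l\<bar>)" by (rule sum_abs)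
          also have "\<dots> \<le> (\<Sum>l<n. \<bar>\<kappa> l\<bar>)" using i by (intro sum_mono2) auto
          finally have 1: "\<bar>\<Sum>j=1..i. \<kappa> (i - j)\<bar> \<le> (\<Sum>l<n. \<bar>\<kappa> l\<bar>)" .
          have 2: "\<bar>(mm n - ctr n) / bn n\<bar> \<le> C3' / real n" using elim(2) bnp by (simp add: abs_divide field_simps)
          have "\<bar>(\<Sum>j=1..i. \<kappa> (i - j)) * ((mm n - ctr n) / bn n)\<bar> \<le> (\<Sum>l<n. \<bar>\<kappa> l\<bar>) * (C3' / real n)"
            unfolding abs_mult using 1 2 by (intro mult_mono) (auto intro: sum_nonneg)
          also have "\<dots> = C3' * ((\<Sum>l<n. \<bar>\<kappa> l\<bar>) / real n)" by simp
          finally show ?thesis using elim(3) by linarith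
        qed
        ultimately have "?T \<ge> \<delta> / 2 \<or> - ?T \<ge> \<delta> / 2" using big by linarith
        then show "\<omega> \<in> (\<Union>i\<in>{1..n}. {\<omega> \<in> space M. 1 * (\<Sum>j=1..i. \<kappa> (i - j) * ((trunc \<epsilon> n (X j \<omega>) - mm n) / bn n)) \<ge> \<delta> / 2}
          \<union> {\<omega> \<in> space M. (-1) * (\<Sum>j=1..i. \<kappa> (i - j) * ((trunc \<epsilon> n (X j \<omega>) - mm n) / bn n)) \<ge> \<delta> / 2})"
          using w i by auto
      qed
      have meas: "{\<omega> \<in> space M. s * (\<Sum>j=1..i. \<kappa> (i - j) * ((trunc \<epsilon> n (X j \<omega>) - mm n) / bn n)) \<ge> \<delta> / 2} \<in> events" for s i
      proof -
        have "random_variable borel (\<lambda>\<omega>. \<Sum>j=1..i. \<kappa> (i - j) * ((trunc \<epsilon> n (X j \<omega>) - mm n) / bn n))"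
        proof (intro borel_measurable_sum)
          fix j assume "j \<in> {1..i}"
          then have "random_variable borel (\<lambda>\<omega>. trunc \<epsilon> n (X j \<omega>))" by (intro measurable_compose[OF X_rv trunc_measurable]) auto
          then show "random_variable borel (\<lambda>\<omega>. \<kappa> (i - j) * ((trunc \<epsilon> n (X j \<omega>) - mm n) / bn n))" by measurable
        qed
        then show ?thesis by measurable
      qed
      have "prob {\<omega> \<in> space M. \<exists>i\<in>{1..n}. \<delta> < \<bar>small_part \<epsilon> n i \<omega>\<bar>} \<le>
         prob (\<Union>i\<in>{1..n}. {\<omega> \<in> space M. 1 * (\<Sum>j=1..i. \<kappa> (i - j) * ((trunc \<epsilon> n (X j \<omega>) - mm n) / bn n)) \<ge> \<delta> / 2}
          \<union> {\<omega> \<in> space M. (-1) * (\<Sum>j=1..i. \<kappa> (i - j) * ((trunc \<epsilon> n (X j \<omega>) - mm n) / bn n)) \<ge> \<delta> / 2})"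
        by (rule finite_measure_mono[OF incl]) (intro sets.finite_UN sets.Un meas finite_atLeastAtMost)
      also have "\<dots> \<le> (\<Sum>i\<in>{1..n}. prob ({\<omega> \<in> space M. 1 * (\<Sum>j=1..i. \<kappa> (i - j) * ((trunc \<epsilon> n (X j \<omega>) - mm n) / bn n)) \<ge> \<delta> / 2}
          \<union> {\<omega> \<in> space M. (-1) * (\<Sum>j=1..i. \<kappa> (i - j) * ((trunc \<epsilon> n (X j \<omega>) - mm n) / bn n)) \<ge> \<delta> / 2}))"
        by (rule finite_measure_subadditive_finite) (intro finite_atLeastAtMost image_subsetI sets.Un meas)+
      also have "\<dots> \<le> (\<Sum>i\<in>{1..n}. exp 1 / (real n)\<^sup>2 + exp 1 / (real n)\<^sup>2)"
      proof (rule sum_mono)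
        fix i assume i: "i \<in> {1..n}"
        show "prob ({\<omega> \<in> space M. 1 * (\<Sum>j=1..i. \<kappa> (i - j) * ((trunc \<epsilon> n (X j \<omega>) - mm n) / bn n)) \<ge> \<delta> / 2}
          \<union> {\<omega> \<in> space M. (-1) * (\<Sum>j=1..i. \<kappa> (i - j) * ((trunc \<epsilon> n (X j \<omega>) - mm n) / bn n)) \<ge> \<delta> / 2})
          \<le> exp 1 / (real n)\<^sup>2 + exp 1 / (real n)\<^sup>2"
          by (rule order_trans[OF measure_Un_le[OF meas meas] add_mono[OF tail tail]]) (use i in auto)
      qed
      also have "\<dots> = 2 * exp 1 / real n" using n by (simp add: power2_eq_square)
      finally show ?case .
    qed
    show ?thesis
    proof (rule real_tendsto_sandwich[OF _ ev tendsto_const])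
      show "(\<lambda>n. 2 * exp 1 / real n) \<longlonglongrightarrow> 0" by real_asymp
    qed auto
  qed
  then show ?thesis using e0 by blast
qed

end

section \<open>Exceptional events and clusters in probability\<close>

lemma (in prob_space) expectation_exp_diff:
  assumes A: "random_variable borel A" and B: "random_variable borel B"
    and nn: "\<And>\<omega>. 0 \<le> A \<omega>" "\<And>\<omega>. 0 \<le> B \<omega>" and bad: "bad \<in> events" and "c \<ge> 0"
    and close: "\<And>\<omega>. \<omega> \<in> space M \<Longrightarrow> \<omega> \<notin> bad \<Longrightarrow> \<bar>A \<omega> - B \<omega>\<bar> \<le> c"
  shows "\<bar>expectation (\<lambda>\<omega>. exp (- A \<omega>)) - expectation (\<lambda>\<omega>. exp (- B \<omega> :: real))\<bar> \<le> c + prob bad"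
proof -
  note [measurable] = A B bad
  have int: "integrable M (\<lambda>\<omega>. exp (- A \<omega>))" "integrable M (\<lambda>\<omega>. exp (- B \<omega>))"
    using nn by (auto intro!: integrable_const_bound[of _ 1])
  have "\<bar>expectation (\<lambda>\<omega>. exp (- A \<omega>)) - expectation (\<lambda>\<omega>. exp (- B \<omega>))\<bar> = \<bar>expectation (\<lambda>\<omega>. exp (- A \<omega>) - exp (- B \<omega>))\<bar>"
    using int by simp
  also have "\<dots> \<le> expectation (\<lambda>\<omega>. \<bar>exp (- A \<omega>) - exp (- B \<omega>)\<bar>)" by (rule integral_abs_bound)
  also have "\<dots> \<le> expectation (\<lambda>\<omega>. c + indicator bad \<omega>)"
  proof (rule integral_mono)
    show "integrable M (\<lambda>\<omega>. \<bar>exp (- A \<omega>) - exp (- B \<omega>)\<bar>)" using int by (intro integrable_abs Bochner_Integration.integrable_diff)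
    show "integrable M (\<lambda>\<omega>. c + indicator bad \<omega>)" by (intro Bochner_Integration.integrable_add integrable_const_bound[of "indicator bad" 1]) auto
    fix \<omega> assume w: "\<omega> \<in> space M"
    show "\<bar>exp (- A \<omega>) - exp (- B \<omega>)\<bar> \<le> c + indicator bad \<omega>"
      using close[OF w] exp_minus_diff_bound[OF nn, of \<omega> \<omega>] \<open>c \<ge> 0\<close> by (cases "\<omega> \<in> bad") auto
  qed
  also have "\<dots> = c + prob bad"
    by (subst Bochner_Integration.integral_add) (auto intro!: integrable_const_bound[of "indicator bad" 1] simp: prob_space)
  finally show ?thesis .
qed

context linear_process
begin

lemma big_event [measurable]: "1 \<le> j \<Longrightarrow> {\<omega> \<in> space M. t < \<bar>X j \<omega>\<bar>} \<in> events"
  using X_rv[of j] by measurable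

lemma prob_big: "1 \<le> j \<Longrightarrow> prob {\<omega> \<in> space M. t < \<bar>X j \<omega>\<bar>} = H t"
proof -
  assume j: "1 \<le> j"
  have "measure (distr M borel (X j)) {y. t < \<bar>y\<bar>} = prob (X j -` {y. t < \<bar>y\<bar>} \<inter> space M)"
    by (rule measure_distr[OF X_rv[OF j]]) simp
  moreover have "X j -` {y. t < \<bar>y\<bar>} \<inter> space M = {\<omega> \<in> space M. t < \<bar>X j \<omega>\<bar>}" by auto
  ultimately show ?thesis using X_law[OF j] by (simp add: H_def)
qed

lemma prob_some:
  assumes "finite I" "I \<subseteq> {1..}"
  shows "{\<omega> \<in> space M. \<exists>j\<in>I. t < \<bar>X j \<omega>\<bar>} \<in> events" "prob {\<omega> \<in> space M. \<exists>j\<in>I. t < \<bar>X j \<omega>\<bar>} \<le> real (card I) * H t"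
proof -
  have e: "{\<omega> \<in> space M. \<exists>j\<in>I. t < \<bar>X j \<omega>\<bar>} = (\<Union>j\<in>I. {\<omega> \<in> space M. t < \<bar>X j \<omega>\<bar>})" by auto
  show "{\<omega> \<in> space M. \<exists>j\<in>I. t < \<bar>X j \<omega>\<bar>} \<in> events"
    unfolding e using assms by (intro sets.finite_UN big_event) auto
  have "prob (\<Union>j\<in>I. {\<omega> \<in> space M. t < \<bar>X j \<omega>\<bar>}) \<le> (\<Sum>j\<in>I. prob {\<omega> \<in> space M. t < \<bar>X j \<omega>\<bar>})"
    using assms by (intro finite_measure_subadditive_finite) (auto intro!: big_event)
  also have "\<dots> = (\<Sum>j\<in>I. H t)" using assms by (intro sum.cong refl prob_big) auto
  finally show "prob {\<omega> \<in> space M. \<exists>j\<in>I. t < \<bar>X j \<omega>\<bar>} \<le> real (card I) * H t" unfolding e by simp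
qed

lemma count_measurable: "random_variable borel (\<lambda>\<omega>. real (card {j \<in> {1..n}. t < \<bar>X j \<omega>\<bar>}))"
  and count_expectation: "expectation (\<lambda>\<omega>. real (card {j \<in> {1..n}. t < \<bar>X j \<omega>\<bar>})) = real n * H t"
  and count_integrable: "integrable M (\<lambda>\<omega>. real (card {j \<in> {1..n}. t < \<bar>X j \<omega>\<bar>}))"
proof -
  have e: "real (card {j \<in> {1..n}. t < \<bar>X j \<omega>\<bar>}) = (\<Sum>j\<in>{1..n}. indicator {\<omega> \<in> space M. t < \<bar>X j \<omega>\<bar>} \<omega>)" if "\<omega> \<in> space M" for \<omega>
    using that by (simp add: indicator_def sum_of_bool_eq Int_def)
  have i: "integrable M (indicator {\<omega> \<in> space M. t < \<bar>X j \<omega>\<bar>} :: 's \<Rightarrow> real)" if "j \<in> {1..n}" for j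
    using that by (intro integrable_const_bound[of _ 1] borel_measurable_indicator big_event) (auto simp: indicator_def)
  then have isum: "integrable M (\<lambda>\<omega>. \<Sum>j\<in>{1..n}. indicator {\<omega> \<in> space M. t < \<bar>X j \<omega>\<bar>} \<omega> :: real)" by (intro Bochner_Integration.integrable_sum)
  then show "integrable M (\<lambda>\<omega>. real (card {j \<in> {1..n}. t < \<bar>X j \<omega>\<bar>}))"
    by (subst Bochner_Integration.integrable_cong[OF refl e]) auto
  then show "random_variable borel (\<lambda>\<omega>. real (card {j \<in> {1..n}. t < \<bar>X j \<omega>\<bar>}))" by simp
  have "expectation (\<lambda>\<omega>. real (card {j \<in> {1..n}. t < \<bar>X j \<omega>\<bar>})) = expectation (\<lambda>\<omega>. \<Sum>j\<in>{1..n}. indicator {\<omega> \<in> space M. t < \<bar>X j \<omega>\<bar>} \<omega>)"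
    by (intro Bochner_Integration.integral_cong refl e)
  also have "\<dots> = (\<Sum>j\<in>{1..n}. expectation (indicator {\<omega> \<in> space M. t < \<bar>X j \<omega>\<bar>}))"
    using i by (rule Bochner_Integration.integral_sum)
  also have "\<dots> = (\<Sum>j\<in>{1..n}. H t)"
  proof (rule sum.cong[OF refl])
    fix j assume "j \<in> {1..n}"
    then have j: "1 \<le> j" by simp
    have "expectation (indicator {\<omega> \<in> space M. t < \<bar>X j \<omega>\<bar>}) = prob ({\<omega> \<in> space M. t < \<bar>X j \<omega>\<bar>} \<inter> space M)"
      by (rule Bochner_Integration.integral_indicator)
    also have "{\<omega> \<in> space M. t < \<bar>X j \<omega>\<bar>} \<inter> space M = {\<omega> \<in> space M. t < \<bar>X j \<omega>\<bar>}" by auto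
    finally show "expectation (indicator {\<omega> \<in> space M. t < \<bar>X j \<omega>\<bar>}) = H t" using prob_big[OF j] by simp
  qed
  finally show "expectation (\<lambda>\<omega>. real (card {j \<in> {1..n}. t < \<bar>X j \<omega>\<bar>})) = real n * H t" by simp
qed

lemma prob_count:
  assumes "k > 0"
  shows "{\<omega> \<in> space M. real k \<le> real (card {j \<in> {1..n}. t < \<bar>X j \<omega>\<bar>})} \<in> events"
    and "prob {\<omega> \<in> space M. real k \<le> real (card {j \<in> {1..n}. t < \<bar>X j \<omega>\<bar>})} \<le> real n * H t / real k"
proof -
  show "{\<omega> \<in> space M. real k \<le> real (card {j \<in> {1..n}. t < \<bar>X j \<omega>\<bar>})} \<in> events"
    using count_measurable by measurable
  have "prob {\<omega> \<in> space M. real (card {j \<in> {1..n}. t < \<bar>X j \<omega>\<bar>}) \<ge> real k} \<le> expectation (\<lambda>\<omega>. real (card {j \<in> {1..n}. t < \<bar>X j \<omega>\<bar>})) / real k"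
    by (rule integral_Markov_inequality_measure[OF count_integrable, of "{}"]) (use assms in auto)
  then show "prob {\<omega> \<in> space M. real k \<le> real (card {j \<in> {1..n}. t < \<bar>X j \<omega>\<bar>})} \<le> real n * H t / real k"
    by (simp only: count_expectation)
qed

text \<open>Two large innovations within \<open>m\<close> steps: independence gives H squared for
  each of the n m pairs, which is O(1/n) at the scale of b_n.\<close>

lemma prob_pair:
  shows "{\<omega> \<in> space M. \<exists>j\<in>{1..n}. \<exists>l\<in>{1..m}. t < \<bar>X j \<omega>\<bar> \<and> t < \<bar>X (j + l) \<omega>\<bar>} \<in> events"
    and "prob {\<omega> \<in> space M. \<exists>j\<in>{1..n}. \<exists>l\<in>{1..m}. t < \<bar>X j \<omega>\<bar> \<and> t < \<bar>X (j + l) \<omega>\<bar>} \<le> real n * real m * (H t)\<^sup>2"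
proof -
  let ?E = "\<lambda>(j, l). {\<omega> \<in> space M. t < \<bar>X j \<omega>\<bar> \<and> t < \<bar>X (j + l) \<omega>\<bar>}"
  have e: "{\<omega> \<in> space M. \<exists>j\<in>{1..n}. \<exists>l\<in>{1..m}. t < \<bar>X j \<omega>\<bar> \<and> t < \<bar>X (j + l) \<omega>\<bar>} = (\<Union>z\<in>{1..n} \<times> {1..m}. ?E z)" by auto
  have Em: "?E z \<in> events" if z: "z \<in> {1..n} \<times> {1..m}" for z
  proof -
    obtain j l where jl: "z = (j, l)" "1 \<le> j" "1 \<le> l" using z by (cases z) auto
    have "?E z = {\<omega> \<in> space M. t < \<bar>X j \<omega>\<bar>} \<inter> {\<omega> \<in> space M. t < \<bar>X (j + l) \<omega>\<bar>}" by (auto simp: jl)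
    then show ?thesis using jl by (auto intro!: sets.Int big_event)
  qed
  have Ep: "prob (?E z) = (H t)\<^sup>2" if z: "z \<in> {1..n} \<times> {1..m}" for z
  proof -
    obtain j l where jl: "z = (j, l)" "1 \<le> j" "1 \<le> l" using z by (cases z) auto
    have "prob (\<Inter>i\<in>{j, j + l}. X i -` {y. t < \<bar>y\<bar>} \<inter> space M) = (\<Prod>i\<in>{j, j + l}. prob (X i -` {y. t < \<bar>y\<bar>} \<inter> space M))"
      by (rule indep_varsD[OF X_indep]) (use jl in auto)
    moreover have "(\<Inter>i\<in>{j, j + l}. X i -` {y. t < \<bar>y\<bar>} \<inter> space M) = ?E z" by (auto simp: jl)
    moreover have "X i -` {y. t < \<bar>y\<bar>} \<inter> space M = {\<omega> \<in> space M. t < \<bar>X i \<omega>\<bar>}" for i by auto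
    ultimately show ?thesis using jl by (simp add: prob_big power2_eq_square)
  qed
  show "{\<omega> \<in> space M. \<exists>j\<in>{1..n}. \<exists>l\<in>{1..m}. t < \<bar>X j \<omega>\<bar> \<and> t < \<bar>X (j + l) \<omega>\<bar>} \<in> events"
    unfolding e by (intro sets.finite_UN Em) auto
  have "prob (\<Union>z\<in>{1..n} \<times> {1..m}. ?E z) \<le> (\<Sum>z\<in>{1..n} \<times> {1..m}. prob (?E z))"
    by (intro finite_measure_subadditive_finite) (auto intro!: Em)
  also have "\<dots> = (\<Sum>z\<in>{1..n} \<times> {1..m}. (H t)\<^sup>2)" by (intro sum.cong refl Ep)
  also have "\<dots> = real n * real m * (H t)\<^sup>2" by simp
  finally show "prob {\<omega> \<in> space M. \<exists>j\<in>{1..n}. \<exists>l\<in>{1..m}. t < \<bar>X j \<omega>\<bar> \<and> t < \<bar>X (j + l) \<omega>\<bar>} \<le> real n * real m * (H t)\<^sup>2"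
    unfolding e .
qed

lemma lin_norm_split:
  assumes b: "0 < bn n" and i: "i \<in> {1..n}"
  shows "lin_norm n i \<omega> = (\<Sum>j | j \<in> {j \<in> {1..n}. \<epsilon> < \<bar>X j \<omega> / bn n\<bar>} \<and> j \<le> i. \<kappa> (i - j) * (X j \<omega> / bn n)) + small_part \<epsilon> n i \<omega>"
proof -
  have t: "X j \<omega> = (if \<epsilon> < \<bar>X j \<omega> / bn n\<bar> then X j \<omega> else 0) + trunc \<epsilon> n (X j \<omega>)" for j
  proof -
    have "\<epsilon> < \<bar>X j \<omega> / bn n\<bar> \<longleftrightarrow> \<epsilon> * bn n < \<bar>X j \<omega>\<bar>" using b by (simp add: abs_divide pos_less_divide_eq)
    then show ?thesis by (auto simp: trunc_def indicator_def abs_le_iff not_less)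
  qed
  have "lin_norm n i \<omega> = (\<Sum>j=1..i. \<kappa> (i - j) * ((if \<epsilon> < \<bar>X j \<omega> / bn n\<bar> then X j \<omega> else 0) / bn n) + \<kappa> (i - j) * (trunc \<epsilon> n (X j \<omega>) - ctr n) / bn n)"
    unfolding lin_norm_def sum_divide_distrib
  proof (rule sum.cong[OF refl])
    fix j
    let ?x = "if \<epsilon> < \<bar>X j \<omega> / bn n\<bar> then X j \<omega> else 0"
    have "\<kappa> (i - j) * (X j \<omega> - ctr n) / bn n = \<kappa> (i - j) * ((?x + trunc \<epsilon> n (X j \<omega>)) - ctr n) / bn n" using t[of j] by (simp only:)
    also have "\<dots> = \<kappa> (i - j) * (?x / bn n) + \<kappa> (i - j) * (trunc \<epsilon> n (X j \<omega>) - ctr n) / bn n"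
      by (simp only: add_diff_eq[symmetric] distrib_left add_divide_distrib times_divide_eq_right)
    finally show "\<kappa> (i - j) * (X j \<omega> - ctr n) / bn n = \<kappa> (i - j) * (?x / bn n) + \<kappa> (i - j) * (trunc \<epsilon> n (X j \<omega>) - ctr n) / bn n" .
  qed
  also have "\<dots> = (\<Sum>j=1..i. \<kappa> (i - j) * ((if \<epsilon> < \<bar>X j \<omega> / bn n\<bar> then X j \<omega> else 0) / bn n)) + small_part \<epsilon> n i \<omega>"
    unfolding small_part_def sum_divide_distrib by (rule sum.distrib)
  also have "(\<Sum>j=1..i. \<kappa> (i - j) * ((if \<epsilon> < \<bar>X j \<omega> / bn n\<bar> then X j \<omega> else 0) / bn n))
      = (\<Sum>j | j \<in> {j \<in> {1..n}. \<epsilon> < \<bar>X j \<omega> / bn n\<bar>} \<and> j \<le> i. \<kappa> (i - j) * (X j \<omega> / bn n))"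
    using i by (intro sum.mono_neutral_cong_right) auto
  finally show ?thesis .
qed

lemma tail_prob_zero: "t > 0 \<Longrightarrow> (\<lambda>n. C * (real n * (H (t * bn n))\<^sup>2)) \<longlonglongrightarrow> 0"
  "t > 0 \<Longrightarrow> (\<lambda>n. C * H (t * bn n)) \<longlonglongrightarrow> 0"
proof -
  assume t: "t > 0"
  have l: "(\<lambda>n. real n * H (t * bn n)) \<longlonglongrightarrow> t powr (- \<alpha>)" by (rule bn_tail[OF t])
  have inv: "(\<lambda>n. 1 / real n) \<longlonglongrightarrow> 0" by real_asymp
  have "(\<lambda>n. C * ((real n * H (t * bn n)) * (1 / real n))) \<longlonglongrightarrow> C * (t powr (- \<alpha>) * 0)"
    by (intro tendsto_intros l inv)
  moreover have "\<forall>\<^sub>F n in sequentially. C * ((real n * H (t * bn n)) * (1 / real n)) = C * H (t * bn n)"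
    using eventually_gt_at_top[of 0] by eventually_elim simp
  ultimately show z: "(\<lambda>n. C * H (t * bn n)) \<longlonglongrightarrow> 0" by (simp add: Lim_transform_eventually)
  have "(\<lambda>n. (C * H (t * bn n)) * (real n * H (t * bn n))) \<longlonglongrightarrow> 0 * t powr (- \<alpha>)"
    by (rule tendsto_mult[OF z l])
  then show "(\<lambda>n. C * (real n * (H (t * bn n))\<^sup>2)) \<longlonglongrightarrow> 0" by (simp add: power2_eq_square mult_ac)
qed

text \<open>The work lies in the order of the choices: R and the counts K0 and Lc first, then the
  modulus e1 and its d, then \<delta>, then the threshold \<epsilon>, then the number K1 of
  innovations above it, then m0, and n last. No constant depends on a later one.\<close>

lemma process_approximation:
  assumes f: "plane_test \<eta> f" and "e > 0"
  shows "\<exists>m0. \<forall>m\<ge>m0. \<forall>\<^sub>F n in sequentially.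
    \<bar>expectation (\<lambda>\<omega>. exp (- (\<Sum>i=1..n. f (real i / real n) (lin_norm n i \<omega>))))
     - expectation (\<lambda>\<omega>. exp (- (\<Sum>j=1..n. \<Sum>l\<le>m. f (real j / real n) (\<kappa> l * (X j \<omega> / bn n)))))\<bar> \<le> e"
proof -
  note fD = plane_testD[OF f]
  \<comment> \<open>Six exceptional events of probability below e/8 each, and e/8 for the cluster
    error.\<close>
  define e8 where "e8 = e / 8"
  have e8: "e8 > 0" using \<open>e > 0\<close> by (simp add: e8_def)
  obtain K where K: "K \<ge> 1" "\<And>l. \<bar>\<kappa> l\<bar> \<le> K" using kappa_bound by blast
  have "(\<lambda>k. real (Suc k) powr (- \<alpha>)) \<longlonglongrightarrow> 0"
    by (rule tendsto_neg_powr) (use alpha filterlim_compose[OF filterlim_real_sequentially filterlim_Suc] in auto)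
  then have "\<forall>\<^sub>F k in sequentially. real (Suc k) powr (- \<alpha>) < e8" by (rule order_tendstoD(2)[OF _ e8])
  then obtain k where k: "real (Suc k) powr (- \<alpha>) < e8" by (auto simp: eventually_sequentially)
  \<comment> \<open>A level that some normalised innovation exceeds with probability below e8 for
    large n.\<close>
  define R where "R = real (Suc k)"
  have R: "R > 0" by (simp add: R_def)
  have evR: "\<forall>\<^sub>F n in sequentially. real n * H (R * bn n) < e8"
    by (rule order_tendstoD(2)[OF bn_tail[OF R]]) (use k in \<open>simp add: R_def\<close>)
  \<comment> \<open>An innovation below this level stays below \<eta>/2 after multiplication by any
    coefficient, hence is invisible to the test function.\<close>
  define \<epsilon>a where "\<epsilon>a = \<eta> / (2 * K)"
  have ea: "\<epsilon>a > 0" using fD(1) K by (simp add: \<epsilon>a_def)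
  have count: "\<exists>k>0. \<forall>\<^sub>F n in sequentially. real n * H (t * bn n) / real k < e8" if t: "t > 0" for t
  proof -
    obtain k :: nat where k: "(t powr (- \<alpha>) + 1) / e8 < real k" using reals_Archimedean2 by blast
    have "0 < (t powr (- \<alpha>) + 1) / e8" using e8 by (simp add: add_nonneg_pos)
    then have k0: "k > 0" using k by (cases k) auto
    have "\<forall>\<^sub>F n in sequentially. real n * H (t * bn n) < t powr (- \<alpha>) + 1" by (rule order_tendstoD(2)[OF bn_tail[OF t]]) simp
    then have "\<forall>\<^sub>F n in sequentially. real n * H (t * bn n) / real k < e8"
    proof eventually_elim
      case (elim n)
      have "t powr (- \<alpha>) + 1 < e8 * real k" using k e8 by (simp add: field_simps)
      then show ?case using elim k0 by (simp add: field_simps)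
    qed
    then show ?thesis using k0 by blast
  qed
  obtain K0 where K0: "K0 > 0" "\<forall>\<^sub>F n in sequentially. real n * H (\<epsilon>a * bn n) / real K0 < e8" using count[OF ea] by blast
  define Lset where "Lset = {l. \<eta> / (2 * R) < \<bar>\<kappa> l\<bar>}"
  have finL: "finite Lset"
  proof -
    have "\<forall>\<^sub>F l in sequentially. \<bar>\<kappa> l\<bar> < \<eta> / (2 * R)"
      using order_tendstoD(2)[OF tendsto_rabs_zero[OF kappa_lim], of "\<eta> / (2 * R)"] fD(1) R by simp
    then obtain N where "\<And>l. l \<ge> N \<Longrightarrow> \<bar>\<kappa> l\<bar> < \<eta> / (2 * R)" by (auto simp: eventually_sequentially)
    then have "Lset \<subseteq> {..<N}" unfolding Lset_def by (auto simp: not_less[symmetric]) (meson less_asym not_le)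
    then show ?thesis by (rule finite_subset) simp
  qed
  define Lc where "Lc = card Lset"
  \<comment> \<open>The added 1 covers an empty \<open>Lset\<close>, where the product of the counts
    is 0.\<close>
  define e1 where "e1 = e8 / (real K0 * real Lc + 1)"
  have e1: "e1 > 0" "real K0 * real Lc * e1 \<le> e8"
  proof -
    have p: "0 < real K0 * real Lc + 1" by (simp add: add_nonneg_pos)
    show "e1 > 0" using e8 p by (simp add: e1_def)
    have "real K0 * real Lc * e8 \<le> e8 * (real K0 * real Lc + 1)" using e8 by (simp add: algebra_simps)
    then show "real K0 * real Lc * e1 \<le> e8" using p by (simp add: e1_def pos_divide_le_eq)
  qed
  obtain d where d: "d > 0" "\<forall>s t x y. \<bar>s - t\<bar> < d \<longrightarrow> \<bar>x - y\<bar> < d \<longrightarrow> \<bar>f s x - f t y\<bar> < e1"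
    using plane_test_uniform[OF f e1(1)] by blast
  \<comment> \<open>4 \<delta> <= \<eta> keeps perturbed values out of the support of f wherever
    they should be; 2 \<delta> < d keeps them within the modulus of continuity.\<close>
  define \<delta> where "\<delta> = min (\<eta> / 4) (d / 4)"
  have delta: "0 < \<delta>" "4 * \<delta> \<le> \<eta>" "2 * \<delta> < d" using fD(1) d(1) by (auto simp: \<delta>_def min_def)
  obtain \<epsilon>b where eb: "\<epsilon>b > 0" "\<And>\<epsilon>. 0 < \<epsilon> \<Longrightarrow> \<epsilon> \<le> \<epsilon>b \<Longrightarrow> (\<lambda>n. prob {\<omega> \<in> space M. \<exists>i\<in>{1..n}. \<delta> < \<bar>small_part \<epsilon> n i \<omega>\<bar>}) \<longlonglongrightarrow> 0"
    using small_part_uniform[OF delta(1)] by blast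
  define \<epsilon> where "\<epsilon> = min \<epsilon>a \<epsilon>b"
  have eps: "0 < \<epsilon>" "\<epsilon> \<le> \<epsilon>a" "\<epsilon> \<le> \<epsilon>b" using ea eb by (auto simp: \<epsilon>_def)
  have ev_small: "\<forall>\<^sub>F n in sequentially. prob {\<omega> \<in> space M. \<exists>i\<in>{1..n}. \<delta> < \<bar>small_part \<epsilon> n i \<omega>\<bar>} < e8"
    by (rule order_tendstoD(2)[OF eb(2)[OF eps(1,3)] e8])
  obtain K1 where K1: "K1 > 0" "\<forall>\<^sub>F n in sequentially. real n * H (\<epsilon> * bn n) / real K1 < e8" using count[OF eps(1)] by blast
  \<comment> \<open>From lag m0 on, at most K1 innovations of size at most R contribute no more than
    \<delta> together.\<close>
  have "\<forall>\<^sub>F l in sequentially. \<bar>\<kappa> l\<bar> < \<delta> / (real K1 * R)"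
    using order_tendstoD(2)[OF tendsto_rabs_zero[OF kappa_lim], of "\<delta> / (real K1 * R)"] delta R K1 by simp
  then obtain m0 where m0: "\<And>l. l \<ge> m0 \<Longrightarrow> \<bar>\<kappa> l\<bar> < \<delta> / (real K1 * R)" by (auto simp: eventually_sequentially)
  have far: "\<bar>\<kappa> l\<bar> * (real K1 * R) \<le> \<delta>" if "l \<ge> m0" for l
    using m0[OF that] K1(1) R by (simp add: field_simps)
  have "\<forall>\<^sub>F n in sequentially.
    \<bar>expectation (\<lambda>\<omega>. exp (- (\<Sum>i=1..n. f (real i / real n) (lin_norm n i \<omega>))))
     - expectation (\<lambda>\<omega>. exp (- (\<Sum>j=1..n. \<Sum>l\<le>m. f (real j / real n) (\<kappa> l * (X j \<omega> / bn n)))))\<bar> \<le> e" if m: "m \<ge> m0" for m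
  proof -
    have "(\<lambda>n. real m / real n) \<longlonglongrightarrow> 0" by real_asymp
    then have ev_mn: "\<forall>\<^sub>F n in sequentially. real m / real n < d" by (rule order_tendstoD(2)[OF _ d(1)])
    have ev_pair: "\<forall>\<^sub>F n in sequentially. real m * (real n * (H (\<epsilon> * bn n))\<^sup>2) < e8"
      by (rule order_tendstoD(2)[OF tail_prob_zero(1)[OF eps(1)] e8])
    have ev_edge: "\<forall>\<^sub>F n in sequentially. real m * H (\<epsilon> * bn n) < e8"
      by (rule order_tendstoD(2)[OF tail_prob_zero(2)[OF eps(1)] e8])
    show ?thesis
      using ev_mn ev_pair ev_edge evR K0(2) ev_small K1(2) bn_pos eventually_gt_at_top[of "m + 1"]
    proof eventually_elim
      case (elim n)
      have bnp: "0 < bn n" by fact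
      have n: "n > 0" "n > m" using elim(9) by auto
      define B1 where "B1 = {\<omega> \<in> space M. \<exists>i\<in>{1..n}. \<delta> < \<bar>small_part \<epsilon> n i \<omega>\<bar>}"
      define B2 where "B2 = {\<omega> \<in> space M. \<exists>j\<in>{1..n}. \<exists>l\<in>{1..m}. \<epsilon> * bn n < \<bar>X j \<omega>\<bar> \<and> \<epsilon> * bn n < \<bar>X (j + l) \<omega>\<bar>}"
      define B3 where "B3 = {\<omega> \<in> space M. \<exists>j\<in>{n - m<..n}. \<epsilon> * bn n < \<bar>X j \<omega>\<bar>}"
      define B4 where "B4 = {\<omega> \<in> space M. \<exists>j\<in>{1..n}. R * bn n < \<bar>X j \<omega>\<bar>}"
      define B5 where "B5 = {\<omega> \<in> space M. real K1 \<le> real (card {j \<in> {1..n}. \<epsilon> * bn n < \<bar>X j \<omega>\<bar>})}"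
      define B6 where "B6 = {\<omega> \<in> space M. real K0 \<le> real (card {j \<in> {1..n}. \<epsilon>a * bn n < \<bar>X j \<omega>\<bar>})}"
      define bad where "bad = B1 \<union> (B2 \<union> (B3 \<union> (B4 \<union> (B5 \<union> B6))))"
      have m1: "B1 \<in> events" unfolding B1_def by measurable
      have m2: "B2 \<in> events" unfolding B2_def by (rule prob_pair(1))
      have m3: "B3 \<in> events" unfolding B3_def by (rule prob_some(1)) auto
      have m4: "B4 \<in> events" unfolding B4_def by (rule prob_some(1)) auto
      have m5: "B5 \<in> events" unfolding B5_def by (rule prob_count(1)[OF K1(1)])
      have m6: "B6 \<in> events" unfolding B6_def by (rule prob_count(1)[OF K0(1)])
      have p2: "prob B2 \<le> real m * (real n * (H (\<epsilon> * bn n))\<^sup>2)" using prob_pair(2)[of n m "\<epsilon> * bn n"] unfolding B2_def by (simp add: mult_ac)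
      have p3: "prob B3 \<le> real m * H (\<epsilon> * bn n)" using prob_some(2)[of "{n - m<..n}" "\<epsilon> * bn n"] n unfolding B3_def by (force simp: subset_iff)
      have p4: "prob B4 \<le> real n * H (R * bn n)" using prob_some(2)[of "{1..n}" "R * bn n"] unfolding B4_def by auto
      have p5: "prob B5 \<le> real n * H (\<epsilon> * bn n) / real K1" unfolding B5_def by (rule prob_count(2)[OF K1(1)])
      have p6: "prob B6 \<le> real n * H (\<epsilon>a * bn n) / real K0" unfolding B6_def by (rule prob_count(2)[OF K0(1)])
      have bad_m: "bad \<in> events" unfolding bad_def by (intro sets.Un m1 m2 m3 m4 m5 m6)
      have "prob bad \<le> prob B1 + (prob B2 + (prob B3 + (prob B4 + (prob B5 + prob B6))))"
        unfolding bad_def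
        by (intro order_trans[OF measure_Un_le] add_left_mono sets.Un m1 m2 m3 m4 m5 m6 order_refl)
      then have pbad: "prob bad \<le> 6 * e8"
        using p2 p3 p4 p5 p6 elim(2-7) unfolding B1_def by linarith
      have close: "\<bar>(\<Sum>i=1..n. f (real i / real n) (lin_norm n i \<omega>)) - (\<Sum>j=1..n. \<Sum>l\<le>m. f (real j / real n) (\<kappa> l * (X j \<omega> / bn n)))\<bar> \<le> real K0 * real Lc * e1"
        if w: "\<omega> \<in> space M" "\<omega> \<notin> bad" for \<omega>
      proof -
        have conv: "t < \<bar>X j \<omega> / bn n\<bar> \<longleftrightarrow> t * bn n < \<bar>X j \<omega>\<bar>" for t j
          using bnp by (simp add: abs_divide pos_less_divide_eq)
        show ?thesis
        proof (rule cluster_approximation[OF f n(1) refl lin_norm_split[OF bnp, where \<epsilon>=\<epsilon>] _ delta(1,2)])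
          show "\<bar>small_part \<epsilon> n i \<omega>\<bar> \<le> \<delta>" if "i \<in> {1..n}" for i
            using w that by (auto simp: bad_def B1_def not_less)
          show "j + m < j'" if "j \<in> {j \<in> {1..n}. \<epsilon> < \<bar>X j \<omega> / bn n\<bar>}" "j' \<in> {j \<in> {1..n}. \<epsilon> < \<bar>X j \<omega> / bn n\<bar>}" "j < j'" for j j'
          proof (rule ccontr)
            assume "\<not> j + m < j'"
            then have "j' - j \<in> {1..m}" "j + (j' - j) = j'" using that(3) by auto
            then obtain l where l: "l \<in> {1..m}" "j' = j + l" by metis
            have "\<omega> \<in> B2" using that(1,2) w(1) l(1) unfolding B2_def conv l(2) by blast
            then show False using w by (simp add: bad_def)
          qed
          show "j + m \<le> n" if "j \<in> {j \<in> {1..n}. \<epsilon> < \<bar>X j \<omega> / bn n\<bar>}" for j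
          proof (rule ccontr)
            assume "\<not> j + m \<le> n"
            then have "\<omega> \<in> B3" using that w unfolding B3_def conv by auto
            then show False using w by (simp add: bad_def)
          qed
          show "\<bar>X j \<omega> / bn n\<bar> \<le> R" if "j \<in> {1..n}" for j
          proof (rule ccontr)
            assume "\<not> \<bar>X j \<omega> / bn n\<bar> \<le> R"
            then have "\<omega> \<in> B4" using that w unfolding B4_def not_le conv by auto
            then show False using w by (simp add: bad_def)
          qed
          show "card {j \<in> {1..n}. \<epsilon> < \<bar>X j \<omega> / bn n\<bar>} \<le> K1"
            unfolding conv using w by (auto simp: bad_def B5_def)
          show "\<bar>\<kappa> l\<bar> * (real K1 * R) \<le> \<delta>" if "m < l" for l using m that by (intro far) auto
          show "card {j \<in> {1..n}. \<eta> / (2 * K) < \<bar>X j \<omega> / bn n\<bar>} \<le> K0"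
            unfolding \<epsilon>a_def[symmetric] conv using w by (auto simp: bad_def B6_def)
          show "finite {l. \<eta> / (2 * R) < \<bar>\<kappa> l\<bar>}" "card {l. \<eta> / (2 * R) < \<bar>\<kappa> l\<bar>} \<le> Lc"
            using finL by (auto simp: Lset_def Lc_def)
          show "\<epsilon> \<le> \<eta> / (2 * K)" using eps by (simp add: \<epsilon>a_def)
          show "\<bar>f s u - f t v\<bar> < e1" if "\<bar>s - t\<bar> < d" "\<bar>u - v\<bar> < d" for s t u v using d that by blast
        qed (use R K eps elim(1) delta in auto)
      qed
      have fm: "random_variable borel (\<lambda>\<omega>. f t (g \<omega>))" if "random_variable borel g" for t g
        by (rule plane_test_measurable[OF f]) (use that in auto)
      have xm: "random_variable borel (\<lambda>\<omega>. \<kappa> l * (X j \<omega> / bn n))" if "j \<in> {1..n}" for j l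
        using X_rv[of j] that by auto
      have "\<bar>expectation (\<lambda>\<omega>. exp (- (\<Sum>i=1..n. f (real i / real n) (lin_norm n i \<omega>))))
        - expectation (\<lambda>\<omega>. exp (- (\<Sum>j=1..n. \<Sum>l\<le>m. f (real j / real n) (\<kappa> l * (X j \<omega> / bn n)))))\<bar> \<le> real K0 * real Lc * e1 + prob bad"
      proof (rule expectation_exp_diff[OF _ _ _ _ bad_m _ close])
        show "random_variable borel (\<lambda>\<omega>. \<Sum>i=1..n. f (real i / real n) (lin_norm n i \<omega>))"
          by (intro borel_measurable_sum fm) measurable
        show "random_variable borel (\<lambda>\<omega>. \<Sum>j=1..n. \<Sum>l\<le>m. f (real j / real n) (\<kappa> l * (X j \<omega> / bn n)))"
          by (intro borel_measurable_sum fm xm)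
      qed (use e1 in \<open>auto intro!: sum_nonneg fD(3)\<close>)
      also have "\<dots> \<le> e8 + 6 * e8" using e1(2) pbad by linarith
      also have "\<dots> \<le> e" using \<open>e > 0\<close> by (simp add: e8_def)
      finally show ?case .
    qed
  qed
  then show ?thesis by blast
qed

end

section \<open>Convergence of the point processes\<close>

definition plane_of :: "(real \<times> real \<Rightarrow> real) \<Rightarrow> real \<Rightarrow> real \<Rightarrow> real" where
  "plane_of f t x = (if x = 0 then 0 else f (max 0 (min 1 t), x))"

lemma plane_of_strip: "0 \<le> t \<Longrightarrow> t \<le> 1 \<Longrightarrow> plane_of f t x = (if (t, x) \<in> strip then f (t, x) else 0)"
  by (auto simp: plane_of_def strip_def max_def min_def)

text \<open>The clamped function is continuous off the axis and identically 0 in a band around it;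
  these two open sets cover the plane. The bound m for |x| + 1/|x| on the support gives \<eta> =
  1/(m + 1).\<close>

lemma plane_test_plane_of:
  assumes f: "f \<in> test_functions strip" and nn: "\<And>z. z \<in> strip \<Longrightarrow> 0 \<le> f z"
  shows "\<exists>\<eta>. plane_test \<eta> (plane_of f)"
proof -
  obtain m where m: "\<forall>z\<in>strip - strip_exh m. f z = 0" using test_function_support[OF f] by blast
  define \<eta> where "\<eta> = 1 / (real m + 1)"
  have eta: "0 < \<eta>" "1 / \<eta> = real m + 1" by (auto simp: \<eta>_def)
  have clamp: "(max 0 (min 1 t), x) \<in> strip" if "x \<noteq> 0" for t x :: real
    using that by (auto simp: strip_def)
  have zero: "plane_of f t x = 0" if "\<bar>x\<bar> \<le> \<eta> \<or> 1 / \<eta> \<le> \<bar>x\<bar>" for t x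
  proof (cases "x = 0")
    case False
    have "real m < \<bar>x\<bar> + 1 / \<bar>x\<bar>"
      using that
    proof
      assume "\<bar>x\<bar> \<le> \<eta>"
      then have "1 / \<eta> \<le> 1 / \<bar>x\<bar>" using False by (intro divide_left_mono) (auto simp: eta)
      then show ?thesis unfolding eta(2) by simp
    next
      assume "1 / \<eta> \<le> \<bar>x\<bar>"
      moreover have "0 \<le> 1 / \<bar>x\<bar>" by simp
      ultimately show ?thesis unfolding eta(2) by linarith
    qed
    then have "(max 0 (min 1 t), x) \<in> strip - strip_exh m" using clamp[OF False] by (auto simp: strip_exh_iff)
    then have "f (max 0 (min 1 t), x) = 0" using m by blast
    then show ?thesis by (simp add: plane_of_def)
  qed (simp add: plane_of_def)
  have f_cont: "continuous_on strip f" using f by (auto simp: test_functions_def)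
  have c1: "continuous_on {z. snd z \<noteq> 0} (\<lambda>z. f (max 0 (min 1 (fst z)), snd z))"
    by (rule continuous_on_compose2[OF f_cont]) (auto intro!: continuous_intros clamp)
  have "continuous_on {z. snd z \<noteq> 0} (\<lambda>(t, x). plane_of f t x)"
    by (rule continuous_on_eq[OF c1]) (auto simp: plane_of_def)
  moreover have "continuous_on {z. \<bar>snd z\<bar> < \<eta>} (\<lambda>(t, x). plane_of f t x)"
    by (rule continuous_on_eq[OF continuous_on_const[of _ 0]]) (auto simp: zero)
  moreover have "open {z :: real \<times> real. snd z \<noteq> 0}" by (intro open_Collect_neq continuous_intros)
  moreover have "open {z :: real \<times> real. \<bar>snd z\<bar> < \<eta>}" by (intro open_Collect_less continuous_intros)
  ultimately have "continuous_on ({z. snd z \<noteq> 0} \<union> {z. \<bar>snd z\<bar> < \<eta>}) (\<lambda>(t, x). plane_of f t x)"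
    by (intro continuous_on_open_Un)
  moreover have "{z :: real \<times> real. snd z \<noteq> 0} \<union> {z. \<bar>snd z\<bar> < \<eta>} = UNIV" using eta by auto
  ultimately have "continuous_on UNIV (\<lambda>(t, x). plane_of f t x)" by simp
  moreover have "0 \<le> plane_of f t x" for t x using nn clamp by (auto simp: plane_of_def)
  moreover have "plane_of f t x = plane_of f (max 0 (min 1 t)) x" for t x by (auto simp: plane_of_def)
  ultimately have "plane_test \<eta> (plane_of f)" unfolding plane_test_def using eta(1) zero by blast
  then show ?thesis ..
qed

lemma plane_test_add:
  assumes "plane_test \<eta> f" "plane_test \<eta>' g"
  shows "plane_test (min \<eta> \<eta>') (\<lambda>t x. f t x + g t x)"
proof -
  note f = plane_testD[OF assms(1)] and g = plane_testD[OF assms(2)]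
  have "1 / \<eta> \<le> 1 / min \<eta> \<eta>'" "1 / \<eta>' \<le> 1 / min \<eta> \<eta>'" using f(1) g(1) by (auto intro!: divide_left_mono)
  then have z: "f t x + g t x = 0" if "\<bar>x\<bar> \<le> min \<eta> \<eta>' \<or> 1 / min \<eta> \<eta>' \<le> \<bar>x\<bar>" for t x
    using that f(4,5)[of x t] g(4,5)[of x t] by (metis add_0 min.boundedE order_trans)
  have c: "continuous_on UNIV (\<lambda>(t, x). f t x + g t x)"
    using continuous_on_add[OF f(2) g(2)] by (simp add: case_prod_unfold)
  have "f t x + g t x = f (max 0 (min 1 t)) x + g (max 0 (min 1 t)) x" for t x
    using f(6)[of t x] g(6)[of t x] by (rule arg_cong2)
  then show ?thesis unfolding plane_test_def using f(1,3) g(1,3) z c by (auto simp: min_def)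
qed

lemma plane_test_scale:
  assumes "plane_test \<eta> f"
  shows "\<exists>\<eta>'. plane_test \<eta>' (\<lambda>t x. f t (c * x))"
proof -
  note f = plane_testD[OF assms]
  define \<eta>' where "\<eta>' = (if c = 0 then 1 else min (\<eta> / \<bar>c\<bar>) (\<bar>c\<bar> * \<eta>))"
  have pos: "0 < \<eta>'" using f(1) by (auto simp: \<eta>'_def)
  have z: "f t (c * x) = 0" if "\<bar>x\<bar> \<le> \<eta>' \<or> 1 / \<eta>' \<le> \<bar>x\<bar>" for t x
  proof (cases "c = 0")
    case True then show ?thesis using f(1) f(4)[of 0] by simp
  next
    case False
    then have e: "\<eta>' \<le> \<eta> / \<bar>c\<bar>" "\<eta>' \<le> \<bar>c\<bar> * \<eta>" by (auto simp: \<eta>'_def)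
    show ?thesis using that
    proof
      assume "\<bar>x\<bar> \<le> \<eta>'"
      then have "\<bar>x\<bar> \<le> \<eta> / \<bar>c\<bar>" using e by simp
      then have "\<bar>c * x\<bar> \<le> \<eta>" using False by (simp add: abs_mult field_simps)
      then show ?thesis by (rule f(4))
    next
      assume x: "1 / \<eta>' \<le> \<bar>x\<bar>"
      have "1 / (\<bar>c\<bar> * \<eta>) \<le> 1 / \<eta>'" using e(2) pos f(1) False by (intro divide_left_mono) auto
      then have "1 / (\<bar>c\<bar> * \<eta>) \<le> \<bar>x\<bar>" using x by simp
      then have "1 / \<eta> \<le> \<bar>c * x\<bar>" using False f(1) by (simp add: abs_mult field_simps)
      then show ?thesis by (rule f(5))
    qed
  qed
  have "continuous_on UNIV (\<lambda>z :: real \<times> real. (fst z, c * snd z))" by (intro continuous_intros)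
  from continuous_on_compose2[OF f(2) this] have c: "continuous_on UNIV (\<lambda>(t, x). f t (c * x))"
    by (simp add: case_prod_unfold)
  have "plane_test \<eta>' (\<lambda>t x. f t (c * x))"
    unfolding plane_test_def using pos f(3) z c f(6) by blast
  then show ?thesis ..
qed

text \<open>The finite number of lags matters. For each fixed x only finitely many lags contribute,
  but with infinitely many non-zero coefficients tending to 0 ever larger |x| are brought back into
  the support of f, so the full sum need not vanish for large |x|. This is why \<open>m\<close> goes
  to infinity only at the end.\<close>

lemma plane_test_cluster:
  assumes "plane_test \<eta> f"
  shows "\<exists>\<eta>'. plane_test \<eta>' (\<lambda>t x. \<Sum>l\<le>(m::nat). f t (\<kappa> l * x))"
proof (induction m)
  case 0
  then show ?case using plane_test_scale[OF assms] by simp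
next
  case (Suc m)
  then obtain \<eta>1 where "plane_test \<eta>1 (\<lambda>t x. \<Sum>l\<le>m. f t (\<kappa> l * x))" by blast
  moreover obtain \<eta>2 where "plane_test \<eta>2 (\<lambda>t x. f t (\<kappa> (Suc m) * x))" using plane_test_scale[OF assms] by blast
  ultimately have "plane_test (min \<eta>1 \<eta>2) (\<lambda>t x. (\<Sum>l\<le>m. f t (\<kappa> l * x)) + f t (\<kappa> (Suc m) * x))"
    by (rule plane_test_add)
  then show ?case by auto
qed

section \<open>The Laplace functional of the linear process\<close>

lemma exp_integral_borel:
  assumes "f \<in> test_functions E"
  shows "(\<lambda>\<mu>. exp (- (\<integral>z. f z \<partial>\<mu>)) :: real) \<in> borel_measurable (borel_of_topology (vague_topology E))"
  using continuous_map_borel_measurable[OF continuous_map_vague_test[OF assms]] by measurable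

context linear_process
begin

lemma lin_norm_eq: "lin_norm n i \<omega> = (lin_proc \<kappa> X i \<omega> - centering F \<kappa> n i) / quantile (abs_df F) (1 - 1 / real n)"
  unfolding lin_norm_def lin_proc_def centering_def bn_def ctr_def[symmetric]
  by (simp add: right_diff_distrib sum_subtractf)

lemma lin_point_process_eq:
  "lin_point_process F \<kappa> X n \<omega> = point_measure_on strip {1..n} (\<lambda>i. (real i / real n, lin_norm n i \<omega>))"
  unfolding lin_point_process_def lin_norm_eq ..

lemma random_element_lin: "random_element (vague_topology strip) M (lin_point_process F \<kappa> X n)"
proof -
  have "random_element (vague_topology strip) M (\<lambda>\<omega>. point_measure_on strip {1..n} (\<lambda>i. (real i / real n, lin_norm n i \<omega>)))"
    by (rule random_element_point_measure)
       (auto intro!: borel_measurable_Pair lin_norm_measurable)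
  then show ?thesis unfolding lin_point_process_eq[abs_def] .
qed

lemma laplace_lin:
  assumes f: "f \<in> test_functions strip" and nn: "\<And>z. z \<in> strip \<Longrightarrow> 0 \<le> f z"
  shows "(\<integral>\<mu>'. exp (- (\<integral>z. f z \<partial>\<mu>')) \<partial>law (vague_topology strip) M (lin_point_process F \<kappa> X n))
    = expectation (\<lambda>\<omega>. exp (- (\<Sum>i=1..n. plane_of f (real i / real n) (lin_norm n i \<omega>))))"
proof (rule integral_law[OF random_element_lin exp_integral_borel[OF f]])
  obtain \<eta> where \<eta>: "plane_test \<eta> (plane_of f)" using plane_test_plane_of[OF f nn] by blast
  have "random_variable borel (\<lambda>\<omega>. plane_of f (real i / real n) (lin_norm n i \<omega>))" for i
    by (rule plane_test_measurable[OF \<eta> _ lin_norm_measurable]) simp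
  then show "random_variable borel (\<lambda>\<omega>. exp (- (\<Sum>i=1..n. plane_of f (real i / real n) (lin_norm n i \<omega>))))"
    by measurable
  show "AE \<omega> in M. lin_point_process F \<kappa> X n \<omega> \<in> topspace (vague_topology strip) \<longrightarrow>
     exp (- (\<integral>z. f z \<partial>lin_point_process F \<kappa> X n \<omega>)) = exp (- (\<Sum>i=1..n. plane_of f (real i / real n) (lin_norm n i \<omega>)))"
  proof (rule AE_I2, rule impI)
    fix \<omega>
    let ?z = "\<lambda>i. (real i / real n, lin_norm n i \<omega>)"
    have R: "point_measure_on strip {1..n} ?z \<in> radon_measures strip" unfolding point_measure_radon_iff by auto
    have "(\<integral>z. f z \<partial>point_measure_on strip {1..n} ?z) = (\<Sum>i | i \<in> {1..n} \<and> ?z i \<in> strip \<and> f (?z i) \<noteq> 0. f (?z i))"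
      by (rule integral_point_measure(1)[OF f nn R])
    also have "\<dots> = (\<Sum>i=1..n. plane_of f (real i / real n) (lin_norm n i \<omega>))"
      by (intro sum.mono_neutral_cong_left) (auto simp: plane_of_strip split: if_splits)
    finally show "exp (- (\<integral>z. f z \<partial>lin_point_process F \<kappa> X n \<omega>)) = exp (- (\<Sum>i=1..n. plane_of f (real i / real n) (lin_norm n i \<omega>)))"
      unfolding lin_point_process_eq by simp
  qed
qed

text \<open>An exchange of limits. For all m from some m0 on, the cluster functional with m lags
  stays within e/4 of the process for large n, so a single m close to the limit in m is
  enough.\<close>

lemma laplace_lin_limit:
  assumes f: "plane_test \<eta> f"
    and jump: "\<And>m. (\<lambda>n. expectation (\<lambda>\<omega>. exp (- (\<Sum>j=1..n. \<Sum>l\<le>m. f (real j / real n) (\<kappa> l * (X j \<omega> / bn n)))))) \<longlonglongrightarrow> L m"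
    and L: "L \<longlonglongrightarrow> L'"
  shows "(\<lambda>n. expectation (\<lambda>\<omega>. exp (- (\<Sum>i=1..n. f (real i / real n) (lin_norm n i \<omega>))))) \<longlonglongrightarrow> L'"
proof (rule LIMSEQ_I)
  fix e :: real assume "e > 0"
  then have e4: "e / 4 > 0" by simp
  obtain m0 where m0: "\<forall>m\<ge>m0. \<forall>\<^sub>F n in sequentially.
    \<bar>expectation (\<lambda>\<omega>. exp (- (\<Sum>i=1..n. f (real i / real n) (lin_norm n i \<omega>))))
     - expectation (\<lambda>\<omega>. exp (- (\<Sum>j=1..n. \<Sum>l\<le>m. f (real j / real n) (\<kappa> l * (X j \<omega> / bn n)))))\<bar> \<le> e / 4"
    using process_approximation[OF f e4] by blast
  obtain m1 where m1: "\<forall>m\<ge>m1. norm (L m - L') < e / 4" using LIMSEQ_D[OF L e4] by blast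
  define m where "m = max m0 m1"
  have Lm: "\<bar>L m - L'\<bar> < e / 4" using m1 by (simp add: m_def)
  obtain n1 where n1: "\<forall>n\<ge>n1. norm (expectation (\<lambda>\<omega>. exp (- (\<Sum>j=1..n. \<Sum>l\<le>m. f (real j / real n) (\<kappa> l * (X j \<omega> / bn n))))) - L m) < e / 4"
    using LIMSEQ_D[OF jump e4] by blast
  have "m \<ge> m0" by (simp add: m_def)
  then obtain n2 where n2: "\<forall>n\<ge>n2. \<bar>expectation (\<lambda>\<omega>. exp (- (\<Sum>i=1..n. f (real i / real n) (lin_norm n i \<omega>))))
     - expectation (\<lambda>\<omega>. exp (- (\<Sum>j=1..n. \<Sum>l\<le>m. f (real j / real n) (\<kappa> l * (X j \<omega> / bn n)))))\<bar> \<le> e / 4"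
    using m0 unfolding eventually_sequentially by blast
  have "norm (expectation (\<lambda>\<omega>. exp (- (\<Sum>i=1..n. f (real i / real n) (lin_norm n i \<omega>)))) - L') < e"
    if n: "n \<ge> max n1 n2" for n
  proof -
    from n have "n \<ge> n1" "n \<ge> n2" by auto
    from n1[rule_format, OF this(1)] n2[rule_format, OF this(2)] Lm \<open>e > 0\<close> show ?thesis
      unfolding real_norm_def by linarith
  qed
  then show "\<exists>no. \<forall>n\<ge>no. norm (expectation (\<lambda>\<omega>. exp (- (\<Sum>i=1..n. f (real i / real n) (lin_norm n i \<omega>)))) - L') < e" by blast
qed

end

section \<open>The limit process\<close>

context marked_renewal_function
begin

text \<open>Exhibits \<open>Z N\<close> as a function of its own marks and waiting times only, so
  that independence of the two halves of the limit process can be quoted.\<close>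

lemma Z_factorization:
  "\<exists>\<Phi> \<in> borel_measurable (PiM (v ` {1..} \<union> w ` {1..}) (\<lambda>_. borel)).
     \<forall>\<omega>. Z N \<omega> = \<Phi> (restrict (\<lambda>i. Y i \<omega>) (v ` {1..} \<union> w ` {1..}))"
proof
  let ?A = "v ` {1..} \<union> w ` {1..}"
  let ?\<Phi> = "\<lambda>x. \<Prod>j=1..N. exp (- h (x (v j)) (\<Sum>k=1..j. x (w k)))"
  have c: "(\<lambda>x. x i) \<in> borel_measurable (PiM ?A (\<lambda>_. borel))" if "i \<in> ?A" for i
    by (rule measurable_component_singleton[OF that])
  show "?\<Phi> \<in> borel_measurable (PiM ?A (\<lambda>_. borel))"
    by (intro borel_measurable_prod measurable_compose[OF _ borel_measurable_exp] borel_measurable_uminus h_measurable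
          borel_measurable_sum c) auto
  show "\<forall>\<omega>. Z N \<omega> = ?\<Phi> (restrict (\<lambda>i. Y i \<omega>) ?A)"
    by (auto simp: Z_def W_def intro!: prod.cong sum.cong arg_cong2[of _ _ _ _ h])
qed

end

text \<open>Since \<kappa> is bounded and W_j tends to infinity, only finitely many j can reach
  level \<eta>; for each of these, \<kappa> i tending to 0 leaves finitely many i.\<close>

lemma finite_cluster_points:
  fixes \<kappa> W :: "nat \<Rightarrow> real"
  assumes "0 < \<alpha>" and kappa: "\<kappa> \<longlonglongrightarrow> 0" and W: "filterlim W at_top sequentially" and pos: "0 < \<eta>"
  shows "finite {(j, i). \<eta> \<le> \<bar>c * \<kappa> i * W j powr (- 1 / \<alpha>)\<bar>}"
proof -
  have neg: "- 1 / \<alpha> < 0" using assms(1) by simp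
  have "(\<lambda>j. W j powr (- 1 / \<alpha>)) \<longlonglongrightarrow> 0" by (rule tendsto_neg_powr[OF neg W])
  then have Wlim: "(\<lambda>j. \<bar>C * W j powr (- 1 / \<alpha>)\<bar>) \<longlonglongrightarrow> 0" for C by (intro tendsto_rabs_zero tendsto_mult_right_zero)
  obtain K where K: "K > 0" "\<And>i. norm (\<kappa> i) \<le> K"
    using convergent_imp_Bseq[OF convergentI[OF kappa]] unfolding Bseq_def by blast
  have "\<forall>\<^sub>F j in sequentially. \<bar>(\<bar>c\<bar> * K) * W j powr (- 1 / \<alpha>)\<bar> < \<eta>" by (rule order_tendstoD(2)[OF Wlim pos])
  then obtain J where J: "\<forall>j\<ge>J. \<bar>(\<bar>c\<bar> * K) * W j powr (- 1 / \<alpha>)\<bar> < \<eta>" unfolding eventually_sequentially by blast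
  have fin: "finite {i. \<eta> \<le> \<bar>c * \<kappa> i * W j powr (- 1 / \<alpha>)\<bar>}" for j
  proof -
    have "(\<lambda>i. \<bar>c * \<kappa> i * W j powr (- 1 / \<alpha>)\<bar>) \<longlonglongrightarrow> 0"
      by (intro tendsto_rabs_zero tendsto_mult_left_zero tendsto_mult_right_zero kappa)
    then have "\<forall>\<^sub>F i in sequentially. \<bar>c * \<kappa> i * W j powr (- 1 / \<alpha>)\<bar> < \<eta>" by (rule order_tendstoD(2)[OF _ pos])
    then obtain m where m: "\<forall>i\<ge>m. \<bar>c * \<kappa> i * W j powr (- 1 / \<alpha>)\<bar> < \<eta>" unfolding eventually_sequentially by blast
    have "i < m" if "\<eta> \<le> \<bar>c * \<kappa> i * W j powr (- 1 / \<alpha>)\<bar>" for i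
      using m[rule_format, of i] that by linarith
    then have "{i. \<eta> \<le> \<bar>c * \<kappa> i * W j powr (- 1 / \<alpha>)\<bar>} \<subseteq> {..<m}" by blast
    then show ?thesis by (rule finite_subset) simp
  qed
  have "j < J" if "\<eta> \<le> \<bar>c * \<kappa> i * W j powr (- 1 / \<alpha>)\<bar>" for i j
  proof (rule ccontr)
    assume "\<not> j < J"
    then have "\<bar>(\<bar>c\<bar> * K) * W j powr (- 1 / \<alpha>)\<bar> < \<eta>" using J by (simp only: not_less)
    moreover have "\<bar>c * \<kappa> i * W j powr (- 1 / \<alpha>)\<bar> \<le> \<bar>(\<bar>c\<bar> * K) * W j powr (- 1 / \<alpha>)\<bar>"
      unfolding abs_mult by (intro mult_mono) (use K in auto)
    ultimately show False using that by linarith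
  qed
  then have "{(j, i). \<eta> \<le> \<bar>c * \<kappa> i * W j powr (- 1 / \<alpha>)\<bar>} \<subseteq> (SIGMA j:{..<J}. {i. \<eta> \<le> \<bar>c * \<kappa> i * W j powr (- 1 / \<alpha>)\<bar>})" by auto
  then show ?thesis by (rule finite_subset) (intro finite_SigmaI finite_lessThan fin)
qed

lemma strip_exh_lower: "z \<in> strip_exh m \<Longrightarrow> 1 / (real m + 1) \<le> \<bar>snd z\<bar>"
proof -
  assume "z \<in> strip_exh m"
  then have nz: "\<bar>snd z\<bar> > 0" and le: "\<bar>snd z\<bar> + 1 / \<bar>snd z\<bar> \<le> real m" by (auto simp: strip_exh_iff strip_def)
  from nz le have "1 / \<bar>snd z\<bar> \<le> real m + 1" by linarith
  then show ?thesis using nz by (simp add: field_simps)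
qed

locale two_sided_marks = prob_space M for M :: "'b measure" +
  fixes V V' w w' :: "nat \<Rightarrow> 'b \<Rightarrow> real"
  assumes indep: "indep_vars (\<lambda>_. borel) (case_sum (case_sum V V') (case_sum w w')) (({1..} <+> {1..}) <+> ({1..} <+> {1..}))"
    and V: "\<And>i. 1 \<le> i \<Longrightarrow> distr M lborel (V i) = unif01" "\<And>i. 1 \<le> i \<Longrightarrow> distr M lborel (V' i) = unif01"
    and w: "\<And>i. 1 \<le> i \<Longrightarrow> distributed M lborel (w i) (exponential_density 1)"
      "\<And>i. 1 \<le> i \<Longrightarrow> distributed M lborel (w' i) (exponential_density 1)"
begin

abbreviation "marks \<equiv> case_sum (case_sum V V') (case_sum w w')"
abbreviation "mark_index \<equiv> ({1..} <+> {1..}) <+> ({1..} <+> {1..}) :: ((nat + nat) + (nat + nat)) set"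

lemma distr_borel: "distr M borel Z = distr M lborel Z"
  by (rule distr_cong) auto

sublocale pos: marked_renewal M marks mark_index "\<lambda>j. Inl (Inl j)" "\<lambda>j. Inr (Inl j)"
  using indep V w distributed_distr_eq_density[OF w(1)]
  by unfold_locales (auto simp: distr_borel inj_def)

sublocale neg: marked_renewal M marks mark_index "\<lambda>j. Inl (Inr j)" "\<lambda>j. Inr (Inr j)"
  using indep V w distributed_distr_eq_density[OF w(2)]
  by unfold_locales (auto simp: distr_borel inj_def)

lemma W_eq: "pos.W N \<omega> = partial_sum w N \<omega>" "neg.W N \<omega> = partial_sum w' N \<omega>"
  by (simp_all add: pos.W_def neg.W_def partial_sum_def)

lemma marks_measurable:
  "1 \<le> j \<Longrightarrow> random_variable borel (V j)" "1 \<le> j \<Longrightarrow> random_variable borel (V' j)"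
  "random_variable borel (partial_sum w j)" "random_variable borel (partial_sum w' j)"
  using pos.rv(1)[of j] neg.rv(1)[of j] pos.W_measurable[of j] neg.W_measurable[of j]
  by (simp_all add: W_eq[abs_def])

lemma AE_unif01:
  assumes "distr M lborel Z = unif01" "random_variable borel Z"
  shows "AE \<omega> in M. 0 \<le> Z \<omega> \<and> Z \<omega> \<le> 1"
proof -
  have "AE x in unif01. x \<in> {0..1}" by (rule AE_uniform_measureI) auto
  then have "AE x in distr M borel Z. x \<in> {0..1}" unfolding distr_borel assms(1) .
  then have "AE \<omega> in M. Z \<omega> \<in> {0..1}" by (subst (asm) AE_distr_iff) (use assms(2) in auto)
  then show ?thesis by simp
qed

text \<open>The almost sure event on which the limit is a genuine point measure and on which all
  pathwise statements about it are made.\<close>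

definition good :: "'b \<Rightarrow> bool" where
  "good \<omega> \<longleftrightarrow> (\<forall>j\<ge>1. 0 \<le> V j \<omega> \<and> V j \<omega> \<le> 1 \<and> 0 \<le> V' j \<omega> \<and> V' j \<omega> \<le> 1
      \<and> 0 < partial_sum w j \<omega> \<and> 0 < partial_sum w' j \<omega>)
    \<and> filterlim (\<lambda>j. partial_sum w j \<omega>) at_top sequentially
    \<and> filterlim (\<lambda>j. partial_sum w' j \<omega>) at_top sequentially"

lemma AE_good: "AE \<omega> in M. good \<omega>"
proof -
  have "AE \<omega> in M. \<forall>j\<in>{1..}. 0 \<le> V j \<omega> \<and> V j \<omega> \<le> 1"
    unfolding AE_ball_countable[OF countableI_type] using AE_unif01[OF V(1) marks_measurable(1)] by simp
  moreover have "AE \<omega> in M. \<forall>j\<in>{1..}. 0 \<le> V' j \<omega> \<and> V' j \<omega> \<le> 1"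
    unfolding AE_ball_countable[OF countableI_type] using AE_unif01[OF V(2) marks_measurable(2)] by simp
  ultimately show ?thesis
    using pos.AE_W_pos neg.AE_W_pos pos.AE_W_at_top neg.AE_W_at_top
    unfolding W_eq by eventually_elim (auto simp: good_def)
qed

lemma product_laplace:
  assumes h: "mark_function h T" and h': "mark_function h' T'"
  shows "(\<lambda>N. expectation (\<lambda>\<omega>. exp (- (\<Sum>j=1..N. h (V j \<omega>) (partial_sum w j \<omega>) + h' (V' j \<omega>) (partial_sum w' j \<omega>)))))
    \<longlonglongrightarrow> exp (- (integral {0..T} (mark_function.\<psi> h) + integral {0..T'} (mark_function.\<psi> h')))"
proof -
  interpret P: mark_function h T by fact
  interpret P': mark_function h' T' by fact
  interpret Q: marked_renewal_function M marks mark_index "\<lambda>j. Inl (Inl j)" "\<lambda>j. Inr (Inl j)" h T ..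
  interpret Q': marked_renewal_function M marks mark_index "\<lambda>j. Inl (Inr j)" "\<lambda>j. Inr (Inr j)" h' T' ..
  let ?A = "(\<lambda>j. Inl (Inl j)) ` {1..} \<union> (\<lambda>j. Inr (Inl j)) ` {1..} :: ((nat + nat) + (nat + nat)) set"
  let ?B = "(\<lambda>j. Inl (Inr j)) ` {1..} \<union> (\<lambda>j. Inr (Inr j)) ` {1..} :: ((nat + nat) + (nat + nat)) set"
  have ind: "indep_var (PiM ?A (\<lambda>_. borel)) (\<lambda>\<omega>. restrict (\<lambda>i. marks i \<omega>) ?A) (PiM ?B (\<lambda>_. borel)) (\<lambda>\<omega>. restrict (\<lambda>i. marks i \<omega>) ?B)"
    by (rule indep_var_restrict[OF indep]) auto
  have prod: "expectation (\<lambda>\<omega>. Q.Z N \<omega> * Q'.Z N \<omega>) = expectation (Q.Z N) * expectation (Q'.Z N)" for N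
  proof -
    obtain \<Phi> where \<Phi>: "\<Phi> \<in> borel_measurable (PiM ?A (\<lambda>_. borel))" "\<And>\<omega>. Q.Z N \<omega> = \<Phi> (restrict (\<lambda>i. marks i \<omega>) ?A)"
      using Q.Z_factorization[of N] by blast
    obtain \<Phi>' where \<Phi>': "\<Phi>' \<in> borel_measurable (PiM ?B (\<lambda>_. borel))" "\<And>\<omega>. Q'.Z N \<omega> = \<Phi>' (restrict (\<lambda>i. marks i \<omega>) ?B)"
      using Q'.Z_factorization[of N] by blast
    have "indep_var borel (\<Phi> \<circ> (\<lambda>\<omega>. restrict (\<lambda>i. marks i \<omega>) ?A)) borel (\<Phi>' \<circ> (\<lambda>\<omega>. restrict (\<lambda>i. marks i \<omega>) ?B))"
      by (rule indep_var_compose[OF ind \<Phi>(1) \<Phi>'(1)])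
    moreover have "\<Phi> \<circ> (\<lambda>\<omega>. restrict (\<lambda>i. marks i \<omega>) ?A) = Q.Z N" "\<Phi>' \<circ> (\<lambda>\<omega>. restrict (\<lambda>i. marks i \<omega>) ?B) = Q'.Z N"
      by (auto simp: fun_eq_iff \<Phi>(2) \<Phi>'(2))
    ultimately have "indep_var borel (Q.Z N) borel (Q'.Z N)" by (simp only:)
    then show ?thesis
      by (rule indep_var_lebesgue_integral)
         (auto intro!: integrable_const_bound[of _ 1] Q.Z_measurable Q'.Z_measurable simp: Q.Z_bounds Q'.Z_bounds)
  qed
  have e: "Q.Z N \<omega> * Q'.Z N \<omega> = exp (- (\<Sum>j=1..N. h (V j \<omega>) (partial_sum w j \<omega>) + h' (V' j \<omega>) (partial_sum w' j \<omega>)))" for N \<omega>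
    unfolding Q.Z_def Q'.Z_def W_eq prod.distrib[symmetric] sum_negf[symmetric]
    by (simp add: exp_sum exp_add[symmetric] add.commute)
  have "(\<lambda>N. expectation (Q.Z N) * expectation (Q'.Z N)) \<longlonglongrightarrow> exp (- integral {0..T} P.\<psi>) * exp (- integral {0..T'} P'.\<psi>)"
    by (intro tendsto_mult Q.laplace_limit Q'.laplace_limit)
  then show ?thesis unfolding prod[symmetric] e by (simp add: exp_add[symmetric] add.commute)
qed

end

locale limit_process = two_sided_marks M V V' w w'
  for M :: "'b measure" and V V' w w' :: "nat \<Rightarrow> 'b \<Rightarrow> real" +
  fixes \<alpha> p q :: real and \<kappa> :: "nat \<Rightarrow> real"
  assumes alpha_pos: "0 < \<alpha>" and kappa_lim: "\<kappa> \<longlonglongrightarrow> 0"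
begin

abbreviation "point_index \<equiv> ({1..} \<times> UNIV) <+> ({1..} \<times> UNIV) :: (nat \<times> nat + nat \<times> nat) set"

definition point :: "nat \<times> nat + nat \<times> nat \<Rightarrow> 'b \<Rightarrow> real \<times> real" where
  "point k \<omega> = case_sum
     (\<lambda>(j, i). (V j \<omega>, p powr (1 / \<alpha>) * \<kappa> i * partial_sum w j \<omega> powr (- 1 / \<alpha>)))
     (\<lambda>(j, i). (V' j \<omega>, - (q powr (1 / \<alpha>)) * \<kappa> i * partial_sum w' j \<omega> powr (- 1 / \<alpha>))) k"

lemma limit_point_process_eq:
  "limit_point_process \<alpha> p q \<kappa> V V' w w' \<omega> = point_measure_on strip point_index (\<lambda>k. point k \<omega>)"
  unfolding limit_point_process_def point_def ..

lemma point_simps: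
  "point (Inl (j, i)) \<omega> = (V j \<omega>, p powr (1 / \<alpha>) * \<kappa> i * partial_sum w j \<omega> powr (- 1 / \<alpha>))"
  "point (Inr (j, i)) \<omega> = (V' j \<omega>, - (q powr (1 / \<alpha>)) * \<kappa> i * partial_sum w' j \<omega> powr (- 1 / \<alpha>))"
  by (simp_all add: point_def)

lemma point_measurable:
  assumes "k \<in> point_index"
  shows "random_variable borel (point k)"
proof (cases k)
  case (Inl z)
  then obtain j i where k: "k = Inl (j, i)" "1 \<le> j" using assms by (cases z) auto
  have "random_variable borel (\<lambda>\<omega>. partial_sum w j \<omega> powr (- 1 / \<alpha>))" using marks_measurable(3)[of j] by measurable
  then show ?thesis unfolding k(1) point_simps[abs_def]
    by (intro borel_measurable_Pair borel_measurable_times borel_measurable_const marks_measurable(1) k(2))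
next
  case (Inr z)
  then obtain j i where k: "k = Inr (j, i)" "1 \<le> j" using assms by (cases z) auto
  have "random_variable borel (\<lambda>\<omega>. partial_sum w' j \<omega> powr (- 1 / \<alpha>))" using marks_measurable(4)[of j] by measurable
  then show ?thesis unfolding k(1) point_simps[abs_def]
    by (intro borel_measurable_Pair borel_measurable_times borel_measurable_const marks_measurable(2) k(2))
qed

lemma finite_points:
  assumes "good \<omega>"
  shows "finite {k \<in> point_index. point k \<omega> \<in> strip_exh m}"
proof -
  have eta: "0 < 1 / (real m + 1)" by simp
  let ?P = "{(j, i). 1 / (real m + 1) \<le> \<bar>p powr (1 / \<alpha>) * \<kappa> i * partial_sum w j \<omega> powr (- 1 / \<alpha>)\<bar>}"
  let ?N = "{(j, i). 1 / (real m + 1) \<le> \<bar>- (q powr (1 / \<alpha>)) * \<kappa> i * partial_sum w' j \<omega> powr (- 1 / \<alpha>)\<bar>}"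
  have fin: "finite ?P" "finite ?N"
    using assms by (auto simp only: good_def intro!: finite_cluster_points alpha_pos kappa_lim eta)
  have "k \<in> ?P <+> ?N" if "point k \<omega> \<in> strip_exh m" for k
  proof (cases k)
    case (Inl z)
    obtain j i where z: "z = (j, i)" by (cases z)
    show ?thesis using strip_exh_lower[OF that] unfolding Inl z point_simps snd_conv by (intro InlI) blast
  next
    case (Inr z)
    obtain j i where z: "z = (j, i)" by (cases z)
    show ?thesis using strip_exh_lower[OF that] unfolding Inr z point_simps snd_conv by (intro InrI) blast
  qed
  then have "{k \<in> point_index. point k \<omega> \<in> strip_exh m} \<subseteq> ?P <+> ?N" by blast
  then show ?thesis by (rule finite_subset) (intro finite_Plus fin)
qed

lemma random_element_limit:
  "random_element (vague_topology strip) M (limit_point_process \<alpha> p q \<kappa> V V' w w')"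
proof -
  have "random_element (vague_topology strip) M (\<lambda>\<omega>. point_measure_on strip point_index (\<lambda>k. point k \<omega>))"
  proof (rule random_element_point_measure)
    show "AE \<omega> in M. \<forall>m. finite {k \<in> point_index. point k \<omega> \<in> strip_exh m}"
      using AE_good by eventually_elim (simp only: finite_points simp_thms)
  qed (auto intro: point_measurable)
  then show ?thesis unfolding limit_point_process_eq[abs_def] .
qed

text \<open>The limit functional cut down to N renewal points and lags up to m. The coefficient is
  placed in front of the height so that each inner sum is the cluster functional evaluated at one
  height, ready for \<open>mark_of\<close>.\<close>

definition box_sum :: "(real \<Rightarrow> real \<Rightarrow> real) \<Rightarrow> nat \<Rightarrow> nat \<Rightarrow> 'b \<Rightarrow> real" where
  "box_sum f N m \<omega> = (\<Sum>j=1..N. (\<Sum>l\<le>m. f (V j \<omega>) (\<kappa> l * (p powr (1 / \<alpha>) * partial_sum w j \<omega> powr (- 1 / \<alpha>))))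
     + (\<Sum>l\<le>m. f (V' j \<omega>) (\<kappa> l * (- (q powr (1 / \<alpha>)) * partial_sum w' j \<omega> powr (- 1 / \<alpha>)))))"

lemma box_sum_eq:
  "box_sum f N m \<omega> = (\<Sum>k\<in>({1..N} \<times> {..m}) <+> ({1..N} \<times> {..m}). f (fst (point k \<omega>)) (snd (point k \<omega>)))"
  by (subst sum.Plus)
     (auto simp: box_sum_def sum.distrib sum.cartesian_product case_prod_unfold point_def mult_ac)

lemma box_sum_measurable:
  assumes "plane_test \<eta> f"
  shows "random_variable borel (box_sum f N m)"
proof -
  have "random_variable borel (\<lambda>\<omega>. f (fst (point k \<omega>)) (snd (point k \<omega>)))" if "k \<in> ({1..N} \<times> {..m}) <+> ({1..N} \<times> {..m})" for k
  proof (rule plane_test_measurable[OF assms])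
    have "random_variable borel (point k)" using that by (intro point_measurable) auto
    then show "random_variable borel (\<lambda>\<omega>. fst (point k \<omega>))" "random_variable borel (\<lambda>\<omega>. snd (point k \<omega>))"
      unfolding borel_prod[symmetric] by measurable
  qed
  then show ?thesis unfolding box_sum_eq[abs_def] by (intro borel_measurable_sum)
qed

text \<open>The limit has exactly the form of \<open>jump_laplace\<close> for the cluster functional
  with m lags. This is where the linear process and its limit meet.\<close>

lemma box_sum_laplace:
  assumes f: "plane_test \<eta> f" and g: "plane_test \<eta>' (\<lambda>t x. \<Sum>l\<le>m. f t (\<kappa> l * x))"
  shows "(\<lambda>N. expectation (\<lambda>\<omega>. exp (- box_sum f N m \<omega>))) \<longlonglongrightarrow>
    exp (- (integral {0..(\<bar>p powr (1/\<alpha>)\<bar> / \<eta>') powr \<alpha>} (mark_function.\<psi> (mark_of \<alpha> (\<lambda>t x. \<Sum>l\<le>m. f t (\<kappa> l * x)) (p powr (1/\<alpha>))))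
      + integral {0..(\<bar>- (q powr (1/\<alpha>))\<bar> / \<eta>') powr \<alpha>} (mark_function.\<psi> (mark_of \<alpha> (\<lambda>t x. \<Sum>l\<le>m. f t (\<kappa> l * x)) (- (q powr (1/\<alpha>)))))))"
    (is "_ \<longlonglongrightarrow> ?L")
proof -
  let ?h = "mark_of \<alpha> (\<lambda>t x. \<Sum>l\<le>m. f t (\<kappa> l * x)) (p powr (1/\<alpha>))"
  let ?h' = "mark_of \<alpha> (\<lambda>t x. \<Sum>l\<le>m. f t (\<kappa> l * x)) (- (q powr (1/\<alpha>)))"
  note mf = mark_function_mark_of[OF g alpha_pos]
  interpret P: mark_function ?h "(\<bar>p powr (1/\<alpha>)\<bar> / \<eta>') powr \<alpha>" by (rule mf)
  interpret P': mark_function ?h' "(\<bar>- (q powr (1/\<alpha>))\<bar> / \<eta>') powr \<alpha>" by (rule mf)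
  have "expectation (\<lambda>\<omega>. exp (- box_sum f N m \<omega>))
    = expectation (\<lambda>\<omega>. exp (- (\<Sum>j=1..N. ?h (V j \<omega>) (partial_sum w j \<omega>) + ?h' (V' j \<omega>) (partial_sum w' j \<omega>))))" for N
  proof (rule integral_cong_AE)
    show "(\<lambda>\<omega>. exp (- box_sum f N m \<omega>)) \<in> borel_measurable M" using box_sum_measurable[OF f] by measurable
    have "(\<lambda>\<omega>. \<Sum>j=1..N. ?h (V j \<omega>) (partial_sum w j \<omega>) + ?h' (V' j \<omega>) (partial_sum w' j \<omega>)) \<in> borel_measurable M"
      by (intro borel_measurable_sum borel_measurable_add P.h_measurable P'.h_measurable marks_measurable) auto
    then show "(\<lambda>\<omega>. exp (- (\<Sum>j=1..N. ?h (V j \<omega>) (partial_sum w j \<omega>) + ?h' (V' j \<omega>) (partial_sum w' j \<omega>)))) \<in> borel_measurable M"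
      by measurable
    show "AE \<omega> in M. exp (- box_sum f N m \<omega>) = exp (- (\<Sum>j=1..N. ?h (V j \<omega>) (partial_sum w j \<omega>) + ?h' (V' j \<omega>) (partial_sum w' j \<omega>)))"
      using AE_good
    proof eventually_elim
      case (elim \<omega>)
      have "box_sum f N m \<omega> = (\<Sum>j=1..N. ?h (V j \<omega>) (partial_sum w j \<omega>) + ?h' (V' j \<omega>) (partial_sum w' j \<omega>))"
        unfolding box_sum_def
      proof (rule sum.cong[OF refl])
        fix j assume "j \<in> {1..N}"
        then have "\<not> partial_sum w j \<omega> \<le> 0" "\<not> partial_sum w' j \<omega> \<le> 0" using elim by (auto simp: good_def not_le)
        then show "(\<Sum>l\<le>m. f (V j \<omega>) (\<kappa> l * (p powr (1 / \<alpha>) * partial_sum w j \<omega> powr (- 1 / \<alpha>))))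
          + (\<Sum>l\<le>m. f (V' j \<omega>) (\<kappa> l * (- (q powr (1 / \<alpha>)) * partial_sum w' j \<omega> powr (- 1 / \<alpha>))))
          = ?h (V j \<omega>) (partial_sum w j \<omega>) + ?h' (V' j \<omega>) (partial_sum w' j \<omega>)"
          by (simp only: mark_of_def if_False)
      qed
      then show ?case by (simp only:)
    qed
  qed
  then show ?thesis using product_laplace[OF mf mf, of "p powr (1/\<alpha>)" "- (q powr (1/\<alpha>))"] by (simp only:)
qed

text \<open>On a good path only finitely many points carry mass for f. Because n(m) >= m, the boxes
  eventually contain all their indices and the truncated sum equals the integral.\<close>

lemma box_sum_eventually:
  assumes f: "f \<in> test_functions strip" and nn: "\<And>z. z \<in> strip \<Longrightarrow> 0 \<le> f z" and good: "good \<omega>" and n: "\<And>m. m \<le> n m"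
  shows "\<forall>\<^sub>F m in sequentially. box_sum (plane_of f) (n m) m \<omega> = (\<integral>z. f z \<partial>point_measure_on strip point_index (\<lambda>k. point k \<omega>))"
proof -
  have R: "point_measure_on strip point_index (\<lambda>k. point k \<omega>) \<in> radon_measures strip"
    unfolding point_measure_radon_iff using finite_points[OF good] by blast
  define D where "D = {k \<in> point_index. point k \<omega> \<in> strip \<and> f (point k \<omega>) \<noteq> 0}"
  have finD: "finite D" unfolding D_def by (rule integral_point_measure(2)[OF f nn R])
  define b where "b = case_sum (\<lambda>(j, i). max j i) (\<lambda>(j :: nat, i :: nat). max j i)"
  obtain m0 where m0: "\<And>k. k \<in> D \<Longrightarrow> b k \<le> m0" using finite_imageI[OF finD, of b] unfolding finite_nat_set_iff_bounded_le by blast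
  have "box_sum (plane_of f) (n m) m \<omega> = (\<Sum>k\<in>D. f (point k \<omega>))" if m: "m \<ge> m0" for m
    unfolding box_sum_eq
  proof (rule sum.mono_neutral_cong_right)
    let ?B = "({1..n m} \<times> {..m}) <+> ({1..n m} \<times> {..m})"
    show "finite ?B" by (intro finite_Plus finite_cartesian_product) auto
    show "D \<subseteq> ?B"
    proof
      fix k assume k: "k \<in> D"
      have "b k \<le> m" using m0[OF k] m by simp
      moreover have "k \<in> point_index" using k by (simp add: D_def)
      ultimately show "k \<in> ?B" using n[of m] by (auto simp: b_def)
    qed
    have t: "0 \<le> fst (point k \<omega>) \<and> fst (point k \<omega>) \<le> 1" if "k \<in> ?B" for k
      using that good by (auto simp: good_def point_simps)
    have pl: "plane_of f (fst (point k \<omega>)) (snd (point k \<omega>)) = (if point k \<omega> \<in> strip then f (point k \<omega>) else 0)" if "k \<in> ?B" for k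
      using plane_of_strip[of "fst (point k \<omega>)" f "snd (point k \<omega>)"] t[OF that] by simp
    show "\<forall>k\<in>?B - D. plane_of f (fst (point k \<omega>)) (snd (point k \<omega>)) = 0"
    proof
      fix k assume k: "k \<in> ?B - D"
      then have "k \<in> point_index" by auto
      then show "plane_of f (fst (point k \<omega>)) (snd (point k \<omega>)) = 0" using k pl[of k] by (auto simp: D_def)
    qed
    fix k assume k: "k \<in> D"
    then have "k \<in> ?B" using \<open>D \<subseteq> ?B\<close> by blast
    then show "plane_of f (fst (point k \<omega>)) (snd (point k \<omega>)) = f (point k \<omega>)" using k pl[of k] by (simp add: D_def)
  qed
  moreover have "(\<integral>z. f z \<partial>point_measure_on strip point_index (\<lambda>k. point k \<omega>)) = (\<Sum>k\<in>D. f (point k \<omega>))"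
    using integral_point_measure(1)[OF f nn R] unfolding D_def by simp
  ultimately show ?thesis unfolding eventually_sequentially by metis
qed

text \<open>For fixed m the limit in N is known, but the full functional is reached only when N and
  m grow together. A diagonal sequence n(m) >= m with error below 1/(m + 1) reconciles the
  two.\<close>

lemma laplace_limit_process:
  assumes f: "f \<in> test_functions strip" and nn: "\<And>z. z \<in> strip \<Longrightarrow> 0 \<le> f z"
    and lim: "\<And>m. (\<lambda>N. expectation (\<lambda>\<omega>. exp (- box_sum (plane_of f) N m \<omega>))) \<longlonglongrightarrow> L m"
  shows "L \<longlonglongrightarrow> (\<integral>\<mu>. exp (- (\<integral>z. f z \<partial>\<mu>)) \<partial>law (vague_topology strip) M (limit_point_process \<alpha> p q \<kappa> V V' w w'))"
proof -
  obtain \<eta> where \<eta>: "plane_test \<eta> (plane_of f)" using plane_test_plane_of[OF f nn] by blast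
  let ?E = "\<lambda>N m. expectation (\<lambda>\<omega>. exp (- box_sum (plane_of f) N m \<omega>))"
  have "\<exists>N\<ge>m. \<bar>?E N m - L m\<bar> < 1 / (real m + 1)" for m
  proof -
    obtain N0 where N0: "\<forall>N\<ge>N0. norm (?E N m - L m) < 1 / (real m + 1)"
      using LIMSEQ_D[OF lim[of m], of "1 / (real m + 1)"] by auto
    then show ?thesis by (intro exI[of _ "max N0 m"]) simp
  qed
  then obtain n where n: "\<And>m. m \<le> n m" "\<And>m. \<bar>?E (n m) m - L m\<bar> < 1 / (real m + 1)" by metis
  \<comment> \<open>The integral in extended-real form, measurable on the whole space, while the
    point measure itself is usable only almost surely.\<close>
  let ?S = "\<lambda>\<omega>. enn2real (\<integral>\<^sup>+k. (if point k \<omega> \<in> strip then ennreal (f (point k \<omega>)) else 0) \<partial>count_space point_index)"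
  have pm: "(\<lambda>\<omega>. if point k \<omega> \<in> strip then ennreal (f (point k \<omega>)) else 0) \<in> borel_measurable M" if k: "k \<in> point_index" for k
  proof -
    have fm: "f \<in> borel_measurable (restrict_space borel strip)" by (rule test_function_measurable[OF f refl])
    have "(\<lambda>z. if z \<in> strip then ennreal (f z) else 0) \<in> borel_measurable borel"
      using fm by (subst measurable_If_restrict_space_iff) auto
    from measurable_compose[OF point_measurable[OF k] this] show ?thesis .
  qed
  have S: "?S \<in> borel_measurable M"
    by (intro borel_measurable_enn2real borel_measurable_nn_integral_count_space pm) auto
  have S_eq: "AE \<omega> in M. ?S \<omega> = (\<integral>z. f z \<partial>point_measure_on strip point_index (\<lambda>k. point k \<omega>))"
    using AE_good
  proof eventually_elim
    case (elim \<omega>)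
    have "point_measure_on strip point_index (\<lambda>k. point k \<omega>) \<in> radon_measures strip"
      unfolding point_measure_radon_iff using finite_points[OF elim] by blast
    from integral_point_measure(3)[OF f nn this] show ?case by simp
  qed
  have "(\<lambda>m. ?E (n m) m) \<longlonglongrightarrow> expectation (\<lambda>\<omega>. exp (- ?S \<omega>))"
  proof (rule integral_dominated_convergence[where w="\<lambda>_. 1"])
    show "(\<lambda>\<omega>. exp (- ?S \<omega>)) \<in> borel_measurable M" using S by measurable
    show "(\<lambda>\<omega>. exp (- box_sum (plane_of f) (n m) m \<omega>)) \<in> borel_measurable M" for m
      using box_sum_measurable[OF \<eta>] by measurable
    have "0 \<le> box_sum (plane_of f) N m \<omega>" for N m \<omega>
      unfolding box_sum_def by (intro sum_nonneg add_nonneg_nonneg plane_testD(3)[OF \<eta>])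
    then show "AE \<omega> in M. norm (exp (- box_sum (plane_of f) (n m) m \<omega>)) \<le> 1" for m by simp
    show "AE \<omega> in M. (\<lambda>m. exp (- box_sum (plane_of f) (n m) m \<omega>)) \<longlonglongrightarrow> exp (- ?S \<omega>)"
      using AE_good S_eq
    proof eventually_elim
      case (elim \<omega>)
      have "\<forall>\<^sub>F m in sequentially. box_sum (plane_of f) (n m) m \<omega> = (\<integral>z. f z \<partial>point_measure_on strip point_index (\<lambda>k. point k \<omega>))"
        by (rule box_sum_eventually[OF f nn elim(1) n(1)])
      then have "\<forall>\<^sub>F m in sequentially. exp (- box_sum (plane_of f) (n m) m \<omega>) = exp (- ?S \<omega>)"
        by (rule eventually_mono) (simp only: elim(2))
      then show ?case by (rule tendsto_eventually)
    qed
  qed simp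
  moreover have "(\<lambda>m. L m - ?E (n m) m) \<longlonglongrightarrow> 0"
  proof (rule Lim_null_comparison)
    show "\<forall>\<^sub>F m in sequentially. norm (L m - ?E (n m) m) \<le> 1 / (real m + 1)"
      using n(2) by (intro always_eventually allI) (simp add: abs_minus_commute less_imp_le)
    show "(\<lambda>m. 1 / (real m + 1)) \<longlonglongrightarrow> 0" by real_asymp
  qed
  ultimately have "(\<lambda>m. (L m - ?E (n m) m) + ?E (n m) m) \<longlonglongrightarrow> 0 + expectation (\<lambda>\<omega>. exp (- ?S \<omega>))"
    by (intro tendsto_add)
  then have "L \<longlonglongrightarrow> expectation (\<lambda>\<omega>. exp (- ?S \<omega>))" by simp
  moreover have "(\<integral>\<mu>. exp (- (\<integral>z. f z \<partial>\<mu>)) \<partial>law (vague_topology strip) M (limit_point_process \<alpha> p q \<kappa> V V' w w'))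
    = expectation (\<lambda>\<omega>. exp (- ?S \<omega>))"
  proof (rule integral_law[OF random_element_limit exp_integral_borel[OF f]])
    show "random_variable borel (\<lambda>\<omega>. exp (- ?S \<omega>))" using S by measurable
    show "AE \<omega> in M. limit_point_process \<alpha> p q \<kappa> V V' w w' \<omega> \<in> topspace (vague_topology strip) \<longrightarrow>
      exp (- (\<integral>z. f z \<partial>limit_point_process \<alpha> p q \<kappa> V V' w w' \<omega>)) = exp (- ?S \<omega>)"
      unfolding limit_point_process_eq using S_eq by eventually_elim (simp only: simp_thms)
  qed
  ultimately show ?thesis by (simp only:)
qed

end

theorem theorem1p3:
  fixes M :: "'a measure" and M' :: "'b measure"
    and F :: "real \<Rightarrow> real" and \<alpha> p q r :: real and \<kappa> :: "nat \<Rightarrow> real"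
    and X :: "nat \<Rightarrow> 'a \<Rightarrow> real" and V V' w w' :: "nat \<Rightarrow> 'b \<Rightarrow> real"
  assumes "0 < \<alpha>" and "\<alpha> < 2"
    and "in_domain_of_attraction F \<alpha>"
    and "tail_balance F p q"
    and "prob_space M"
    and "prob_space.indep_vars M (\<lambda>_. borel) X {1..}"
    and "\<And>i. 1 \<le> i \<Longrightarrow> cdf (distr M borel (X i)) = F"
    and "\<kappa> \<longlonglongrightarrow> 0"
    and "0 < r" and "summable (\<lambda>i. \<bar>\<kappa> i\<bar> powr r)"
    and "prob_space M'"
    and "prob_space.indep_vars M' (\<lambda>_. borel)
           (case_sum (case_sum V V') (case_sum w w'))
           (({1..} <+> {1..}) <+> ({1..} <+> {1..}))"
    and "\<And>i. 1 \<le> i \<Longrightarrow> distr M' lborel (V i) = uniform_measure lborel {0..1}"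
    and "\<And>i. 1 \<le> i \<Longrightarrow> distr M' lborel (V' i) = uniform_measure lborel {0..1}"
    and "\<And>i. 1 \<le> i \<Longrightarrow> distributed M' lborel (w i) (exponential_density 1)"
    and "\<And>i. 1 \<le> i \<Longrightarrow> distributed M' lborel (w' i) (exponential_density 1)"
  shows "conv_in_distribution (vague_topology strip)
           M (lin_point_process F \<kappa> X)
           M' (limit_point_process \<alpha> p q \<kappa> V V' w w')"
proof -
  interpret M: prob_space M by fact
  interpret M': prob_space M' by fact
  define \<mu> where "\<mu> = distr M borel (X 1)"
  have rd: "real_distribution (distr M borel (X i))" if "1 \<le> i" for i
    using assms(6) that by (intro M.real_distribution_distr) (auto simp: M.indep_vars_def)
  have mu: "real_distribution \<mu>" unfolding \<mu>_def by (rule rd) simp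
  interpret mu: real_distribution \<mu> by (rule mu)
  have F: "F = cdf \<mu>" unfolding \<mu>_def by (rule assms(7)[symmetric]) simp
  have law: "distr M borel (X i) = \<mu>" if "1 \<le> i" for i
    by (rule cdf_unique[OF rd[OF that] mu]) (simp only: assms(7)[OF that] F[symmetric])
  obtain a b \<nu> where "\<And>n. 0 < a n" "stable_law \<alpha> \<nu>"
    "weak_conv_m (\<lambda>n. distr (iid_sum_law n \<mu>) borel (\<lambda>s. (s - b n) / a n)) \<nu>"
    using assms(3) unfolding in_domain_of_attraction_def F interval_measure_cdf[OF mu] by blast
  then interpret L: linear_process \<mu> \<nu> a b \<alpha> M X p q \<kappa> r
    by unfold_locales (use assms(1,2,4,6,8-10) mu law in \<open>simp_all only: F\<close>)
  interpret P: limit_process M' V V' w w' \<alpha> p q \<kappa>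
    by unfold_locales (use assms in simp_all)
  show ?thesis unfolding F
  proof (rule conv_in_distribution_stripI)
    fix f assume f: "f \<in> test_functions strip" and nn: "\<And>z. z \<in> strip \<Longrightarrow> 0 \<le> f z"
    obtain \<eta> where \<eta>: "plane_test \<eta> (plane_of f)" using plane_test_plane_of[OF f nn] by blast
    have "\<forall>m. \<exists>\<eta>'. plane_test \<eta>' (\<lambda>t x. \<Sum>l\<le>m. plane_of f t (\<kappa> l * x))"
      using plane_test_cluster[OF \<eta>] by blast
    then obtain \<eta>' where \<eta>': "\<And>m. plane_test (\<eta>' m) (\<lambda>t x. \<Sum>l\<le>m. plane_of f t (\<kappa> l * x))" by metis
    define g where "g m t x = (\<Sum>l\<le>m. plane_of f t (\<kappa> l * x))" for m t x
    \<comment> \<open>The common value for m lags: the limit in n for the innovations and the limit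
      in N for the truncated limit process. The final step lets m tend to infinity on both
      sides.\<close>
    define L where "L m = exp (- (integral {0..(\<bar>p powr (1/\<alpha>)\<bar> / \<eta>' m) powr \<alpha>} (mark_function.\<psi> (mark_of \<alpha> (g m) (p powr (1/\<alpha>))))
      + integral {0..(\<bar>- (q powr (1/\<alpha>))\<bar> / \<eta>' m) powr \<alpha>} (mark_function.\<psi> (mark_of \<alpha> (g m) (- (q powr (1/\<alpha>)))))))" for m
    have jump: "(\<lambda>n. M.expectation (\<lambda>\<omega>. exp (- (\<Sum>j=1..n. \<Sum>l\<le>m. plane_of f (real j / real n) (\<kappa> l * (X j \<omega> / L.bn n)))))) \<longlonglongrightarrow> L m" for m
      using L.jump_laplace[OF \<eta>'[of m]] unfolding L_def g_def[abs_def] .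
    have box: "(\<lambda>N. M'.expectation (\<lambda>\<omega>. exp (- P.box_sum (plane_of f) N m \<omega>))) \<longlonglongrightarrow> L m" for m
      using P.box_sum_laplace[OF \<eta> \<eta>'[of m]] unfolding L_def g_def[abs_def] .
    have "(\<integral>\<mu>'. exp (- (\<integral>z. f z \<partial>\<mu>')) \<partial>law (vague_topology strip) M (lin_point_process (cdf \<mu>) \<kappa> X n))
      = M.expectation (\<lambda>\<omega>. exp (- (\<Sum>i=1..n. plane_of f (real i / real n) (L.lin_norm n i \<omega>))))" for n
      by (rule L.laplace_lin[OF f nn])
    moreover have "L \<longlonglongrightarrow> (\<integral>\<mu>'. exp (- (\<integral>z. f z \<partial>\<mu>')) \<partial>law (vague_topology strip) M' (limit_point_process \<alpha> p q \<kappa> V V' w w'))"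
      by (rule P.laplace_limit_process[OF f nn box])
    ultimately show "(\<lambda>n. \<integral>\<mu>'. exp (- (\<integral>z. f z \<partial>\<mu>')) \<partial>law (vague_topology strip) M (lin_point_process (cdf \<mu>) \<kappa> X n))
      \<longlonglongrightarrow> (\<integral>\<mu>'. exp (- (\<integral>z. f z \<partial>\<mu>')) \<partial>law (vague_topology strip) M' (limit_point_process \<alpha> p q \<kappa> V V' w w'))"
      using L.laplace_lin_limit[OF \<eta> jump] by (simp only:)
  qed (fact assms L.random_element_lin P.random_element_limit)+
qed


end
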